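(* Let $M$ be an o-minimal structure in a language $L$. Let $A\subseteq M$ be a set definable in $M$ with $|A|>1$. Then \[ |S^{\mathrm{def}}(A)| \leq |A|^{|L|+\aleph_0}. \] Suppose moreover that $A$ is infinite, and fix a formula $\varphi(x;y)$ of $L$. For any type $p(x)\in S_x^{\mathrm{def}}(M)$, let \[ p|_{\varphi, A}(x) = \{\varphi(x; a) : a\in A^{|y|},\ \varphi(x; a)\in p(x) \}. \] Then \[ |\{ p|_{\varphi, A}(x) : p(x) \in S_x^{\mathrm{def}}(M)\}| \leq |A|. \]
   Context: O-minimality is understood in the sense of van den Dries' book "Tame Topology and O-minimal Structures": $M$ is an expansion of a dense linear order $(M,<)$ without endpoints such that every subset of $M$ definable with parameters is a finite union of points and open intervals with endpoints in $M\cup\{-\infty,+\infty\}$. "Definable" set means definable in $M$, possibly with parameters from $M$. Tuples of variables $x,y,z$ are finite (and taken from a fixed countable supply of variables); $|x|$ is the length of $x$. For a formula $\psi(y;z)$ and $c\in M^{|z|}$, $\psi(M;c)=\{b\in M^{|y|}: M\models\psi(b;c)\}$. The number of $L$-formulas is $|L|+\aleph_0$. Types are complete and consistent: a type $p(x)$ over a set $A\subseteq M$ is a complete consistent (with the theory of $M$ with parameters from $A$) set of $L$-formulas in the object variables $x$ with parameters from $A$. A type $p(x)$ over $A\subseteq M$ is called definable if for every $L$-formula $\varphi(x;y)$ there are an $L$-formula $\psi(y;z)$ and some $c\in M^{|z|}$ such that \[ \{b\in M^{|y|} : \varphi(x;b)\in p(x)\}=\psi(M;c) \] (note that $\varphi(x;b)\in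 p(x)$ forces $b\in A^{|y|}$, and that $c$ is allowed to be a tuple from $M$, not necessarily from $A$). $S_x^{\mathrm{def}}(A)$ denotes the set of definable types over $A$ with object variable tuple $x$, and $S^{\mathrm{def}}(A)$ denotes the set of all definable types over $A$ (over all finite tuples of object variables $x$). *)

theory Defs
  imports Main
begin

unbundle cardinal_syntax

text \<open>Constants are function symbols of arity 0.\<close>

record ('f, 'r) language =
  fun_syms :: "'f set"
  fun_ar :: "'f \<Rightarrow> nat"
  rel_syms :: "'r set"
  rel_ar :: "'r \<Rightarrow> nat"

definition lang_card :: "('f, 'r) language \<Rightarrow> ('f + 'r) rel" where
  "lang_card L = |fun_syms L <+> rel_syms L|"

text \<open>
  The variables are the natural numbers. An element \<open>a\<close> of the universe \<open>'m\<close> may occur in a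
  formula as the parameter \<open>Par a\<close>; \<open>params \<phi>\<close> is the set of parameters of \<open>\<phi>\<close>.
\<close>

datatype (dead 'f, trm_params: 'm) trm =
  Var nat
| Par 'm
| Fun 'f "('f, 'm) trm list"

datatype (dead 'f, dead 'r, params: 'm) fm =
  Eq "('f, 'm) trm" "('f, 'm) trm"
| Rel 'r "('f, 'm) trm list"
| Neg "('f, 'r, 'm) fm"
| Conj "('f, 'r, 'm) fm" "('f, 'r, 'm) fm"
| Ex nat "('f, 'r, 'm) fm"

primrec trm_vars :: "('f, 'm) trm \<Rightarrow> nat set" where
  "trm_vars (Var v) = {v}"
| "trm_vars (Par a) = {}"
| "trm_vars (Fun f ts) = \<Union> (set (map trm_vars ts))"

primrec free_vars :: "('f, 'r, 'm) fm \<Rightarrow> nat set" where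
  "free_vars (Eq t u) = trm_vars t \<union> trm_vars u"
| "free_vars (Rel r ts) = \<Union> (set (map trm_vars ts))"
| "free_vars (Neg \<phi>) = free_vars \<phi>"
| "free_vars (Conj \<phi> \<psi>) = free_vars \<phi> \<union> free_vars \<psi>"
| "free_vars (Ex v \<phi>) = free_vars \<phi> - {v}"

primrec wf_trm :: "('f, 'r) language \<Rightarrow> ('f, 'm) trm \<Rightarrow> bool" where
  "wf_trm L (Var v) \<longleftrightarrow> True"
| "wf_trm L (Par a) \<longleftrightarrow> True"
| "wf_trm L (Fun f ts) \<longleftrightarrow>
     f \<in> fun_syms L \<and> length ts = fun_ar L f \<and> list_all id (map (wf_trm L) ts)"

primrec wf_fm :: "('f, 'r) language \<Rightarrow> ('f, 'r, 'm) fm \<Rightarrow> bool" where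
  "wf_fm L (Eq t u) \<longleftrightarrow> wf_trm L t \<and> wf_trm L u"
| "wf_fm L (Rel r ts) \<longleftrightarrow>
     r \<in> rel_syms L \<and> length ts = rel_ar L r \<and> list_all (wf_trm L) ts"
| "wf_fm L (Neg \<phi>) \<longleftrightarrow> wf_fm L \<phi>"
| "wf_fm L (Conj \<phi> \<psi>) \<longleftrightarrow> wf_fm L \<phi> \<and> wf_fm L \<psi>"
| "wf_fm L (Ex v \<phi>) \<longleftrightarrow> wf_fm L \<phi>"

text \<open>
  The \<open>L\<close>-formulas with parameters from \<open>A\<close> and free variables among \<open>x\<close>. The plain
  \<open>L\<close>-formulas are the case \<open>A = {}\<close>, and a formula \<open>\<phi>(x;y)\<close> is a member of
  \<open>formulas L {} (x @ y)\<close> with \<open>distinct (x @ y)\<close>.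
\<close>

definition formulas :: "('f, 'r) language \<Rightarrow> 'm set \<Rightarrow> nat list \<Rightarrow> ('f, 'r, 'm) fm set" where
  "formulas L A x = {\<phi>. wf_fm L \<phi> \<and> params \<phi> \<subseteq> A \<and> free_vars \<phi> \<subseteq> set x}"

primrec inst_trm :: "(nat \<rightharpoonup> 'm) \<Rightarrow> ('f, 'm) trm \<Rightarrow> ('f, 'm) trm" where
  "inst_trm s (Var v) = (case s v of None \<Rightarrow> Var v | Some a \<Rightarrow> Par a)"
| "inst_trm s (Par a) = Par a"
| "inst_trm s (Fun f ts) = Fun f (map (inst_trm s) ts)"

primrec inst_fm :: "(nat \<rightharpoonup> 'm) \<Rightarrow> ('f, 'r, 'm) fm \<Rightarrow> ('f, 'r, 'm) fm" where
  "inst_fm s (Eq t u) = Eq (inst_trm s t) (inst_trm s u)"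
| "inst_fm s (Rel r ts) = Rel r (map (inst_trm s) ts)"
| "inst_fm s (Neg \<phi>) = Neg (inst_fm s \<phi>)"
| "inst_fm s (Conj \<phi> \<psi>) = Conj (inst_fm s \<phi>) (inst_fm s \<psi>)"
| "inst_fm s (Ex v \<phi>) = Ex v (inst_fm (s(v := None)) \<phi>)"

text \<open>\<open>inst y b \<phi>\<close> is \<open>\<phi>(x;b)\<close>, for \<open>\<phi>(x;y)\<close> and a tuple \<open>b\<close> of the same length as \<open>y\<close>.\<close>

definition inst :: "nat list \<Rightarrow> 'm list \<Rightarrow> ('f, 'r, 'm) fm \<Rightarrow> ('f, 'r, 'm) fm" where
  "inst y b = inst_fm [y [\<mapsto>] b]"

text \<open>
  The universe of a structure is the whole type \<open>'m\<close>. Only the interpretation of the symbols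
  of the language, on tuples of the right length, is ever used.
\<close>

record ('f, 'r, 'm) struct =
  fun_int :: "'f \<Rightarrow> 'm list \<Rightarrow> 'm"
  rel_int :: "'r \<Rightarrow> 'm list \<Rightarrow> bool"

primrec trm_val :: "('f, 'r, 'm) struct \<Rightarrow> (nat \<Rightarrow> 'm) \<Rightarrow> ('f, 'm) trm \<Rightarrow> 'm" where
  "trm_val M e (Var v) = e v"
| "trm_val M e (Par a) = a"
| "trm_val M e (Fun f ts) = fun_int M f (map (trm_val M e) ts)"

primrec sat :: "('f, 'r, 'm) struct \<Rightarrow> (nat \<Rightarrow> 'm) \<Rightarrow> ('f, 'r, 'm) fm \<Rightarrow> bool" where
  "sat M e (Eq t u) \<longleftrightarrow> trm_val M e t = trm_val M e u"
| "sat M e (Rel r ts) \<longleftrightarrow> rel_int M r (map (trm_val M e) ts)"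
| "sat M e (Neg \<phi>) \<longleftrightarrow> \<not> sat M e \<phi>"
| "sat M e (Conj \<phi> \<psi>) \<longleftrightarrow> sat M e \<phi> \<and> sat M e \<psi>"
| "sat M e (Ex v \<phi>) \<longleftrightarrow> (\<exists>a. sat M (e(v := a)) \<phi>)"

text \<open>Truth in \<open>M\<close>; it is only applied to sentences, whose value does not depend on \<open>e\<close>.\<close>

definition models :: "('f, 'r, 'm) struct \<Rightarrow> ('f, 'r, 'm) fm \<Rightarrow> bool" where
  "models M \<theta> \<longleftrightarrow> (\<forall>e. sat M e \<theta>)"

text \<open>The set \<open>\<psi>(M;c)\<close>, for a formula \<open>\<psi>(y;z)\<close>.\<close>

definition solutions ::
    "('f, 'r, 'm) struct \<Rightarrow> ('f, 'r, 'm) fm \<Rightarrow> nat list \<Rightarrow> nat list \<Rightarrow> 'm list \<Rightarrow> 'm list set" where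
  "solutions M \<psi> y z c = {b. length b = length y \<and> models M (inst (y @ z) (b @ c) \<psi>)}"

text \<open>Definability is with parameters: \<open>c\<close> ranges over tuples from \<open>M\<close>.\<close>

definition definable :: "('f, 'r) language \<Rightarrow> ('f, 'r, 'm) struct \<Rightarrow> nat \<Rightarrow> 'm list set \<Rightarrow> bool" where
  "definable L M n D \<longleftrightarrow>
     (\<exists>y z c. \<exists>\<psi>\<in>formulas L {} (y @ z).
        distinct (y @ z) \<and> length y = n \<and> length c = length z \<and> D = solutions M \<psi> y z c)"

definition definable_subset :: "('f, 'r) language \<Rightarrow> ('f, 'r, 'm) struct \<Rightarrow> 'm set \<Rightarrow> bool" where
  "definable_subset L M X \<longleftrightarrow> definable L M 1 ((\<lambda>a. [a]) ` X)"

definition open_intervals :: "'m::linorder set set" where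
  "open_intervals =
     {{a<..<b} | a b. True} \<union> {{a<..} | a. True} \<union> {{..<b} | b. True} \<union> {UNIV}"

definition o_minimal ::
    "('f, 'r) language \<Rightarrow> ('f, 'r, 'm::unbounded_dense_linorder) struct \<Rightarrow> bool" where
  "o_minimal L M \<longleftrightarrow>
     (\<exists>lt\<in>rel_syms L. rel_ar L lt = 2 \<and> (\<forall>a b. rel_int M lt [a, b] \<longleftrightarrow> a < b)) \<and>
     (\<forall>X. definable_subset L M X \<longrightarrow>
        (\<exists>\<F>. finite \<F> \<and> \<F> \<subseteq> {{a} | a. True} \<union> open_intervals \<and> X = \<Union>\<F>))"

text \<open>
  The theory of \<open>M\<close> with parameters from \<open>A\<close> is complete, so a set of formulas is consistent
  with it if and only if each of its finite subsets is satisfied by some tuple of \<open>M\<close>.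
\<close>

definition consistent :: "('f, 'r, 'm) struct \<Rightarrow> ('f, 'r, 'm) fm set \<Rightarrow> bool" where
  "consistent M p \<longleftrightarrow> (\<forall>F. finite F \<longrightarrow> F \<subseteq> p \<longrightarrow> (\<exists>e. \<forall>\<phi>\<in>F. sat M e \<phi>))"

definition types ::
    "('f, 'r) language \<Rightarrow> ('f, 'r, 'm) struct \<Rightarrow> nat list \<Rightarrow> 'm set \<Rightarrow> ('f, 'r, 'm) fm set set" where
  "types L M x A =
     {p. p \<subseteq> formulas L A x \<and> consistent M p \<and> (\<forall>\<phi>\<in>formulas L A x. \<phi> \<in> p \<or> Neg \<phi> \<in> p)}"

text \<open>
  Here \<open>\<phi>(x;b) \<in> p(x)\<close> is understood to include \<open>b \<in> A\<^sup>|\<^sup>y\<^sup>|\<close>. The syntactic substitution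
  instance alone would not force this when some variable of \<open>y\<close> is not free in \<open>\<phi>\<close>.
\<close>

definition definable_type ::
    "('f, 'r) language \<Rightarrow> ('f, 'r, 'm) struct \<Rightarrow> nat list \<Rightarrow> 'm set \<Rightarrow> ('f, 'r, 'm) fm set \<Rightarrow> bool" where
  "definable_type L M x A p \<longleftrightarrow>
     (\<forall>y. \<forall>\<phi>\<in>formulas L {} (x @ y). distinct (x @ y) \<longrightarrow>
        (\<exists>z c. \<exists>\<psi>\<in>formulas L {} (y @ z). distinct (y @ z) \<and> length c = length z \<and>
           {b. length b = length y \<and> set b \<subseteq> A \<and> inst y b \<phi> \<in> p} = solutions M \<psi> y z c))"

definition def_types_in ::
    "('f, 'r) language \<Rightarrow> ('f, 'r, 'm) struct \<Rightarrow> nat list \<Rightarrow> 'm set \<Rightarrow> ('f, 'r, 'm) fm set set" where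
  "def_types_in L M x A = {p \<in> types L M x A. definable_type L M x A p}"

definition def_types ::
    "('f, 'r) language \<Rightarrow> ('f, 'r, 'm) struct \<Rightarrow> 'm set \<Rightarrow> ('f, 'r, 'm) fm set set" where
  "def_types L M A = (\<Union>x\<in>{x. distinct x}. def_types_in L M x A)"

text \<open>The restriction \<open>p|\<^sub>\<phi>\<^sub>,\<^sub>A\<close>, for \<open>\<phi>(x;y)\<close>.\<close>

definition restrict_type ::
    "nat list \<Rightarrow> ('f, 'r, 'm) fm \<Rightarrow> 'm set \<Rightarrow> ('f, 'r, 'm) fm set \<Rightarrow> ('f, 'r, 'm) fm set" where
  "restrict_type y \<phi> A p =
     {inst y a \<phi> | a. length a = length y \<and> set a \<subseteq> A \<and> inst y a \<phi> \<in> p}"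

end

theory Submission
  imports Defs
begin

text \<open>
  Both bounds come from one counting principle. Let \<open>A\<close> be infinite and definable, let \<open>q\<close> be
  a definable type in the variables \<open>V\<close>, and let \<open>R s\<close> be a definable family of predicates
  in these variables. The trace of \<open>q\<close> is the set of all \<open>s\<close> in a power of \<open>A\<close> with
  \<open>R s\<close> in \<open>q\<close>. For fixed \<open>R\<close>, at most \<open>|A|\<close> sets arise as traces when \<open>q\<close> varies
  (\<open>few_traces\<close>). The second bound is this principle for the family \<open>\<phi>(x;b)\<close>.

  For the first bound with \<open>A\<close> infinite, a definable type over \<open>A\<close> is determined by the sets
  of all tuples \<open>b\<close> from \<open>A\<close> with \<open>\<phi>(x;b)\<close> in the type, one for each parameter-free formula
  \<open>\<phi>(x;y)\<close>. Each of these sets is the part in \<open>A\<close> of some \<open>\<psi>(M;c)\<close>. For fixed \<open>\<psi>\<close>,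
  these parts are traces of types realised in \<open>M\<close> by \<open>c\<close>, hence at most \<open>|A|\<close> in number
  (\<open>few_definable_families\<close>). With \<open>\<kappa>\<close> the number of formulas, a type is therefore given by a
  function from a set of size \<open>\<kappa>\<close> to a set of size \<open>|A| ^c \<kappa>\<close> (\<open>card_def_types_in\<close>). If \<open>A\<close> is
  finite, there are only \<open>\<kappa>\<close> formulas over \<open>A\<close>, and \<open>|A|\<close> is at least two.

  The counting principle is proved by induction on the number of variables of the types. Whether
  \<open>R s\<close> holds at a point depends on where its last coordinate lies among the boundary points of
  a set on the line. By uniform finiteness these are boundedly many definable functions \<open>f\<close> of
  \<open>s\<close> and of the other coordinates. So it suffices to count, for one such function, the sets of
  all \<open>s\<close> for which \<open>q\<close> says that \<open>f(s)\<close> equals, respectively lies below, the last coordinate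
  (\<open>small_function_traces\<close>). The first set, if not empty, consists of all \<open>s\<close> with
  \<open>f(s) = f(s')\<close> in \<open>q\<close> for one \<open>s'\<close>, which the induction hypothesis counts. The second is an
  initial segment of the weak order given by \<open>f(s) \<le> f(s')\<close> in \<open>q\<close>; again by the induction
  hypothesis, at most \<open>|A|\<close> such orders occur. It is a definable initial segment, because \<open>q\<close>
  is a definable type. So everything is reduced to the following statement (\<open>few_cuts\<close>): a
  definable weak order on a subset of a finite power of \<open>A\<close> has at most \<open>|A|\<close> definable initial
  segments, called cuts here.

  For this one uses induction on the number \<open>n\<close> of coordinates, and the hyperplanes obtained by
  fixing the value \<open>a\<close> of one of them. If a cut can be approached, from above or from below, by
  points of a hyperplane, or by points of a thin set, that is, one of dimension less than \<open>n\<close>, then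
  it is determined by cuts in fewer coordinates. Otherwise, for every \<open>a\<close>, the cut runs through
  the inside of a class of the equivalence relation of lying in the same gap of the hyperplane at
  \<open>a\<close>, and this class is fat, that is, not thin. A definable equivalence relation has only boundedly
  many fat classes (\<open>bounded_fat_classes\<close>); so the class is the \<open>j\<close>-th fat class for one of
  finitely many \<open>j\<close>. As \<open>a\<close> approaches a suitable limit point of \<open>A\<close> from one side, or an end of the
  line, these classes approach the cut, and so the cut is determined by \<open>j\<close>, the limit point and
  the side.

  The facts on o-minimal structures that this needs are the monotonicity theorem, in a form for
  definable weak orders (\<open>monotone_piece\<close>), a Fubini property of finite sets (\<open>fubini_finite\<close>), and
  uniform finiteness in any number of parameters (\<open>uniform_finiteness\<close>). They do not use formulas,
  only closure properties of a collection of definable predicates and the behaviour of definable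
  sets on the line; formulas enter at the end.
\<close>

section \<open>Definable predicates on environments\<close>

definition coord_map :: "((nat \<Rightarrow> 'a) \<Rightarrow> 'a) \<Rightarrow> bool" where
  "coord_map \<tau> \<longleftrightarrow> (\<exists>j. \<tau> = (\<lambda>e. e j)) \<or> (\<exists>c. \<tau> = (\<lambda>_. c))"

text \<open>
  A predicate on environments plays the role of a formula whose free variables are natural numbers.
  Substitutions are restricted to variables and constants, since these are all that is ever substituted;
  function symbols are hidden inside the definable predicates.
\<close>

definition env_map :: "((nat \<Rightarrow> 'a) \<Rightarrow> nat \<Rightarrow> 'a) \<Rightarrow> bool" where
  "env_map \<sigma> \<longleftrightarrow> (\<forall>i. coord_map (\<lambda>e. \<sigma> e i))"

definition supported :: "nat set \<Rightarrow> ((nat \<Rightarrow> 'a) \<Rightarrow> 'b) \<Rightarrow> bool" where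
  "supported I P \<longleftrightarrow> (\<forall>e e'. (\<forall>i\<in>I. e i = e' i) \<longrightarrow> P e = P e')"

lemma supportedD: "supported I P \<Longrightarrow> (\<And>i. i \<in> I \<Longrightarrow> e i = e' i) \<Longrightarrow> P e = P e'"
  unfolding supported_def by blast

named_theorems dfn_intros

lemma coord_map_var [dfn_intros]: "coord_map (\<lambda>e. e j)"
  by (auto simp: coord_map_def)

lemma coord_map_const [dfn_intros]: "coord_map (\<lambda>e. c)"
  by (auto simp: coord_map_def)

lemma env_map_id [dfn_intros]: "env_map (\<lambda>e. e)"
  by (auto simp: env_map_def coord_map_def)

lemma env_map_reindex [dfn_intros]: "env_map (\<lambda>e i. e (f i))"
  by (auto simp: env_map_def coord_map_def)

lemma env_map_const [dfn_intros]: "env_map (\<lambda>e. s)"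
  by (auto simp: env_map_def coord_map_def)

lemma env_map_coord: "env_map \<sigma> \<Longrightarrow> coord_map (\<lambda>e. \<sigma> e i)"
  by (simp add: env_map_def)

lemma env_map_upd [dfn_intros]:
  assumes "env_map \<sigma>" "coord_map \<tau>" shows "env_map (\<lambda>e. (\<sigma> e)(v := \<tau> e))"
  unfolding env_map_def
proof
  fix i show "coord_map (\<lambda>e. ((\<sigma> e)(v := \<tau> e)) i)"
    using assms by (cases "i = v") (simp_all add: env_map_def)
qed

lemma env_map_case_nat [dfn_intros]:
  assumes "coord_map \<tau>" "env_map \<sigma>" shows "env_map (\<lambda>e. case_nat (\<tau> e) (\<sigma> e))"
  unfolding env_map_def
proof
  fix i show "coord_map (\<lambda>e. case_nat (\<tau> e) (\<sigma> e) i)"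
    using assms by (cases i) (simp_all add: env_map_def)
qed

text \<open>
  The consequences of o-minimality that the proof uses, for a collection \<open>dfn\<close> of predicates on
  environments. The bound variable of a quantifier is coordinate \<open>0\<close>, and the others are shifted up
  by one. The boundary points of a definable set of elements are finite in number, and a definable initial
  segment that is neither empty nor everything has an end point; parameters enter through \<open>s\<close>.
\<close>

locale omin = unbounded_dense_linorder le lt
  for le :: "'a \<Rightarrow> 'a \<Rightarrow> bool" (infix \<open>\<sqsubseteq>\<close> 50) and lt :: "'a \<Rightarrow> 'a \<Rightarrow> bool" (infix \<open>\<sqsubset>\<close> 50) +
  fixes dfn :: "((nat \<Rightarrow> 'a) \<Rightarrow> bool) \<Rightarrow> bool"
  assumes dfn_less: "dfn (\<lambda>e. e i \<sqsubset> e j)"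
    and dfn_not [dfn_intros]: "dfn P \<Longrightarrow> dfn (\<lambda>e. \<not> P e)"
    and dfn_conj [dfn_intros]: "dfn P \<Longrightarrow> dfn Q \<Longrightarrow> dfn (\<lambda>e. P e \<and> Q e)"
    and dfn_ex [dfn_intros]: "dfn (\<lambda>e. R (\<lambda>i. e (Suc i)) (e 0)) \<Longrightarrow> dfn (\<lambda>e. \<exists>a. R e a)"
    and dfn_subst: "dfn P \<Longrightarrow> env_map \<sigma> \<Longrightarrow> dfn (\<lambda>e. P (\<sigma> e))"
    and dfn_support: "dfn P \<Longrightarrow> \<exists>k. supported {..<k} P"
    and finite_boundary_ax: "dfn P \<Longrightarrow>
      finite {x. \<not> (\<exists>a b. a \<sqsubset> x \<and> x \<sqsubset> b \<and>
                  (\<forall>y. a \<sqsubset> y \<and> y \<sqsubset> b \<longrightarrow> P (case_nat y s) = P (case_nat x s)))}"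
    and complete_ax: "dfn P \<Longrightarrow> (\<And>x y. x \<sqsubset> y \<Longrightarrow> P (case_nat y s) \<Longrightarrow> P (case_nat x s)) \<Longrightarrow>
      P (case_nat u s) \<Longrightarrow> \<not> P (case_nat v s) \<Longrightarrow>
      \<exists>a. (\<forall>x. x \<sqsubset> a \<longrightarrow> P (case_nat x s)) \<and> (\<forall>x. a \<sqsubset> x \<longrightarrow> \<not> P (case_nat x s))"
begin

text \<open>
  Reversing the order gives the mirror image of every statement proved in the locale.
\<close>

lemma dual: "omin (\<lambda>x y. y \<sqsubseteq> x) (\<lambda>x y. y \<sqsubset> x) dfn"
proof (intro omin.intro omin_axioms.intro)
  show "class.unbounded_dense_linorder (\<lambda>x y. y \<sqsubseteq> x) (\<lambda>x y. y \<sqsubset> x)"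
    by unfold_locales
      (use dense in \<open>auto simp: lt_ex gt_ex less_le_not_le[symmetric] intro: order.trans\<close>)
next
  fix P s assume P: "dfn P"
  have *: "(\<exists>a b. x \<sqsubset> a \<and> b \<sqsubset> x \<and> (\<forall>y. y \<sqsubset> a \<and> b \<sqsubset> y \<longrightarrow> Q y)) =
      (\<exists>a b. a \<sqsubset> x \<and> x \<sqsubset> b \<and> (\<forall>y. a \<sqsubset> y \<and> y \<sqsubset> b \<longrightarrow> Q y))" for x Q by blast
  show "finite {x. \<not> (\<exists>a b. x \<sqsubset> a \<and> b \<sqsubset> x \<and>
                  (\<forall>y. y \<sqsubset> a \<and> b \<sqsubset> y \<longrightarrow> P (case_nat y s) = P (case_nat x s)))}"
    unfolding * using finite_boundary_ax[OF P] .
next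
  fix P s u v assume P: "dfn P" and mono: "\<And>x y. y \<sqsubset> x \<Longrightarrow> P (case_nat y s) \<Longrightarrow> P (case_nat x s)"
    and uv: "P (case_nat u s)" "\<not> P (case_nat v s)"
  have "\<exists>a. (\<forall>x. x \<sqsubset> a \<longrightarrow> \<not> P (case_nat x s)) \<and> (\<forall>x. a \<sqsubset> x \<longrightarrow> \<not> \<not> P (case_nat x s))"
    by (rule complete_ax[OF dfn_not[OF P], of s v u]) (use mono uv in auto)
  then show "\<exists>a. (\<forall>x. a \<sqsubset> x \<longrightarrow> P (case_nat x s)) \<and> (\<forall>x. x \<sqsubset> a \<longrightarrow> \<not> P (case_nat x s))" by blast
qed (fact dfn_less dfn_not dfn_conj dfn_ex dfn_subst dfn_support)+

lemma dfn_lessI [dfn_intros]: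
  assumes "coord_map \<tau>" "coord_map \<tau>'" shows "dfn (\<lambda>e. \<tau> e \<sqsubset> \<tau>' e)"
proof -
  have "env_map (\<lambda>e i. if i = (0::nat) then \<tau> e else \<tau>' e)"
    unfolding env_map_def
  proof
    fix i show "coord_map (\<lambda>e. if i = (0::nat) then \<tau> e else \<tau>' e)"
      using assms by (cases "i = 0") simp_all
  qed
  from dfn_subst[OF dfn_less[of 0 1] this] show ?thesis by simp
qed

lemma dfn_disj [dfn_intros]:
  assumes "dfn P" "dfn Q" shows "dfn (\<lambda>e. P e \<or> Q e)"
proof -
  have "dfn (\<lambda>e. \<not> (\<not> P e \<and> \<not> Q e))" by (intro dfn_not dfn_conj assms)
  then show ?thesis by simp
qed

lemma dfn_imp [dfn_intros]:
  assumes "dfn P" "dfn Q" shows "dfn (\<lambda>e. P e \<longrightarrow> Q e)"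
proof -
  have "dfn (\<lambda>e. \<not> P e \<or> Q e)" by (intro dfn_not dfn_disj assms)
  then show ?thesis unfolding imp_conv_disj .
qed

lemma dfn_iff [dfn_intros]:
  assumes "dfn P" "dfn Q" shows "dfn (\<lambda>e. P e = Q e)"
proof -
  have "dfn (\<lambda>e. (P e \<longrightarrow> Q e) \<and> (Q e \<longrightarrow> P e))" by (intro dfn_imp dfn_conj assms)
  then show ?thesis unfolding iff_conv_conj_imp .
qed

lemma dfn_all [dfn_intros]:
  assumes "dfn (\<lambda>e. R (\<lambda>i. e (Suc i)) (e 0))" shows "dfn (\<lambda>e. \<forall>a. R e a)"
proof -
  have "dfn (\<lambda>e. \<not> (\<exists>a. \<not> R e a))" by (intro dfn_not dfn_ex assms)
  then show ?thesis by simp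
qed

lemma dfn_const [dfn_intros]: "dfn (\<lambda>e. b)"
  using dfn_less[of 0 0] dfn_not[OF dfn_less[of 0 0]] by (cases b) simp_all

lemma dfn_leI [dfn_intros]:
  assumes "coord_map \<tau>" "coord_map \<tau>'" shows "dfn (\<lambda>e. \<tau> e \<sqsubseteq> \<tau>' e)"
  using dfn_not[OF dfn_lessI[OF assms(2,1)]] by (simp add: not_less)

lemma dfn_eqI [dfn_intros]:
  assumes "coord_map \<tau>" "coord_map \<tau>'" shows "dfn (\<lambda>e. \<tau> e = \<tau>' e)"
  unfolding order.eq_iff by (intro dfn_conj dfn_leI assms)

definition dfn_v :: "('a \<Rightarrow> bool) \<Rightarrow> bool" where
  "dfn_v X \<longleftrightarrow> dfn (\<lambda>e. X (e 0))"

definition dfn_vv :: "('a \<Rightarrow> 'a \<Rightarrow> bool) \<Rightarrow> bool" where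
  "dfn_vv R \<longleftrightarrow> dfn (\<lambda>e. R (e 0) (e (Suc 0)))"

definition dfn_ev :: "((nat \<Rightarrow> 'a) \<Rightarrow> 'a \<Rightarrow> bool) \<Rightarrow> bool" where
  "dfn_ev E \<longleftrightarrow> dfn (\<lambda>e. E (\<lambda>i. e (Suc i)) (e 0))"

lemma dfn_vD: "dfn_v X \<Longrightarrow> coord_map \<tau> \<Longrightarrow> dfn (\<lambda>e. X (\<tau> e))"
  unfolding dfn_v_def
  using dfn_subst[OF _ env_map_case_nat[OF _ env_map_id], of "\<lambda>e. X (e 0)" \<tau>] by simp

lemma dfn_vvD: "dfn_vv R \<Longrightarrow> coord_map \<tau> \<Longrightarrow> coord_map \<tau>' \<Longrightarrow> dfn (\<lambda>e. R (\<tau> e) (\<tau>' e))"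
  unfolding dfn_vv_def
  using dfn_subst[OF _ env_map_case_nat[OF _ env_map_case_nat[OF _ env_map_id]],
      of "\<lambda>e. R (e 0) (e (Suc 0))" \<tau> \<tau>'] by simp

lemma dfn_evD: "dfn_ev E \<Longrightarrow> env_map \<sigma> \<Longrightarrow> coord_map \<tau> \<Longrightarrow> dfn (\<lambda>e. E (\<sigma> e) (\<tau> e))"
  unfolding dfn_ev_def
  using dfn_subst[OF _ env_map_case_nat, of "\<lambda>e. E (\<lambda>i. e (Suc i)) (e 0)" \<tau> \<sigma>] by simp

lemma dfn_vI: "dfn (\<lambda>e. X (e 0)) \<Longrightarrow> dfn_v X" by (simp add: dfn_v_def)
lemma dfn_vvI: "dfn (\<lambda>e. R (e 0) (e (Suc 0))) \<Longrightarrow> dfn_vv R" by (simp add: dfn_vv_def)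
lemma dfn_evI: "dfn (\<lambda>e. E (\<lambda>i. e (Suc i)) (e 0)) \<Longrightarrow> dfn_ev E" by (simp add: dfn_ev_def)

lemma dfn_v_section: "dfn (\<lambda>e. R (\<lambda>i. e (Suc i)) (e 0)) \<Longrightarrow> dfn_v (R s)"
  by (rule dfn_vI, rule dfn_evD[OF dfn_evI]) (auto intro: dfn_intros)

definition bdry :: "('a \<Rightarrow> bool) \<Rightarrow> 'a set" where
  "bdry X = {x. \<not> (\<exists>a b. a \<sqsubset> x \<and> x \<sqsubset> b \<and> (\<forall>y. a \<sqsubset> y \<and> y \<sqsubset> b \<longrightarrow> X y = X x))}"

lemma finite_bdry: "dfn_v X \<Longrightarrow> finite (bdry X)"
  using finite_boundary_ax[of "\<lambda>e. X (e 0)" undefined] by (simp add: dfn_v_def bdry_def)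

lemma complete_down:
  assumes "dfn_v X" "\<forall>x y. x \<sqsubset> y \<and> X y \<longrightarrow> X x" "X u" "\<not> X v"
  shows "\<exists>a. (\<forall>x. x \<sqsubset> a \<longrightarrow> X x) \<and> (\<forall>x. a \<sqsubset> x \<longrightarrow> \<not> X x)"
  using complete_ax[of "\<lambda>e. X (e 0)" undefined u v] assms by (auto simp: dfn_v_def)

text \<open>
  Definable completeness replaces the least upper bound principle: the first point at which \<open>X\<close> fails
  would be an end point of a definable initial segment, and \<open>step\<close> excludes it.
\<close>

lemma real_induct:
  assumes X: "dfn_v X"
    and base: "\<exists>d. c \<sqsubset> d \<and> (\<forall>y. c \<sqsubset> y \<and> y \<sqsubset> d \<longrightarrow> X y)"
    and step: "\<And>s. c \<sqsubset> s \<Longrightarrow> s \<sqsubset> b \<Longrightarrow> (\<And>y. c \<sqsubset> y \<Longrightarrow> y \<sqsubset> s \<Longrightarrow> X y) \<Longrightarrow>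
        X s \<and> (\<exists>d. s \<sqsubset> d \<and> (\<forall>y. s \<sqsubset> y \<and> y \<sqsubset> d \<longrightarrow> X y))"
    and v: "c \<sqsubset> v" "v \<sqsubset> b"
  shows "X v"
proof (rule ccontr)
  assume nv: "\<not> X v"
  define Z where "Z z \<longleftrightarrow> (\<forall>y. c \<sqsubset> y \<and> y \<sqsubseteq> z \<longrightarrow> X y)" for z
  have "dfn_v Z" unfolding Z_def by (intro dfn_vI dfn_intros dfn_vD[OF X])
  moreover have "\<forall>x y. x \<sqsubset> y \<and> Z y \<longrightarrow> Z x" unfolding Z_def by (meson order.trans less_imp_le)
  moreover have "Z c" unfolding Z_def by (meson leD)
  moreover have "\<not> Z v" using nv v unfolding Z_def by blast
  ultimately obtain a where a: "\<And>x. x \<sqsubset> a \<Longrightarrow> Z x" "\<And>x. a \<sqsubset> x \<Longrightarrow> \<not> Z x"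
    using complete_down[of Z c v] by blast
  have av: "a \<sqsubseteq> v" using a(1) \<open>\<not> Z v\<close> not_less by blast
  have ca: "c \<sqsubseteq> a" using a(2) \<open>Z c\<close> not_less by blast
  have less: "X y" if "c \<sqsubset> y" "y \<sqsubset> a" for y using a(1)[OF that(2)] that unfolding Z_def by blast
  have "\<exists>d. a \<sqsubset> d \<and> (\<forall>y. a \<sqsubset> y \<and> y \<sqsubset> d \<longrightarrow> X y) \<and> (c \<sqsubset> a \<longrightarrow> X a)"
  proof (cases "c = a")
    case True then show ?thesis using base by auto
  next
    case False
    then have "c \<sqsubset> a" using ca by simp
    moreover have "a \<sqsubset> b" using av v(2) by (rule le_less_trans)
    ultimately show ?thesis using step less by blast
  qed
  then obtain d where d: "a \<sqsubset> d" "\<And>y. a \<sqsubset> y \<Longrightarrow> y \<sqsubset> d \<Longrightarrow> X y" "c \<sqsubset> a \<Longrightarrow> X a" by blast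
  obtain x where x: "a \<sqsubset> x" "x \<sqsubset> d" using dense d(1) by blast
  have "Z x" unfolding Z_def
  proof (intro allI impI)
    fix y assume y: "c \<sqsubset> y \<and> y \<sqsubseteq> x"
    consider "y \<sqsubset> a" | "y = a" | "a \<sqsubset> y" using less_linear by blast
    then show "X y" using y x d less by cases (auto intro: le_less_trans)
  qed
  then show False using a(2) x(1) by blast
qed

lemma finite_least: "finite S \<Longrightarrow> S \<noteq> {} \<Longrightarrow> \<exists>m\<in>S. \<forall>x\<in>S. m \<sqsubseteq> x"
proof (induction rule: finite_ne_induct)
  case (singleton x) then show ?case by simp
next
  case (insert x F)
  then obtain m where "m \<in> F" "\<forall>x\<in>F. m \<sqsubseteq> x" by blast
  then show ?case using linear[of x m] by (metis insert_iff order.trans order.refl)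
qed

lemma finite_gap_right: "finite F \<Longrightarrow> \<exists>b. a \<sqsubset> b \<and> (\<forall>x. a \<sqsubset> x \<and> x \<sqsubset> b \<longrightarrow> x \<notin> F)"
proof -
  assume F: "finite F"
  show ?thesis
  proof (cases "{x\<in>F. a \<sqsubset> x} = {}")
    case True then show ?thesis using gt_ex[of a] by blast
  next
    case False
    then obtain m where "m \<in> F" "a \<sqsubset> m" "\<forall>x\<in>{x\<in>F. a \<sqsubset> x}. m \<sqsubseteq> x"
      using finite_least[of "{x\<in>F. a \<sqsubset> x}"] F by auto
    then show ?thesis by (metis (mono_tags, lifting) leD mem_Collect_eq)
  qed
qed

lemma finite_gap_left: "finite F \<Longrightarrow> \<exists>b. b \<sqsubset> a \<and> (\<forall>x. x \<sqsubset> a \<and> b \<sqsubset> x \<longrightarrow> x \<notin> F)"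
  using omin.finite_gap_right[OF dual] .

lemma infinite_interval: "a \<sqsubset> b \<Longrightarrow> infinite {x. a \<sqsubset> x \<and> x \<sqsubset> b}"
proof
  assume ab: "a \<sqsubset> b" and fin: "finite {x. a \<sqsubset> x \<and> x \<sqsubset> b}"
  obtain d where d: "a \<sqsubset> d" "\<And>x. a \<sqsubset> x \<Longrightarrow> x \<sqsubset> d \<Longrightarrow> \<not> (a \<sqsubset> x \<and> x \<sqsubset> b)"
    using finite_gap_right[OF fin, of a] by auto
  show False
  proof (cases "d \<sqsubset> b")
    case True
    obtain x where "a \<sqsubset> x" "x \<sqsubset> d" using dense d(1) by blast
    then show False using d(2) True by (blast intro: less_trans)
  next
    case False
    obtain x where "a \<sqsubset> x" "x \<sqsubset> b" using dense ab by blast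
    then show False using d(2) False by (meson less_le_trans not_less)
  qed
qed

text \<open>
  A definable set without boundary points in an interval contains all of it or nothing of it, because a
  change of value would occur at a boundary point by \<open>real_induct\<close>.
\<close>

lemma const_on_interval:
  assumes X: "dfn_v X" and nb: "\<And>x. a \<sqsubset> x \<Longrightarrow> x \<sqsubset> b \<Longrightarrow> x \<notin> bdry X"
    and xy: "a \<sqsubset> x" "x \<sqsubset> b" "a \<sqsubset> y" "y \<sqsubset> b"
  shows "X x = X y"
proof -
  have main: "X v = X c" if c: "a \<sqsubset> c" and cv: "c \<sqsubset> v" "v \<sqsubset> b" for c v
  proof -
    have loc: "\<exists>p q. p \<sqsubset> x \<and> x \<sqsubset> q \<and> (\<forall>y. p \<sqsubset> y \<and> y \<sqsubset> q \<longrightarrow> X y = X x)" if "c \<sqsubseteq> x" "x \<sqsubset> b" for x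
      using nb[of x] that c unfolding bdry_def by (auto intro: less_le_trans)
    have "X v = X c" if "c \<sqsubset> v" "v \<sqsubset> b" for v
      using _ _ _ that
    proof (rule real_induct[of "\<lambda>v. X v = X c"])
      show "dfn_v (\<lambda>v. X v = X c)" by (intro dfn_vI dfn_intros dfn_vD[OF X])
      show "\<exists>d. c \<sqsubset> d \<and> (\<forall>y. c \<sqsubset> y \<and> y \<sqsubset> d \<longrightarrow> X y = X c)"
        using loc[of c] cv by (meson less_trans order.refl)
      fix s assume s: "c \<sqsubset> s" "s \<sqsubset> b" "\<And>y. c \<sqsubset> y \<Longrightarrow> y \<sqsubset> s \<Longrightarrow> X y = X c"
      obtain p q where pq: "p \<sqsubset> s" "s \<sqsubset> q" "\<And>y. p \<sqsubset> y \<Longrightarrow> y \<sqsubset> q \<Longrightarrow> X y = X s"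
        using loc[of s] s(1,2) less_imp_le by blast
      obtain z where "p \<sqsubset> z" "c \<sqsubset> z" "z \<sqsubset> s" using pq(1) s(1)
        by (metis dense less_trans less_linear)
      then have "X s = X c" using pq(3)[of z] s(3)[of z] less_trans[OF _ pq(2)] by blast
      then show "X s = X c \<and> (\<exists>d. s \<sqsubset> d \<and> (\<forall>y. s \<sqsubset> y \<and> y \<sqsubset> d \<longrightarrow> X y = X c))"
        using pq(3) less_trans[OF pq(1)] pq(2) by blast
    qed
    then show ?thesis using cv by blast
  qed
  show ?thesis using main[of x y] main[of y x] xy less_linear[of x y] by auto
qed

lemma infinite_has_interval:
  assumes X: "dfn_v X" and "infinite {x. X x}"
  obtains a b where "a \<sqsubset> b" "\<And>x. a \<sqsubset> x \<Longrightarrow> x \<sqsubset> b \<Longrightarrow> X x"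
proof -
  have "infinite ({x. X x} - bdry X)" using assms finite_bdry by auto
  then have "{x. X x} - bdry X \<noteq> {}" by (metis finite.emptyI)
  then obtain x where x: "X x" "x \<notin> bdry X" by blast
  then obtain a b where "a \<sqsubset> x" "x \<sqsubset> b" "\<And>y. a \<sqsubset> y \<Longrightarrow> y \<sqsubset> b \<Longrightarrow> X y"
    unfolding bdry_def by blast
  then show ?thesis using that[of a b] less_trans[of a x b] by blast
qed

lemma infinite_iff_interval:
  assumes "dfn_v X"
  shows "infinite {x. X x} \<longleftrightarrow> (\<exists>a b. a \<sqsubset> b \<and> (\<forall>x. a \<sqsubset> x \<and> x \<sqsubset> b \<longrightarrow> X x))"
proof
  assume "infinite {x. X x}"
  then show "\<exists>a b. a \<sqsubset> b \<and> (\<forall>x. a \<sqsubset> x \<and> x \<sqsubset> b \<longrightarrow> X x)"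
    using infinite_has_interval[OF assms] by metis
next
  assume "\<exists>a b. a \<sqsubset> b \<and> (\<forall>x. a \<sqsubset> x \<and> x \<sqsubset> b \<longrightarrow> X x)"
  then obtain a b where ab: "a \<sqsubset> b" "\<forall>x. a \<sqsubset> x \<and> x \<sqsubset> b \<longrightarrow> X x" by blast
  then have "{x. a \<sqsubset> x \<and> x \<sqsubset> b} \<subseteq> {x. X x}" by blast
  then show "infinite {x. X x}" using infinite_interval[OF ab(1)] infinite_super by blast
qed

text \<open>
  An infinite definable subset of the line contains an interval, so finiteness is a first-order condition.
\<close>

lemma dfn_finite [dfn_intros]:
  assumes "dfn (\<lambda>e. R (\<lambda>i. e (Suc i)) (e 0))" shows "dfn (\<lambda>e. finite {a. R e a})"
proof -
  have "finite {a. R e a} \<longleftrightarrow> \<not> (\<exists>a b. a \<sqsubset> b \<and> (\<forall>x. a \<sqsubset> x \<and> x \<sqsubset> b \<longrightarrow> R e x))" for e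
    using infinite_iff_interval[OF dfn_v_section[OF assms], of e] by blast
  then show ?thesis by simp (intro dfn_intros dfn_evD[OF dfn_evI[OF assms]])
qed

definition near_right :: "'a \<Rightarrow> ('a \<Rightarrow> bool) \<Rightarrow> bool" where
  "near_right a Q \<longleftrightarrow> (\<exists>b. a \<sqsubset> b \<and> (\<forall>x. a \<sqsubset> x \<and> x \<sqsubset> b \<longrightarrow> Q x))"

definition near_left :: "'a \<Rightarrow> ('a \<Rightarrow> bool) \<Rightarrow> bool" where
  "near_left a Q \<longleftrightarrow> (\<exists>b. b \<sqsubset> a \<and> (\<forall>x. x \<sqsubset> a \<and> b \<sqsubset> x \<longrightarrow> Q x))"

lemma dual_near_right: "omin.near_right (\<lambda>x y. y \<sqsubset> x) = near_left"
  unfolding omin.near_right_def[OF dual] near_left_def by (rule refl)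

lemma dual_near_left: "omin.near_left (\<lambda>x y. y \<sqsubset> x) = near_right"
  unfolding omin.near_left_def[OF dual] near_right_def by (rule refl)

lemma dfn_near_right [dfn_intros]:
  assumes "coord_map \<tau>" "dfn (\<lambda>e. R (\<lambda>i. e (Suc i)) (e 0))"
  shows "dfn (\<lambda>e. near_right (\<tau> e) (R e))"
proof -
  have "dfn (\<lambda>e. near_right (e 0) (R (\<lambda>i. e (Suc i))))"
    unfolding near_right_def by (intro dfn_intros dfn_evD[OF dfn_evI[OF assms(2)]])
  from dfn_subst[OF this env_map_case_nat[OF assms(1) env_map_id]] show ?thesis by simp
qed

lemma dfn_near_left [dfn_intros]:
  assumes "coord_map \<tau>" "dfn (\<lambda>e. R (\<lambda>i. e (Suc i)) (e 0))"
  shows "dfn (\<lambda>e. near_left (\<tau> e) (R e))"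
  using omin.dfn_near_right[OF dual, of \<tau> R, OF assms] unfolding dual_near_right .

text \<open>
  The finitely many boundary points of \<open>X\<close> leave an interval to the right of \<open>a\<close> free, so a definable
  predicate has a constant value there.
\<close>

lemma near_right_cases:
  assumes "dfn_v X" shows "near_right a X \<or> near_right a (\<lambda>x. \<not> X x)"
proof -
  obtain b where b: "a \<sqsubset> b" "\<And>x. a \<sqsubset> x \<Longrightarrow> x \<sqsubset> b \<Longrightarrow> x \<notin> bdry X"
    using finite_gap_right[OF finite_bdry[OF assms], of a] by blast
  obtain z where z: "a \<sqsubset> z" "z \<sqsubset> b" using dense b(1) by blast
  have "X x = X z" if "a \<sqsubset> x" "x \<sqsubset> b" for x
    using const_on_interval[OF assms b(2) that z] .
  then show ?thesis unfolding near_right_def using b(1) by (cases "X z") blast+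
qed

lemma near_right_conj: "near_right a P \<Longrightarrow> near_right a Q \<Longrightarrow> near_right a (\<lambda>x. P x \<and> Q x)"
proof -
  assume "near_right a P" "near_right a Q"
  then obtain b c where "a \<sqsubset> b" "\<forall>x. a \<sqsubset> x \<and> x \<sqsubset> b \<longrightarrow> P x" "a \<sqsubset> c" "\<forall>x. a \<sqsubset> x \<and> x \<sqsubset> c \<longrightarrow> Q x"
    unfolding near_right_def by blast
  then show ?thesis unfolding near_right_def
    by (cases "b \<sqsubseteq> c") (use less_le_trans in blast, use less_trans[of _ c b] in \<open>auto simp: not_le\<close>)
qed

lemma near_right_mono: "near_right a P \<Longrightarrow> (\<And>x. P x \<Longrightarrow> Q x) \<Longrightarrow> near_right a Q"
  unfolding near_right_def by blast

lemma near_right_ex: "near_right a P \<Longrightarrow> \<exists>x. a \<sqsubset> x \<and> P x"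
  unfolding near_right_def using dense by blast

lemma near_right_less: "a \<sqsubset> b \<Longrightarrow> near_right a (\<lambda>x. a \<sqsubset> x \<and> x \<sqsubset> b)"
  unfolding near_right_def by blast

lemmas near_left_cases = omin.near_right_cases[OF dual, unfolded dual_near_right]
lemmas near_left_conj = omin.near_right_conj[OF dual, unfolded dual_near_right]
lemmas near_left_mono = omin.near_right_mono[OF dual, unfolded dual_near_right]
lemmas near_left_ex = omin.near_right_ex[OF dual, unfolded dual_near_right]
lemmas near_left_less = omin.near_right_less[OF dual, unfolded dual_near_right]

end

section \<open>The monotonicity theorem for definable weak orders\<close>

lemma finite_image_factor:
  assumes "finite (h ` S)" and "\<And>x y. x \<in> S \<Longrightarrow> y \<in> S \<Longrightarrow> h x = h y \<Longrightarrow> f x = f y"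
  shows "finite (f ` S)"
proof -
  have "f ` S \<subseteq> (\<lambda>k. f (inv_into S h k)) ` (h ` S)"
  proof
    fix z assume "z \<in> f ` S"
    then obtain x where x: "x \<in> S" "z = f x" by blast
    then have "f (inv_into S h (h x)) = f x"
      by (intro assms(2)) (auto intro: inv_into_into f_inv_into_f)
    then show "z \<in> (\<lambda>k. f (inv_into S h k)) ` (h ` S)"
      using x by (intro image_eqI[of _ _ "h x"]) auto
  qed
  then show ?thesis using assms(1) finite_surj by blast
qed

text \<open>
  Totally preordered sets: comparisons \<open>f x \<le> f y\<close> of the values of a function. Working with
  these instead of functions allows comparing sets, such as the initial segments below, that are not coded
  by a single element.
\<close>

definition weak_order :: "('a \<Rightarrow> 'a \<Rightarrow> bool) \<Rightarrow> bool" where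
  "weak_order R \<longleftrightarrow> (\<forall>x y. R x y \<or> R y x) \<and> (\<forall>x y z. R x y \<and> R y z \<longrightarrow> R x z)"

lemma weak_order_total: "weak_order R \<Longrightarrow> R x y \<or> R y x"
  unfolding weak_order_def by blast

lemma weak_order_trans: "weak_order R \<Longrightarrow> R x y \<Longrightarrow> R y z \<Longrightarrow> R x z"
  unfolding weak_order_def by blast

context omin begin

lemma subinterval:
  assumes X: "dfn_v X" and inf: "infinite {x. a \<sqsubset> x \<and> x \<sqsubset> b \<and> X x}"
  obtains c d where "a \<sqsubseteq> c" "c \<sqsubset> d" "d \<sqsubseteq> b" "\<And>x. c \<sqsubset> x \<Longrightarrow> x \<sqsubset> d \<Longrightarrow> X x"
proof -
  have "dfn_v (\<lambda>x. a \<sqsubset> x \<and> x \<sqsubset> b \<and> X x)" by (intro dfn_vI dfn_intros dfn_vD[OF X])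
  from infinite_has_interval[OF this inf]
  obtain c d where cd: "c \<sqsubset> d" "\<And>x. c \<sqsubset> x \<Longrightarrow> x \<sqsubset> d \<Longrightarrow> a \<sqsubset> x \<and> x \<sqsubset> b \<and> X x" by metis
  have "a \<sqsubseteq> c"
  proof (rule ccontr)
    assume "\<not> a \<sqsubseteq> c" then have "c \<sqsubset> a" by simp
    from near_right_ex[OF near_right_conj[OF near_right_less[OF this] near_right_less[OF cd(1)]]]
    obtain x where "c \<sqsubset> x" "x \<sqsubset> a" "x \<sqsubset> d" by blast
    then show False using cd(2)[of x] less_asym by blast
  qed
  moreover have "d \<sqsubseteq> b"
  proof (rule ccontr)
    assume "\<not> d \<sqsubseteq> b" then have "b \<sqsubset> d" by simp
    from near_left_ex[OF near_left_conj[OF near_left_less[OF this] near_left_less[OF cd(1)]]]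
    obtain x where "c \<sqsubset> x" "b \<sqsubset> x" "x \<sqsubset> d" by blast
    then show False using cd(2)[of x] less_asym by blast
  qed
  ultimately show ?thesis using that cd by blast
qed

lemma subinterval_cover:
  assumes X: "dfn_v X" and Y: "dfn_v Y" and ab: "a \<sqsubset> b"
    and cov: "\<And>x. a \<sqsubset> x \<Longrightarrow> x \<sqsubset> b \<Longrightarrow> X x \<or> Y x"
  obtains c d where "a \<sqsubseteq> c" "c \<sqsubset> d" "d \<sqsubseteq> b" "(\<forall>x. c \<sqsubset> x \<and> x \<sqsubset> d \<longrightarrow> X x) \<or> (\<forall>x. c \<sqsubset> x \<and> x \<sqsubset> d \<longrightarrow> Y x)"
proof -
  have "{x. a \<sqsubset> x \<and> x \<sqsubset> b} = {x. a \<sqsubset> x \<and> x \<sqsubset> b \<and> X x} \<union> {x. a \<sqsubset> x \<and> x \<sqsubset> b \<and> Y x}"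
    using cov by blast
  then have "infinite {x. a \<sqsubset> x \<and> x \<sqsubset> b \<and> X x} \<or> infinite {x. a \<sqsubset> x \<and> x \<sqsubset> b \<and> Y x}"
    using infinite_interval[OF ab] by (metis finite_UnI)
  then show ?thesis
  proof
    assume "infinite {x. a \<sqsubset> x \<and> x \<sqsubset> b \<and> X x}"
    from subinterval[OF X this] show ?thesis using that by metis
  next
    assume "infinite {x. a \<sqsubset> x \<and> x \<sqsubset> b \<and> Y x}"
    from subinterval[OF Y this] show ?thesis using that by metis
  qed
qed

lemma le_interval: "a \<sqsubseteq> c \<Longrightarrow> d \<sqsubseteq> b \<Longrightarrow> c \<sqsubset> x \<Longrightarrow> x \<sqsubset> d \<Longrightarrow> a \<sqsubset> x \<and> x \<sqsubset> b"
  by (meson le_less_trans less_le_trans)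

text \<open>
  With \<open>R x y\<close> read as \<open>f x \<le> f y\<close>: near \<open>w\<close>, the values on the left of \<open>w\<close> are
  larger than those on the right.
\<close>

definition valley :: "('a \<Rightarrow> 'a \<Rightarrow> bool) \<Rightarrow> 'a \<Rightarrow> bool" where
  "valley R w \<longleftrightarrow> (\<exists>g d. g \<sqsubset> w \<and> w \<sqsubset> d \<and> (\<forall>z y. g \<sqsubset> z \<and> z \<sqsubset> w \<and> w \<sqsubset> y \<and> y \<sqsubset> d \<longrightarrow> \<not> R z y))"

text \<open>
  For an injective function all of whose points are strict local minima: far to the right, each value
  \<open>f x\<close> is eventually larger than the later ones, and it is smaller than the values right after \<open>x\<close>. The
  last point where the comparison with \<open>f x\<close> changes is a valley. This gives valleys arbitrarily close to
  \<open>b\<close>, and being a valley is definable.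
\<close>

lemma local_min_valley:
  assumes R: "dfn_vv R" and wo: "weak_order R"
    and ab: "a \<sqsubset> b"
    and inj: "\<And>x y. a \<sqsubset> x \<Longrightarrow> x \<sqsubset> b \<Longrightarrow> a \<sqsubset> y \<Longrightarrow> y \<sqsubset> b \<Longrightarrow> x \<noteq> y \<Longrightarrow> \<not> (R x y \<and> R y x)"
    and mr: "\<And>x. a \<sqsubset> x \<Longrightarrow> x \<sqsubset> b \<Longrightarrow> near_right x (\<lambda>y. \<not> R y x)"
    and ml: "\<And>x. a \<sqsubset> x \<Longrightarrow> x \<sqsubset> b \<Longrightarrow> near_left x (\<lambda>y. \<not> R y x)"
  shows "near_left b (valley R)"
proof -
  note tot = weak_order_total[OF wo] and tr = weak_order_trans[OF wo]
  \<comment> \<open>\<open>Bs x\<close> means that all later values are larger. It fails close to \<open>b\<close>, because just left of a point there are larger values.\<close>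
  define Bs where "Bs x \<longleftrightarrow> (\<forall>y. x \<sqsubset> y \<and> y \<sqsubset> b \<longrightarrow> \<not> R y x)" for x
  have Bs: "dfn_v Bs" unfolding Bs_def by (intro dfn_vI dfn_intros dfn_vvD[OF R])
  have "\<not> near_left b Bs"
  proof
    assume "near_left b Bs"
    from near_left_conj[OF this near_left_less[OF ab]] obtain c where
      c: "c \<sqsubset> b" "\<And>x. c \<sqsubset> x \<Longrightarrow> x \<sqsubset> b \<Longrightarrow> Bs x \<and> a \<sqsubset> x" unfolding near_left_def by blast
    obtain y where y: "c \<sqsubset> y" "y \<sqsubset> b" using dense c(1) by blast
    from near_left_ex[OF near_left_conj[OF ml[of y] near_left_less[OF y(1)]]] c(2)[OF y] y
    obtain z where z: "z \<sqsubset> y" "c \<sqsubset> z" "\<not> R z y" by blast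
    then have "Bs z" using c(2)[of z] y less_trans by blast
    then show False using z y tot unfolding Bs_def by blast
  qed
  then have "near_left b (\<lambda>x. \<not> Bs x)" using near_left_cases[OF Bs] by blast
  from near_left_conj[OF this near_left_less[OF ab]] obtain a' where
    a': "a' \<sqsubset> b" "\<And>x. a' \<sqsubset> x \<Longrightarrow> x \<sqsubset> b \<Longrightarrow> \<not> Bs x \<and> a \<sqsubset> x" unfolding near_left_def by blast
  have claim1: "near_left b (\<lambda>y. \<not> R x y)" if x: "a' \<sqsubset> x" "x \<sqsubset> b" for x
  proof (rule ccontr)
    assume "\<not> near_left b (\<lambda>y. \<not> R x y)"
    then have "near_left b (\<lambda>y. R x y)"
      using near_left_cases[of "\<lambda>y. R x y" b] dfn_vI[OF dfn_vvD[OF R coord_map_const coord_map_var]]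
      by blast
    then obtain d1 where d1: "d1 \<sqsubset> b" "\<And>y. y \<sqsubset> b \<Longrightarrow> d1 \<sqsubset> y \<Longrightarrow> R x y"
      unfolding near_left_def by blast
    define D where "D d \<longleftrightarrow> \<not> (\<forall>y. d \<sqsubset> y \<and> y \<sqsubset> b \<longrightarrow> R x y)" for d
    have D: "dfn_v D" unfolding D_def by (intro dfn_vI dfn_intros dfn_vvD[OF R])
    have Ddown: "\<forall>u v. u \<sqsubset> v \<and> D v \<longrightarrow> D u" using less_trans unfolding D_def by blast
    obtain y0 where y0: "x \<sqsubset> y0" "y0 \<sqsubset> b" "R y0 x" using a'(2)[OF x] unfolding Bs_def by blast
    have "\<not> R x y0" using inj[of x y0] y0 a'(2)[OF x] x less_trans by blast
    then have Dy: "D d" if "d \<sqsubset> y0" for d using that y0 unfolding D_def by blast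
    have nDd1: "\<not> D d1" using d1 unfolding D_def by blast
    obtain d0 where d0: "\<And>d. d \<sqsubset> d0 \<Longrightarrow> D d" "\<And>d. d0 \<sqsubset> d \<Longrightarrow> \<not> D d"
      using complete_down[OF D Ddown Dy[OF y0(1)], OF nDd1] by blast
    have "\<not> d0 \<sqsubset> y0" using dense[of d0 y0] Dy d0(2) by blast
    then have xd0: "x \<sqsubset> d0" using y0(1) less_le_trans not_less by blast
    have "\<not> d1 \<sqsubset> d0" using d0(1)[of d1] nDd1 by blast
    then have d0b: "d0 \<sqsubset> b" using d1(1) le_less_trans not_less by blast
    have Rr: "R x y" if y: "d0 \<sqsubset> y" "y \<sqsubset> b" for y
    proof -
      obtain d where "d0 \<sqsubset> d" "d \<sqsubset> y" using dense y(1) by blast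
      then show ?thesis using d0(2)[of d] y unfolding D_def by blast
    qed
    have a'd0: "a' \<sqsubset> d0" using x(1) xd0 less_trans by blast
    obtain y1 where "d0 \<sqsubset> y1" "y1 \<sqsubset> b" "R y1 d0" using a'(2)[OF a'd0 d0b] unfolding Bs_def by blast
    then have Rd0: "R x d0" using Rr tr by blast
    obtain g where g: "g \<sqsubset> d0" "\<And>z. z \<sqsubset> d0 \<Longrightarrow> g \<sqsubset> z \<Longrightarrow> \<not> R z d0"
      using ml[of d0] a'(2)[OF a'd0 d0b] d0b unfolding near_left_def by blast
    obtain d where d: "g \<sqsubset> d" "d \<sqsubset> d0" using dense g(1) by blast
    have "R x y" if "d \<sqsubset> y" "y \<sqsubset> b" for y
    proof -
      consider "y \<sqsubset> d0" | "y = d0" | "d0 \<sqsubset> y" using less_linear by blast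
      then show ?thesis
      proof cases
        case 1
        then have "\<not> R y d0" using g(2) d(1) that(1) less_trans by blast
        then show ?thesis using tot tr Rd0 by blast
      qed (use Rd0 Rr that in auto)
    qed
    then show False using d0(1)[OF d(2)] unfolding D_def by blast
  qed
  have claim2: "\<exists>w. x \<sqsubset> w \<and> w \<sqsubset> b \<and> valley R w" if x: "a' \<sqsubset> x" "x \<sqsubset> b" for x
  proof -
    obtain d1 where d1: "d1 \<sqsubset> b" "\<And>y. y \<sqsubset> b \<Longrightarrow> d1 \<sqsubset> y \<Longrightarrow> \<not> R x y"
      using claim1[OF x] unfolding near_left_def by blast
    define D where "D d \<longleftrightarrow> \<not> (\<forall>y. d \<sqsubset> y \<and> y \<sqsubset> b \<longrightarrow> \<not> R x y)" for d
    have D: "dfn_v D" unfolding D_def by (intro dfn_vI dfn_intros dfn_vvD[OF R])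
    have Ddown: "\<forall>u v. u \<sqsubset> v \<and> D v \<longrightarrow> D u" using less_trans unfolding D_def by blast
    have ax: "a \<sqsubset> x" using a'(2)[OF x] by blast
    obtain x1 where x1: "x \<sqsubset> x1" "\<And>y. x \<sqsubset> y \<Longrightarrow> y \<sqsubset> x1 \<Longrightarrow> \<not> R y x"
      using mr[OF ax x(2)] unfolding near_right_def by blast
    obtain x2 where x2: "x \<sqsubset> x2" "x2 \<sqsubset> x1" "x2 \<sqsubset> b"
      using near_right_ex[OF near_right_conj[OF near_right_less[OF x1(1)] near_right_less[OF x(2)]]] by blast
    have Rx2: "R x x2" using x1(2) x2 tot by blast
    have Dx: "D d" if "d \<sqsubset> x2" for d using that Rx2 x2 unfolding D_def by blast
    have nDd1: "\<not> D d1" using d1 unfolding D_def by blast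
    obtain w where w: "\<And>d. d \<sqsubset> w \<Longrightarrow> D d" "\<And>d. w \<sqsubset> d \<Longrightarrow> \<not> D d"
      using complete_down[OF D Ddown Dx[OF x2(1)], OF nDd1] by blast
    have "\<not> w \<sqsubset> x2" using dense[of w x2] Dx w(2) by blast
    then have xw: "x \<sqsubset> w" using x2(1) less_le_trans not_less by blast
    have "\<not> d1 \<sqsubset> w" using w(1)[of d1] nDd1 by blast
    then have wb: "w \<sqsubset> b" using d1(1) le_less_trans not_less by blast
    have nR: "\<not> R x y" if y: "w \<sqsubset> y" "y \<sqsubset> b" for y
    proof -
      obtain d where "w \<sqsubset> d" "d \<sqsubset> y" using dense y(1) by blast
      then show ?thesis using w(2)[of d] y unfolding D_def by blast
    qed
    have aw: "a \<sqsubset> w" using ax xw less_trans by blast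
    from near_right_ex[OF near_right_conj[OF mr[OF aw wb] near_right_less[OF wb]]]
    obtain y1 where "w \<sqsubset> y1" "y1 \<sqsubset> b" "\<not> R y1 w" by blast
    then have nRw: "\<not> R x w" using nR tot tr by blast
    have "\<not> near_left w (\<lambda>z. \<not> R x z)"
    proof
      assume "near_left w (\<lambda>z. \<not> R x z)"
      then obtain g where g: "g \<sqsubset> w" "\<And>z. z \<sqsubset> w \<Longrightarrow> g \<sqsubset> z \<Longrightarrow> \<not> R x z" unfolding near_left_def by blast
      obtain d where d: "g \<sqsubset> d" "d \<sqsubset> w" using dense g(1) by blast
      have "\<not> R x y" if "d \<sqsubset> y" "y \<sqsubset> b" for y
        using less_linear[of y w] g(2)[of y] nRw nR[of y] that less_trans[OF d(1)] by blast
      then show False using w(1)[OF d(2)] unfolding D_def by blast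
    qed
    then have "near_left w (\<lambda>z. R x z)"
      using near_left_cases[of "\<lambda>y. R x y" w] dfn_vI[OF dfn_vvD[OF R coord_map_const coord_map_var]]
      by blast
    then obtain g where g: "g \<sqsubset> w" "\<And>z. z \<sqsubset> w \<Longrightarrow> g \<sqsubset> z \<Longrightarrow> R x z" unfolding near_left_def by blast
    have "valley R w" unfolding valley_def using g wb nR tr by blast
    then show ?thesis using xw wb by blast
  qed
  have V: "dfn_v (valley R)" unfolding valley_def by (intro dfn_vI dfn_intros dfn_vvD[OF R])
  show ?thesis
  proof (rule ccontr)
    assume "\<not> near_left b (valley R)"
    then have "near_left b (\<lambda>x. \<not> valley R x)" using near_left_cases[OF V] by blast
    from near_left_conj[OF this near_left_less[OF a'(1)]] obtain c where
      c: "c \<sqsubset> b" "\<And>x. c \<sqsubset> x \<Longrightarrow> x \<sqsubset> b \<Longrightarrow> \<not> valley R x \<and> a' \<sqsubset> x" unfolding near_left_def by blast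
    obtain x where x: "c \<sqsubset> x" "x \<sqsubset> b" using dense c(1) by blast
    obtain w where "x \<sqsubset> w" "w \<sqsubset> b" "valley R w" using claim2[of x] c(2)[OF x] x by blast
    then show False using c(2)[of w] x less_trans by blast
  qed
qed

text \<open>
  Apply the previous lemma, and then its mirror image on an interval that consists of valleys: a point
  would be a valley for both directions, which is contradictory.
\<close>

lemma no_local_min_everywhere:
  assumes R: "dfn_vv R" and wo: "weak_order R"
    and ab: "a \<sqsubset> b"
    and inj: "\<And>x y. a \<sqsubset> x \<Longrightarrow> x \<sqsubset> b \<Longrightarrow> a \<sqsubset> y \<Longrightarrow> y \<sqsubset> b \<Longrightarrow> x \<noteq> y \<Longrightarrow> \<not> (R x y \<and> R y x)"
    and mr: "\<And>x. a \<sqsubset> x \<Longrightarrow> x \<sqsubset> b \<Longrightarrow> near_right x (\<lambda>y. \<not> R y x)"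
    and ml: "\<And>x. a \<sqsubset> x \<Longrightarrow> x \<sqsubset> b \<Longrightarrow> near_left x (\<lambda>y. \<not> R y x)"
  shows False
proof -
  note tot = weak_order_total[OF wo] and tr = weak_order_trans[OF wo]
  have "near_left b (valley R)"
    by (rule local_min_valley[OF R wo ab]) (fact inj mr ml)+
  from near_left_conj[OF this near_left_less[OF ab]]
  obtain c where c: "c \<sqsubset> b" "\<And>x. c \<sqsubset> x \<Longrightarrow> x \<sqsubset> b \<Longrightarrow> valley R x \<and> a \<sqsubset> x" unfolding near_left_def by blast
  have "near_right c (omin.valley (\<lambda>x y. y \<sqsubset> x) R)"
    by (rule omin.local_min_valley[OF dual, unfolded dual_near_right dual_near_left, where R=R and a=b and b=c])
      (use R wo c mr ml inj in blast)+
  from near_right_ex[OF near_right_conj[OF this near_right_less[OF c(1)]]]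
  obtain w where w: "c \<sqsubset> w" "w \<sqsubset> b" "omin.valley (\<lambda>x y. y \<sqsubset> x) R w" by blast
  then obtain g d where gd: "g \<sqsubset> w" "w \<sqsubset> d" "\<And>z y. g \<sqsubset> z \<Longrightarrow> z \<sqsubset> w \<Longrightarrow> w \<sqsubset> y \<Longrightarrow> y \<sqsubset> d \<Longrightarrow> \<not> R y z"
    unfolding omin.valley_def[OF dual] by blast
  obtain g' d' where gd': "g' \<sqsubset> w" "w \<sqsubset> d'" "\<And>z y. g' \<sqsubset> z \<Longrightarrow> z \<sqsubset> w \<Longrightarrow> w \<sqsubset> y \<Longrightarrow> y \<sqsubset> d' \<Longrightarrow> \<not> R z y"
    using c(2)[OF w(1,2)] unfolding valley_def by blast
  obtain z where "g \<sqsubset> z" "g' \<sqsubset> z" "z \<sqsubset> w"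
    using near_left_ex[OF near_left_conj[OF near_left_less[OF gd(1)] near_left_less[OF gd'(1)]]] by blast
  moreover obtain y where "w \<sqsubset> y" "y \<sqsubset> d" "y \<sqsubset> d'"
    using near_right_ex[OF near_right_conj[OF near_right_less[OF gd(2)] near_right_less[OF gd'(2)]]] by blast
  ultimately show False using gd(3) gd'(3) tot by blast
qed

text \<open>
  Local increase on both sides of each point propagates along the interval by \<open>real_induct\<close>.
\<close>

lemma locally_increasing:
  assumes R: "dfn_vv R" and wo: "weak_order R"
    and mr: "\<And>x. a \<sqsubset> x \<Longrightarrow> x \<sqsubset> b \<Longrightarrow> near_right x (\<lambda>y. \<not> R y x)"
    and ml: "\<And>x. a \<sqsubset> x \<Longrightarrow> x \<sqsubset> b \<Longrightarrow> near_left x (\<lambda>y. \<not> R x y)"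
    and xy: "a \<sqsubset> x" "x \<sqsubset> y" "y \<sqsubset> b"
  shows "\<not> R y x"
proof -
  note tot = weak_order_total[OF wo] and tr = weak_order_trans[OF wo]
  show ?thesis
  proof (rule real_induct[of "\<lambda>v. \<not> R v x" x b])
  show "dfn_v (\<lambda>v. \<not> R v x)" by (intro dfn_vI dfn_intros dfn_vvD[OF R])
  show "\<exists>d. x \<sqsubset> d \<and> (\<forall>y. x \<sqsubset> y \<and> y \<sqsubset> d \<longrightarrow> \<not> R y x)"
    using mr[of x] xy less_trans unfolding near_right_def by blast
  fix s assume s: "x \<sqsubset> s" "s \<sqsubset> b" "\<And>y. x \<sqsubset> y \<Longrightarrow> y \<sqsubset> s \<Longrightarrow> \<not> R y x"
  have as: "a \<sqsubset> s" using xy(1) s(1) less_trans by blast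
  from near_left_ex[OF near_left_conj[OF ml[OF as s(2)] near_left_less[OF s(1)]]]
  obtain z where z: "z \<sqsubset> s" "x \<sqsubset> z" "\<not> R s z" by blast
  have 1: "\<not> R s x" using s(3)[OF z(2,1)] z(3) tot tr by blast
  obtain d where "s \<sqsubset> d" "\<And>y. s \<sqsubset> y \<Longrightarrow> y \<sqsubset> d \<Longrightarrow> \<not> R y s"
    using mr[OF as s(2)] unfolding near_right_def by blast
  then have "s \<sqsubset> d \<and> (\<forall>y. s \<sqsubset> y \<and> y \<sqsubset> d \<longrightarrow> \<not> R y x)" using 1 tot tr by blast
  then show "\<not> R s x \<and> (\<exists>d. s \<sqsubset> d \<and> (\<forall>y. s \<sqsubset> y \<and> y \<sqsubset> d \<longrightarrow> \<not> R y x))" using 1 by blast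
qed (use xy in auto)
qed

text \<open>
  Either one level set is infinite and contains an interval, or all level sets are finite; then the
  points that are least in their level set are infinite in number, and no two of them are equivalent.
\<close>

lemma const_or_injective_piece:
  assumes R: "dfn_vv R" and wo: "weak_order R"
    and ab: "a \<sqsubset> b"
  obtains c d where "a \<sqsubseteq> c" "c \<sqsubset> d" "d \<sqsubseteq> b"
    "(\<forall>x y. c \<sqsubset> x \<and> x \<sqsubset> d \<and> c \<sqsubset> y \<and> y \<sqsubset> d \<longrightarrow> R x y) \<or>
     (\<forall>x y. c \<sqsubset> x \<and> x \<sqsubset> d \<and> c \<sqsubset> y \<and> y \<sqsubset> d \<longrightarrow> x \<noteq> y \<longrightarrow> \<not> (R x y \<and> R y x))"
proof -
  note tot = weak_order_total[OF wo] and tr = weak_order_trans[OF wo]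
  show ?thesis
  proof (cases "\<exists>x. infinite {y. a \<sqsubset> y \<and> y \<sqsubset> b \<and> R x y \<and> R y x}")
  case True
  then obtain x where x: "infinite {y. a \<sqsubset> y \<and> y \<sqsubset> b \<and> R x y \<and> R y x}" by blast
  have "dfn_v (\<lambda>y. R x y \<and> R y x)" by (intro dfn_vI dfn_intros dfn_vvD[OF R])
  from subinterval[OF this x] obtain c d where "a \<sqsubseteq> c" "c \<sqsubset> d" "d \<sqsubseteq> b"
    "\<And>y. c \<sqsubset> y \<Longrightarrow> y \<sqsubset> d \<Longrightarrow> R x y \<and> R y x" by metis
  then show ?thesis using that[of c d] tr by blast
next
  case False
  define X where "X x \<longleftrightarrow> (\<forall>y. a \<sqsubset> y \<and> y \<sqsubset> x \<longrightarrow> \<not> (R x y \<and> R y x))" for x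
  have X: "dfn_v X" unfolding X_def by (intro dfn_vI dfn_intros dfn_vvD[OF R])
  have "infinite {x. a \<sqsubset> x \<and> x \<sqsubset> b \<and> X x}"
  proof
    assume fin: "finite {x. a \<sqsubset> x \<and> x \<sqsubset> b \<and> X x}"
    have "{y. a \<sqsubset> y \<and> y \<sqsubset> b} \<subseteq> (\<Union>x\<in>{x. a \<sqsubset> x \<and> x \<sqsubset> b \<and> X x}. {y. a \<sqsubset> y \<and> y \<sqsubset> b \<and> R x y \<and> R y x})"
    proof
      fix y assume y: "y \<in> {y. a \<sqsubset> y \<and> y \<sqsubset> b}"
      let ?C = "{z. a \<sqsubset> z \<and> z \<sqsubset> b \<and> R y z \<and> R z y}"
      have "finite ?C" using False by blast
      moreover have "y \<in> ?C" using y tot by auto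
      ultimately obtain m where m: "m \<in> ?C" "\<And>z. z \<in> ?C \<Longrightarrow> m \<sqsubseteq> z" using finite_least[of ?C] by blast
      have "X m" unfolding X_def
      proof (intro allI impI notI)
        fix z assume z: "a \<sqsubset> z \<and> z \<sqsubset> m" "R m z \<and> R z m"
        then have "z \<in> ?C" using m(1) tr less_trans by blast
        then show False using m(2) z(1) leD by blast
      qed
      then show "y \<in> (\<Union>x\<in>{x. a \<sqsubset> x \<and> x \<sqsubset> b \<and> X x}. {y. a \<sqsubset> y \<and> y \<sqsubset> b \<and> R x y \<and> R y x})"
        using m(1) y by blast
    qed
    moreover have "finite (\<Union>x\<in>{x. a \<sqsubset> x \<and> x \<sqsubset> b \<and> X x}. {y. a \<sqsubset> y \<and> y \<sqsubset> b \<and> R x y \<and> R y x})"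
      using fin False by blast
    ultimately show False using infinite_interval[OF ab] finite_subset by blast
  qed
  from subinterval[OF X this] obtain c d where cd: "a \<sqsubseteq> c" "c \<sqsubset> d" "d \<sqsubseteq> b"
    "\<And>x. c \<sqsubset> x \<Longrightarrow> x \<sqsubset> d \<Longrightarrow> X x" by metis
  have "\<not> (R x y \<and> R y x)" if "c \<sqsubset> x" "x \<sqsubset> d" "c \<sqsubset> y" "y \<sqsubset> d" "x \<noteq> y" for x y
    using cd(4)[of x] cd(4)[of y] le_interval[OF cd(1,3), of x] le_interval[OF cd(1,3), of y]
      that less_linear[of x y] unfolding X_def by blast
  then show ?thesis using that[of c d] cd by blast
qed
qed

text \<open>
  The monotonicity theorem. On an injective piece each of the four local comparisons has constant truth
  value after shrinking; the two combinations in which every point is a local extremum are impossible.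
\<close>

lemma monotone_piece:
  assumes R: "dfn_vv R" and wo: "weak_order R"
    and ab: "a \<sqsubset> b"
  obtains c d where "a \<sqsubseteq> c" "c \<sqsubset> d" "d \<sqsubseteq> b"
    "(\<forall>x y. c \<sqsubset> x \<and> x \<sqsubset> d \<and> c \<sqsubset> y \<and> y \<sqsubset> d \<longrightarrow> R x y) \<or>
     (\<forall>x y. c \<sqsubset> x \<and> x \<sqsubset> y \<and> y \<sqsubset> d \<longrightarrow> \<not> R y x) \<or>
     (\<forall>x y. c \<sqsubset> x \<and> x \<sqsubset> y \<and> y \<sqsubset> d \<longrightarrow> \<not> R x y)"
proof -
  note tot = weak_order_total[OF wo] and tr = weak_order_trans[OF wo]
  obtain a1 b1 where ab1: "a \<sqsubseteq> a1" "a1 \<sqsubset> b1" "b1 \<sqsubseteq> b" and ci: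
    "(\<forall>x y. a1 \<sqsubset> x \<and> x \<sqsubset> b1 \<and> a1 \<sqsubset> y \<and> y \<sqsubset> b1 \<longrightarrow> R x y) \<or>
     (\<forall>x y. a1 \<sqsubset> x \<and> x \<sqsubset> b1 \<and> a1 \<sqsubset> y \<and> y \<sqsubset> b1 \<longrightarrow> x \<noteq> y \<longrightarrow> \<not> (R x y \<and> R y x))"
    by (rule const_or_injective_piece[OF assms]) (rule that)
  show ?thesis
  proof (cases "\<forall>x y. a1 \<sqsubset> x \<and> x \<sqsubset> b1 \<and> a1 \<sqsubset> y \<and> y \<sqsubset> b1 \<longrightarrow> R x y")
    case True then show ?thesis using that ab1 by blast
  next
    case False
    then have inj: "\<not> (R x y \<and> R y x)" if "a1 \<sqsubset> x" "x \<sqsubset> b1" "a1 \<sqsubset> y" "y \<sqsubset> b1" "x \<noteq> y" for x y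
      using ci that by blast
    define R' where "R' x y \<longleftrightarrow> R y x" for x y
    have wo': "weak_order R'" using wo unfolding weak_order_def R'_def by blast
    have R': "dfn_vv R'" unfolding R'_def by (intro dfn_vvI dfn_vvD[OF R] dfn_intros)
    define RU where "RU x \<longleftrightarrow> near_right x (\<lambda>y. \<not> R y x)" for x
    define RD where "RD x \<longleftrightarrow> near_right x (\<lambda>y. \<not> R x y)" for x
    define LU where "LU x \<longleftrightarrow> near_left x (\<lambda>y. \<not> R y x)" for x
    define LD where "LD x \<longleftrightarrow> near_left x (\<lambda>y. \<not> R x y)" for x
    have d: "dfn_v RU" "dfn_v RD" "dfn_v LU" "dfn_v LD"
      unfolding RU_def RD_def LU_def LD_def by (intro dfn_vI dfn_intros dfn_vvD[OF R])+
    have r: "RU x \<or> RD x" if "a1 \<sqsubset> x" "x \<sqsubset> b1" for x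
    proof -
      have "near_right x (\<lambda>y. R y x) \<or> near_right x (\<lambda>y. \<not> R y x)"
        by (intro near_right_cases dfn_vI dfn_vvD[OF R] dfn_intros)
      moreover have "RD x" if "near_right x (\<lambda>y. R y x)"
        unfolding RD_def using near_right_conj[OF that near_right_less[OF \<open>x \<sqsubset> b1\<close>]]
        by (rule near_right_mono) (use inj[of x] \<open>a1 \<sqsubset> x\<close> \<open>x \<sqsubset> b1\<close> less_trans in blast)
      ultimately show ?thesis unfolding RU_def by blast
    qed
    have l: "LU x \<or> LD x" if "a1 \<sqsubset> x" "x \<sqsubset> b1" for x
    proof -
      have "near_left x (\<lambda>y. R y x) \<or> near_left x (\<lambda>y. \<not> R y x)"
        by (intro near_left_cases dfn_vI dfn_vvD[OF R] dfn_intros)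
      moreover have "LD x" if "near_left x (\<lambda>y. R y x)"
        unfolding LD_def using near_left_conj[OF that near_left_less[OF \<open>a1 \<sqsubset> x\<close>]]
        by (rule near_left_mono) (use inj[of x] \<open>a1 \<sqsubset> x\<close> \<open>x \<sqsubset> b1\<close> less_trans in blast)
      ultimately show ?thesis unfolding LU_def by blast
    qed
    obtain a2 b2 where ab2: "a1 \<sqsubseteq> a2" "a2 \<sqsubset> b2" "b2 \<sqsubseteq> b1"
      "(\<forall>x. a2 \<sqsubset> x \<and> x \<sqsubset> b2 \<longrightarrow> RU x) \<or> (\<forall>x. a2 \<sqsubset> x \<and> x \<sqsubset> b2 \<longrightarrow> RD x)"
      using subinterval_cover[OF d(1,2) ab1(2) r] by metis
    note in1 = le_interval[OF ab2(1,3)]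
    obtain a3 b3 where ab3: "a2 \<sqsubseteq> a3" "a3 \<sqsubset> b3" "b3 \<sqsubseteq> b2"
      "(\<forall>x. a3 \<sqsubset> x \<and> x \<sqsubset> b3 \<longrightarrow> LU x) \<or> (\<forall>x. a3 \<sqsubset> x \<and> x \<sqsubset> b3 \<longrightarrow> LD x)"
      using subinterval_cover[OF d(3,4) ab2(2)] l in1 by metis
    note in2 = le_interval[OF ab3(1,3)]
    have inj3: "\<not> (R x y \<and> R y x)" if "a3 \<sqsubset> x" "x \<sqsubset> b3" "a3 \<sqsubset> y" "y \<sqsubset> b3" "x \<noteq> y" for x y
      using inj[of x y] in1[of x] in1[of y] in2[of x] in2[of y] that by blast
    have sub: "a \<sqsubseteq> a3" "b3 \<sqsubseteq> b" using ab1 ab2 ab3 by (meson order.trans)+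
    consider "\<forall>x. a3 \<sqsubset> x \<and> x \<sqsubset> b3 \<longrightarrow> RU x \<and> LU x" | "\<forall>x. a3 \<sqsubset> x \<and> x \<sqsubset> b3 \<longrightarrow> RU x \<and> LD x"
      | "\<forall>x. a3 \<sqsubset> x \<and> x \<sqsubset> b3 \<longrightarrow> RD x \<and> LU x" | "\<forall>x. a3 \<sqsubset> x \<and> x \<sqsubset> b3 \<longrightarrow> RD x \<and> LD x"
      using ab2(4) ab3(4) in2 by metis
    then show ?thesis
    proof cases
      case 1
      then show ?thesis using no_local_min_everywhere[OF R wo ab3(2) inj3] unfolding RU_def LU_def by blast
    next
      case 2
      then have "\<not> R y x" if "a3 \<sqsubset> x" "x \<sqsubset> y" "y \<sqsubset> b3" for x y
        using locally_increasing[OF R wo _ _ that] unfolding RU_def LD_def by blast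
      then show ?thesis using that[of a3 b3] sub ab3(2) by blast
    next
      case 3
      then have "\<not> R' y x" if "a3 \<sqsubset> x" "x \<sqsubset> y" "y \<sqsubset> b3" for x y
        using locally_increasing[OF R' wo' _ _ that] unfolding RD_def LU_def R'_def by blast
      then show ?thesis using that[of a3 b3] sub ab3(2) unfolding R'_def by blast
    next
      case 4
      then show ?thesis using no_local_min_everywhere[OF R' wo' ab3(2)] inj3
        unfolding RD_def LD_def R'_def by blast
    qed
  qed
qed

text \<open>
  Immediate from monotonicity: some point of the interval lies below, in the weak order, all points of a
  subinterval of which it is an end point. This is how a bound at one point becomes a uniform bound.
\<close>

lemma semi_max_piece:
  assumes R: "dfn_vv R" and wo: "weak_order R"
    and ab: "a \<sqsubset> b"
  obtains t c d where "a \<sqsubset> t" "t \<sqsubset> b" "a \<sqsubseteq> c" "c \<sqsubset> d" "d \<sqsubseteq> b" "t = c \<or> t = d" "\<And>x. c \<sqsubset> x \<Longrightarrow> x \<sqsubset> d \<Longrightarrow> R t x"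
proof -
  note tot = weak_order_total[OF wo] and tr = weak_order_trans[OF wo]
  obtain c d where cd: "a \<sqsubseteq> c" "c \<sqsubset> d" "d \<sqsubseteq> b" and m:
    "(\<forall>x y. c \<sqsubset> x \<and> x \<sqsubset> d \<and> c \<sqsubset> y \<and> y \<sqsubset> d \<longrightarrow> R x y) \<or>
     (\<forall>x y. c \<sqsubset> x \<and> x \<sqsubset> y \<and> y \<sqsubset> d \<longrightarrow> \<not> R y x) \<or>
     (\<forall>x y. c \<sqsubset> x \<and> x \<sqsubset> y \<and> y \<sqsubset> d \<longrightarrow> \<not> R x y)"
    by (rule monotone_piece[OF assms]) (rule that)
  obtain t where t: "c \<sqsubset> t" "t \<sqsubset> d" using dense cd(2) by blast
  have t': "a \<sqsubset> t" "t \<sqsubset> b" using le_interval[OF cd(1,3) t] by auto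
  have "(\<forall>x. t \<sqsubset> x \<and> x \<sqsubset> d \<longrightarrow> R t x) \<or> (\<forall>x. c \<sqsubset> x \<and> x \<sqsubset> t \<longrightarrow> R t x)"
    using m t tot by (meson less_trans)
  then show ?thesis
  proof
    assume "\<forall>x. t \<sqsubset> x \<and> x \<sqsubset> d \<longrightarrow> R t x"
    then show ?thesis using that[of t t d] t t' cd less_imp_le by blast
  next
    assume "\<forall>x. c \<sqsubset> x \<and> x \<sqsubset> t \<longrightarrow> R t x"
    then show ?thesis using that[of t c t] t t' cd less_imp_le by blast
  qed
qed

text \<open>
  Compare \<open>t\<close> and \<open>t'\<close> by inclusion of the initial segments right of \<open>p\<close> on which \<open>Q t\<close> and
  \<open>Q t'\<close> hold. For a least \<open>t\<close> on a piece, its segment works for the whole piece.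
\<close>

lemma uniform_right:
  assumes Q: "dfn_vv Q" and ab: "a \<sqsubset> b" and nr: "\<forall>t. a \<sqsubset> t \<and> t \<sqsubset> b \<longrightarrow> near_right p (Q t)"
  obtains c d q where "a \<sqsubseteq> c" "c \<sqsubset> d" "d \<sqsubseteq> b" "p \<sqsubset> q"
    "\<And>t y. c \<sqsubset> t \<Longrightarrow> t \<sqsubset> d \<Longrightarrow> p \<sqsubset> y \<Longrightarrow> y \<sqsubset> q \<Longrightarrow> Q t y"
proof -
  define G where "G t x \<longleftrightarrow> (\<forall>y. p \<sqsubset> y \<and> y \<sqsubset> x \<longrightarrow> Q t y)" for t x
  define R where "R t t' \<longleftrightarrow> (\<forall>x. G t x \<longrightarrow> G t' x)" for t t'
  have R: "dfn_vv R" unfolding R_def G_def by (intro dfn_vvI dfn_intros dfn_vvD[OF Q])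
  have G_mono: "G t x" if "x \<sqsubseteq> x'" "G t x'" for t x x'
    using that less_le_trans unfolding G_def by blast
  have tot: "R t t' \<or> R t' t" for t t'
    unfolding R_def using G_mono linear by blast
  have wo: "weak_order R" using tot unfolding weak_order_def R_def by blast
  obtain t c d where t: "a \<sqsubset> t" "t \<sqsubset> b" "a \<sqsubseteq> c" "c \<sqsubset> d" "d \<sqsubseteq> b" "\<And>x. c \<sqsubset> x \<Longrightarrow> x \<sqsubset> d \<Longrightarrow> R t x"
    by (rule semi_max_piece[OF R wo ab]) (rule that)
  obtain q where "p \<sqsubset> q" "G t q" using nr t(1,2) unfolding near_right_def G_def by blast
  then show ?thesis using that[of c d q] t unfolding R_def G_def by blast
qed

text \<open>
  As in \<open>uniform_right\<close>, with segments that start at \<open>t\<close> itself; the least point is an end point of the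
  piece, so after shrinking the piece all later points are close enough.
\<close>

lemma uniform_diag_right:
  assumes P: "dfn_vv P" and ab: "a \<sqsubset> b" and nr: "\<forall>t. a \<sqsubset> t \<and> t \<sqsubset> b \<longrightarrow> near_right t (P t)"
  obtains c d where "a \<sqsubseteq> c" "c \<sqsubset> d" "d \<sqsubseteq> b" "\<And>t u. c \<sqsubset> t \<Longrightarrow> t \<sqsubset> u \<Longrightarrow> u \<sqsubset> d \<Longrightarrow> P t u"
proof -
  define G where "G t x \<longleftrightarrow> (\<forall>y. t \<sqsubset> y \<and> y \<sqsubset> x \<longrightarrow> P t y)" for t x
  define R where "R t t' \<longleftrightarrow> (\<forall>x. G t x \<longrightarrow> G t' x)" for t t'
  have R: "dfn_vv R" unfolding R_def G_def by (intro dfn_vvI dfn_intros dfn_vvD[OF P])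
  have G_mono: "G t x" if "x \<sqsubseteq> x'" "G t x'" for t x x'
    using that less_le_trans unfolding G_def by blast
  have tot: "R t t' \<or> R t' t" for t t'
    unfolding R_def using G_mono linear by blast
  have wo: "weak_order R" using tot unfolding weak_order_def R_def by blast
  obtain t c d where t: "a \<sqsubset> t" "t \<sqsubset> b" "a \<sqsubseteq> c" "c \<sqsubset> d" "d \<sqsubseteq> b" "t = c \<or> t = d"
    "\<And>x. c \<sqsubset> x \<Longrightarrow> x \<sqsubset> d \<Longrightarrow> R t x"
    by (rule semi_max_piece[OF R wo ab]) (rule that)
  obtain q where q: "t \<sqsubset> q" "G t q" using nr t(1,2) unfolding near_right_def G_def by blast
  have Gq: "P x y" if "c \<sqsubset> x" "x \<sqsubset> d" "x \<sqsubset> y" "y \<sqsubset> q" for x y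
    using t(7)[of x] that q(2) unfolding R_def G_def by blast
  show ?thesis
  proof (cases "t = d")
    case True
    then show ?thesis using that[of c d] t Gq q(1) less_trans by blast
  next
    case False
    then have tc: "t = c" using t(6) by blast
    obtain d' where d': "c \<sqsubset> d'" "d' \<sqsubset> d" "d' \<sqsubset> q"
      using near_right_ex[OF near_right_conj[OF near_right_less[OF t(4)] near_right_less[OF q(1)[unfolded tc]]]]
      by blast
    have "P x y" if "c \<sqsubset> x" "x \<sqsubset> y" "y \<sqsubset> d'" for x y
      by (rule Gq) (use that d' less_trans in blast)+
    moreover have "d' \<sqsubseteq> b" using d'(2) t(5) by (meson less_imp_le order.trans)
    ultimately show ?thesis using that[of c d'] t(3) d'(1) by blast
  qed
qed

lemma uniform_left:
  assumes Q: "dfn_vv Q" and ab: "a \<sqsubset> b" and nr: "\<forall>t. a \<sqsubset> t \<and> t \<sqsubset> b \<longrightarrow> near_left p (Q t)"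
  obtains c d q where "a \<sqsubseteq> c" "c \<sqsubset> d" "d \<sqsubseteq> b" "q \<sqsubset> p"
    "\<And>t y. c \<sqsubset> t \<Longrightarrow> t \<sqsubset> d \<Longrightarrow> q \<sqsubset> y \<Longrightarrow> y \<sqsubset> p \<Longrightarrow> Q t y"
proof (rule omin.uniform_right[OF dual, unfolded dual_near_right, where Q=Q and a=b and b=a and p=p])
  show "\<forall>t. t \<sqsubset> b \<and> a \<sqsubset> t \<longrightarrow> near_left p (Q t)" using nr by blast
  fix c d q assume "c \<sqsubseteq> b" "d \<sqsubset> c" "a \<sqsubseteq> d" "q \<sqsubset> p"
    "\<And>t y. t \<sqsubset> c \<Longrightarrow> d \<sqsubset> t \<Longrightarrow> y \<sqsubset> p \<Longrightarrow> q \<sqsubset> y \<Longrightarrow> Q t y"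
  then show thesis using that[of d c q] by blast
qed (use Q ab in auto)

lemma uniform_diag_left:
  assumes P: "dfn_vv P" and ab: "a \<sqsubset> b" and nr: "\<forall>t. a \<sqsubset> t \<and> t \<sqsubset> b \<longrightarrow> near_left t (P t)"
  obtains c d where "a \<sqsubseteq> c" "c \<sqsubset> d" "d \<sqsubseteq> b" "\<And>t u. c \<sqsubset> u \<Longrightarrow> u \<sqsubset> t \<Longrightarrow> t \<sqsubset> d \<Longrightarrow> P t u"
proof (rule omin.uniform_diag_right[OF dual, unfolded dual_near_right, where P=P and a=b and b=a])
  show "\<forall>t. t \<sqsubset> b \<and> a \<sqsubset> t \<longrightarrow> near_left t (P t)" using nr by blast
  fix c d assume "c \<sqsubseteq> b" "d \<sqsubset> c" "a \<sqsubseteq> d"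
    "\<And>t u. t \<sqsubset> c \<Longrightarrow> u \<sqsubset> t \<Longrightarrow> d \<sqsubset> u \<Longrightarrow> P t u"
  then show thesis using that[of d c] by blast
qed (use P ab in auto)

end

section \<open>Planar sets with finite fibres\<close>

context omin begin

text \<open>
  Names the position of a point relative to a finite set by a number, which makes the choice of a gap
  definable.
\<close>

definition gap_index :: "'a set \<Rightarrow> 'a \<Rightarrow> nat" where
  "gap_index B x = card {b \<in> B. b \<sqsubset> x}"

lemma same_gap_less:
  assumes B: "finite B" "x \<notin> B" "y \<notin> B" "gap_index B x = gap_index B y" and xy: "x \<sqsubseteq> y"
  obtains p q where "p \<sqsubset> x" "x \<sqsubset> q" "p \<sqsubset> y" "y \<sqsubset> q" "\<And>z. p \<sqsubset> z \<Longrightarrow> z \<sqsubset> q \<Longrightarrow> z \<notin> B"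
proof -
  have "{b \<in> B. b \<sqsubset> x} \<subseteq> {b \<in> B. b \<sqsubset> y}" using xy less_le_trans by blast
  moreover have "card {b \<in> B. b \<sqsubset> x} = card {b \<in> B. b \<sqsubset> y}" using B(4) by (simp add: gap_index_def)
  ultimately have eq: "{b \<in> B. b \<sqsubset> x} = {b \<in> B. b \<sqsubset> y}"
    using B(1) by (intro card_subset_eq) auto
  obtain p where p: "p \<sqsubset> x" "\<And>z. z \<sqsubset> x \<Longrightarrow> p \<sqsubset> z \<Longrightarrow> z \<notin> B"
    using finite_gap_left[OF B(1), of x] by blast
  obtain q where q: "y \<sqsubset> q" "\<And>z. y \<sqsubset> z \<Longrightarrow> z \<sqsubset> q \<Longrightarrow> z \<notin> B"
    using finite_gap_right[OF B(1), of y] by blast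
  have "z \<notin> B" if "p \<sqsubset> z" "z \<sqsubset> q" for z
  proof
    assume z: "z \<in> B"
    then have "\<not> z \<sqsubset> x" "\<not> y \<sqsubset> z" using p(2) q(2) that by blast+
    then have "z \<sqsubset> y" "\<not> z \<sqsubset> x" using z B(2,3) by (auto simp: not_less order.order_iff_strict)
    then show False using eq z by blast
  qed
  then show ?thesis using that[of p q] p(1) q(1) xy le_less_trans less_le_trans by blast
qed

lemma same_gap:
  assumes B: "finite B" "x \<notin> B" "y \<notin> B" "gap_index B x = gap_index B y"
  obtains p q where "p \<sqsubset> x" "x \<sqsubset> q" "p \<sqsubset> y" "y \<sqsubset> q" "\<And>z. p \<sqsubset> z \<Longrightarrow> z \<sqsubset> q \<Longrightarrow> z \<notin> B"
proof (cases "x \<sqsubseteq> y")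
  case True show ?thesis by (rule same_gap_less[OF B True]) (rule that)
next
  case False
  then have "y \<sqsubseteq> x" by simp
  show ?thesis
    by (rule same_gap_less[OF B(1,3,2) B(4)[symmetric] \<open>y \<sqsubseteq> x\<close>]) (rule that)
qed

lemma gap_index_le: "finite B \<Longrightarrow> gap_index B x \<le> card B"
  unfolding gap_index_def by (rule card_mono) auto

text \<open>
  Filter notation for truth on a neighbourhood; \<open>x\<close> is not a boundary point of \<open>X\<close> if and only if
  \<open>X\<close> is constant near \<open>x\<close> (\<open>bdry_nbhd\<close>).
\<close>

definition nbhd :: "'a \<Rightarrow> ('a \<Rightarrow> bool) \<Rightarrow> bool" where
  "nbhd a Q \<longleftrightarrow> (\<exists>c d. c \<sqsubset> a \<and> a \<sqsubset> d \<and> (\<forall>x. c \<sqsubset> x \<and> x \<sqsubset> d \<longrightarrow> Q x))"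

lemma nbhd_dual: "omin.nbhd (\<lambda>x y. y \<sqsubset> x) = nbhd"
  unfolding omin.nbhd_def[OF dual] nbhd_def by (intro ext) blast

lemma dfn_nbhd [dfn_intros]:
  assumes "coord_map \<tau>" "dfn (\<lambda>e. R (\<lambda>i. e (Suc i)) (e 0))"
  shows "dfn (\<lambda>e. nbhd (\<tau> e) (R e))"
proof -
  have "dfn (\<lambda>e. nbhd (e 0) (R (\<lambda>i. e (Suc i))))"
    unfolding nbhd_def by (intro dfn_intros dfn_evD[OF dfn_evI[OF assms(2)]])
  from dfn_subst[OF this env_map_case_nat[OF assms(1) env_map_id]] show ?thesis by simp
qed

lemma nbhdI: "c \<sqsubset> a \<Longrightarrow> a \<sqsubset> d \<Longrightarrow> (\<And>x. c \<sqsubset> x \<Longrightarrow> x \<sqsubset> d \<Longrightarrow> Q x) \<Longrightarrow> nbhd a Q"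
  unfolding nbhd_def by blast

lemma nbhd_self: "nbhd a Q \<Longrightarrow> Q a"
  unfolding nbhd_def by blast

lemma nbhd_mono: "nbhd a P \<Longrightarrow> (\<And>x. P x \<Longrightarrow> Q x) \<Longrightarrow> nbhd a Q"
  unfolding nbhd_def by blast

lemma nbhd_iff: "nbhd a Q \<longleftrightarrow> near_left a Q \<and> Q a \<and> near_right a Q"
proof
  assume "nbhd a Q" then show "near_left a Q \<and> Q a \<and> near_right a Q"
    unfolding nbhd_def near_left_def near_right_def using less_trans by blast
next
  assume a: "near_left a Q \<and> Q a \<and> near_right a Q"
  then obtain c d where "c \<sqsubset> a" "\<And>x. x \<sqsubset> a \<Longrightarrow> c \<sqsubset> x \<Longrightarrow> Q x" "a \<sqsubset> d" "\<And>x. a \<sqsubset> x \<Longrightarrow> x \<sqsubset> d \<Longrightarrow> Q x"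
    unfolding near_left_def near_right_def by blast
  then show "nbhd a Q" using nbhdI[of c a d Q] a less_linear by metis
qed

lemma nbhd_conj: "nbhd a P \<Longrightarrow> nbhd a Q \<Longrightarrow> nbhd a (\<lambda>x. P x \<and> Q x)"
  unfolding nbhd_iff using near_left_conj near_right_conj by blast

lemma nbhd_interval: "c \<sqsubset> a \<Longrightarrow> a \<sqsubset> d \<Longrightarrow> nbhd a (\<lambda>x. c \<sqsubset> x \<and> x \<sqsubset> d)"
  by (rule nbhdI) auto

lemma bdry_nbhd: "x \<notin> bdry X \<longleftrightarrow> nbhd x (\<lambda>y. X y = X x)"
  unfolding bdry_def nbhd_def by blast

lemma interval_in_infinite:
  assumes X: "dfn_v X" and "infinite {t. X t}" and "finite {t. Y t}"
  obtains a b where "a \<sqsubset> b" "\<And>t. a \<sqsubset> t \<Longrightarrow> t \<sqsubset> b \<Longrightarrow> X t \<and> \<not> Y t"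
proof -
  obtain a b where ab: "a \<sqsubset> b" "\<And>t. a \<sqsubset> t \<Longrightarrow> t \<sqsubset> b \<Longrightarrow> X t"
    by (rule infinite_has_interval[OF assms(1,2)]) (rule that)
  obtain d where "a \<sqsubset> d" "\<And>t. a \<sqsubset> t \<Longrightarrow> t \<sqsubset> d \<Longrightarrow> \<not> Y t"
    using finite_gap_right[OF assms(3), of a] by auto
  then show ?thesis using that[of a b] that[of a d] ab
    by (cases "b \<sqsubseteq> d") (auto dest: less_le_trans less_trans simp: not_le)
qed

definition interior2 :: "('a \<Rightarrow> 'a \<Rightarrow> bool) \<Rightarrow> 'a \<Rightarrow> 'a \<Rightarrow> bool" where
  "interior2 W t u \<longleftrightarrow> nbhd u (W t)"

lemma infinite_interior2:
  assumes W: "dfn_vv W" and inf: "infinite {u. W t u}"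
  shows "infinite {u. interior2 W t u}"
proof -
  have "dfn_v (W t)" by (intro dfn_vI dfn_vvD[OF W] dfn_intros)
  then obtain a b where ab: "a \<sqsubset> b" "\<And>u. a \<sqsubset> u \<Longrightarrow> u \<sqsubset> b \<Longrightarrow> W t u"
    by (rule infinite_has_interval[OF _ inf]) (rule that)
  then have "{u. a \<sqsubset> u \<and> u \<sqsubset> b} \<subseteq> {u. interior2 W t u}" unfolding interior2_def by (blast intro: nbhdI)
  then show ?thesis using infinite_interval[OF ab(1)] infinite_super by blast
qed

text \<open>
  Small sets in the plane look small from both sides. Suppose infinitely many vertical fibres of \<open>W\<close>
  were infinite; then those over an interval \<open>(a,b)\<close> have interior. Let \<open>\<mu> u\<close> be the least \<open>t\<close> in
  \<open>(a,b)\<close> such that \<open>u\<close> is interior to the fibre over \<open>t\<close>. Near each \<open>u\<close>, this \<open>\<mu>\<close> is at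
  most \<open>\<mu> u\<close>, so it is not strictly monotone on any interval. By the monotonicity theorem it takes only
  finitely many values, although it takes values arbitrarily close to \<open>a\<close>.
\<close>

lemma fubini_finite:
  assumes W: "dfn_vv W" and fin: "\<And>u. finite {t. W t u}"
  shows "finite {t. infinite {u. W t u}}"
proof (rule ccontr)
  assume inf: "infinite {t. infinite {u. W t u}}"
  have "dfn_v (\<lambda>t. infinite {u. W t u})" by (intro dfn_vI dfn_intros dfn_vvD[OF W])
  from infinite_has_interval[OF this inf]
  obtain a b where ab: "a \<sqsubset> b" "\<And>t. a \<sqsubset> t \<Longrightarrow> t \<sqsubset> b \<Longrightarrow> infinite {u. W t u}" by auto
  define V where "V t u \<longleftrightarrow> interior2 W t u" for t u
  have V: "dfn_vv V" unfolding V_def interior2_def by (intro dfn_vvI dfn_intros dfn_vvD[OF W])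
  have V_nbhd: "nbhd u (V t)" if "V t u" for t u
    using that unfolding V_def interior2_def nbhd_def by blast
  have V_ne: "\<exists>u. V t u" if "a \<sqsubset> t" "t \<sqsubset> b" for t
    using infinite_interior2[OF W ab(2)[OF that]] unfolding V_def by (metis (no_types) Collect_empty_eq finite.emptyI)
  define M where "M u t \<longleftrightarrow> a \<sqsubset> t \<and> t \<sqsubset> b \<and> V t u" for u t
  have M: "dfn_vv M" unfolding M_def by (intro dfn_vvI dfn_intros dfn_vvD[OF V])
  have finM: "finite {t. M u t}" for u
    by (rule finite_subset[OF _ fin[of u]]) (auto simp: M_def V_def interior2_def dest: nbhd_self)
  define \<mu> where "\<mu> u = (SOME t. M u t \<and> (\<forall>t'. M u t' \<longrightarrow> t \<sqsubseteq> t'))" for u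
  have \<mu>: "M u (\<mu> u) \<and> (\<forall>t'. M u t' \<longrightarrow> \<mu> u \<sqsubseteq> t')" if "M u t" for u t
  proof -
    have "\<exists>t. M u t \<and> (\<forall>t'. M u t' \<longrightarrow> t \<sqsubseteq> t')"
      using finite_least[OF finM, of u] that by blast
    then show ?thesis unfolding \<mu>_def by (rule someI_ex)
  qed
  define R where "R u u' \<longleftrightarrow> (\<forall>t'. M u' t' \<longrightarrow> (\<exists>t. t \<sqsubseteq> t' \<and> M u t))" for u u'
  have R: "dfn_vv R" unfolding R_def by (intro dfn_vvI dfn_intros dfn_vvD[OF M])
  have wo: "weak_order R" unfolding weak_order_def R_def
    by (meson linear order.trans)
  have R_near: "nbhd u (\<lambda>u'. R u' u)" if "M u t" for u t
  proof -
    have m: "M u (\<mu> u)" "\<And>t'. M u t' \<Longrightarrow> \<mu> u \<sqsubseteq> t'" using \<mu>[OF that] by blast+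
    have "nbhd u (V (\<mu> u))" using V_nbhd m(1) unfolding M_def by blast
    then show ?thesis
      by (rule nbhd_mono) (use m in \<open>auto simp: R_def M_def\<close>)
  qed
  define U where "U u \<longleftrightarrow> (\<exists>t. M u t)" for u
  \<comment> \<open>The points near which \<open>\<mu>\<close> is not constant.\<close>
  define N where "N u \<longleftrightarrow> U u \<and> \<not> nbhd u (\<lambda>u'. R u' u \<and> R u u')" for u
  have U: "dfn_v U" unfolding U_def by (intro dfn_vI dfn_intros dfn_vvD[OF M])
  have N: "dfn_v N" unfolding N_def by (intro dfn_vI dfn_intros dfn_vvD[OF R] dfn_vD[OF U])
  have finN: "finite {u. N u}"
  proof (rule ccontr)
    assume "infinite {u. N u}"
    from infinite_has_interval[OF N this]
    obtain c d where cd: "c \<sqsubset> d" "\<And>u. c \<sqsubset> u \<Longrightarrow> u \<sqsubset> d \<Longrightarrow> N u" by auto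
    obtain c' d' where cd': "c \<sqsubseteq> c'" "c' \<sqsubset> d'" "d' \<sqsubseteq> d" and m:
      "(\<forall>x y. c' \<sqsubset> x \<and> x \<sqsubset> d' \<and> c' \<sqsubset> y \<and> y \<sqsubset> d' \<longrightarrow> R x y) \<or>
       (\<forall>x y. c' \<sqsubset> x \<and> x \<sqsubset> y \<and> y \<sqsubset> d' \<longrightarrow> \<not> R y x) \<or>
       (\<forall>x y. c' \<sqsubset> x \<and> x \<sqsubset> y \<and> y \<sqsubset> d' \<longrightarrow> \<not> R x y)"
      by (rule monotone_piece[OF R wo cd(1)]) (rule that)
    obtain u where u: "c' \<sqsubset> u" "u \<sqsubset> d'" using dense cd'(2) by blast
    have Nu: "N u" using cd(2) le_interval[OF cd'(1,3) u] by blast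
    then obtain t where "M u t" unfolding N_def U_def by blast
    from nbhd_conj[OF R_near[OF this] nbhd_interval[OF u]]
    have near: "nbhd u (\<lambda>u'. R u' u \<and> c' \<sqsubset> u' \<and> u' \<sqsubset> d')" .
    have "near_right u (\<lambda>u'. R u' u \<and> c' \<sqsubset> u' \<and> u' \<sqsubset> d')" "near_left u (\<lambda>u'. R u' u \<and> c' \<sqsubset> u' \<and> u' \<sqsubset> d')"
      using near unfolding nbhd_iff by blast+
    from near_right_ex[OF this(1)] near_left_ex[OF this(2)]
    obtain v w where vw: "u \<sqsubset> v" "R v u" "v \<sqsubset> d'" "w \<sqsubset> u" "R w u" "c' \<sqsubset> w" by blast
    from m show False
    proof (elim disjE)
      assume const: "\<forall>x y. c' \<sqsubset> x \<and> x \<sqsubset> d' \<and> c' \<sqsubset> y \<and> y \<sqsubset> d' \<longrightarrow> R x y"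
      have "nbhd u (\<lambda>u'. R u' u \<and> R u u')"
        using near by (rule nbhd_mono) (use const u in blast)
      then show False using Nu unfolding N_def by blast
    qed (use vw u in blast)+
  qed
  define B where "B = {u. N u} \<union> bdry U"
  have finB: "finite B" unfolding B_def using finN finite_bdry[OF U] by blast
  have same: "\<mu> u = \<mu> u'" if uu: "U u" "U u'" "u \<notin> B" "u' \<notin> B" "gap_index B u = gap_index B u'" for u u'
  proof -
    obtain p q where pq: "p \<sqsubset> u" "u \<sqsubset> q" "p \<sqsubset> u'" "u' \<sqsubset> q" "\<And>z. p \<sqsubset> z \<Longrightarrow> z \<sqsubset> q \<Longrightarrow> z \<notin> B"
      by (rule same_gap[OF finB uu(3-5)]) (rule that)
    have Uz: "U z" if "p \<sqsubset> z" "z \<sqsubset> q" for z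
      using const_on_interval[OF U _ that pq(1,2)] pq(5) uu(1) unfolding B_def by blast
    define X where "X x \<longleftrightarrow> R x u \<and> R u x" for x
    have X: "dfn_v X" unfolding X_def by (intro dfn_vI dfn_intros dfn_vvD[OF R])
    have Xb: "x \<notin> bdry X" if x: "p \<sqsubset> x" "x \<sqsubset> q" for x
    proof -
      have "nbhd x (\<lambda>y. R y x \<and> R x y)" using Uz[OF x] pq(5)[OF x] unfolding B_def N_def by blast
      then show ?thesis unfolding bdry_nbhd
        by (rule nbhd_mono) (use weak_order_trans[OF wo] in \<open>unfold X_def, blast\<close>)
    qed
    have "X u" using weak_order_total[OF wo] unfolding X_def by blast
    then have "X u'" using const_on_interval[OF X Xb pq(1,2) pq(3,4)] by blast
    then have r: "R u u'" "R u' u" unfolding X_def by auto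
    obtain t where t: "M u t" using uu(1) unfolding U_def by blast
    obtain t' where t': "M u' t'" using uu(2) unfolding U_def by blast
    obtain s where s: "s \<sqsubseteq> \<mu> u'" "M u s" using r(1) \<mu>[OF t'] unfolding R_def by blast
    obtain s' where s': "s' \<sqsubseteq> \<mu> u" "M u' s'" using r(2) \<mu>[OF t] unfolding R_def by blast
    have "\<mu> u \<sqsubseteq> s" "\<mu> u' \<sqsubseteq> s'" using \<mu>[OF t] \<mu>[OF t'] s(2) s'(2) by blast+
    then have "\<mu> u \<sqsubseteq> \<mu> u'" "\<mu> u' \<sqsubseteq> \<mu> u" using s(1) s'(1) order.trans by blast+
    then show ?thesis by simp
  qed
  have finT: "finite (\<mu> ` {u. U u})"
  proof -
    have "finite (\<mu> ` ({u. U u} - B))"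
    proof (rule finite_image_factor[of "gap_index B"])
      show "finite (gap_index B ` ({u. U u} - B))"
        by (rule finite_subset[of _ "{..card B}"]) (use gap_index_le[OF finB] in auto)
    qed (use same in auto)
    moreover have "\<mu> ` {u. U u} \<subseteq> \<mu> ` ({u. U u} - B) \<union> \<mu> ` B" by blast
    ultimately show ?thesis using finB by (meson finite_Un finite_imageI finite_subset)
  qed
  obtain c where c: "a \<sqsubset> c" "\<And>x. a \<sqsubset> x \<Longrightarrow> x \<sqsubset> c \<Longrightarrow> x \<notin> \<mu> ` {u. U u}"
    using finite_gap_right[OF finT, of a] by blast
  from near_right_ex[OF near_right_conj[OF near_right_less[OF c(1)] near_right_less[OF ab(1)]]]
  obtain t where t: "a \<sqsubset> t" "t \<sqsubset> c" "t \<sqsubset> b" by blast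
  obtain u where "V t u" using V_ne t by blast
  then have m: "M u t" unfolding M_def using t by blast
  then have "a \<sqsubset> \<mu> u" "\<mu> u \<sqsubseteq> t" using \<mu>[OF m] unfolding M_def by blast+
  then have "\<mu> u \<notin> \<mu> ` {u. U u}" using c(2) t(2) le_less_trans by blast
  then show False using m unfolding U_def by blast
qed

text \<open>
  By \<open>fubini_finite\<close> some \<open>u\<close> is interior to the fibres over a whole interval of \<open>t\<close>, and
  \<open>uniform_right\<close> makes a one-sided neighbourhood of \<open>u\<close> independent of \<open>t\<close>.
\<close>

lemma box:
  assumes W: "dfn_vv W" and inf: "infinite {t. infinite {u. W t u}}"
  obtains c d p q where "c \<sqsubset> d" "p \<sqsubset> q"
    "\<And>t u. c \<sqsubset> t \<Longrightarrow> t \<sqsubset> d \<Longrightarrow> p \<sqsubset> u \<Longrightarrow> u \<sqsubset> q \<Longrightarrow> W t u"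
proof -
  let ?V = "interior2 W"
  have V: "dfn_vv ?V" unfolding interior2_def by (intro dfn_vvI dfn_intros dfn_vvD[OF W])
  have "infinite {t. infinite {u. ?V t u}}"
    by (rule infinite_super[OF _ inf]) (use infinite_interior2[OF W] in blast)
  then obtain u where u: "infinite {t. ?V t u}" using fubini_finite[OF V] by blast
  have "dfn_v (\<lambda>t. ?V t u)" by (intro dfn_vI dfn_vvD[OF V] dfn_intros)
  from infinite_has_interval[OF this u]
  obtain c d where cd: "c \<sqsubset> d" "\<And>t. c \<sqsubset> t \<Longrightarrow> t \<sqsubset> d \<Longrightarrow> ?V t u" by auto
  have nr: "\<forall>t. c \<sqsubset> t \<and> t \<sqsubset> d \<longrightarrow> near_right u (W t)"
    using cd(2) unfolding interior2_def nbhd_iff by blast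
  obtain c' d' q where "c' \<sqsubset> d'" "u \<sqsubset> q"
    "\<And>t y. c' \<sqsubset> t \<Longrightarrow> t \<sqsubset> d' \<Longrightarrow> u \<sqsubset> y \<Longrightarrow> y \<sqsubset> q \<Longrightarrow> W t y"
    by (rule uniform_right[OF W cd(1) nr]) (rule that)
  then show ?thesis by (rule that)
qed

end

section \<open>Local constancy of the number of points in a finite fibre\<close>

context omin begin

lemma dfn_ex1 [dfn_intros]:
  assumes "dfn (\<lambda>e. R (\<lambda>i. e (Suc i)) (e 0))" shows "dfn (\<lambda>e. \<exists>!a. R e a)"
  unfolding Ex1_def by (intro dfn_intros dfn_evD[OF dfn_evI[OF assms]])

text \<open>
  Near \<open>(t,u)\<close> the set \<open>E\<close> either is the graph of a function through this point that is continuous at \<open>t\<close>, or it is empty.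
  The condition is stated with intervals instead of functions so that it is first-order.
\<close>

definition normal :: "('a \<Rightarrow> 'a \<Rightarrow> bool) \<Rightarrow> 'a \<Rightarrow> 'a \<Rightarrow> bool" where
  "normal E t u \<longleftrightarrow>
    (E t u \<longrightarrow> (\<exists>p0 q0. p0 \<sqsubset> u \<and> u \<sqsubset> q0 \<and> (\<forall>p q. p0 \<sqsubseteq> p \<and> p \<sqsubset> u \<and> u \<sqsubset> q \<and> q \<sqsubseteq> q0 \<longrightarrow>
      nbhd t (\<lambda>t'. \<exists>!u'. p \<sqsubset> u' \<and> u' \<sqsubset> q \<and> E t' u')))) \<and>
    (\<not> E t u \<longrightarrow> (\<exists>p q. p \<sqsubset> u \<and> u \<sqsubset> q \<and> nbhd t (\<lambda>t'. \<forall>u'. p \<sqsubset> u' \<and> u' \<sqsubset> q \<longrightarrow> \<not> E t' u')))"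

definition bounded_above_near :: "('a \<Rightarrow> 'a \<Rightarrow> bool) \<Rightarrow> 'a \<Rightarrow> bool" where
  "bounded_above_near E t \<longleftrightarrow> (\<exists>q. nbhd t (\<lambda>t'. \<forall>u. E t' u \<longrightarrow> u \<sqsubset> q))"

definition bounded_below_near :: "('a \<Rightarrow> 'a \<Rightarrow> bool) \<Rightarrow> 'a \<Rightarrow> bool" where
  "bounded_below_near E t \<longleftrightarrow> (\<exists>p. nbhd t (\<lambda>t'. \<forall>u. E t' u \<longrightarrow> p \<sqsubset> u))"

text \<open>
  The conditions under which no point of the finite fibre over \<open>t\<close> can appear, disappear or escape to
  infinity when \<open>t\<close> moves slightly.
\<close>

definition tame_at :: "('a \<Rightarrow> 'a \<Rightarrow> bool) \<Rightarrow> 'a \<Rightarrow> bool" where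
  "tame_at E t \<longleftrightarrow> bounded_above_near E t \<and> bounded_below_near E t \<and> (\<forall>u. normal E t u)"

text \<open>
  Emptiness near each single point of a closed interval spreads over the interval by \<open>real_induct\<close>, which
  replaces compactness.
\<close>

lemma normal_gap:
  assumes E: "dfn_vv E" and pq: "p \<sqsubset> q"
    and gap: "\<And>u. p \<sqsubseteq> u \<Longrightarrow> u \<sqsubseteq> q \<Longrightarrow> \<not> E t u \<and> normal E t u"
  shows "nbhd t (\<lambda>t'. \<forall>u. p \<sqsubseteq> u \<and> u \<sqsubseteq> q \<longrightarrow> \<not> E t' u)"
proof -
  define X where "X x \<longleftrightarrow> x \<sqsubseteq> q \<longrightarrow> nbhd t (\<lambda>t'. \<forall>u. p \<sqsubseteq> u \<and> u \<sqsubseteq> x \<longrightarrow> \<not> E t' u)" for x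
  have X: "dfn_v X" unfolding X_def by (intro dfn_vI dfn_intros dfn_vvD[OF E])
  obtain b where b: "q \<sqsubset> b" using gt_ex by blast
  have box: "\<exists>p' q'. p' \<sqsubset> u \<and> u \<sqsubset> q' \<and> nbhd t (\<lambda>t'. \<forall>u'. p' \<sqsubset> u' \<and> u' \<sqsubset> q' \<longrightarrow> \<not> E t' u')"
    if "p \<sqsubseteq> u" "u \<sqsubseteq> q" for u
    using gap[OF that] unfolding normal_def by blast
  have "X q"
  proof (rule real_induct[OF X _ _ pq b])
    obtain p' q' where b: "p' \<sqsubset> p" "p \<sqsubset> q'" "nbhd t (\<lambda>t'. \<forall>u'. p' \<sqsubset> u' \<and> u' \<sqsubset> q' \<longrightarrow> \<not> E t' u')"
      using box[OF order.refl less_imp_le[OF pq]] by blast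
    have "X y" if "p \<sqsubset> y" "y \<sqsubset> q'" for y
      unfolding X_def
      by (rule impI, rule nbhd_mono[OF b(3)])
        (use less_le_trans[OF b(1)] le_less_trans[OF _ that(2)] in blast)
    then show "\<exists>d. p \<sqsubset> d \<and> (\<forall>y. p \<sqsubset> y \<and> y \<sqsubset> d \<longrightarrow> X y)" using b(2) by blast
  next
    fix s assume s: "p \<sqsubset> s" "s \<sqsubset> b" "\<And>y. p \<sqsubset> y \<Longrightarrow> y \<sqsubset> s \<Longrightarrow> X y"
    show "X s \<and> (\<exists>d. s \<sqsubset> d \<and> (\<forall>y. s \<sqsubset> y \<and> y \<sqsubset> d \<longrightarrow> X y))"
    proof (cases "s \<sqsubseteq> q")
      case False
      then show ?thesis unfolding X_def using s(2) by (meson less_le_not_le less_le_trans not_less order.trans)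
    next
      case True
      obtain p' q' where b: "p' \<sqsubset> s" "s \<sqsubset> q'" "nbhd t (\<lambda>t'. \<forall>u'. p' \<sqsubset> u' \<and> u' \<sqsubset> q' \<longrightarrow> \<not> E t' u')"
        using box[OF less_imp_le[OF s(1)] True] by blast
      obtain z where z: "p' \<sqsubset> z" "p \<sqsubset> z" "z \<sqsubset> s"
        using near_left_ex[OF near_left_conj[OF near_left_less[OF b(1)] near_left_less[OF s(1)]]] by blast
      have "z \<sqsubseteq> q" using z(3) True by (meson less_imp_le order.trans)
      then have Xz: "nbhd t (\<lambda>t'. \<forall>u. p \<sqsubseteq> u \<and> u \<sqsubseteq> z \<longrightarrow> \<not> E t' u)" using s(3)[OF z(2,3)] unfolding X_def by blast
      have "X y" if y: "y \<sqsubset> q'" for y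
        unfolding X_def
      proof
        show "nbhd t (\<lambda>t'. \<forall>u. p \<sqsubseteq> u \<and> u \<sqsubseteq> y \<longrightarrow> \<not> E t' u)"
          by (rule nbhd_mono[OF nbhd_conj[OF Xz b(3)]])
            (meson z(1) y less_le_trans le_less_trans not_le less_imp_le)
      qed
      then show ?thesis using b(2) by blast
    qed
  qed
  then show ?thesis unfolding X_def by blast
qed

text \<open>
  Normality keeps exactly one point in a small interval around a given point of the fibre; the intervals on
  both sides of it contain fewer points.
\<close>

lemma card_locally_constant_between:
  assumes E: "dfn_vv E" and fin: "\<And>t. finite {u. E t u}"
  shows "x \<sqsubset> y \<Longrightarrow> \<not> E t x \<Longrightarrow> \<not> E t y \<Longrightarrow> (\<And>u. x \<sqsubseteq> u \<Longrightarrow> u \<sqsubseteq> y \<Longrightarrow> normal E t u) \<Longrightarrow>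
    card {u. x \<sqsubset> u \<and> u \<sqsubset> y \<and> E t u} = n \<Longrightarrow>
    nbhd t (\<lambda>t'. card {u. x \<sqsubseteq> u \<and> u \<sqsubseteq> y \<and> E t' u} = n)"
proof (induction n arbitrary: x y rule: less_induct)
  case (less n)
  have fin': "finite {u. P u \<and> Q u \<and> E t u}" for P Q t
    by (rule finite_subset[OF _ fin[of t]]) auto
  show ?case
  proof (cases "{u. x \<sqsubset> u \<and> u \<sqsubset> y \<and> E t u} = {}")
    case True
    have "\<not> E t u" if "x \<sqsubseteq> u" "u \<sqsubseteq> y" for u
      using True less.prems(2,3) that by (auto simp: order.order_iff_strict)
    then have "nbhd t (\<lambda>t'. \<forall>u. x \<sqsubseteq> u \<and> u \<sqsubseteq> y \<longrightarrow> \<not> E t' u)"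
      using less.prems(4) by (intro normal_gap[OF E less.prems(1)]) auto
    then show ?thesis
    proof (rule nbhd_mono)
      fix t' assume "\<forall>u. x \<sqsubseteq> u \<and> u \<sqsubseteq> y \<longrightarrow> \<not> E t' u"
      then have none: "{u. x \<sqsubseteq> u \<and> u \<sqsubseteq> y \<and> E t' u} = {}" by blast
      show "card {u. x \<sqsubseteq> u \<and> u \<sqsubseteq> y \<and> E t' u} = n"
        using less.prems(5) unfolding True none by simp
    qed
  next
    case False
    then obtain e where e: "x \<sqsubset> e" "e \<sqsubset> y" "E t e" by blast
    obtain p0 q0 where pq0: "p0 \<sqsubset> e" "e \<sqsubset> q0"
      "\<And>p q. p0 \<sqsubseteq> p \<Longrightarrow> p \<sqsubset> e \<Longrightarrow> e \<sqsubset> q \<Longrightarrow> q \<sqsubseteq> q0 \<Longrightarrow> nbhd t (\<lambda>t'. \<exists>!u'. p \<sqsubset> u' \<and> u' \<sqsubset> q \<and> E t' u')"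
      using less.prems(4)[of e] e less_imp_le unfolding normal_def by blast
    have "near_left e (\<lambda>p. \<not> E t p)"
      using finite_gap_left[OF fin, of e t] unfolding near_left_def by blast
    from near_left_ex[OF near_left_conj[OF this near_left_conj[OF near_left_less[OF e(1)] near_left_less[OF pq0(1)]]]]
    obtain p where p: "p \<sqsubset> e" "\<not> E t p" "x \<sqsubset> p" "p0 \<sqsubset> p" by blast
    have "near_right e (\<lambda>p. \<not> E t p)"
      using finite_gap_right[OF fin, of e t] unfolding near_right_def by blast
    from near_right_ex[OF near_right_conj[OF this near_right_conj[OF near_right_less[OF e(2)] near_right_less[OF pq0(2)]]]]
    obtain q where q: "e \<sqsubset> q" "\<not> E t q" "q \<sqsubset> y" "q \<sqsubset> q0" by blast
    have one: "nbhd t (\<lambda>t'. \<exists>!u'. p \<sqsubset> u' \<and> u' \<sqsubset> q \<and> E t' u')"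
      using pq0(3)[of p q] p q less_imp_le by blast
    have single: "u = e" if "p \<sqsubset> u" "u \<sqsubset> q" "E t u" for u
      using nbhd_self[OF one] p(1) q(1) e(3) that by blast
    let ?A = "{u. x \<sqsubset> u \<and> u \<sqsubset> p \<and> E t u}" and ?B = "{u. q \<sqsubset> u \<and> u \<sqsubset> y \<and> E t u}"
    have pq: "p \<sqsubset> q" using p(1) q(1) less_trans by blast
    have "{u. x \<sqsubset> u \<and> u \<sqsubset> y \<and> E t u} = insert e (?A \<union> ?B)" (is "?L = ?R")
    proof
      show "?L \<subseteq> ?R"
      proof
        fix u assume u: "u \<in> ?L"
        consider "u \<sqsubset> p" | "u = p" | "p \<sqsubset> u \<and> u \<sqsubset> q" | "u = q" | "q \<sqsubset> u" using less_linear by metis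
        then show "u \<in> ?R" using u single p(2) q(2) by cases auto
      qed
      show "?R \<subseteq> ?L" using e p(3) q(3) pq less_trans by blast
    qed
    moreover have "e \<notin> ?A \<union> ?B" using p(1) q(1) less_asym by blast
    moreover have "?A \<inter> ?B = {}" using pq less_trans less_asym by blast
    ultimately have n: "n = Suc (card ?A + card ?B)"
      using less.prems(5) fin' by (simp add: card_Un_disjoint)
    have A: "nbhd t (\<lambda>t'. card {u. x \<sqsubseteq> u \<and> u \<sqsubseteq> p \<and> E t' u} = card ?A)"
    proof (rule less.IH[OF _ p(3) less.prems(2) p(2) _ refl])
      fix u assume "x \<sqsubseteq> u" "u \<sqsubseteq> p"
      then show "normal E t u" using less.prems(4)[of u] p(1) e(2) le_less_trans less_imp_le less_trans by blast
    qed (use n in simp)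
    have B: "nbhd t (\<lambda>t'. card {u. q \<sqsubseteq> u \<and> u \<sqsubseteq> y \<and> E t' u} = card ?B)"
    proof (rule less.IH[OF _ q(3) q(2) less.prems(3) _ refl])
      fix u assume "q \<sqsubseteq> u" "u \<sqsubseteq> y"
      then show "normal E t u" using less.prems(4)[of u] q(1) e(1) less_le_trans less_imp_le less_trans by blast
    qed (use n in simp)
    show ?thesis
    proof (rule nbhd_mono[OF nbhd_conj[OF one nbhd_conj[OF A B]]])
      fix t' assume t': "(\<exists>!u'. p \<sqsubset> u' \<and> u' \<sqsubset> q \<and> E t' u') \<and>
        card {u. x \<sqsubseteq> u \<and> u \<sqsubseteq> p \<and> E t' u} = card ?A \<and> card {u. q \<sqsubseteq> u \<and> u \<sqsubseteq> y \<and> E t' u} = card ?B"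
      then obtain v where v: "p \<sqsubset> v" "v \<sqsubset> q" "E t' v" "\<And>u. p \<sqsubset> u \<Longrightarrow> u \<sqsubset> q \<Longrightarrow> E t' u \<Longrightarrow> u = v" by blast
      let ?A' = "{u. x \<sqsubseteq> u \<and> u \<sqsubseteq> p \<and> E t' u}" and ?B' = "{u. q \<sqsubseteq> u \<and> u \<sqsubseteq> y \<and> E t' u}"
      have "{u. x \<sqsubseteq> u \<and> u \<sqsubseteq> y \<and> E t' u} = insert v (?A' \<union> ?B')" (is "?L = ?R")
      proof
        show "?L \<subseteq> ?R"
        proof
          fix u assume u: "u \<in> ?L"
          consider "u \<sqsubseteq> p" | "p \<sqsubset> u \<and> u \<sqsubset> q" | "q \<sqsubseteq> u" using not_less by metis
          then show "u \<in> ?R" using u v(4) by cases auto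
        qed
        have "x \<sqsubseteq> v" "v \<sqsubseteq> y" using v(1,2) p(3) q(3) less_trans less_imp_le by blast+
        moreover have "p \<sqsubseteq> y" "x \<sqsubseteq> q" using pq p(3) q(3) less_trans less_imp_le by blast+
        ultimately show "?R \<subseteq> ?L" using v(3) order.trans by blast
      qed
      moreover have "v \<notin> ?A' \<union> ?B'" using v(1,2) leD by blast
      moreover have "?A' \<inter> ?B' = {}" using pq le_less_trans leD by blast
      ultimately show "card {u. x \<sqsubseteq> u \<and> u \<sqsubseteq> y \<and> E t' u} = n"
        using t' n fin' by (simp add: card_Un_disjoint)
    qed
  qed
qed

lemma tame_at_card:
  assumes E: "dfn_vv E" and fin: "\<And>t. finite {u. E t u}" and tame: "tame_at E t"
  shows "nbhd t (\<lambda>t'. card {u. E t' u} = card {u. E t u})"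
proof -
  obtain p q where pq: "nbhd t (\<lambda>t'. \<forall>u. E t' u \<longrightarrow> p \<sqsubset> u)" "nbhd t (\<lambda>t'. \<forall>u. E t' u \<longrightarrow> u \<sqsubset> q)"
    using tame unfolding tame_at_def bounded_above_near_def bounded_below_near_def by blast
  obtain q' where q': "p \<sqsubset> q'" "q \<sqsubseteq> q'" using gt_ex[of p] linear less_le_trans by blast
  have nb: "nbhd t (\<lambda>t'. \<forall>u. E t' u \<longrightarrow> p \<sqsubset> u \<and> u \<sqsubset> q')"
    by (rule nbhd_mono[OF nbhd_conj[OF pq]]) (use q'(2) less_le_trans in blast)
  then have t: "\<And>u. E t u \<Longrightarrow> p \<sqsubset> u \<and> u \<sqsubset> q'" by (blast dest: nbhd_self)
  have "nbhd t (\<lambda>t'. card {u. p \<sqsubseteq> u \<and> u \<sqsubseteq> q' \<and> E t' u} = card {u. p \<sqsubset> u \<and> u \<sqsubset> q' \<and> E t u})"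
    by (rule card_locally_constant_between[OF E fin q'(1) _ _ _ refl])
      (use t tame in \<open>auto simp: tame_at_def\<close>)
  from nbhd_conj[OF this nb] show ?thesis
  proof (rule nbhd_mono)
    fix t' assume t': "card {u. p \<sqsubseteq> u \<and> u \<sqsubseteq> q' \<and> E t' u} = card {u. p \<sqsubset> u \<and> u \<sqsubset> q' \<and> E t u} \<and>
      (\<forall>u. E t' u \<longrightarrow> p \<sqsubset> u \<and> u \<sqsubset> q')"
    then have "{u. p \<sqsubseteq> u \<and> u \<sqsubseteq> q' \<and> E t' u} = {u. E t' u}" using less_imp_le by blast
    moreover have "{u. p \<sqsubset> u \<and> u \<sqsubset> q' \<and> E t u} = {u. E t u}" using t by blast
    ultimately show "card {u. E t' u} = card {u. E t u}" using t' by simp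
  qed
qed

lemma finite_strict_upper: "finite F \<Longrightarrow> \<exists>q. \<forall>u\<in>F. u \<sqsubset> q"
proof (induction rule: finite_induct)
  case (insert x F)
  then obtain q where "\<forall>u\<in>F. u \<sqsubset> q" by blast
  moreover obtain q' where "x \<sqsubset> q'" using gt_ex by blast
  ultimately show ?case using linear[of q q'] less_le_trans by (metis insert_iff)
qed simp

text \<open>
  Compare fibres by their largest elements. On a monotone piece the largest element between two points
  is bounded by its values at these points.
\<close>

lemma finite_not_bounded_above_near:
  assumes E: "dfn_vv E" and fin: "\<And>t. finite {u. E t u}"
  shows "finite {t. \<not> bounded_above_near E t}"
proof (rule ccontr)
  assume inf: "infinite {t. \<not> bounded_above_near E t}"
  have "dfn_v (\<lambda>t. \<not> bounded_above_near E t)"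
    unfolding bounded_above_near_def by (intro dfn_vI dfn_intros dfn_vvD[OF E])
  from infinite_has_interval[OF this inf]
  obtain a b where ab: "a \<sqsubset> b" "\<And>t. a \<sqsubset> t \<Longrightarrow> t \<sqsubset> b \<Longrightarrow> \<not> bounded_above_near E t" by auto
  define R where "R t t' \<longleftrightarrow> (\<forall>u. E t u \<longrightarrow> (\<exists>u'. u \<sqsubseteq> u' \<and> E t' u'))" for t t'
  have R: "dfn_vv R" unfolding R_def by (intro dfn_vvI dfn_intros dfn_vvD[OF E])
  have tot: "R t t' \<or> R t' t" for t t'
  proof (rule disjCI)
    assume "\<not> R t' t"
    then obtain u where "E t' u" "\<And>u'. E t u' \<Longrightarrow> \<not> u \<sqsubseteq> u'" unfolding R_def by blast
    then show "R t t'" unfolding R_def using linear by blast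
  qed
  have "R x z" if "R x y" "R y z" for x y z using that order.trans unfolding R_def by blast
  with tot have wo: "weak_order R" unfolding weak_order_def by blast
  obtain c d where cd: "a \<sqsubseteq> c" "c \<sqsubset> d" "d \<sqsubseteq> b" and m:
      "(\<forall>x y. c \<sqsubset> x \<and> x \<sqsubset> d \<and> c \<sqsubset> y \<and> y \<sqsubset> d \<longrightarrow> R x y) \<or>
       (\<forall>x y. c \<sqsubset> x \<and> x \<sqsubset> y \<and> y \<sqsubset> d \<longrightarrow> \<not> R y x) \<or>
       (\<forall>x y. c \<sqsubset> x \<and> x \<sqsubset> y \<and> y \<sqsubset> d \<longrightarrow> \<not> R x y)"
    by (rule monotone_piece[OF R wo ab(1)]) (rule that)
  obtain t where t: "c \<sqsubset> t" "t \<sqsubset> d" using dense cd(2) by blast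
  obtain t1 where t1: "c \<sqsubset> t1" "t1 \<sqsubset> t" using dense t(1) by blast
  obtain t2 where t2: "t \<sqsubset> t2" "t2 \<sqsubset> d" using dense t(2) by blast
  have "R t' t1 \<or> R t' t2" if t': "t1 \<sqsubset> t'" "t' \<sqsubset> t2" for t'
  proof -
    have "c \<sqsubset> t'" "t' \<sqsubset> d" "t1 \<sqsubset> d" using t' t1 t2 t less_trans by blast+
    with m show ?thesis using weak_order_total[OF wo, of t' t1] weak_order_total[OF wo, of t' t2] t' t1(1) t2(2)
      by blast
  qed
  moreover obtain q where "\<forall>u\<in>{u. E t1 u} \<union> {u. E t2 u}. u \<sqsubset> q"
    using finite_strict_upper fin by (meson finite_UnI)
  ultimately have q: "u \<sqsubset> q" if "t1 \<sqsubset> t'" "t' \<sqsubset> t2" "E t' u" for t' u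
    using that unfolding R_def by (metis UnCI le_less_trans mem_Collect_eq)
  have "nbhd t (\<lambda>t'. \<forall>u. E t' u \<longrightarrow> u \<sqsubset> q)"
    by (rule nbhdI[OF t1(2) t2(1)]) (use q in blast)
  then have "bounded_above_near E t" unfolding bounded_above_near_def by blast
  then show False using ab(2) le_interval[OF cd(1,3) t] by blast
qed

lemma finite_not_bounded_below_near:
  assumes E: "dfn_vv E" and fin: "\<And>t. finite {u. E t u}"
  shows "finite {t. \<not> bounded_below_near E t}"
  using omin.finite_not_bounded_above_near[OF dual E fin]
  unfolding omin.bounded_above_near_def[OF dual] bounded_below_near_def nbhd_dual .

text \<open>
  Otherwise a whole box would consist of points that are not normal; but just right of its lower side
  \<open>p\<close> the fibres, being finite, can be avoided uniformly.
\<close>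

lemma finite_infinitely_not_normal:
  assumes E: "dfn_vv E" and fin: "\<And>t. finite {u. E t u}"
  shows "finite {t. infinite {u. \<not> normal E t u}}"
proof (rule ccontr)
  have A: "dfn_vv (\<lambda>t u. \<not> normal E t u)"
    unfolding normal_def by (intro dfn_vvI dfn_intros dfn_vvD[OF E])
  assume "infinite {t. infinite {u. \<not> normal E t u}}"
  from box[OF A this] obtain c d p q where cd: "c \<sqsubset> d" "p \<sqsubset> q"
    "\<And>t u. c \<sqsubset> t \<Longrightarrow> t \<sqsubset> d \<Longrightarrow> p \<sqsubset> u \<Longrightarrow> u \<sqsubset> q \<Longrightarrow> \<not> normal E t u" by metis
  have nE: "dfn_vv (\<lambda>t u. \<not> E t u)" by (intro dfn_vvI dfn_intros dfn_vvD[OF E])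
  have nr: "\<forall>t. c \<sqsubset> t \<and> t \<sqsubset> d \<longrightarrow> near_right p (\<lambda>u. \<not> E t u)"
    using finite_gap_right[OF fin] unfolding near_right_def by blast
  obtain c' d' q' where *: "c \<sqsubseteq> c'" "c' \<sqsubset> d'" "d' \<sqsubseteq> d" "p \<sqsubset> q'"
    "\<And>t y. c' \<sqsubset> t \<Longrightarrow> t \<sqsubset> d' \<Longrightarrow> p \<sqsubset> y \<Longrightarrow> y \<sqsubset> q' \<Longrightarrow> \<not> E t y"
    by (rule uniform_right[OF nE cd(1) nr]) (rule that)
  obtain t where t: "c' \<sqsubset> t" "t \<sqsubset> d'" using dense *(2) by blast
  obtain u where u: "p \<sqsubset> u" "u \<sqsubset> q" "u \<sqsubset> q'"
    using near_right_ex[OF near_right_conj[OF near_right_less[OF cd(2)] near_right_less[OF *(4)]]] by blast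
  have "nbhd t (\<lambda>t'. \<forall>u'. p \<sqsubset> u' \<and> u' \<sqsubset> q' \<longrightarrow> \<not> E t' u')"
    using *(5) by (intro nbhdI[OF t]) blast
  then have "normal E t u" unfolding normal_def using *(5)[OF t u(1,3)] u(1,3) by blast
  then show False using cd(3) le_interval[OF *(1,3) t] u(1,2) by blast
qed

lemma strictly_monotone_cases:
  assumes fin_img: "\<And>x y. c \<sqsubset> x \<Longrightarrow> x \<sqsubset> d \<Longrightarrow> c \<sqsubset> y \<Longrightarrow> y \<sqsubset> d \<Longrightarrow> R x y \<longleftrightarrow> b x \<sqsubseteq> b y"
    and m: "(\<forall>x y. c \<sqsubset> x \<and> x \<sqsubset> y \<and> y \<sqsubset> d \<longrightarrow> \<not> R y x) \<or> (\<forall>x y. c \<sqsubset> x \<and> x \<sqsubset> y \<and> y \<sqsubset> d \<longrightarrow> \<not> R x y)"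
  shows "(\<forall>x y. c \<sqsubset> x \<and> x \<sqsubset> y \<and> y \<sqsubset> d \<longrightarrow> b x \<sqsubset> b y) \<or> (\<forall>x y. c \<sqsubset> x \<and> x \<sqsubset> y \<and> y \<sqsubset> d \<longrightarrow> b y \<sqsubset> b x)"
proof -
  have "b x \<sqsubset> b y" if "\<not> R y x" "c \<sqsubset> x" "x \<sqsubset> y" "y \<sqsubset> d" for x y
    using fin_img[of y x] that less_trans[OF that(2,3)] less_trans[OF that(3,4)] by (auto simp: not_le)
  moreover have "b y \<sqsubset> b x" if "\<not> R x y" "c \<sqsubset> x" "x \<sqsubset> y" "y \<sqsubset> d" for x y
    using fin_img[of x y] that less_trans[OF that(2,3)] less_trans[OF that(3,4)] by (auto simp: not_le)
  ultimately show ?thesis using m by blast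
qed

text \<open>
  The image of a strictly monotone definable function is infinite and hence contains an interval; on
  its preimage there are no jumps.
\<close>

lemma strictly_monotone_continuous:
  assumes G: "dfn_vv (\<lambda>t u. c \<sqsubset> t \<and> t \<sqsubset> d \<and> u = b t)" and cd: "c \<sqsubset> d"
    and m: "(\<forall>x y. c \<sqsubset> x \<and> x \<sqsubset> y \<and> y \<sqsubset> d \<longrightarrow> b x \<sqsubset> b y) \<or> (\<forall>x y. c \<sqsubset> x \<and> x \<sqsubset> y \<and> y \<sqsubset> d \<longrightarrow> b y \<sqsubset> b x)"
  obtains c' d' where "c \<sqsubseteq> c'" "c' \<sqsubset> d'" "d' \<sqsubseteq> d"
    "\<And>t p q. c' \<sqsubset> t \<Longrightarrow> t \<sqsubset> d' \<Longrightarrow> p \<sqsubset> b t \<Longrightarrow> b t \<sqsubset> q \<Longrightarrow> nbhd t (\<lambda>t'. p \<sqsubset> b t' \<and> b t' \<sqsubset> q)"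
proof -
  have inj: "x = y" if "c \<sqsubset> x" "x \<sqsubset> d" "c \<sqsubset> y" "y \<sqsubset> d" "b x = b y" for x y
    using m that less_linear[of x y] by (metis less_irrefl)
  have I: "dfn_v (\<lambda>u. \<exists>t. c \<sqsubset> t \<and> t \<sqsubset> d \<and> u = b t)"
    by (intro dfn_vI dfn_intros dfn_vvD[OF G])
  have "{u. \<exists>t. c \<sqsubset> t \<and> t \<sqsubset> d \<and> u = b t} = b ` {t. c \<sqsubset> t \<and> t \<sqsubset> d}" by auto
  moreover have "inj_on b {t. c \<sqsubset> t \<and> t \<sqsubset> d}" using inj unfolding inj_on_def by blast
  ultimately have "infinite {u. \<exists>t. c \<sqsubset> t \<and> t \<sqsubset> d \<and> u = b t}"
    using infinite_interval[OF cd] finite_imageD by metis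
  from infinite_has_interval[OF I this] obtain p0 q0 where pq0: "p0 \<sqsubset> q0"
    "\<And>u. p0 \<sqsubset> u \<Longrightarrow> u \<sqsubset> q0 \<Longrightarrow> \<exists>t. c \<sqsubset> t \<and> t \<sqsubset> d \<and> u = b t" by metis
  have "{u. p0 \<sqsubset> u \<and> u \<sqsubset> q0} \<subseteq> b ` {t. c \<sqsubset> t \<and> t \<sqsubset> d \<and> (\<exists>u. (c \<sqsubset> t \<and> t \<sqsubset> d \<and> u = b t) \<and> p0 \<sqsubset> u \<and> u \<sqsubset> q0)}"
    using pq0(2) by blast
  then have inf: "infinite {t. c \<sqsubset> t \<and> t \<sqsubset> d \<and> (\<exists>u. (c \<sqsubset> t \<and> t \<sqsubset> d \<and> u = b t) \<and> p0 \<sqsubset> u \<and> u \<sqsubset> q0)}"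
    using infinite_interval[OF pq0(1)] finite_surj by blast
  have X: "dfn_v (\<lambda>t. \<exists>u. (c \<sqsubset> t \<and> t \<sqsubset> d \<and> u = b t) \<and> p0 \<sqsubset> u \<and> u \<sqsubset> q0)"
    by (intro dfn_vI dfn_intros dfn_vvD[OF G])
  obtain c' d' where c': "c \<sqsubseteq> c'" "c' \<sqsubset> d'" "d' \<sqsubseteq> d"
    "\<And>t. c' \<sqsubset> t \<Longrightarrow> t \<sqsubset> d' \<Longrightarrow> \<exists>u. (c \<sqsubset> t \<and> t \<sqsubset> d \<and> u = b t) \<and> p0 \<sqsubset> u \<and> u \<sqsubset> q0"
    by (rule subinterval[OF X inf]) (rule that)
  have "nbhd t (\<lambda>t'. p \<sqsubset> b t' \<and> b t' \<sqsubset> q)" if t: "c' \<sqsubset> t" "t \<sqsubset> d'" and pq: "p \<sqsubset> b t" "b t \<sqsubset> q" for t p q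
  proof -
    have bt: "c \<sqsubset> t" "t \<sqsubset> d" "p0 \<sqsubset> b t" "b t \<sqsubset> q0" using c'(4)[OF t] by auto
    obtain b1 where b1: "p \<sqsubset> b1" "p0 \<sqsubset> b1" "b1 \<sqsubset> b t"
      using near_left_ex[OF near_left_conj[OF near_left_less[OF pq(1)] near_left_less[OF bt(3)]]] by blast
    obtain b2 where b2: "b t \<sqsubset> b2" "b2 \<sqsubset> q" "b2 \<sqsubset> q0"
      using near_right_ex[OF near_right_conj[OF near_right_less[OF pq(2)] near_right_less[OF bt(4)]]] by blast
    obtain s1 where s1: "c \<sqsubset> s1" "s1 \<sqsubset> d" "b1 = b s1"
      using pq0(2)[OF b1(2) less_trans[OF b1(3) bt(4)]] by blast
    obtain s2 where s2: "c \<sqsubset> s2" "s2 \<sqsubset> d" "b2 = b s2"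
      using pq0(2)[OF less_trans[OF bt(3) b2(1)] b2(3)] by blast
    from m show ?thesis
    proof
      assume inc: "\<forall>x y. c \<sqsubset> x \<and> x \<sqsubset> y \<and> y \<sqsubset> d \<longrightarrow> b x \<sqsubset> b y"
      have 1: "s1 \<sqsubset> t" using inc s1 bt b1(3) less_linear[of s1 t] less_asym by blast
      have 2: "t \<sqsubset> s2" using inc s2 bt b2(1) less_linear[of s2 t] less_asym by blast
      show ?thesis
      proof (rule nbhdI[OF 1 2])
        fix x assume x: "s1 \<sqsubset> x" "x \<sqsubset> s2"
        have "b s1 \<sqsubset> b x" "b x \<sqsubset> b s2" using inc s1 s2 x less_trans by blast+
        then show "p \<sqsubset> b x \<and> b x \<sqsubset> q" using b1 b2 s1 s2 less_trans by blast
      qed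
    next
      assume dec: "\<forall>x y. c \<sqsubset> x \<and> x \<sqsubset> y \<and> y \<sqsubset> d \<longrightarrow> b y \<sqsubset> b x"
      have 1: "t \<sqsubset> s1" using dec s1 bt b1(3) less_linear[of s1 t] less_asym by blast
      have 2: "s2 \<sqsubset> t" using dec s2 bt b2(1) less_linear[of s2 t] less_asym by blast
      show ?thesis
      proof (rule nbhdI[OF 2 1])
        fix x assume x: "s2 \<sqsubset> x" "x \<sqsubset> s1"
        have "b s1 \<sqsubset> b x" "b x \<sqsubset> b s2" using dec s1 s2 x less_trans by blast+
        then show "p \<sqsubset> b x \<and> b x \<sqsubset> q" using b1 b2 s1 s2 less_trans by blast
      qed
    qed
  qed
  then show ?thesis using that[OF c'(1-3)] by blast
qed

text \<open>
  For each \<open>t\<close>, the fibre over \<open>t\<close> has no points near \<open>b t\<close> apart from possibly \<open>b t\<close>. So it has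
  no points between \<open>b t\<close> and \<open>b t'\<close> for \<open>t'\<close> near \<open>t\<close>, and \<open>uniform_diag_right\<close> and
  \<open>uniform_diag_left\<close> make this hold for all pairs from one interval. Then the values of \<open>b\<close> at two
  fixed points on either side of \<open>t\<close> bound a box around \<open>(t, b t)\<close> in which \<open>E\<close> is contained in the
  graph of \<open>b\<close>.
\<close>

lemma normal_on_graph:
  assumes B: "dfn_vv (\<lambda>t u. c \<sqsubset> t \<and> t \<sqsubset> d \<and> u = b t)" and cd: "c \<sqsubset> d"
    and E: "dfn_vv E" and fin: "\<And>t. finite {u. E t u}"
    and m: "(\<forall>x y. c \<sqsubset> x \<and> x \<sqsubset> y \<and> y \<sqsubset> d \<longrightarrow> b x \<sqsubset> b y) \<or> (\<forall>x y. c \<sqsubset> x \<and> x \<sqsubset> y \<and> y \<sqsubset> d \<longrightarrow> b y \<sqsubset> b x)"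
  shows "\<exists>t. c \<sqsubset> t \<and> t \<sqsubset> d \<and> normal E t (b t)"
proof -
  obtain c1 d1 where cd1: "c \<sqsubseteq> c1" "c1 \<sqsubset> d1" "d1 \<sqsubseteq> d" and cont:
    "\<And>t p q. c1 \<sqsubset> t \<Longrightarrow> t \<sqsubset> d1 \<Longrightarrow> p \<sqsubset> b t \<Longrightarrow> b t \<sqsubset> q \<Longrightarrow> nbhd t (\<lambda>t'. p \<sqsubset> b t' \<and> b t' \<sqsubset> q)"
    by (rule strictly_monotone_continuous[OF B cd m]) (rule that)
  define G where "G t u \<longleftrightarrow> c \<sqsubset> t \<and> t \<sqsubset> d \<and> u = b t" for t u
  have G: "dfn_vv G" unfolding G_def by (rule B)
  define P where "P t t' \<longleftrightarrow> (\<forall>v v' u. G t v \<and> G t' v' \<and> ((v \<sqsubset> u \<and> u \<sqsubseteq> v') \<or> (v' \<sqsubseteq> u \<and> u \<sqsubset> v)) \<longrightarrow> \<not> E t u)" for t t'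
  have P: "dfn_vv P" unfolding P_def by (intro dfn_vvI dfn_intros dfn_vvD[OF E] dfn_vvD[OF G])
  have Pn: "nbhd t (P t)" if t: "c1 \<sqsubset> t" "t \<sqsubset> d1" for t
  proof -
    obtain q where q: "b t \<sqsubset> q" "\<And>x. b t \<sqsubset> x \<Longrightarrow> x \<sqsubset> q \<Longrightarrow> \<not> E t x"
      using finite_gap_right[OF fin, of "b t" t] by blast
    obtain p where p: "p \<sqsubset> b t" "\<And>x. x \<sqsubset> b t \<Longrightarrow> p \<sqsubset> x \<Longrightarrow> \<not> E t x"
      using finite_gap_left[OF fin, of "b t" t] by blast
    from cont[OF t p(1) q(1)] show ?thesis
      by (rule nbhd_mono) (use p(2) q(2) le_less_trans less_le_trans in \<open>unfold P_def G_def, blast\<close>)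
  qed
  have nr: "\<forall>t. c1 \<sqsubset> t \<and> t \<sqsubset> d1 \<longrightarrow> near_right t (P t)" using Pn unfolding nbhd_iff by blast
  obtain c2 d2 where cd2: "c1 \<sqsubseteq> c2" "c2 \<sqsubset> d2" "d2 \<sqsubseteq> d1" "\<And>t u. c2 \<sqsubset> t \<Longrightarrow> t \<sqsubset> u \<Longrightarrow> u \<sqsubset> d2 \<Longrightarrow> P t u"
    by (rule uniform_diag_right[OF P cd1(2) nr]) (rule that)
  have nl: "\<forall>t. c2 \<sqsubset> t \<and> t \<sqsubset> d2 \<longrightarrow> near_left t (P t)"
    using Pn le_interval[OF cd2(1,3)] unfolding nbhd_iff by blast
  obtain c3 d3 where cd3: "c2 \<sqsubseteq> c3" "c3 \<sqsubset> d3" "d3 \<sqsubseteq> d2" "\<And>t u. c3 \<sqsubset> u \<Longrightarrow> u \<sqsubset> t \<Longrightarrow> t \<sqsubset> d3 \<Longrightarrow> P t u"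
    by (rule uniform_diag_left[OF P cd2(2) nl]) (rule that)
  have X: "dfn_v (\<lambda>t. \<exists>u. G t u \<and> E t u)" "dfn_v (\<lambda>t. \<not> (\<exists>u. G t u \<and> E t u))"
    by (intro dfn_vI dfn_intros dfn_vvD[OF E] dfn_vvD[OF G])+
  obtain c4 d4 where cd4: "c3 \<sqsubseteq> c4" "c4 \<sqsubset> d4" "d4 \<sqsubseteq> d3"
    "(\<forall>t. c4 \<sqsubset> t \<and> t \<sqsubset> d4 \<longrightarrow> (\<exists>u. G t u \<and> E t u)) \<or> (\<forall>t. c4 \<sqsubset> t \<and> t \<sqsubset> d4 \<longrightarrow> \<not> (\<exists>u. G t u \<and> E t u))"
    by (rule subinterval_cover[OF X cd3(2)]) (auto intro: that)
  have in3: "c3 \<sqsubset> t \<and> t \<sqsubset> d3" if "c4 \<sqsubset> t" "t \<sqsubset> d4" for t using le_interval[OF cd4(1,3) that] .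
  have in2: "c2 \<sqsubset> t \<and> t \<sqsubset> d2" if "c4 \<sqsubset> t" "t \<sqsubset> d4" for t using le_interval[OF cd3(1,3)] in3[OF that] by blast
  have in1: "c1 \<sqsubset> t \<and> t \<sqsubset> d1" if "c4 \<sqsubset> t" "t \<sqsubset> d4" for t using le_interval[OF cd2(1,3)] in2[OF that] by blast
  have in0: "c \<sqsubset> t \<and> t \<sqsubset> d" if "c4 \<sqsubset> t" "t \<sqsubset> d4" for t using le_interval[OF cd1(1,3)] in1[OF that] by blast
  have noE: "\<not> E t u" if t: "c4 \<sqsubset> t" "t \<sqsubset> d4" "c4 \<sqsubset> t'" "t' \<sqsubset> d4" "t \<noteq> t'"
    and u: "(b t \<sqsubset> u \<and> u \<sqsubseteq> b t') \<or> (b t' \<sqsubseteq> u \<and> u \<sqsubset> b t)" for t t' u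
  proof -
    have "P t t'" using cd2(4)[of t t'] cd3(4)[of t' t] in2 in3 t less_linear[of t t'] by blast
    then show ?thesis using u in0 t unfolding P_def G_def by blast
  qed
  obtain t where t: "c4 \<sqsubset> t" "t \<sqsubset> d4" using dense cd4(2) by blast
  obtain t1 where t1: "c4 \<sqsubset> t1" "t1 \<sqsubset> t" using dense t(1) by blast
  obtain t2 where t2: "t \<sqsubset> t2" "t2 \<sqsubset> d4" using dense t(2) by blast
  have t12: "t1 \<sqsubset> d4" "c4 \<sqsubset> t2" using t t1 t2 less_trans by blast+
  have between: "c4 \<sqsubset> x" "x \<sqsubset> d4" if "t1 \<sqsubset> x" "x \<sqsubset> t2" for x using that t1 t2 less_trans by blast+
  have "\<exists>p q. (\<forall>x. t1 \<sqsubset> x \<and> x \<sqsubset> t2 \<longrightarrow> p \<sqsubset> b x \<and> b x \<sqsubset> q) \<and> p \<in> {b t1, b t2} \<and> q \<in> {b t1, b t2}"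
    using m
  proof
    assume "\<forall>x y. c \<sqsubset> x \<and> x \<sqsubset> y \<and> y \<sqsubset> d \<longrightarrow> b x \<sqsubset> b y"
    then have "\<forall>x. t1 \<sqsubset> x \<and> x \<sqsubset> t2 \<longrightarrow> b t1 \<sqsubset> b x \<and> b x \<sqsubset> b t2"
      using in0[OF t1(1) t12(1)] in0[OF t12(2) t2(2)] between in0 by blast
    then show ?thesis by blast
  next
    assume "\<forall>x y. c \<sqsubset> x \<and> x \<sqsubset> y \<and> y \<sqsubset> d \<longrightarrow> b y \<sqsubset> b x"
    then have "\<forall>x. t1 \<sqsubset> x \<and> x \<sqsubset> t2 \<longrightarrow> b t2 \<sqsubset> b x \<and> b x \<sqsubset> b t1"
      using in0[OF t1(1) t12(1)] in0[OF t12(2) t2(2)] between in0 by blast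
    then show ?thesis by blast
  qed
  then obtain p q where pq: "\<And>x. t1 \<sqsubset> x \<Longrightarrow> x \<sqsubset> t2 \<Longrightarrow> p \<sqsubset> b x \<and> b x \<sqsubset> q"
    "p = b t1 \<or> p = b t2" "q = b t1 \<or> q = b t2" by blast
  have only: "u = b x" if x: "t1 \<sqsubset> x" "x \<sqsubset> t2" and u: "p \<sqsubset> u" "u \<sqsubset> q" "E x u" for x u
  proof (rule ccontr)
    assume "u \<noteq> b x"
    then consider "b x \<sqsubset> u" | "u \<sqsubset> b x" using less_linear by blast
    then show False
    proof cases
      case 1
      then show False using noE[OF between[OF x] t1(1) t12(1)] noE[OF between[OF x] t12(2) t2(2)]
        x u pq(3) less_imp_le by blast
    next
      case 2
      then show False using noE[OF between[OF x] t1(1) t12(1)] noE[OF between[OF x] t12(2) t2(2)]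
        x u pq(2) less_imp_le by blast
    qed
  qed
  have pqt: "p \<sqsubset> b t" "b t \<sqsubset> q" using pq(1)[OF t1(2) t2(1)] by auto
  have "normal E t (b t)"
  proof (cases "\<forall>t. c4 \<sqsubset> t \<and> t \<sqsubset> d4 \<longrightarrow> (\<exists>u. G t u \<and> E t u)")
    case True
    then have on: "E x (b x)" if "t1 \<sqsubset> x" "x \<sqsubset> t2" for x using between[OF that] unfolding G_def by blast
    have "nbhd t (\<lambda>t'. \<exists>!u'. p' \<sqsubset> u' \<and> u' \<sqsubset> q' \<and> E t' u')"
      if "p \<sqsubseteq> p'" "p' \<sqsubset> b t" "b t \<sqsubset> q'" "q' \<sqsubseteq> q" for p' q'
    proof -
      have "nbhd t (\<lambda>t'. p' \<sqsubset> b t' \<and> b t' \<sqsubset> q')" using cont in1[OF t] that(2,3) by blast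
      from nbhd_conj[OF this nbhd_interval[OF t1(2) t2(1)]] show ?thesis
      proof (rule nbhd_mono)
        fix x assume x: "(p' \<sqsubset> b x \<and> b x \<sqsubset> q') \<and> t1 \<sqsubset> x \<and> x \<sqsubset> t2"
        show "\<exists>!u'. p' \<sqsubset> u' \<and> u' \<sqsubset> q' \<and> E x u'"
        proof (rule ex1I[of _ "b x"])
          show "p' \<sqsubset> b x \<and> b x \<sqsubset> q' \<and> E x (b x)" using x on by blast
          show "u' = b x" if "p' \<sqsubset> u' \<and> u' \<sqsubset> q' \<and> E x u'" for u'
            using only[of x u'] x that \<open>p \<sqsubseteq> p'\<close> \<open>q' \<sqsubseteq> q\<close> le_less_trans less_le_trans by blast
        qed
      qed
    qed
    then show ?thesis using on[OF t1(2) t2(1)] pqt unfolding normal_def by blast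
  next
    case False
    then have off: "\<not> E x (b x)" if "t1 \<sqsubset> x" "x \<sqsubset> t2" for x
      using between[OF that] cd4(4) in0[OF between[OF that]] unfolding G_def by blast
    have "nbhd t (\<lambda>t'. \<forall>u'. p \<sqsubset> u' \<and> u' \<sqsubset> q \<longrightarrow> \<not> E t' u')"
      by (rule nbhdI[OF t1(2) t2(1)]) (use only off in blast)
    then show ?thesis using off[OF t1(2) t2(1)] pqt unfolding normal_def by blast
  qed
  then show ?thesis using in0[OF t] by blast
qed

lemma normal_on_horizontal:
  assumes cd: "c \<sqsubset> d" and E: "dfn_vv E" and fin: "\<And>t. finite {u. E t u}"
  shows "\<exists>t. c \<sqsubset> t \<and> t \<sqsubset> d \<and> normal E t b"
proof -
  have nE: "dfn_vv (\<lambda>t u. \<not> E t u)" by (intro dfn_vvI dfn_intros dfn_vvD[OF E])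
  have X: "dfn_v (\<lambda>t. E t b)" "dfn_v (\<lambda>t. \<not> E t b)"
    by (intro dfn_vI dfn_intros dfn_vvD[OF E])+
  obtain c1 d1 where cd1: "c \<sqsubseteq> c1" "c1 \<sqsubset> d1" "d1 \<sqsubseteq> d"
    "(\<forall>t. c1 \<sqsubset> t \<and> t \<sqsubset> d1 \<longrightarrow> E t b) \<or> (\<forall>t. c1 \<sqsubset> t \<and> t \<sqsubset> d1 \<longrightarrow> \<not> E t b)"
    by (rule subinterval_cover[OF X cd]) (auto intro: that)
  have nr: "\<forall>t. c1 \<sqsubset> t \<and> t \<sqsubset> d1 \<longrightarrow> near_right b (\<lambda>u. \<not> E t u)"
    using finite_gap_right[OF fin] unfolding near_right_def by blast
  obtain c2 d2 q where cd2: "c1 \<sqsubseteq> c2" "c2 \<sqsubset> d2" "d2 \<sqsubseteq> d1" "b \<sqsubset> q"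
    "\<And>t y. c2 \<sqsubset> t \<Longrightarrow> t \<sqsubset> d2 \<Longrightarrow> b \<sqsubset> y \<Longrightarrow> y \<sqsubset> q \<Longrightarrow> \<not> E t y"
    by (rule uniform_right[OF nE cd1(2) nr]) (rule that)
  have nl: "\<forall>t. c2 \<sqsubset> t \<and> t \<sqsubset> d2 \<longrightarrow> near_left b (\<lambda>u. \<not> E t u)"
    using finite_gap_left[OF fin] unfolding near_left_def by blast
  obtain c3 d3 p where cd3: "c2 \<sqsubseteq> c3" "c3 \<sqsubset> d3" "d3 \<sqsubseteq> d2" "p \<sqsubset> b"
    "\<And>t y. c3 \<sqsubset> t \<Longrightarrow> t \<sqsubset> d3 \<Longrightarrow> p \<sqsubset> y \<Longrightarrow> y \<sqsubset> b \<Longrightarrow> \<not> E t y"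
    by (rule uniform_left[OF nE cd2(2) nl]) (rule that)
  obtain t where t: "c3 \<sqsubset> t" "t \<sqsubset> d3" using dense cd3(2) by blast
  have in2: "c2 \<sqsubset> x \<and> x \<sqsubset> d2" if "c3 \<sqsubset> x" "x \<sqsubset> d3" for x using le_interval[OF cd3(1,3) that] .
  have in1: "c1 \<sqsubset> x \<and> x \<sqsubset> d1" if "c3 \<sqsubset> x" "x \<sqsubset> d3" for x using le_interval[OF cd2(1,3)] in2[OF that] by blast
  have only: "u = b" if "c3 \<sqsubset> x" "x \<sqsubset> d3" "p \<sqsubset> u" "u \<sqsubset> q" "E x u" for x u
    using cd2(5)[of x u] cd3(5)[of x u] in2 that less_linear[of u b] by blast
  have "normal E t b"
  proof (cases "E t b")
    case True
    then have on: "E x b" if "c3 \<sqsubset> x" "x \<sqsubset> d3" for x using cd1(4) in1 t that by blast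
    have "nbhd t (\<lambda>t'. \<exists>!u'. p' \<sqsubset> u' \<and> u' \<sqsubset> q' \<and> E t' u')"
      if "p \<sqsubseteq> p'" "p' \<sqsubset> b" "b \<sqsubset> q'" "q' \<sqsubseteq> q" for p' q'
    proof (rule nbhdI[OF t])
      fix x assume x: "c3 \<sqsubset> x" "x \<sqsubset> d3"
      show "\<exists>!u'. p' \<sqsubset> u' \<and> u' \<sqsubset> q' \<and> E x u'"
      proof (rule ex1I[of _ b])
        show "p' \<sqsubset> b \<and> b \<sqsubset> q' \<and> E x b" using that on[OF x] by blast
        show "u' = b" if "p' \<sqsubset> u' \<and> u' \<sqsubset> q' \<and> E x u'" for u'
          using only[OF x, of u'] that \<open>p \<sqsubseteq> p'\<close> \<open>q' \<sqsubseteq> q\<close> le_less_trans less_le_trans by blast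
      qed
    qed
    then show ?thesis using True cd2(4) cd3(4) unfolding normal_def by blast
  next
    case False
    then have off: "\<not> E x b" if "c3 \<sqsubset> x" "x \<sqsubset> d3" for x using cd1(4) in1 t that by blast
    have "nbhd t (\<lambda>t'. \<forall>u'. p \<sqsubset> u' \<and> u' \<sqsubset> q \<longrightarrow> \<not> E t' u')"
      by (rule nbhdI[OF t]) (use only off in blast)
    then show ?thesis using False cd2(4) cd3(4) unfolding normal_def by blast
  qed
  then show ?thesis using le_interval[OF cd1(1,3)] in1[OF t] by blast
qed

text \<open>
  Suppose that there are such \<open>u\<close> over infinitely many \<open>t\<close>. Over all but finitely many of these \<open>t\<close>
  there is a least one, and on a piece it is a constant or strictly monotone function of \<open>t\<close>. Such a
  function has a normal point in its graph.
\<close>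

lemma finite_not_normal:
  assumes E: "dfn_vv E" and fin: "\<And>t. finite {u. E t u}"
  shows "finite {t. \<exists>u. \<not> normal E t u}"
proof (rule ccontr)
  define A where "A t u \<longleftrightarrow> \<not> normal E t u" for t u
  have A: "dfn_vv A"
    unfolding A_def normal_def by (intro dfn_vvI dfn_intros dfn_vvD[OF E])
  have finA: "finite {t. infinite {u. A t u}}"
    unfolding A_def using finite_infinitely_not_normal[OF E fin] .
  assume "infinite {t. \<exists>u. \<not> normal E t u}"
  then have inf: "infinite {t. \<exists>u. A t u}" unfolding A_def .
  have X: "dfn_v (\<lambda>t. \<exists>u. A t u)" by (intro dfn_vI dfn_intros dfn_vvD[OF A])
  from interval_in_infinite[OF X inf finA]
  obtain a b where ab: "a \<sqsubset> b" "\<And>t. a \<sqsubset> t \<Longrightarrow> t \<sqsubset> b \<Longrightarrow> (\<exists>u. A t u) \<and> finite {u. A t u}" by auto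
  define m where "m t = (SOME u. A t u \<and> (\<forall>u'. A t u' \<longrightarrow> u \<sqsubseteq> u'))" for t
  have m: "A t (m t) \<and> (\<forall>u'. A t u' \<longrightarrow> m t \<sqsubseteq> u')" if "a \<sqsubset> t" "t \<sqsubset> b" for t
  proof -
    have "\<exists>u. A t u \<and> (\<forall>u'. A t u' \<longrightarrow> u \<sqsubseteq> u')"
      using finite_least[of "{u. A t u}"] ab(2)[OF that] by blast
    then show ?thesis unfolding m_def by (rule someI_ex)
  qed
  define R where "R t t' \<longleftrightarrow> (\<forall>u'. A t' u' \<longrightarrow> (\<exists>u. u \<sqsubseteq> u' \<and> A t u))" for t t'
  have R: "dfn_vv R" unfolding R_def by (intro dfn_vvI dfn_intros dfn_vvD[OF A])
  have wo: "weak_order R" unfolding weak_order_def R_def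
    by (meson linear order.trans)
  have Rm: "R x y \<longleftrightarrow> m x \<sqsubseteq> m y" if x: "a \<sqsubset> x" "x \<sqsubset> b" and y: "a \<sqsubset> y" "y \<sqsubset> b" for x y
    unfolding R_def using m[OF x] m[OF y] order.trans by blast
  obtain c d where cd: "a \<sqsubseteq> c" "c \<sqsubset> d" "d \<sqsubseteq> b" and mp:
      "(\<forall>x y. c \<sqsubset> x \<and> x \<sqsubset> d \<and> c \<sqsubset> y \<and> y \<sqsubset> d \<longrightarrow> R x y) \<or>
       (\<forall>x y. c \<sqsubset> x \<and> x \<sqsubset> y \<and> y \<sqsubset> d \<longrightarrow> \<not> R y x) \<or>
       (\<forall>x y. c \<sqsubset> x \<and> x \<sqsubset> y \<and> y \<sqsubset> d \<longrightarrow> \<not> R x y)"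
    by (rule monotone_piece[OF R wo ab(1)]) (rule that)
  note inn = le_interval[OF cd(1,3)]
  have Rm': "R x y \<longleftrightarrow> m x \<sqsubseteq> m y" if "c \<sqsubset> x" "x \<sqsubset> d" "c \<sqsubset> y" "y \<sqsubset> d" for x y
    using Rm inn that by blast
  have "\<exists>t. c \<sqsubset> t \<and> t \<sqsubset> d \<and> normal E t (m t)"
  proof (cases "\<forall>x y. c \<sqsubset> x \<and> x \<sqsubset> d \<and> c \<sqsubset> y \<and> y \<sqsubset> d \<longrightarrow> R x y")
    case True
    obtain t0 where t0: "c \<sqsubset> t0" "t0 \<sqsubset> d" using dense cd(2) by blast
    have "m t = m t0" if "c \<sqsubset> t" "t \<sqsubset> d" for t
      using Rm'[OF that t0] Rm'[OF t0 that] True that t0 by (auto intro: order.antisym)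
    then show ?thesis using normal_on_horizontal[OF cd(2) E fin, of "m t0"] by metis
  next
    case False
    have mono: "(\<forall>x y. c \<sqsubset> x \<and> x \<sqsubset> y \<and> y \<sqsubset> d \<longrightarrow> m x \<sqsubset> m y) \<or> (\<forall>x y. c \<sqsubset> x \<and> x \<sqsubset> y \<and> y \<sqsubset> d \<longrightarrow> m y \<sqsubset> m x)"
      by (rule strictly_monotone_cases[of c d R, OF Rm']) (use False mp in \<open>assumption+ | blast\<close>)+
    have "c \<sqsubset> t \<and> t \<sqsubset> d \<and> u = m t \<longleftrightarrow> c \<sqsubset> t \<and> t \<sqsubset> d \<and> A t u \<and> (\<forall>u'. A t u' \<longrightarrow> u \<sqsubseteq> u')" for t u
      using m[of t] inn[of t] order.antisym by blast
    then have G: "dfn_vv (\<lambda>t u. c \<sqsubset> t \<and> t \<sqsubset> d \<and> u = m t)"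
      by simp (intro dfn_vvI dfn_intros dfn_vvD[OF A])
    show ?thesis using normal_on_graph[OF G cd(2) E fin mono] .
  qed
  then show False using m inn unfolding A_def by blast
qed

text \<open>
  The one-parameter form of uniform finiteness: away from finitely many \<open>t\<close>, the number of points in the
  fibre is locally constant.
\<close>

lemma finite_not_tame:
  assumes E: "dfn_vv E" and fin: "\<And>t. finite {u. E t u}"
  shows "finite {t. \<not> tame_at E t}"
proof -
  have "{t. \<not> tame_at E t} = {t. \<not> bounded_above_near E t} \<union> {t. \<not> bounded_below_near E t} \<union> {t. \<exists>u. \<not> normal E t u}"
    unfolding tame_at_def by blast
  then show ?thesis
    using finite_not_bounded_above_near[OF E fin] finite_not_bounded_below_near[OF E fin] finite_not_normal[OF E fin]
    by simp
qed

end

section \<open>Uniform finiteness\<close>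

text \<open>
  The iterated quantifier \<open>there are infinitely many\<close> over the coordinates \<open>vs\<close>. It replaces
  having interior, and sets that are not fat in all coordinates are the thin ones.
\<close>

primrec fat :: "nat list \<Rightarrow> ((nat \<Rightarrow> 'a) \<Rightarrow> bool) \<Rightarrow> (nat \<Rightarrow> 'a) \<Rightarrow> bool" where
  "fat [] C s = C s"
| "fat (v # vs) C s = infinite {x. fat vs C (s(v := x))}"

lemma fat_cong:
  "(\<And>i. i \<notin> set vs \<Longrightarrow> s i = s' i) \<Longrightarrow> fat vs C s = fat vs C s'"
proof (induction vs arbitrary: s s')
  case Nil
  then have "s = s'" by auto
  then show ?case by simp
next
  case (Cons v vs)
  have "fat vs C (s(v := x)) = fat vs C (s'(v := x))" for x
    by (rule Cons.IH) (use Cons.prems in auto)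
  then show ?case by simp
qed

lemma fat_mono_on:
  "fat vs C s \<Longrightarrow> (\<And>z. (\<forall>i. i \<notin> set vs \<longrightarrow> z i = s i) \<Longrightarrow> C z \<Longrightarrow> D z) \<Longrightarrow> fat vs D s"
proof (induction vs arbitrary: s)
  case Nil then show ?case using Nil.prems(2)[of s] by simp
next
  case (Cons v vs)
  have "fat vs D (s(v := x))" if "fat vs C (s(v := x))" for x
    by (rule Cons.IH[OF that]) (rule Cons.prems(2), auto)
  then have "{x. fat vs C (s(v := x))} \<subseteq> {x. fat vs D (s(v := x))}" by blast
  then show ?case using Cons.prems(1) by (auto dest: finite_subset)
qed

lemma fat_disj: "fat vs (\<lambda>z. C z \<or> D z) s \<Longrightarrow> fat vs C s \<or> fat vs D s"
proof (induction vs arbitrary: s)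
  case Nil then show ?case by simp
next
  case (Cons v vs)
  have "{x. fat vs (\<lambda>z. C z \<or> D z) (s(v := x))} \<subseteq> {x. fat vs C (s(v := x))} \<union> {x. fat vs D (s(v := x))}"
    using Cons.IH by blast
  then show ?case using Cons.prems by (auto dest: finite_subset)
qed

lemma fat_ex: "fat vs C s \<Longrightarrow> \<exists>z. C z \<and> (\<forall>i. i \<notin> set vs \<longrightarrow> z i = s i)"
proof (induction vs arbitrary: s)
  case Nil then show ?case by auto
next
  case (Cons v vs)
  then obtain x where "fat vs C (s(v := x))" by (auto dest!: infinite_imp_nonempty)
  from Cons.IH[OF this] show ?case by auto
qed

text \<open>
  Chooses one environment among those that agree on \<open>I\<close>.
\<close>

definition restr :: "nat set \<Rightarrow> (nat \<Rightarrow> 'a) \<Rightarrow> nat \<Rightarrow> 'a" where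
  "restr I s = (\<lambda>i. if i \<in> I then s i else undefined)"

lemma supported_restr: "supported I (\<lambda>s. P (restr I s))"
  unfolding supported_def
proof (intro allI impI)
  fix e e' :: "nat \<Rightarrow> 'a" assume "\<forall>i\<in>I. e i = e' i"
  then have "restr I e = restr I e'" unfolding restr_def by auto
  then show "P (restr I e) = P (restr I e')" by simp
qed

lemma coord_map_comp: "coord_map \<tau> \<Longrightarrow> env_map \<sigma> \<Longrightarrow> coord_map (\<lambda>e. \<tau> (\<sigma> e))"
  unfolding coord_map_def[of \<tau>] by (auto intro: env_map_coord coord_map_const)

lemma env_map_comp: "env_map \<rho> \<Longrightarrow> env_map \<sigma> \<Longrightarrow> env_map (\<lambda>e. \<rho> (\<sigma> e))"
  unfolding env_map_def[of "\<lambda>e. \<rho> (\<sigma> e)"] using coord_map_comp env_map_coord by blast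

lemma env_map_restr [dfn_intros]:
  assumes "env_map \<sigma>" shows "env_map (\<lambda>e. restr I (\<sigma> e))"
  unfolding env_map_def
proof
  fix i show "coord_map (\<lambda>e. restr I (\<sigma> e) i)"
    using assms by (cases "i \<in> I") (auto simp: restr_def env_map_coord coord_map_const)
qed

context omin begin

text \<open>
  A predicate of two environments is regarded as a predicate of one by interleaving them.
\<close>

definition dfn_ee :: "((nat \<Rightarrow> 'a) \<Rightarrow> (nat \<Rightarrow> 'a) \<Rightarrow> bool) \<Rightarrow> bool" where
  "dfn_ee R \<longleftrightarrow> dfn (\<lambda>e. R (\<lambda>i. e (2 * i)) (\<lambda>i. e (Suc (2 * i))))"

lemma dfn_eeI: "dfn (\<lambda>e. R (\<lambda>i. e (2 * i)) (\<lambda>i. e (Suc (2 * i)))) \<Longrightarrow> dfn_ee R"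
  by (simp add: dfn_ee_def)

lemma dfn_eeD:
  assumes "dfn_ee R" "env_map \<sigma>" "env_map \<rho>" shows "dfn (\<lambda>e. R (\<sigma> e) (\<rho> e))"
proof -
  have "env_map (\<lambda>e i. if even i then \<sigma> e (i div 2) else \<rho> e (i div 2))"
    unfolding env_map_def
  proof
    fix i show "coord_map (\<lambda>e. if even i then \<sigma> e (i div 2) else \<rho> e (i div 2))"
      using assms by (cases "even i") (auto simp: env_map_coord)
  qed
  from dfn_subst[OF assms(1)[unfolded dfn_ee_def] this] show ?thesis by simp
qed

lemma dfn_fat:
  assumes "dfn_ee R" "env_map \<sigma>" "env_map \<rho>" shows "dfn (\<lambda>e. fat vs (R (\<sigma> e)) (\<rho> e))"
  using assms(2,3)
proof (induction vs arbitrary: \<sigma> \<rho>)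
  case Nil then show ?case using dfn_eeD[OF assms(1)] by simp
next
  case (Cons v vs)
  have "dfn (\<lambda>e. fat vs (R (\<sigma> (\<lambda>i. e (Suc i)))) ((\<rho> (\<lambda>i. e (Suc i)))(v := e 0)))"
    by (rule Cons.IH) (intro env_map_comp[OF Cons.prems(1)] env_map_comp[OF Cons.prems(2)] dfn_intros)+
  then show ?case by simp (intro dfn_intros)
qed

lemma dfn_fat1:
  assumes "dfn C" "env_map \<rho>" shows "dfn (\<lambda>e. fat vs C (\<rho> e))"
proof -
  have "dfn_ee (\<lambda>s z. C z)" by (intro dfn_eeI dfn_subst[OF assms(1)] dfn_intros)
  from dfn_fat[OF this env_map_id assms(2)] show ?thesis .
qed

text \<open>
  Having at least \<open>Suc j\<close> elements means that some element can be removed such that at least \<open>j\<close> remain.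
\<close>

lemma dfn_card_ge:
  assumes "dfn_ev R" "\<And>s. finite {a. R s a}" shows "dfn (\<lambda>s. j \<le> card {a. R s a})"
  using assms
proof (induction j arbitrary: R)
  case 0 then show ?case by (simp add: dfn_const)
next
  case (Suc j)
  define R' where "R' s a \<longleftrightarrow> R (\<lambda>i. s (Suc i)) a \<and> a \<noteq> s 0" for s a
  have "dfn_ev R'" unfolding R'_def by (intro dfn_evI dfn_intros dfn_evD[OF Suc.prems(1)])
  moreover have "finite {a. R' s a}" for s
    by (rule finite_subset[OF _ Suc.prems(2)]) (auto simp: R'_def)
  ultimately have IH: "dfn (\<lambda>s. j \<le> card {a. R' s a})" by (rule Suc.IH)
  have "Suc j \<le> card {a. R s a} \<longleftrightarrow> (\<exists>x. R s x \<and> j \<le> card {a. R' (case_nat x s) a})" for s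
  proof -
    have eq: "{a. R' (case_nat x s) a} = {a. R s a} - {x}" for x unfolding R'_def by auto
    show ?thesis unfolding eq
    proof
      assume l: "Suc j \<le> card {a. R s a}"
      then have "{a. R s a} \<noteq> {}" by force
      then obtain x where "R s x" by blast
      then show "\<exists>x. R s x \<and> j \<le> card ({a. R s a} - {x})" using l by (auto simp: card_Diff_singleton)
    next
      assume "\<exists>x. R s x \<and> j \<le> card ({a. R s a} - {x})"
      then obtain x where x: "R s x" "j \<le> card ({a. R s a} - {x})" by blast
      have "card {a. R s a} = Suc (card ({a. R s a} - {x}))"
        using card.remove[OF Suc.prems(2), of x s] x(1) by simp
      then show "Suc j \<le> card {a. R s a}" using x(2) by simp
    qed
  qed
  moreover have "dfn (\<lambda>s. \<exists>x. R s x \<and> j \<le> card {a. R' (case_nat x s) a})"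
    by (intro dfn_intros dfn_evD[OF Suc.prems(1)] dfn_subst[OF IH])
  ultimately show ?case by simp
qed

lemma dfn_card_eq:
  assumes "dfn_ev R" "\<And>s. finite {a. R s a}" "env_map \<sigma>" shows "dfn (\<lambda>e. card {a. R (\<sigma> e) a} = j)"
proof -
  have eq: "(card {a. R s a} = j) \<longleftrightarrow> j \<le> card {a. R s a} \<and> \<not> Suc j \<le> card {a. R s a}" for s by auto
  have "dfn (\<lambda>s. card {a. R s a} = j)"
    unfolding eq by (intro dfn_intros dfn_card_ge assms)
  from dfn_subst[OF this assms(3)] show ?thesis .
qed

text \<open>
  Iterates \<open>fubini_finite\<close>: if each line in direction \<open>v\<close> meets \<open>W\<close> in finitely many points, only finitely
  many slices of \<open>W\<close> perpendicular to \<open>v\<close> are fat.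
\<close>

lemma fat_fubini:
  assumes W: "dfn W" and fin: "\<And>s. finite {x. W (s(v := x))}"
  shows "v \<notin> set vs \<Longrightarrow> finite {x. fat vs W (s(v := x))}"
proof (induction vs arbitrary: s)
  case Nil show ?case unfolding fat.simps by (rule fin)
next
  case (Cons u vs)
  have "dfn_vv (\<lambda>x y. fat vs W (s(v := x, u := y)))"
    by (intro dfn_vvI dfn_fat1[OF W] dfn_intros)
  moreover have "finite {x. fat vs W (s(v := x, u := y))}" for y
  proof -
    have "s(v := x, u := y) = s(u := y, v := x)" for x
      using Cons.prems by (intro fun_upd_twist) auto
    moreover have "finite {x. fat vs W ((s(u := y))(v := x))}" using Cons.prems by (intro Cons.IH) auto
    ultimately show ?thesis by presburger
  qed
  ultimately show ?case
    unfolding fat.simps by (rule fubini_finite[of "\<lambda>x y. fat vs W (s(v := x, u := y))"])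
qed

lemma gap_index_interval:
  assumes "\<And>z. p \<sqsubset> z \<Longrightarrow> z \<sqsubset> q \<Longrightarrow> z \<notin> B" "p \<sqsubset> x" "x \<sqsubset> q" "p \<sqsubset> y" "y \<sqsubset> q"
  shows "gap_index B x = gap_index B y"
proof -
  have "{b \<in> B. b \<sqsubset> x} = {b \<in> B. b \<sqsubset> y}"
    using assms less_trans by (metis (lifting) less_linear)
  then show ?thesis unfolding gap_index_def by simp
qed

text \<open>
  The induction step over the coordinates. On \<open>C\<close> the number of points of \<open>E s\<close> does not depend on the
  coordinates in \<open>vs\<close>, in which \<open>C\<close> is fat. To make it independent of \<open>v\<close> as well, cut the \<open>v\<close>-axis
  at the finitely many points where \<open>C\<close>, or the number on most of the slice of \<open>C\<close>, may change. Between them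
  the number is constant, and over them the union of the sets \<open>E s\<close> is a family with one parameter less.
  The number of cutting points is bounded because they form such a family, too.
\<close>

lemma uniform_finiteness_split:
  assumes E: "dfn_ev E" and fin: "\<And>s. finite {t. E s t}"
    and I: "finite I" and v: "v \<in> I" "v \<notin> set vs" "set vs \<subseteq> I"
    and IH: "\<forall>E' I'. dfn_ev E' \<and> (\<forall>s. finite {t. E' s t}) \<and> I' \<subset> I \<and> supported I' E' \<longrightarrow>
      (\<exists>N. \<forall>s. card {t. E' s t} \<le> N)"
    and C: "dfn C"
    and Cn: "\<And>s s'. restr I s = s \<Longrightarrow> restr I s' = s' \<Longrightarrow> C s \<Longrightarrow> C s' \<Longrightarrow> (\<forall>i. i \<notin> set vs \<longrightarrow> s i = s' i) \<Longrightarrow>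
      card {t. E s t} = card {t. E s' t}"
    and Cf: "\<And>s. restr I s = s \<Longrightarrow> C s \<Longrightarrow> fat vs C s"
  shows "\<exists>\<D> N. finite \<D> \<and> (\<forall>D\<in>\<D>. dfn D \<and>
      (\<forall>s s'. restr I s = s \<and> restr I s' = s' \<and> D s \<and> D s' \<and> (\<forall>i. i \<notin> set (v # vs) \<longrightarrow> s i = s' i) \<longrightarrow>
        card {t. E s t} = card {t. E s' t}) \<and>
      (\<forall>s. restr I s = s \<and> D s \<longrightarrow> fat (v # vs) D s)) \<and>
    (\<forall>s. restr I s = s \<and> C s \<longrightarrow> card {t. E s t} \<le> N \<or> (\<exists>D\<in>\<D>. D s))"
proof -
  define n where "n s = card {t. E s t}" for s
  define T where "T s \<longleftrightarrow> tame_at (\<lambda>x. E (s(v := x))) (s v)" for s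
  have T: "dfn T"
    unfolding T_def tame_at_def normal_def bounded_above_near_def bounded_below_near_def
    by (intro dfn_intros dfn_evD[OF E])
  have Ev: "dfn_vv (\<lambda>x. E (s(v := x)))" for s by (intro dfn_vvI dfn_evD[OF E] dfn_intros)
  have finT: "finite {x. \<not> T (s(v := x))}" for s
    using finite_not_tame[OF Ev fin, of s] unfolding T_def by simp
  have T_near: "nbhd (s v) (\<lambda>x. n (s(v := x)) = n s)" if "T s" for s
    using tame_at_card[OF Ev fin that[unfolded T_def]] unfolding n_def by simp
  have Cv: "dfn_v (\<lambda>x. C (s(v := x)))" for s by (intro dfn_vI dfn_subst[OF C] dfn_intros)
  \<comment> \<open>The exceptional points of \<open>C\<close>: moving them in direction \<open>v\<close> may change the number or leave \<open>C\<close>.\<close>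
  define W where "W s \<longleftrightarrow> C s \<and> (\<not> T s \<or> \<not> nbhd (s v) (\<lambda>x. C (s(v := x))))" for s
  have W: "dfn W" unfolding W_def by (intro dfn_intros dfn_subst[OF C] dfn_subst[OF T] env_map_coord)
  have finW: "finite {x. W (s(v := x))}" for s
  proof (rule finite_subset)
    show "{x. W (s(v := x))} \<subseteq> {x. \<not> T (s(v := x))} \<union> bdry (\<lambda>x. C (s(v := x)))"
      unfolding W_def using bdry_nbhd[of _ "\<lambda>x. C (s(v := x))"] by auto
    show "finite ({x. \<not> T (s(v := x))} \<union> bdry (\<lambda>x. C (s(v := x))))"
      using finT finite_bdry[OF Cv] by simp
  qed
  define X where "X s x \<longleftrightarrow> fat vs C (s(v := x))" for s x
  have X: "dfn_ev X" unfolding X_def by (intro dfn_evI dfn_fat1[OF C] dfn_intros)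
  have Xs: "dfn_v (X s)" for s by (intro dfn_vI dfn_evD[OF X] dfn_intros)
  \<comment> \<open>The cutting points on the \<open>v\<close>-axis.\<close>
  define Q0 where "Q0 s x \<longleftrightarrow> fat vs W (s(v := x)) \<or> \<not> nbhd x (\<lambda>y. X s y = X s x)" for s x
  have Q0: "dfn_ev Q0" unfolding Q0_def by (intro dfn_evI dfn_intros dfn_fat1[OF W] dfn_evD[OF X])
  have finQ0: "finite {x. Q0 s x}" for s
    using fat_fubini[OF W finW v(2), of s] finite_bdry[OF Xs, of s] unfolding Q0_def
    by (simp add: Collect_disj_eq bdry_nbhd[symmetric])
  have Q0_cong: "Q0 s = Q0 s'" if "\<And>i. i \<notin> set (v # vs) \<Longrightarrow> s i = s' i" for s s'
  proof -
    have "fat vs D (s(v := x)) = fat vs D (s'(v := x))" for D x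
      by (rule fat_cong) (use that in auto)
    then show ?thesis unfolding Q0_def X_def by simp
  qed
  define J where "J = I - set (v # vs)"
  define Q where "Q s = Q0 (restr J s)" for s
  have Q: "dfn_ev Q" unfolding Q_def by (intro dfn_evI dfn_evD[OF Q0] dfn_intros)
  have finQ: "finite {x. Q s x}" for s unfolding Q_def by (rule finQ0)
  have Q_eq: "Q s = Q0 s" if "restr I s = s" for s
    unfolding Q_def
  proof (rule Q0_cong)
    fix i assume "i \<notin> set (v # vs)"
    then show "restr J s i = s i" using fun_cong[OF that, of i] by (auto simp: restr_def J_def split: if_splits)
  qed
  have Q_cong: "Q s = Q s'" if "\<And>i. i \<notin> set (v # vs) \<Longrightarrow> s i = s' i" for s s'
  proof -
    have "restr J s = restr J s'" using that unfolding restr_def J_def by auto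
    then show ?thesis unfolding Q_def by simp
  qed
  obtain K where K: "\<And>s. card {x. Q s x} \<le> K"
    using IH[rule_format, of Q J] Q finQ supported_restr[of J Q0, folded Q_def] v(1) unfolding J_def by auto
  \<comment> \<open>The union of the sets \<open>E s\<close> over the cutting points, which has one parameter less.\<close>
  define F where "F s t \<longleftrightarrow> (\<exists>x. Q s x \<and> E (s(v := x)) t)" for s t
  have F: "dfn_ev F" unfolding F_def by (intro dfn_evI dfn_intros dfn_evD[OF Q] dfn_evD[OF E])
  have finF: "finite {t. F s t}" for s
  proof -
    have "{t. F s t} = (\<Union>x\<in>{x. Q s x}. {t. E (s(v := x)) t})" unfolding F_def by blast
    then show ?thesis using finQ fin by simp
  qed
  define F' where "F' s = F (restr (I - {v}) s)" for s
  have "dfn_ev F'" unfolding F'_def by (intro dfn_evI dfn_evD[OF F] dfn_intros)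
  moreover have "finite {t. F' s t}" for s unfolding F'_def by (rule finF)
  ultimately obtain N where N: "\<And>s. card {t. F' s t} \<le> N"
    using IH[rule_format, of F' "I - {v}"] supported_restr[of "I - {v}" F, folded F'_def] v(1)
    by auto
  define g where "g s = gap_index {x. Q s x} (s v)" for s
  have g_eq: "g s = card {b. Q s b \<and> b \<sqsubset> s v}" for s unfolding g_def gap_index_def by simp
  have g: "dfn (\<lambda>s. g s = j)" for j
    unfolding g_eq
    by (rule dfn_card_eq[OF _ _ env_map_id])
      (use finQ in \<open>auto intro!: dfn_evI dfn_intros dfn_evD[OF Q] env_map_coord\<close>)
  define D where "D j s \<longleftrightarrow> C s \<and> \<not> Q s (s v) \<and> g s = j" for j s
  have D: "dfn (D j)" for j
    unfolding D_def by (intro dfn_intros dfn_subst[OF C] dfn_evD[OF Q] dfn_subst[OF g])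
  have XC: "X s (s v)" if "restr I s = s" "C s" for s
    using Cf[OF that] unfolding X_def by simp
  have base_upd: "restr I (s(v := x)) = s(v := x)" if "restr I s = s" for s x
  proof
    fix i show "restr I (s(v := x)) i = (s(v := x)) i"
      using fun_cong[OF that, of i] v(1) by (auto simp: restr_def split: if_splits)
  qed
  have base_off: "restr I z = z" if "restr I s = s" "\<forall>i. i \<notin> set vs \<longrightarrow> z i = s i" for s z
  proof
    fix i show "restr I z i = z i"
      using fun_cong[OF that(1), of i] that(2) v(3) by (auto simp: restr_def split: if_splits)
  qed
  have in_gap: "X s y \<and> nbhd y (X s)" if s: "restr I s = s" "C s" and gap: "p \<sqsubset> s v" "s v \<sqsubset> q"
      "\<And>z. p \<sqsubset> z \<Longrightarrow> z \<sqsubset> q \<Longrightarrow> \<not> Q s z" and y: "p \<sqsubset> y" "y \<sqsubset> q" for s p q y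
  proof -
    have "z \<notin> bdry (X s)" if "p \<sqsubset> z" "z \<sqsubset> q" for z
      using gap(3)[OF that] unfolding Q_eq[OF s(1)] Q0_def bdry_nbhd by blast
    then have "X s z" if "p \<sqsubset> z" "z \<sqsubset> q" for z
      using const_on_interval[OF Xs _ gap(1,2) that] XC[OF s] by blast
    then show ?thesis using y nbhdI[OF y] by blast
  qed
  have D_const: "n s = n s'" if s: "restr I s = s" "restr I s' = s'" "D j s" "D j s'"
    and off: "\<forall>i. i \<notin> set (v # vs) \<longrightarrow> s i = s' i" for j s s'
  proof -
    have Qs: "Q s' = Q s" using Q_cong[of s s'] off by simp
    have Cs: "C s" "C s'" using s unfolding D_def by blast+
    have nQ: "s v \<notin> {x. Q s x}" "s' v \<notin> {x. Q s x}" using s(3,4) unfolding D_def Qs by blast+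
    have "gap_index {x. Q s x} (s v) = gap_index {x. Q s x} (s' v)"
      using s(3,4) unfolding D_def g_def Qs by simp
    then obtain p q where pq: "p \<sqsubset> s v" "s v \<sqsubset> q" "p \<sqsubset> s' v" "s' v \<sqsubset> q" "\<And>z. p \<sqsubset> z \<Longrightarrow> z \<sqsubset> q \<Longrightarrow> z \<notin> {x. Q s x}"
      by (rule same_gap[OF finQ nQ]) (rule that)
    then have gap: "\<And>z. p \<sqsubset> z \<Longrightarrow> z \<sqsubset> q \<Longrightarrow> \<not> Q s z" by blast
    define m where "m = n s"
    have Cm: "dfn (\<lambda>z. C z \<and> n z = m)"
      unfolding n_def by (intro dfn_intros dfn_subst[OF C] dfn_card_eq[OF E fin])
    \<comment> \<open>Most points of the slice at \<open>y\<close> have the number \<open>m\<close>. This is constant between cutting points.\<close>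
    define Y where "Y y \<longleftrightarrow> fat vs (\<lambda>z. C z \<and> n z = m) (s(v := y))" for y
    have Y: "dfn_v Y" unfolding Y_def by (intro dfn_vI dfn_fat1[OF Cm] dfn_intros)
    have Y_iff: "Y y \<longleftrightarrow> n z = m" if Xy: "X s y" and z: "C z" "\<forall>i. i \<notin> set vs \<longrightarrow> z i = (s(v := y)) i" for y z
    proof
      have bz: "restr I z = z" using base_off[OF base_upd[OF s(1)] z(2)] .
      assume "Y y"
      then obtain z' where z': "C z'" "n z' = m" "\<forall>i. i \<notin> set vs \<longrightarrow> z' i = (s(v := y)) i"
        unfolding Y_def using fat_ex by blast
      have "restr I z' = z'" using base_off[OF base_upd[OF s(1)] z'(3)] .
      then show "n z = m" using Cn[OF bz _ z(1) z'(1)] z(2) z'(2,3) unfolding n_def by simp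
    next
      have bz: "restr I z = z" using base_off[OF base_upd[OF s(1)] z(2)] .
      assume nz: "n z = m"
      show "Y y" unfolding Y_def
      proof (rule fat_mono_on[OF Xy[unfolded X_def]])
        fix z' assume z': "\<forall>i. i \<notin> set vs \<longrightarrow> z' i = (s(v := y)) i" "C z'"
        have "restr I z' = z'" using base_off[OF base_upd[OF s(1)] z'(1)] .
        then show "C z' \<and> n z' = m" using Cn[OF bz _ z(1) z'(2)] z(2) z'(1,2) nz unfolding n_def by simp
      qed
    qed
    have "y \<notin> bdry Y" if y: "p \<sqsubset> y" "y \<sqsubset> q" for y
    proof -
      have Xy: "X s y" "nbhd y (X s)" using in_gap[OF s(1) Cs(1) pq(1,2) gap y] by blast+
      have "\<not> fat vs W (s(v := y))" using gap[OF y] unfolding Q_eq[OF s(1)] Q0_def by blast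
      moreover have "fat vs (\<lambda>z. W z \<or> (C z \<and> \<not> W z)) (s(v := y))"
        using Xy(1) unfolding X_def by (rule fat_mono_on) blast
      ultimately have "fat vs (\<lambda>z. C z \<and> \<not> W z) (s(v := y))"
        by (blast dest: fat_disj[of vs W "\<lambda>z. C z \<and> \<not> W z" "s(v := y)"])
      then obtain z where z: "C z" "\<not> W z" "\<forall>i. i \<notin> set vs \<longrightarrow> z i = (s(v := y)) i"
        using fat_ex by blast
      have zv: "z v = y" using z(3) v(2) by simp
      have near: "nbhd y (\<lambda>x. C (z(v := x)))" "nbhd y (\<lambda>x. n (z(v := x)) = n z)"
        using z(1,2) T_near[of z] unfolding W_def zv by blast+
      have "nbhd y (\<lambda>x. Y x = Y y)"
      proof (rule nbhd_mono[OF nbhd_conj[OF Xy(2) nbhd_conj[OF near]]])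
        fix x assume x: "X s x \<and> C (z(v := x)) \<and> n (z(v := x)) = n z"
        have "Y x \<longleftrightarrow> n (z(v := x)) = m" using x z(3) v(2) by (intro Y_iff) auto
        moreover have "Y y \<longleftrightarrow> n z = m" using Xy(1) z by (intro Y_iff) auto
        ultimately show "Y x = Y y" using x by simp
      qed
      then show ?thesis unfolding bdry_nbhd .
    qed
    then have YY: "Y (s v) = Y (s' v)" using const_on_interval[OF Y _ pq(1-4)] by blast
    have "Y (s v)" using Y_iff[of "s v" s] XC[OF s(1) Cs(1)] Cs(1) m_def by simp
    moreover have "Y (s' v) \<longleftrightarrow> n s' = m"
      using in_gap[OF s(1) Cs(1) pq(1,2) gap pq(3,4)] Cs(2) off by (intro Y_iff) auto
    ultimately show ?thesis using YY m_def by simp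
  qed
  have D_fat: "fat (v # vs) (D j) s" if s: "restr I s = s" "D j s" for j s
  proof -
    have Cs: "C s" and nQ: "s v \<notin> {x. Q s x}" using s(2) unfolding D_def by blast+
    obtain p q where pq: "p \<sqsubset> s v" "s v \<sqsubset> q" "\<And>z. p \<sqsubset> z \<Longrightarrow> z \<sqsubset> q \<Longrightarrow> z \<notin> {x. Q s x}"
      by (rule same_gap[OF finQ nQ nQ refl]) (rule that)
    then have gap: "\<And>z. p \<sqsubset> z \<Longrightarrow> z \<sqsubset> q \<Longrightarrow> \<not> Q s z" by blast
    have "fat vs (D j) (s(v := y))" if y: "p \<sqsubset> y" "y \<sqsubset> q" for y
    proof -
      have "fat vs C (s(v := y))" using in_gap[OF s(1) Cs pq(1,2) gap y] unfolding X_def by blast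
      then show ?thesis
      proof (rule fat_mono_on)
        fix z assume z: "\<forall>i. i \<notin> set vs \<longrightarrow> z i = (s(v := y)) i" "C z"
        have zv: "z v = y" using z(1) v(2) by simp
        have Qz: "Q z = Q s" by (rule Q_cong) (use z(1) in auto)
        have "g z = g s" unfolding g_def Qz zv
          by (rule gap_index_interval[OF pq(3) y pq(1,2)])
        then show "D j z" using z(2) gap[OF y] s(2) unfolding D_def Qz zv by blast
      qed
    qed
    then have "{y. p \<sqsubset> y \<and> y \<sqsubset> q} \<subseteq> {y. fat vs (D j) (s(v := y))}" by blast
    moreover have "infinite {y. p \<sqsubset> y \<and> y \<sqsubset> q}" using infinite_interval less_trans[OF pq(1,2)] by blast
    ultimately show ?thesis using infinite_super by auto
  qed
  have cover: "n s \<le> N \<or> (\<exists>j\<le>K. D j s)" if s: "restr I s = s" "C s" for s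
  proof (cases "Q s (s v)")
    case False
    have "g s \<le> K" unfolding g_def using gap_index_le[OF finQ] K le_trans by blast
    then show ?thesis using False s(2) unfolding D_def by blast
  next
    case True
    let ?r = "restr (I - {v}) s"
    have "?r(v := s v) = s"
    proof
      fix i show "(?r(v := s v)) i = s i"
        using fun_cong[OF s(1), of i] by (auto simp: restr_def split: if_splits)
    qed
    moreover have "Q ?r = Q s"
    proof -
      have "restr J ?r = restr J s" unfolding restr_def J_def by auto
      then show ?thesis unfolding Q_def by simp
    qed
    ultimately have "{t. E s t} \<subseteq> {t. F' s t}" using True unfolding F'_def F_def by auto
    then have "n s \<le> card {t. F' s t}" unfolding n_def F'_def using finF by (intro card_mono) auto
    then show ?thesis using N[of s] by linarith
  qed
  show ?thesis
  proof (intro exI[of _ "D ` {..K}"] exI[of _ N] conjI ballI allI impI)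
    fix P assume "P \<in> D ` {..K}"
    then obtain j where j: "P = D j" by blast
    show "dfn P" using D j by simp
    fix s
    show "card {t. E s t} = card {t. E s' t}"
      if "restr I s = s \<and> restr I s' = s' \<and> P s \<and> P s' \<and> (\<forall>i. i \<notin> set (v # vs) \<longrightarrow> s i = s' i)" for s'
      using D_const[of s s' j] that unfolding j n_def by blast
    show "fat (v # vs) P s" if "restr I s = s \<and> P s" using D_fat that unfolding j by blast
  next
    fix s assume "restr I s = s \<and> C s"
    then show "card {t. E s t} \<le> N \<or> (\<exists>D\<in>D ` {..K}. D s)" using cover unfolding n_def by blast
  qed simp
qed

text \<open>
  Starting with a single piece, the coordinates are treated one after the other.
\<close>

lemma uniform_finiteness_stage:
  assumes E: "dfn_ev E" and fin: "\<And>s. finite {t. E s t}" and I: "finite I"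
    and IH: "\<forall>E' I'. dfn_ev E' \<and> (\<forall>s. finite {t. E' s t}) \<and> I' \<subset> I \<and> supported I' E' \<longrightarrow>
      (\<exists>N. \<forall>s. card {t. E' s t} \<le> N)"
  shows "set vs \<subseteq> I \<Longrightarrow> distinct vs \<Longrightarrow> \<exists>\<D> N. finite \<D> \<and> (\<forall>D\<in>\<D>. dfn D \<and>
      (\<forall>s s'. restr I s = s \<and> restr I s' = s' \<and> D s \<and> D s' \<and> (\<forall>i. i \<notin> set vs \<longrightarrow> s i = s' i) \<longrightarrow>
        card {t. E s t} = card {t. E s' t}) \<and>
      (\<forall>s. restr I s = s \<and> D s \<longrightarrow> fat vs D s)) \<and>
    (\<forall>s. restr I s = s \<longrightarrow> card {t. E s t} \<le> N \<or> (\<exists>D\<in>\<D>. D s))"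
proof (induction vs)
  case Nil
  have "(\<forall>i. s i = s' i) \<Longrightarrow> s = s'" for s s' :: "nat \<Rightarrow> 'a" by auto
  then show ?case
    by (intro exI[of _ "{\<lambda>_. True}"] exI[of _ 0]) (auto intro: dfn_const)
next
  case (Cons v vs)
  let ?good = "\<lambda>vs D. dfn D \<and>
      (\<forall>s s'. restr I s = s \<and> restr I s' = s' \<and> D s \<and> D s' \<and> (\<forall>i. i \<notin> set vs \<longrightarrow> s i = s' i) \<longrightarrow>
        card {t. E s t} = card {t. E s' t}) \<and>
      (\<forall>s. restr I s = s \<and> D s \<longrightarrow> fat vs D s)"
  obtain \<C> N where \<C>: "finite \<C>" "\<forall>C\<in>\<C>. ?good vs C"
    "\<forall>s. restr I s = s \<longrightarrow> card {t. E s t} \<le> N \<or> (\<exists>C\<in>\<C>. C s)"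
    using Cons.IH Cons.prems by auto
  have "\<exists>\<D> N. finite \<D> \<and> (\<forall>D\<in>\<D>. ?good (v # vs) D) \<and>
    (\<forall>s. restr I s = s \<and> C s \<longrightarrow> card {t. E s t} \<le> N \<or> (\<exists>D\<in>\<D>. D s))" if "C \<in> \<C>" for C
  proof (rule uniform_finiteness_split[OF E fin I _ _ _ IH])
    show "v \<in> I" "v \<notin> set vs" "set vs \<subseteq> I" using Cons.prems by auto
    have C: "?good vs C" using \<C>(2) that by (rule bspec)
    show "dfn C" using C by (rule conjunct1)
    show "card {t. E s t} = card {t. E s' t}"
      if "restr I s = s" "restr I s' = s'" "C s" "C s'" "\<forall>i. i \<notin> set vs \<longrightarrow> s i = s' i" for s s'
      using C[THEN conjunct2, THEN conjunct1] that by blast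
    show "fat vs C s" if "restr I s = s" "C s" for s
      using C[THEN conjunct2, THEN conjunct2] that by blast
  qed
  then have "\<forall>C\<in>\<C>. \<exists>\<D> N. finite \<D> \<and> (\<forall>D\<in>\<D>. ?good (v # vs) D) \<and>
    (\<forall>s. restr I s = s \<and> C s \<longrightarrow> card {t. E s t} \<le> N \<or> (\<exists>D\<in>\<D>. D s))" by blast
  from bchoice[OF this] obtain \<D> where "\<forall>C\<in>\<C>. \<exists>N. finite (\<D> C) \<and> (\<forall>D\<in>\<D> C. ?good (v # vs) D) \<and>
    (\<forall>s. restr I s = s \<and> C s \<longrightarrow> card {t. E s t} \<le> N \<or> (\<exists>D\<in>\<D> C. D s))" by (rule exE)
  from bchoice[OF this] obtain N' where
    \<D>: "\<forall>C\<in>\<C>. finite (\<D> C) \<and> (\<forall>D\<in>\<D> C. ?good (v # vs) D) \<and>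
    (\<forall>s. restr I s = s \<and> C s \<longrightarrow> card {t. E s t} \<le> N' C \<or> (\<exists>D\<in>\<D> C. D s))" by (rule exE)
  have N': "N' C \<le> N + sum N' \<C>" if "C \<in> \<C>" for C
    using member_le_sum[of C \<C> N'] \<C>(1) that by simp
  have cov: "card {t. E s t} \<le> N + sum N' \<C> \<or> (\<exists>D\<in>\<Union> (\<D> ` \<C>). D s)" if s: "restr I s = s" for s
  proof -
    from \<C>(3)[rule_format, OF s] show ?thesis
    proof (elim disjE bexE)
      assume "card {t. E s t} \<le> N" then show ?thesis by simp
    next
      fix C assume 2: "C \<in> \<C>" "C s"
      have "\<forall>s. restr I s = s \<and> C s \<longrightarrow> card {t. E s t} \<le> N' C \<or> (\<exists>D\<in>\<D> C. D s)"
        using bspec[OF \<D> 2(1)] by (elim conjE)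
      then have "card {t. E s t} \<le> N' C \<or> (\<exists>D\<in>\<D> C. D s)" using s 2(2) by simp
      then show ?thesis using N'[OF 2(1)] 2(1) by auto
    qed
  qed
  have good: "\<forall>D\<in>\<Union> (\<D> ` \<C>). ?good (v # vs) D"
  proof
    fix D assume "D \<in> \<Union> (\<D> ` \<C>)"
    then obtain C where C: "C \<in> \<C>" "D \<in> \<D> C" by blast
    from bspec[OF \<D> C(1)] have "\<forall>D\<in>\<D> C. ?good (v # vs) D" by (elim conjE)
    then show "?good (v # vs) D" using C(2) by (rule bspec)
  qed
  have "finite (\<Union> (\<D> ` \<C>))" using \<C>(1) \<D> by simp
  then show ?case using cov good
    by (intro exI[of _ "\<Union> (\<D> ` \<C>)"] exI[of _ "N + sum N' \<C>"] conjI allI impI)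
qed

text \<open>
  When all coordinates have been treated, the number is constant on each of finitely many pieces and
  bounded elsewhere.
\<close>

lemma uniform_finiteness_supported:
  assumes "finite I" "dfn_ev E" "\<And>s. finite {t. E s t}" "supported I E"
  shows "\<exists>N. \<forall>s. card {t. E s t} \<le> N"
  using assms
proof (induction I arbitrary: E rule: finite_psubset_induct)
  case (psubset I)
  obtain vs where vs: "distinct vs" "set vs = I" using finite_distinct_list[OF psubset.hyps] by blast
  have IH: "\<forall>E' I'. dfn_ev E' \<and> (\<forall>s. finite {t. E' s t}) \<and> I' \<subset> I \<and> supported I' E' \<longrightarrow>
      (\<exists>N. \<forall>s. card {t. E' s t} \<le> N)"
    using psubset.IH by blast
  obtain \<D> N where \<D>: "finite \<D>"
    "\<forall>D\<in>\<D>. \<forall>s s'. restr I s = s \<and> restr I s' = s' \<and> D s \<and> D s' \<and> (\<forall>i. i \<notin> set vs \<longrightarrow> s i = s' i) \<longrightarrow>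
        card {t. E s t} = card {t. E s' t}"
    "\<forall>s. restr I s = s \<longrightarrow> card {t. E s t} \<le> N \<or> (\<exists>D\<in>\<D>. D s)"
    using uniform_finiteness_stage[OF psubset.prems(1,2) psubset.hyps IH, of vs] vs by auto
  define k where "k D = card {t. E (SOME s. restr I s = s \<and> D s) t}" for D
  have k: "card {t. E s t} = k D" if "D \<in> \<D>" "restr I s = s" "D s" for s D
  proof -
    let ?s = "SOME s. restr I s = s \<and> D s"
    have "\<exists>s. restr I s = s \<and> D s" using that by blast
    then have s': "restr I ?s = ?s \<and> D ?s" by (rule someI_ex)
    have "s i = ?s i" if "i \<notin> I" for i
      using fun_cong[OF \<open>restr I s = s\<close>, of i] fun_cong[OF conjunct1[OF s'], of i] that
      by (simp add: restr_def)
    then show ?thesis using \<D>(2) that s' vs(2) unfolding k_def by blast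
  qed
  have "card {t. E s t} \<le> N + sum k \<D>" for s
  proof -
    let ?r = "restr I s"
    have r: "restr I ?r = ?r" unfolding restr_def by auto
    have "E s = E ?r" using psubset.prems(3) by (rule supportedD) (simp add: restr_def)
    moreover have "card {t. E ?r t} \<le> N + sum k \<D>"
    proof -
      consider "card {t. E ?r t} \<le> N" | D where "D \<in> \<D>" "D ?r" using \<D>(3) r by blast
      then show ?thesis
      proof cases
        case 1 then show ?thesis by simp
      next
        case 2
        then show ?thesis using k[OF 2(1) r 2(2)] member_le_sum[of D \<D> k] \<D>(1) by simp
      qed
    qed
    ultimately show ?thesis by simp
  qed
  then show ?case by blast
qed

theorem uniform_finiteness:
  assumes E: "dfn_ev E" and fin: "\<And>s. finite {t. E s t}"
  shows "\<exists>N. \<forall>s. card {t. E s t} \<le> N"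
proof -
  obtain k where k: "supported {..<k} (\<lambda>e. E (\<lambda>i. e (Suc i)) (e 0))"
    using dfn_support E unfolding dfn_ev_def by blast
  have "supported {..<k} E"
    unfolding supported_def
  proof (intro allI impI ext)
    fix s s' :: "nat \<Rightarrow> 'a" and t assume "\<forall>i\<in>{..<k}. s i = s' i"
    then show "E s t = E s' t"
      using supportedD[OF k, of "case_nat t s" "case_nat t s'"] by (simp split: nat.splits)
  qed
  then show ?thesis by (intro uniform_finiteness_supported[OF _ E fin]) auto
qed

end

section \<open>Fat classes of definable equivalence relations\<close>

definition ilv :: "(nat \<Rightarrow> 'a) \<Rightarrow> (nat \<Rightarrow> 'a) \<Rightarrow> nat \<Rightarrow> 'a" where
  "ilv s z = (\<lambda>i. if even i then s (i div 2) else z (i div 2))"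

lemma ilv_simps [simp]: "ilv s z (2 * i) = s i" "ilv s z (Suc (2 * i)) = z i"
  by (simp_all add: ilv_def)

lemma env_map_ilv [dfn_intros]:
  assumes "env_map \<sigma>" "env_map \<rho>" shows "env_map (\<lambda>e. ilv (\<sigma> e) (\<rho> e))"
  unfolding env_map_def
proof
  fix i show "coord_map (\<lambda>e. ilv (\<sigma> e) (\<rho> e) i)"
    using assms by (cases "even i") (auto simp: ilv_def env_map_coord)
qed

primrec ex_coords :: "nat list \<Rightarrow> ((nat \<Rightarrow> 'a) \<Rightarrow> bool) \<Rightarrow> (nat \<Rightarrow> 'a) \<Rightarrow> bool" where
  "ex_coords [] C s = C s"
| "ex_coords (v # vs) C s = (\<exists>x. ex_coords vs C (s(v := x)))"

lemma ex_coords_iff: "ex_coords vs C s \<longleftrightarrow> (\<exists>z. (\<forall>i. i \<notin> set vs \<longrightarrow> z i = s i) \<and> C z)"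
proof (induction vs arbitrary: s)
  case Nil
  have "(\<forall>i. z i = s i) \<longleftrightarrow> z = s" for z :: "nat \<Rightarrow> 'a" by auto
  then show ?case by auto
next
  case (Cons v vs)
  show ?case unfolding ex_coords.simps Cons.IH
  proof (intro iffI; elim exE conjE)
    fix x z assume "\<forall>i. i \<notin> set vs \<longrightarrow> z i = (s(v := x)) i" "C z"
    then show "\<exists>z. (\<forall>i. i \<notin> set (v # vs) \<longrightarrow> z i = s i) \<and> C z" by (intro exI[of _ z]) auto
  next
    fix z assume "\<forall>i. i \<notin> set (v # vs) \<longrightarrow> z i = s i" "C z"
    then show "\<exists>x z. (\<forall>i. i \<notin> set vs \<longrightarrow> z i = (s(v := x)) i) \<and> C z"
      by (intro exI[of _ "z v"] exI[of _ z]) auto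
  qed
qed

lemma fat_supported:
  "supported I X \<Longrightarrow> (\<And>i. i \<in> I - set vs \<Longrightarrow> s i = s' i) \<Longrightarrow> fat vs X s = fat vs X s'"
proof (induction vs arbitrary: s s')
  case Nil
  then show ?case using supportedD[OF Nil.prems(1), of s s'] by simp
next
  case (Cons v vs)
  have "fat vs X (s(v := x)) = fat vs X (s'(v := x))" for x
    by (rule Cons.IH[OF Cons.prems(1)]) (use Cons.prems(2) in auto)
  then show ?case by simp
qed

context omin begin

lemma dfn_ex_coords:
  assumes C: "dfn C" shows "dfn (ex_coords vs C)"
proof (induction vs)
  case Nil
  have "ex_coords [] C = C" by auto
  then show ?case using C by simp
next
  case (Cons v vs)
  have "dfn (\<lambda>s. \<exists>x. ex_coords vs C (s(v := x)))" by (intro dfn_intros dfn_subst[OF Cons])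
  moreover have "ex_coords (v # vs) C = (\<lambda>s. \<exists>x. ex_coords vs C (s(v := x)))" by (rule ext) simp
  ultimately show ?case by simp
qed

lemma dfn_ex_env [dfn_intros]:
  assumes "dfn (\<lambda>e. Q (\<lambda>i. e (2 * i)) (\<lambda>i. e (Suc (2 * i))))" shows "dfn (\<lambda>e. \<exists>z. Q e z)"
proof -
  let ?C = "\<lambda>e. Q (\<lambda>i. e (2 * i)) (\<lambda>i. e (Suc (2 * i)))"
  obtain k where k: "supported {..<k} ?C" using dfn_support[OF assms] by blast
  define vs where "vs = filter odd [0..<k]"
  have "(\<exists>z. Q e z) \<longleftrightarrow> ex_coords vs ?C (ilv e e)" for e
    unfolding ex_coords_iff
  proof (intro iffI; elim exE conjE)
    fix z assume z: "Q e z"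
    define f where "f = (\<lambda>i. if i \<in> set vs then ilv e z i else ilv e e i)"
    have "f i = ilv e z i" if "i < k" for i
      using that by (auto simp: f_def vs_def ilv_def)
    then have "?C f = ?C (ilv e z)" by (intro supportedD[OF k]) auto
    then have "?C f" using z by simp
    then show "\<exists>z. (\<forall>i. i \<notin> set vs \<longrightarrow> z i = ilv e e i) \<and> ?C z"
      by (intro exI[of _ f]) (auto simp: f_def)
  next
    fix f assume f: "\<forall>i. i \<notin> set vs \<longrightarrow> f i = ilv e e i" "?C f"
    have "f (2 * i) = e i" for i using f(1) by (simp add: vs_def)
    then show "\<exists>z. Q e z" using f(2) by auto
  qed
  then show ?thesis
    by simp (intro dfn_subst[OF dfn_ex_coords[OF assms]] dfn_intros)
qed

lemma dfn_all_env [dfn_intros]: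
  assumes "dfn (\<lambda>e. Q (\<lambda>i. e (2 * i)) (\<lambda>i. e (Suc (2 * i))))" shows "dfn (\<lambda>e. \<forall>z. Q e z)"
proof -
  have "dfn (\<lambda>e. \<not> (\<exists>z. \<not> Q e z))" by (intro dfn_intros assms)
  then show ?thesis by simp
qed

definition dfn_eee :: "((nat \<Rightarrow> 'a) \<Rightarrow> (nat \<Rightarrow> 'a) \<Rightarrow> (nat \<Rightarrow> 'a) \<Rightarrow> bool) \<Rightarrow> bool" where
  "dfn_eee R \<longleftrightarrow> dfn_ee (\<lambda>p. R (\<lambda>i. p (2 * i)) (\<lambda>i. p (Suc (2 * i))))"

lemma dfn_eeeI:
  "dfn (\<lambda>e. R (\<lambda>i. e (2 * (2 * i))) (\<lambda>i. e (2 * (Suc (2 * i)))) (\<lambda>i. e (Suc (2 * i)))) \<Longrightarrow> dfn_eee R"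
  by (simp add: dfn_eee_def dfn_ee_def)

lemma dfn_eeeD:
  assumes "dfn_eee R" "env_map \<sigma>" "env_map \<rho>" "env_map \<omega>" shows "dfn (\<lambda>e. R (\<sigma> e) (\<rho> e) (\<omega> e))"
  using dfn_eeD[OF assms(1)[unfolded dfn_eee_def] env_map_ilv[OF assms(2,3)] assms(4)] by simp

lemma dfn_fat3:
  assumes "dfn_eee R" "env_map \<sigma>" "env_map \<rho>" "env_map \<omega>" shows "dfn (\<lambda>e. fat vs (R (\<sigma> e) (\<rho> e)) (\<omega> e))"
  using dfn_fat[OF assms(1)[unfolded dfn_eee_def] env_map_ilv[OF assms(2,3)] assms(4)] by simp

lemma bdry_of_germs:
  assumes "near_right x S" "near_left x (\<lambda>y. \<not> S y)" shows "x \<in> bdry S"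
proof (rule ccontr)
  assume "x \<notin> bdry S"
  then have "nbhd x (\<lambda>y. S y = S x)" unfolding bdry_nbhd by simp
  then have "near_right x (\<lambda>y. S y = S x)" "near_left x (\<lambda>y. S y = S x)" unfolding nbhd_iff by blast+
  from near_right_ex[OF near_right_conj[OF this(1) assms(1)]] near_left_ex[OF near_left_conj[OF this(2) assms(2)]]
  show False by blast
qed

text \<open>
  Otherwise, by \<open>uniform_diag_right\<close>, there is an interval such that for all \<open>x < y\<close> in it some set
  \<open>S w\<close> begins at \<open>x\<close> and reaches \<open>y\<close>. Then \<open>y\<close> would lie in infinitely many of the sets.
\<close>

lemma finite_left_ends:
  assumes S: "dfn_ev S"
    and K: "\<And>y. finite (S ` {w. S w y})"
  shows "finite {x. \<exists>w. near_right x (S w) \<and> near_left x (\<lambda>y. \<not> S w y)}"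
proof (rule ccontr)
  assume inf: "infinite {x. \<exists>w. near_right x (S w) \<and> near_left x (\<lambda>y. \<not> S w y)}"
  have "dfn_v (\<lambda>x. \<exists>w. near_right x (S w) \<and> near_left x (\<lambda>y. \<not> S w y))"
    by (intro dfn_vI dfn_intros dfn_evD[OF S])
  from infinite_has_interval[OF this inf] obtain a b where ab: "a \<sqsubset> b"
    "\<And>x. a \<sqsubset> x \<Longrightarrow> x \<sqsubset> b \<Longrightarrow> \<exists>w. near_right x (S w) \<and> near_left x (\<lambda>y. \<not> S w y)" by auto
  define P where "P x y \<longleftrightarrow> (\<exists>w. near_left x (\<lambda>y. \<not> S w y) \<and> (\<forall>u. x \<sqsubset> u \<and> u \<sqsubseteq> y \<longrightarrow> S w u))" for x y
  have P: "dfn_vv P" unfolding P_def by (intro dfn_vvI dfn_intros dfn_evD[OF S])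
  have nr: "\<forall>x. a \<sqsubset> x \<and> x \<sqsubset> b \<longrightarrow> near_right x (P x)"
  proof (intro allI impI)
    fix x assume x: "a \<sqsubset> x \<and> x \<sqsubset> b"
    then obtain w where w: "near_right x (S w)" "near_left x (\<lambda>y. \<not> S w y)" using ab(2) by blast
    then obtain d where d: "x \<sqsubset> d" "\<And>u. x \<sqsubset> u \<Longrightarrow> u \<sqsubset> d \<Longrightarrow> S w u" unfolding near_right_def by blast
    have "P x y" if "x \<sqsubset> y" "y \<sqsubset> d" for y
      unfolding P_def using w(2) d(2) le_less_trans[OF _ that(2)] by blast
    then show "near_right x (P x)" unfolding near_right_def using d(1) by blast
  qed
  obtain c d where cd: "a \<sqsubseteq> c" "c \<sqsubset> d" "d \<sqsubseteq> b" "\<And>x y. c \<sqsubset> x \<Longrightarrow> x \<sqsubset> y \<Longrightarrow> y \<sqsubset> d \<Longrightarrow> P x y"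
    by (rule uniform_diag_right[OF P ab(1) nr]) (rule that)
  obtain y where y: "c \<sqsubset> y" "y \<sqsubset> d" using dense cd(2) by blast
  have "{x. c \<sqsubset> x \<and> x \<sqsubset> y} \<subseteq> (\<Union>f \<in> S ` {w. S w y}. bdry f)"
  proof
    fix x assume "x \<in> {x. c \<sqsubset> x \<and> x \<sqsubset> y}"
    then have x: "c \<sqsubset> x" "x \<sqsubset> y" by auto
    then obtain w where w: "near_left x (\<lambda>y. \<not> S w y)" "\<And>u. x \<sqsubset> u \<Longrightarrow> u \<sqsubseteq> y \<Longrightarrow> S w u"
      using cd(4)[OF x y(2)] unfolding P_def by blast
    have "near_right x (S w)" unfolding near_right_def using w(2) x(2) less_imp_le by blast
    then have "x \<in> bdry (S w)" using bdry_of_germs w(1) by blast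
    moreover have "S w y" using w(2) x(2) by simp
    ultimately show "x \<in> (\<Union>f \<in> S ` {w. S w y}. bdry f)" by blast
  qed
  moreover have "finite (bdry (S w))" for w
    by (intro finite_bdry dfn_vI dfn_evD[OF S] dfn_intros)
  then have "finite (\<Union>f \<in> S ` {w. S w y}. bdry f)" using K by blast
  ultimately show False using infinite_interval[OF y(1)] finite_subset by blast
qed

lemma finite_right_ends:
  assumes S: "dfn_ev S"
    and K: "\<And>y. finite (S ` {w. S w y})"
  shows "finite {x. \<exists>w. near_left x (S w) \<and> near_right x (\<lambda>y. \<not> S w y)}"
proof -
  have "omin.dfn_ev dfn S" using S unfolding omin.dfn_ev_def[OF dual] dfn_ev_def .
  from omin.finite_left_ends[OF dual this K] show ?thesis unfolding dual_near_right dual_near_left .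
qed

lemma near_right_near_right: "near_right z Q \<Longrightarrow> near_right z (\<lambda>u. near_right u Q)"
  unfolding near_right_def using less_trans by blast

lemma near_left_near_right: "near_left z Q \<Longrightarrow> near_left z (\<lambda>u. near_right u Q)"
  unfolding near_left_def near_right_def using less_trans by blast

text \<open>
  Any finitely many of the sets that contain an interval of the same gap of \<open>B\<close> have a point in common. So
  at most \<open>N0\<close> of the classes belong to one gap, and each infinite set contains an interval in some gap.
\<close>

lemma bounded_fat_classes_step:
  fixes N0 :: nat
  assumes S: "dfn_ev S" and \<kappa>: "\<And>w. S w = \<Phi> (\<kappa> w)"
    and K: "\<And>y. finite (\<kappa> ` {w. S w y}) \<and> card (\<kappa> ` {w. S w y}) \<le> N0"
    and B: "B = {x. \<exists>w. (near_right x (S w) \<and> near_left x (\<lambda>y. \<not> S w y)) \<or>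
      (near_left x (S w) \<and> near_right x (\<lambda>y. \<not> S w y))}" and finB: "finite B" and cB: "card B \<le> K1"
  shows "finite (\<kappa> ` {w. infinite {x. S w x}}) \<and> card (\<kappa> ` {w. infinite {x. S w x}}) \<le> Suc K1 * N0"
proof -
  have Sw: "dfn_v (S w)" for w by (intro dfn_vI dfn_evD[OF S] dfn_intros)
  \<comment> \<open>The classes that have points in the \<open>j\<close>-th gap.\<close>
  define T where "T j = \<kappa> ` {w. \<exists>x. x \<notin> B \<and> gap_index B x = j \<and> near_right x (S w)}" for j
  have germ: "near_right x' (S w)"
    if x: "x \<notin> B" "x' \<notin> B" "gap_index B x = gap_index B x'" "near_right x (S w)" for x x' w
  proof -
    define X where "X x \<longleftrightarrow> near_right x (S w)" for x
    have X: "dfn_v X" unfolding X_def by (intro dfn_vI dfn_intros dfn_vD[OF Sw])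
    obtain p q where pq: "p \<sqsubset> x" "x \<sqsubset> q" "p \<sqsubset> x'" "x' \<sqsubset> q" "\<And>z. p \<sqsubset> z \<Longrightarrow> z \<sqsubset> q \<Longrightarrow> z \<notin> B"
      by (rule same_gap[OF finB x(1-3)]) (rule that)
    have "z \<notin> bdry X" if z: "p \<sqsubset> z" "z \<sqsubset> q" for z
    proof -
      have nB: "\<not> (near_right z (S w) \<and> near_left z (\<lambda>y. \<not> S w y))"
        "\<not> (near_left z (S w) \<and> near_right z (\<lambda>y. \<not> S w y))" using pq(5)[OF z] unfolding B by blast+
      obtain b where b: "near_right z (\<lambda>y. S w y = b)" "near_left z (\<lambda>y. S w y = b)"
      proof (cases "near_right z (S w)")
        case True
        then have "near_left z (S w)" using nB(1) near_left_cases[OF Sw] by blast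
        then show ?thesis using True that[of True] by simp
      next
        case False
        then have "near_right z (\<lambda>y. \<not> S w y)" using near_right_cases[OF Sw] by blast
        moreover from this have "near_left z (\<lambda>y. \<not> S w y)" using nB(2) near_left_cases[OF Sw] by blast
        ultimately show ?thesis using that[of False] by simp
      qed
      have Xb: "X u = b" if "near_right u (\<lambda>y. S w y = b)" for u
      proof (cases b)
        case True then show ?thesis using that unfolding X_def by simp
      next
        case False
        have "\<not> near_right u (S w)"
        proof
          assume "near_right u (S w)"
          from near_right_ex[OF near_right_conj[OF this that]] False show False by blast
        qed
        then show ?thesis using False unfolding X_def by simp
      qed
      have "nbhd z (\<lambda>u. X u = X z)"
        unfolding nbhd_iff
        using near_right_mono[OF near_right_near_right[OF b(1)]] near_left_mono[OF near_left_near_right[OF b(2)]]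
          Xb Xb[OF b(1)] by simp
      then show ?thesis unfolding bdry_nbhd .
    qed
    then have "X x = X x'" using const_on_interval[OF X _ pq(1-4)] by blast
    then show ?thesis using x(4) unfolding X_def by simp
  qed
  have Tj: "finite (T j) \<and> card (T j) \<le> N0" for j
  proof (rule finite_if_finite_subsets_card_bdd)
    fix F assume F0: "F \<subseteq> T j" "finite F"
    then have F: "finite F \<and> F \<subseteq> T j" by blast
    show "card F \<le> N0"
    proof (cases "F = {}")
      case True then show ?thesis by simp
    next
      case False
      then obtain x0 where x0: "x0 \<notin> B" "gap_index B x0 = j" using F unfolding T_def by blast
      have "near_right x0 (\<Phi> f)" if "f \<in> F" for f
      proof -
        have "f \<in> T j" using F that by blast
        then obtain w x where "f = \<kappa> w" "x \<notin> B" "gap_index B x = j" "near_right x (S w)"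
          unfolding T_def by blast
        then show ?thesis using germ[OF _ x0(1)] x0(2) \<kappa> by simp
      qed
      moreover have "finite G \<Longrightarrow> (\<And>f. f \<in> G \<Longrightarrow> near_right x0 (\<Phi> f)) \<Longrightarrow> near_right x0 (\<lambda>y. \<forall>f\<in>G. \<Phi> f y)" for G
      proof (induction G rule: finite_induct)
        case empty then show ?case using gt_ex[of x0] unfolding near_right_def by blast
      next
        case (insert g G)
        then have "near_right x0 (\<lambda>y. \<Phi> g y \<and> (\<forall>f\<in>G. \<Phi> f y))" by (intro near_right_conj) auto
        then show ?case by simp
      qed
      ultimately have "near_right x0 (\<lambda>y. \<forall>f\<in>F. \<Phi> f y)" using F by blast
      from near_right_ex[OF this] obtain y where "\<forall>f\<in>F. \<Phi> f y" by blast
      then have "F \<subseteq> \<kappa> ` {w. S w y}" using F \<kappa> unfolding T_def by auto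
      then show ?thesis using K[of y] card_mono le_trans by blast
    qed
  qed
  have sub: "\<kappa> ` {w. infinite {x. S w x}} \<subseteq> (\<Union>j\<in>{..K1}. T j)"
  proof
    fix f assume "f \<in> \<kappa> ` {w. infinite {x. S w x}}"
    then obtain w where w: "f = \<kappa> w" "infinite {x. S w x}" by blast
    have "finite {t. t \<in> B}" using finB by simp
    from interval_in_infinite[OF Sw w(2) this] obtain a b where ab: "a \<sqsubset> b"
      "\<And>t. a \<sqsubset> t \<Longrightarrow> t \<sqsubset> b \<Longrightarrow> S w t \<and> t \<notin> B" by metis
    obtain x where x: "a \<sqsubset> x" "x \<sqsubset> b" using dense ab(1) by blast
    have "near_right x (S w)" unfolding near_right_def using x ab(2) less_trans by blast
    then have "f \<in> T (gap_index B x)" unfolding T_def using w(1) ab(2)[OF x] by blast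
    moreover have "gap_index B x \<le> K1" using gap_index_le[OF finB] cB le_trans by blast
    ultimately show "f \<in> (\<Union>j\<in>{..K1}. T j)" by blast
  qed
  have "card (\<Union>j\<in>{..K1}. T j) \<le> (\<Sum>j\<in>{..K1}. card (T j))" by (rule card_UN_le) simp
  also have "\<dots> \<le> (\<Sum>j\<in>{..K1}. N0)" by (rule sum_mono) (use Tj in blast)
  finally have "card (\<Union>j\<in>{..K1}. T j) \<le> Suc K1 * N0" by simp
  moreover have fU: "finite (\<Union>j\<in>{..K1}. T j)" using Tj by blast
  ultimately show ?thesis using sub finite_subset card_mono[OF fU sub] le_trans by blast
qed

text \<open>
  Induction on the coordinates. For the class of \<open>w\<close>, the set of all \<open>x\<close> such that its slice at \<open>v = x\<close>
  is fat in \<open>vs\<close> depends only on the class; by induction each \<open>x\<close> lies in boundedly many of these sets. The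
  end points of their intervals are finite in number by \<open>finite_left_ends\<close> and its mirror image, uniformly
  so by \<open>uniform_finiteness\<close>. Between two adjacent end points each set contains all points or none, up to
  finitely many.
\<close>

theorem bounded_fat_classes:
  assumes R: "dfn_eee R" and sym: "\<And>p w z. R p w z \<Longrightarrow> R p z w"
    and trans: "\<And>p w z y. R p w z \<Longrightarrow> R p z y \<Longrightarrow> R p w y"
  shows "\<exists>N. \<forall>p z. finite (R p ` {w. fat vs (R p w) z}) \<and> card (R p ` {w. fat vs (R p w) z}) \<le> N"
proof (induction vs)
  case Nil
  have eq: "R p w = R p z" if "R p w z" for p w z
    using sym trans that by (intro ext) blast
  have sub: "R p ` {w. R p w z} \<subseteq> {R p z}" for p z using eq by blast
  have "finite (R p ` {w. R p w z}) \<and> card (R p ` {w. R p w z}) \<le> 1" for p z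
    using card_mono[OF _ sub, of p z] finite_subset[OF sub, of p z] by simp
  then show ?case unfolding fat.simps by (intro exI[of _ 1] allI)
next
  case (Cons v vs)
  then obtain N0 where N0: "\<And>p z. finite (R p ` {w. fat vs (R p w) z}) \<and> card (R p ` {w. fat vs (R p w) z}) \<le> N0"
    by blast
  define S where "S p z w x \<longleftrightarrow> fat vs (R p w) (z(v := x))" for p z w x
  have S: "dfn (\<lambda>e. S (\<sigma> e) (\<rho> e) (\<omega> e) (\<tau> e))" if "env_map \<sigma>" "env_map \<rho>" "env_map \<omega>" "coord_map \<tau>" for \<sigma> \<rho> \<omega> \<tau>
    unfolding S_def by (intro dfn_fat3[OF R] env_map_upd that)
  have Spz: "dfn_ev (S p z)" for p z by (intro dfn_evI S dfn_intros)
  have \<kappa>: "S p z w = (\<lambda>x. fat vs (R p w) (z(v := x)))" for p z w unfolding S_def by (rule ext) simp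
  have KR: "finite (R p ` {w. S p z w y}) \<and> card (R p ` {w. S p z w y}) \<le> N0" for p z y
    using N0[of p "z(v := y)"] unfolding S_def .
  have KS: "finite (S p z ` {w. S p z w y})" for p z y
  proof -
    have "S p z ` {w. S p z w y} = (\<lambda>f x. fat vs f (z(v := x))) ` (R p ` {w. S p z w y})"
      unfolding image_image \<kappa> by simp
    then show ?thesis using KR[of p z y] by simp
  qed
  define B where "B p z x \<longleftrightarrow> (\<exists>w. (near_right x (S p z w) \<and> near_left x (\<lambda>y. \<not> S p z w y)) \<or>
      (near_left x (S p z w) \<and> near_right x (\<lambda>y. \<not> S p z w y)))" for p z x
  have finB: "finite {x. B p z x}" for p z
    using finite_left_ends[OF Spz KS, of p z] finite_right_ends[OF Spz KS, of p z]
    unfolding B_def ex_disj_distrib Collect_disj_eq by blast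
  have "dfn_ev (\<lambda>e. B (\<lambda>i. e (2 * i)) (\<lambda>i. e (Suc (2 * i))))"
    unfolding B_def by (intro dfn_evI dfn_intros S)
  from uniform_finiteness[OF this finB] obtain K1 where
    "\<And>e. card {x. B (\<lambda>i. e (2 * i)) (\<lambda>i. e (Suc (2 * i))) x} \<le> K1" by blast
  from this[of "ilv _ _"] have K1: "card {x. B p z x} \<le> K1" for p z by simp
  have "finite (R p ` {w. infinite {x. S p z w x}}) \<and> card (R p ` {w. infinite {x. S p z w x}}) \<le> Suc K1 * N0" for p z
    by (rule bounded_fat_classes_step[OF Spz \<kappa> KR _ finB K1]) (simp add: B_def)
  then show ?case unfolding fat.simps S_def by (intro exI[of _ "Suc K1 * N0"] allI)
qed

end

section \<open>Definable cuts of weak orders on tuples from a definable set\<close>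

text \<open>
  There is a strictly increasing chain of \<open>j\<close> elements satisfying \<open>F\<close> below \<open>z\<close>. Numbering the
  fat classes in this way keeps the \<open>j\<close>-th one definable uniformly in the parameters.
\<close>

primrec count_below :: "('b \<Rightarrow> 'b \<Rightarrow> bool) \<Rightarrow> ('b \<Rightarrow> bool) \<Rightarrow> nat \<Rightarrow> 'b \<Rightarrow> bool" where
  "count_below r F 0 z \<longleftrightarrow> True"
| "count_below r F (Suc j) z \<longleftrightarrow> (\<exists>w. F w \<and> r w z \<and> count_below r F j w)"

definition supported2 :: "nat set \<Rightarrow> ((nat \<Rightarrow> 'a) \<Rightarrow> (nat \<Rightarrow> 'a) \<Rightarrow> bool) \<Rightarrow> bool" where
  "supported2 I R \<longleftrightarrow> (\<forall>x x' y y'. (\<forall>i\<in>I. x i = x' i) \<and> (\<forall>i\<in>I. y i = y' i) \<longrightarrow> R x y = R x' y')"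

lemma supported2D: "supported2 I R \<Longrightarrow> (\<And>i. i \<in> I \<Longrightarrow> x i = x' i) \<Longrightarrow> (\<And>i. i \<in> I \<Longrightarrow> y i = y' i) \<Longrightarrow> R x y = R x' y'"
  unfolding supported2_def by blast

definition weak_order_on :: "('b \<Rightarrow> bool) \<Rightarrow> ('b \<Rightarrow> 'b \<Rightarrow> bool) \<Rightarrow> bool" where
  "weak_order_on Z R \<longleftrightarrow> (\<forall>x y. Z x \<and> Z y \<longrightarrow> R x y \<or> R y x) \<and>
    (\<forall>x y z. Z x \<and> Z y \<and> Z z \<and> R x y \<and> R y z \<longrightarrow> R x z)"

locale omin_set = omin +
  fixes A :: "'a set"
  assumes dfn_A: "dfn_v (\<lambda>a. a \<in> A)" and infinite_A: "infinite A"
begin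

definition small :: "'b set \<Rightarrow> bool" where
  "small S \<longleftrightarrow> |S| \<le>o |A|"

lemma small_subset: "small T \<Longrightarrow> S \<subseteq> T \<Longrightarrow> small S"
  unfolding small_def using card_of_mono1 ordLeq_transitive by blast

lemma small_image: "small S \<Longrightarrow> small (f ` S)"
  unfolding small_def using card_of_image ordLeq_transitive by blast

lemma small_finite: "finite S \<Longrightarrow> small S"
  unfolding small_def
  by (rule ordLess_imp_ordLeq, rule finite_ordLess_infinite)
    (simp_all add: card_of_Well_order card_of_well_order_on Field_card_of infinite_A)

lemma small_A: "small A"
  unfolding small_def using card_of_mono1[of A A] by simp

lemma small_UN: "small I \<Longrightarrow> (\<And>i. i \<in> I \<Longrightarrow> small (F i)) \<Longrightarrow> small (\<Union>i\<in>I. F i)"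
  unfolding small_def using card_of_UNION_ordLeq_infinite[OF infinite_A] by blast

lemma small_Times: "small S \<Longrightarrow> small T \<Longrightarrow> small (S \<times> T)"
proof -
  assume "small S" "small T"
  then have "small (\<Union>s\<in>S. Pair s ` T)" by (intro small_UN small_image)
  moreover have "S \<times> T = (\<Union>s\<in>S. Pair s ` T)" by auto
  ultimately show ?thesis by simp
qed

lemma small_Un: "small S \<Longrightarrow> small T \<Longrightarrow> small (S \<union> T)"
proof -
  assume "small S" "small T"
  then have ST: "small (if b then S else T)" for b by simp
  have "small (\<Union>b\<in>UNIV. if b then S else T)"
    by (rule small_UN[OF small_finite ST]) simp
  moreover have "S \<union> T \<subseteq> (\<Union>b\<in>UNIV. if b then S else T)" by (auto split: if_splits)
  ultimately show ?thesis by (rule small_subset)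
qed

lemma small_factor:
  assumes "small (h ` S)" and "\<And>x y. x \<in> S \<Longrightarrow> y \<in> S \<Longrightarrow> h x = h y \<Longrightarrow> f x = f y"
  shows "small (f ` S)"
proof -
  have "f ` S \<subseteq> (\<lambda>k. f (inv_into S h k)) ` (h ` S)"
  proof
    fix z assume "z \<in> f ` S"
    then obtain x where x: "x \<in> S" "z = f x" by blast
    then have "f (inv_into S h (h x)) = f x"
      by (intro assms(2)) (auto intro: inv_into_into f_inv_into_f)
    then show "z \<in> (\<lambda>k. f (inv_into S h k)) ` (h ` S)"
      using x by (intro image_eqI[of _ _ "h x"]) auto
  qed
  then show ?thesis using assms(1) small_image small_subset by blast
qed

text \<open>
  Families counted by \<open>|A|\<close> may be combined finitely often, since \<open>A\<close> is infinite.
\<close>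

lemma small_determined:
  assumes "finite K" and "\<And>k. k \<in> K \<Longrightarrow> small (f k ` Q)"
    and "\<And>q q'. q \<in> Q \<Longrightarrow> q' \<in> Q \<Longrightarrow> (\<And>k. k \<in> K \<Longrightarrow> f k q = f k q') \<Longrightarrow> g q = g q'"
  shows "small (g ` Q)"
proof -
  have "small ((\<lambda>q k. if k \<in> K then f k q else undefined) ` Q)"
    using assms(1,2)
  proof (induction K rule: finite_induct)
    case empty
    have "((\<lambda>q k. if k \<in> {} then f k q else undefined) ` Q) \<subseteq> {\<lambda>_. undefined}" by auto
    then show ?case using small_finite finite_subset by blast
  next
    case (insert k0 K)
    let ?h = "\<lambda>K q k. if k \<in> K then f k q else undefined"
    have "?h (insert k0 K) q = (\<lambda>(y, h). h(k0 := y)) (f k0 q, ?h K q)" for q using insert.hyps by auto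
    then have "?h (insert k0 K) ` Q \<subseteq> (\<lambda>(y, h). h(k0 := y)) ` (f k0 ` Q \<times> ?h K ` Q)" by blast
    moreover have "small (f k0 ` Q \<times> ?h K ` Q)" using insert by (intro small_Times) auto
    ultimately show ?case using small_image small_subset by blast
  qed
  then show ?thesis
  proof (rule small_factor)
    fix q q' assume q: "q \<in> Q" "q' \<in> Q"
      "(\<lambda>k. if k \<in> K then f k q else undefined) = (\<lambda>k. if k \<in> K then f k q' else undefined)"
    have "f k q = f k q'" if "k \<in> K" for k using fun_cong[OF q(3), of k] that by simp
    then show "g q = g q'" using assms(3) q(1,2) by blast
  qed
qed

lemma small_envs:
  "finite I \<Longrightarrow> small {z. restr I z = z \<and> (\<forall>i\<in>I. z i \<in> A)}"
proof (induction I rule: finite_induct)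
  case empty
  have "{z. restr {} z = z \<and> (\<forall>i\<in>{}. z i \<in> A)} \<subseteq> {\<lambda>_. undefined}" by (auto simp: restr_def)
  then show ?case using small_finite finite_subset by blast
next
  case (insert v I)
  let ?S = "\<lambda>I. {z. restr I z = z \<and> (\<forall>i\<in>I. z i \<in> A)}"
  have "?S (insert v I) \<subseteq> (\<lambda>(a, z). z(v := a)) ` (A \<times> ?S I)"
  proof
    fix z assume z: "z \<in> ?S (insert v I)"
    have "z i = ((restr I z)(v := z v)) i" for i
    proof -
      have "restr (insert v I) z i = z i" using z by simp
      then show ?thesis by (auto simp: restr_def split: if_splits)
    qed
    then have "z = (restr I z)(v := z v)" by (rule ext)
    moreover have "(z v, restr I z) \<in> A \<times> ?S I" using z by (auto simp: restr_def)
    ultimately show "z \<in> (\<lambda>(a, z). z(v := a)) ` (A \<times> ?S I)" by (auto intro!: image_eqI[of _ _ "(z v, restr I z)"])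
  qed
  then show ?case using small_Times[OF small_A insert.IH] small_image small_subset by blast
qed

definition near_top :: "('a \<Rightarrow> bool) \<Rightarrow> bool" where
  "near_top Q \<longleftrightarrow> (\<exists>b. \<forall>x. lt b x \<longrightarrow> Q x)"

definition near_bot :: "('a \<Rightarrow> bool) \<Rightarrow> bool" where
  "near_bot Q \<longleftrightarrow> (\<exists>b. \<forall>x. lt x b \<longrightarrow> Q x)"

end

context omin begin

lemma eventually_const_top:
  assumes X: "dfn_v X" shows "\<exists>b. (\<forall>x. b \<sqsubset> x \<longrightarrow> X x) \<or> (\<forall>x. b \<sqsubset> x \<longrightarrow> \<not> X x)"
proof -
  obtain b where b: "\<forall>u\<in>bdry X. u \<sqsubset> b" using finite_strict_upper[OF finite_bdry[OF X]] by blast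
  have "X x = X y" if "b \<sqsubset> x" "b \<sqsubset> y" for x y
  proof -
    obtain c where "\<forall>u\<in>{x, y}. u \<sqsubset> c" using finite_strict_upper[of "{x, y}"] by blast
    then show ?thesis using const_on_interval[OF X, of b c x y] b that less_asym by blast
  qed
  then show ?thesis by blast
qed

lemma eventually_const_bot:
  assumes X: "dfn_v X" shows "\<exists>b. (\<forall>x. x \<sqsubset> b \<longrightarrow> X x) \<or> (\<forall>x. x \<sqsubset> b \<longrightarrow> \<not> X x)"
  using omin.eventually_const_top[OF dual] X unfolding omin.dfn_v_def[OF dual] dfn_v_def by blast

end

context omin_set begin

text \<open>
  Ultrafilters on the algebra of definable sets of elements; those in \<open>germs\<close> are the one-sided
  neighbourhoods of points and of the two ends.
\<close>

definition germ :: "(('a \<Rightarrow> bool) \<Rightarrow> bool) \<Rightarrow> bool" where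
  "germ E \<longleftrightarrow> (\<forall>P Q. E P \<and> E Q \<longrightarrow> E (\<lambda>x. P x \<and> Q x)) \<and> (\<forall>P Q. E P \<and> (\<forall>x. P x \<longrightarrow> Q x) \<longrightarrow> E Q) \<and>
    (\<forall>P. E P \<longrightarrow> (\<exists>x. P x)) \<and> (\<forall>X. dfn_v X \<longrightarrow> E X \<or> E (\<lambda>x. \<not> X x))"

definition germs :: "(('a \<Rightarrow> bool) \<Rightarrow> bool) set" where
  "germs = range near_right \<union> range near_left \<union> {near_top, near_bot}"

lemma germ_germs: "E \<in> germs \<Longrightarrow> germ E"
proof -
  have "germ (near_right t)" for t
    unfolding germ_def
  proof (intro conjI allI impI)
    fix P Q :: "'a \<Rightarrow> bool"
    show "near_right t (\<lambda>x. P x \<and> Q x)" if "near_right t P \<and> near_right t Q"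
      using that near_right_conj by blast
    show "near_right t Q" if "near_right t P \<and> (\<forall>x. P x \<longrightarrow> Q x)"
      using that by (auto intro: near_right_mono)
    show "\<exists>x. P x" if "near_right t P" using near_right_ex[OF that] by blast
    show "near_right t P \<or> near_right t (\<lambda>x. \<not> P x)" if "dfn_v P" by (rule near_right_cases[OF that])
  qed
  moreover have "germ (near_left t)" for t
    unfolding germ_def
  proof (intro conjI allI impI)
    fix P Q :: "'a \<Rightarrow> bool"
    show "near_left t (\<lambda>x. P x \<and> Q x)" if "near_left t P \<and> near_left t Q"
      using that near_left_conj by blast
    show "near_left t Q" if "near_left t P \<and> (\<forall>x. P x \<longrightarrow> Q x)"
      using that by (auto intro: near_left_mono)
    show "\<exists>x. P x" if "near_left t P" using near_left_ex[OF that] by blast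
    show "near_left t P \<or> near_left t (\<lambda>x. \<not> P x)" if "dfn_v P" by (rule near_left_cases[OF that])
  qed
  moreover have "germ near_top"
    unfolding germ_def
  proof (intro conjI allI impI)
    fix P Q :: "'a \<Rightarrow> bool"
    assume "near_top P \<and> near_top Q"
    then obtain b c where "\<forall>x. lt b x \<longrightarrow> P x" "\<forall>x. lt c x \<longrightarrow> Q x" unfolding near_top_def by blast
    moreover obtain d where "\<forall>u\<in>{b, c}. lt u d" using finite_strict_upper[of "{b, c}"] by blast
    ultimately show "near_top (\<lambda>x. P x \<and> Q x)" unfolding near_top_def using less_trans by blast
  next
    fix P assume "near_top P" then show "\<exists>x. P x" unfolding near_top_def using gt_ex by blast
  next
    fix X assume "dfn_v X" then show "near_top X \<or> near_top (\<lambda>x. \<not> X x)"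
      unfolding near_top_def using eventually_const_top by blast
  qed (auto simp: near_top_def)
  moreover have "germ near_bot"
    unfolding germ_def
  proof (intro conjI allI impI)
    fix P Q :: "'a \<Rightarrow> bool"
    assume "near_bot P \<and> near_bot Q"
    then obtain b c where "\<forall>x. lt x b \<longrightarrow> P x" "\<forall>x. lt x c \<longrightarrow> Q x" unfolding near_bot_def by blast
    moreover obtain d where "\<forall>u\<in>{b, c}. lt d u" using omin.finite_strict_upper[OF dual, of "{b, c}"] by blast
    ultimately show "near_bot (\<lambda>x. P x \<and> Q x)" unfolding near_bot_def using less_trans by blast
  next
    fix P assume "near_bot P" then show "\<exists>x. P x" unfolding near_bot_def using lt_ex by blast
  next
    fix X assume "dfn_v X" then show "near_bot X \<or> near_bot (\<lambda>x. \<not> X x)"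
      unfolding near_bot_def using eventually_const_bot by blast
  qed (auto simp: near_bot_def)
  ultimately show "E \<in> germs \<Longrightarrow> germ E" unfolding germs_def by blast
qed

lemma germ_conj: "germ E \<Longrightarrow> E P \<Longrightarrow> E Q \<Longrightarrow> E (\<lambda>x. P x \<and> Q x)"
  and germ_mono: "germ E \<Longrightarrow> E P \<Longrightarrow> (\<And>x. P x \<Longrightarrow> Q x) \<Longrightarrow> E Q"
  and germ_ex: "germ E \<Longrightarrow> E P \<Longrightarrow> \<exists>x. P x"
  and germ_cases: "germ E \<Longrightarrow> dfn_v X \<Longrightarrow> E X \<or> E (\<lambda>x. \<not> X x)"
  unfolding germ_def by blast+

lemma germ_finite_cases:
  assumes E: "germ E" and "E P" "\<And>j. j \<le> (N::nat) \<Longrightarrow> dfn_v (X j)" "\<And>x. P x \<Longrightarrow> \<exists>j\<le>N. X j x"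
  shows "\<exists>j\<le>N. E (X j)"
proof (rule ccontr)
  assume no: "\<not> (\<exists>j\<le>N. E (X j))"
  have "n \<le> N \<Longrightarrow> E (\<lambda>x. P x \<and> (\<forall>j\<le>n. \<not> X j x))" for n
  proof (induction n)
    case 0
    have "E (\<lambda>x. \<not> X 0 x)" using germ_cases[OF E assms(3)] no by blast
    from germ_conj[OF E assms(2) this] show ?case by simp
  next
    case (Suc n)
    have "E (\<lambda>x. \<not> X (Suc n) x)" using germ_cases[OF E assms(3)] no Suc.prems by blast
    moreover have "E (\<lambda>x. P x \<and> (\<forall>j\<le>n. \<not> X j x))" using Suc by simp
    ultimately have "E (\<lambda>x. \<not> X (Suc n) x \<and> P x \<and> (\<forall>j\<le>n. \<not> X j x))" using germ_conj[OF E] by blast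
    then show ?case by (rule germ_mono[OF E]) (auto simp: le_Suc_eq)
  qed
  from germ_ex[OF E this[OF Nat.le_refl]] show False using assms(4) by blast
qed

text \<open>
  Such a germ is attached to a point of \<open>A\<close>, to one of the finitely many boundary points of \<open>A\<close>, or to an
  end of the line.
\<close>

lemma small_germs_in_A: "small {E \<in> germs. E (\<lambda>a. a \<in> A)}"
proof -
  let ?B = "A \<union> bdry (\<lambda>a. a \<in> A)"
  have "small ?B" using small_Un[OF small_A small_finite[OF finite_bdry[OF dfn_A]]] .
  then have "small (near_right ` ?B \<union> near_left ` ?B \<union> {near_top, near_bot})"
    by (intro small_Un[OF small_Un] small_image[of ?B]) (simp_all add: small_finite)
  moreover have "{E \<in> germs. E (\<lambda>a. a \<in> A)} \<subseteq> near_right ` ?B \<union> near_left ` ?B \<union> {near_top, near_bot}"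
  proof
    fix E assume E: "E \<in> {E \<in> germs. E (\<lambda>a. a \<in> A)}"
    have "t \<in> ?B" if "near_right t (\<lambda>a. a \<in> A) \<or> near_left t (\<lambda>a. a \<in> A)" for t
    proof (rule ccontr)
      assume "t \<notin> ?B"
      then have t: "t \<notin> A" "t \<notin> bdry (\<lambda>a. a \<in> A)" by blast+
      from t(2) have "nbhd t (\<lambda>y. (y \<in> A) = (t \<in> A))" unfolding bdry_nbhd .
      then have "nbhd t (\<lambda>x. x \<notin> A)" by (rule nbhd_mono) (use t(1) in blast)
      then have "near_right t (\<lambda>x. x \<notin> A)" "near_left t (\<lambda>x. x \<notin> A)" unfolding nbhd_iff by blast+
      then show False using that near_right_ex[OF near_right_conj] near_left_ex[OF near_left_conj] by blast
    qed
    then show "E \<in> near_right ` ?B \<union> near_left ` ?B \<union> {near_top, near_bot}"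
      using E unfolding germs_def by blast
  qed
  ultimately show ?thesis by (rule small_subset)
qed

text \<open>
  The sets \<open>C u\<close> form a downward directed family of nonempty definable sets without a common point. The
  supremum of the \<open>t\<close> below which some \<open>C u\<close> is empty exists by definable completeness, and the sets
  accumulate at it, on one side.
\<close>

lemma chain_germ:
  assumes C: "\<And>u. u \<in> S \<Longrightarrow> dfn_v (C u)" and G: "dfn_v (\<lambda>t. \<exists>u\<in>S. \<forall>x. lt x t \<longrightarrow> \<not> C u x)"
    and dir: "\<And>u u'. u \<in> S \<Longrightarrow> u' \<in> S \<Longrightarrow> \<exists>w\<in>S. (\<forall>x. C w x \<longrightarrow> C u x) \<and> (\<forall>x. C w x \<longrightarrow> C u' x)"
    and ne: "\<And>u. u \<in> S \<Longrightarrow> \<exists>x. C u x" and nopt: "\<And>t. \<exists>u\<in>S. \<not> C u t"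
  shows "\<exists>E\<in>germs. \<forall>u\<in>S. E (C u)"
proof -
  define Lo where "Lo t \<longleftrightarrow> (\<exists>u\<in>S. \<forall>x. lt x t \<longrightarrow> \<not> C u x)" for t
  have Lo: "dfn_v Lo" unfolding Lo_def by (rule G)
  have down: "\<forall>x y. lt x y \<and> Lo y \<longrightarrow> Lo x" unfolding Lo_def using less_trans by blast
  have decide: "E (C u)" if E: "E \<in> germs" and u: "u \<in> S" and n: "\<not> E (\<lambda>x. \<not> C u x)" for E u
    using germ_cases[OF germ_germs[OF E] C[OF u]] n by blast
  consider "\<forall>t. Lo t" | "\<forall>t. \<not> Lo t" | "(\<exists>t. Lo t) \<and> (\<exists>t. \<not> Lo t)" by blast
  then show ?thesis
  proof cases
    case 1
    have "near_top (C u)" if u: "u \<in> S" for u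
    proof (rule decide[OF _ u])
      show "\<not> near_top (\<lambda>x. \<not> C u x)"
      proof
        assume "near_top (\<lambda>x. \<not> C u x)"
        then obtain b where b: "\<And>x. lt b x \<Longrightarrow> \<not> C u x" unfolding near_top_def by blast
        obtain c where c: "lt b c" using gt_ex by blast
        obtain u' where u': "u' \<in> S" "\<And>x. lt x c \<Longrightarrow> \<not> C u' x" using 1 unfolding Lo_def by blast
        obtain w where w: "w \<in> S" "\<And>x. C w x \<Longrightarrow> C u x" "\<And>x. C w x \<Longrightarrow> C u' x" using dir[OF u u'(1)] by blast
        obtain x where x: "C w x" using ne[OF w(1)] by blast
        then have "\<not> lt x c" using u'(2) w(3) by blast
        then have "lt b x" using c less_le_trans not_less by blast
        then show False using b w(2) x by blast
      qed
    qed (simp add: germs_def)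
    then show ?thesis unfolding germs_def by blast
  next
    case 2
    have "near_bot (C u)" if u: "u \<in> S" for u
    proof (rule decide[OF _ u])
      show "\<not> near_bot (\<lambda>x. \<not> C u x)" using 2 u unfolding Lo_def near_bot_def by blast
    qed (simp add: germs_def)
    then show ?thesis unfolding germs_def by blast
  next
    case 3
    then obtain l h where "Lo l" "\<not> Lo h" by blast
    from complete_down[OF Lo down this] obtain t where
      t: "\<And>x. lt x t \<Longrightarrow> Lo x" "\<And>x. lt t x \<Longrightarrow> \<not> Lo x" by blast
    show ?thesis
    proof (cases "Lo t")
      case False
      have "near_left t (C u)" if u: "u \<in> S" for u
      proof (rule decide[OF _ u])
        show "\<not> near_left t (\<lambda>x. \<not> C u x)"
        proof
          assume "near_left t (\<lambda>x. \<not> C u x)"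
          then obtain b where b: "lt b t" "\<And>x. lt x t \<Longrightarrow> lt b x \<Longrightarrow> \<not> C u x" unfolding near_left_def by blast
          obtain c where c: "lt b c" "lt c t" using dense b(1) by blast
          obtain u' where u': "u' \<in> S" "\<And>x. lt x c \<Longrightarrow> \<not> C u' x" using t(1)[OF c(2)] unfolding Lo_def by blast
          obtain w where w: "w \<in> S" "\<And>x. C w x \<Longrightarrow> C u x" "\<And>x. C w x \<Longrightarrow> C u' x" using dir[OF u u'(1)] by blast
          obtain x where x: "lt x t" "C w x" using False w(1) unfolding Lo_def by blast
          then have "\<not> lt x c" using u'(2) w(3) by blast
          then have "lt b x" using c(1) less_le_trans not_less by blast
          then show False using b(2) x w(2) by blast
        qed
      qed (simp add: germs_def)
      then show ?thesis unfolding germs_def by blast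
    next
      case True
      then obtain u0 where u0: "u0 \<in> S" "\<And>x. lt x t \<Longrightarrow> \<not> C u0 x" unfolding Lo_def by blast
      obtain u1 where u1: "u1 \<in> S" "\<not> C u1 t" using nopt by blast
      obtain u2 where u2: "u2 \<in> S" "\<And>x. C u2 x \<Longrightarrow> C u0 x" "\<And>x. C u2 x \<Longrightarrow> C u1 x" using dir[OF u0(1) u1(1)] by blast
      have "near_right t (C u)" if u: "u \<in> S" for u
      proof (rule decide[OF _ u])
        show "\<not> near_right t (\<lambda>x. \<not> C u x)"
        proof
          assume "near_right t (\<lambda>x. \<not> C u x)"
          then obtain b where b: "lt t b" "\<And>x. lt t x \<Longrightarrow> lt x b \<Longrightarrow> \<not> C u x" unfolding near_right_def by blast
          obtain w where w: "w \<in> S" "\<And>x. C w x \<Longrightarrow> C u x" "\<And>x. C w x \<Longrightarrow> C u2 x" using dir[OF u u2(1)] by blast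
          obtain x where x: "lt x b" "C w x" using t(2)[OF b(1)] w(1) unfolding Lo_def by blast
          have "\<not> lt x t" "x \<noteq> t" using u0(2) u1(2) u2(2,3) w(3) x(2) by blast+
          then have "lt t x" using less_linear by blast
          then show False using b(2) x w(2) by blast
        qed
      qed (simp add: germs_def)
      then show ?thesis unfolding germs_def by blast
    qed
  qed
qed

definition cuts :: "((nat \<Rightarrow> 'a) \<Rightarrow> (nat \<Rightarrow> 'a) \<Rightarrow> bool) \<Rightarrow> ((nat \<Rightarrow> 'a) \<Rightarrow> bool) \<Rightarrow> nat set \<Rightarrow> ((nat \<Rightarrow> 'a) \<Rightarrow> bool) set" where
  "cuts R Z I = {U. dfn U \<and> supported I U \<and> (\<forall>z. U z \<longrightarrow> Z z) \<and> (\<forall>z z'. U z' \<and> Z z \<and> R z z' \<longrightarrow> U z)}"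

definition order_data :: "((nat \<Rightarrow> 'a) \<Rightarrow> (nat \<Rightarrow> 'a) \<Rightarrow> bool) \<Rightarrow> ((nat \<Rightarrow> 'a) \<Rightarrow> bool) \<Rightarrow> nat set \<Rightarrow> bool" where
  "order_data R Z I \<longleftrightarrow> dfn_ee R \<and> supported2 I R \<and> dfn Z \<and> supported I Z \<and> (\<forall>z. Z z \<longrightarrow> (\<forall>i\<in>I. z i \<in> A)) \<and> weak_order_on Z R"

definition few_cuts :: "nat set \<Rightarrow> bool" where
  "few_cuts I \<longleftrightarrow> (\<forall>R Z. order_data R Z I \<longrightarrow> small (cuts R Z I))"

text \<open>
  A subset of \<open>Z\<close> on which coordinate \<open>v\<close> is a function of the others is ordered as a set in one
  coordinate less, and a cut of \<open>Z\<close> induces a cut there.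
\<close>

lemma small_cuts_on_graph:
  assumes few: "few_cuts (I - {v})" and v: "v \<in> I" and od: "order_data R Z I"
    and G: "dfn_ev G" "supported (I - {v}) G" "\<And>z y y'. G z y \<Longrightarrow> G z y' \<Longrightarrow> y = y'"
  shows "small ((\<lambda>U z. U z \<and> G z (z v)) ` cuts R Z I)"
proof -
  have R: "dfn_ee R" and Rs: "supported2 I R" and Z: "dfn Z" and Zs: "supported I Z"
    and ZA: "\<And>z i. Z z \<Longrightarrow> i \<in> I \<Longrightarrow> z i \<in> A" and wo: "weak_order_on Z R"
    using od unfolding order_data_def by blast+
  define Z' where "Z' z \<longleftrightarrow> (\<exists>y. G z y \<and> Z (z(v := y)))" for z
  define R' where "R' z z' \<longleftrightarrow> (\<exists>y y'. G z y \<and> G z' y' \<and> R (z(v := y)) (z'(v := y')))" for z z'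
  have Gs: "G z = G z'" if "\<And>i. i \<in> I - {v} \<Longrightarrow> z i = z' i" for z z'
    using supportedD[OF G(2) that] by simp
  have sub_supp: "supported (I - {v}) (\<lambda>z. \<exists>y. G z y \<and> P (z(v := y)))" if P: "supported I P" for P
    unfolding supported_def
  proof (intro allI impI)
    fix z z' :: "nat \<Rightarrow> 'a" assume a: "\<forall>i\<in>I - {v}. z i = z' i"
    have "P (z(v := y)) = P (z'(v := y))" for y by (rule supportedD[OF P]) (use a in auto)
    then show "(\<exists>y. G z y \<and> P (z(v := y))) = (\<exists>y. G z' y \<and> P (z'(v := y)))" using Gs[of z z'] a by auto
  qed
  have Rsub: "R (z(v := y)) (w(v := y')) = R (z'(v := y)) (w'(v := y'))"
    if "\<And>i. i \<in> I - {v} \<Longrightarrow> z i = z' i" "\<And>i. i \<in> I - {v} \<Longrightarrow> w i = w' i" for z z' w w' y y'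
    by (rule supported2D[OF Rs]) (use that in auto)
  have "order_data R' Z' (I - {v})"
    unfolding order_data_def
  proof (intro conjI)
    show "dfn_ee R'" unfolding R'_def by (intro dfn_eeI dfn_intros dfn_evD[OF G(1)] dfn_eeD[OF R])
    show "supported2 (I - {v}) R'"
      unfolding supported2_def
    proof (intro allI impI)
      fix x x' y y' :: "nat \<Rightarrow> 'a" assume a: "(\<forall>i\<in>I - {v}. x i = x' i) \<and> (\<forall>i\<in>I - {v}. y i = y' i)"
      then have "G x = G x'" "G y = G y'" "\<And>s t. R (x(v := s)) (y(v := t)) = R (x'(v := s)) (y'(v := t))"
        using Gs Rsub by blast+
      then show "R' x y = R' x' y'" unfolding R'_def by simp
    qed
    show "dfn Z'" unfolding Z'_def by (intro dfn_intros dfn_evD[OF G(1)] dfn_subst[OF Z])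
    show "supported (I - {v}) Z'" unfolding Z'_def by (rule sub_supp[OF Zs])
    show "\<forall>z. Z' z \<longrightarrow> (\<forall>i\<in>I - {v}. z i \<in> A)"
    proof (intro allI impI ballI)
      fix z i assume z: "Z' z" and i: "i \<in> I - {v}"
      obtain y where "Z (z(v := y))" using z unfolding Z'_def by blast
      from ZA[OF this, of i] show "z i \<in> A" using i by auto
    qed
    show "weak_order_on Z' R'"
      unfolding weak_order_on_def
    proof (intro conjI allI impI)
      fix x y assume "Z' x \<and> Z' y"
      then show "R' x y \<or> R' y x" using wo unfolding weak_order_on_def Z'_def R'_def by blast
    next
      fix x y z assume "Z' x \<and> Z' y \<and> Z' z \<and> R' x y \<and> R' y z"
      then obtain a b c a' b' b'' c' where *: "G x a" "Z (x(v := a))" "G y b" "Z (y(v := b))" "G z c" "Z (z(v := c))"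
        "G x a'" "G y b'" "R (x(v := a')) (y(v := b'))" "G y b''" "G z c'" "R (y(v := b'')) (z(v := c'))"
        unfolding Z'_def R'_def by blast
      have "a' = a" "b' = b" "b'' = b" "c' = c" using G(3) * by blast+
      then have "R (x(v := a)) (z(v := c))" using * wo unfolding weak_order_on_def by blast
      then show "R' x z" using * unfolding R'_def by blast
    qed
  qed
  then have small': "small (cuts R' Z' (I - {v}))" using few unfolding few_cuts_def by blast
  have "(\<lambda>U z. U z \<and> G z (z v)) ` cuts R Z I \<subseteq> (\<lambda>U z. U z \<and> G z (z v)) ` cuts R' Z' (I - {v})"
  proof
    fix P assume "P \<in> (\<lambda>U z. U z \<and> G z (z v)) ` cuts R Z I"
    then obtain U where U: "U \<in> cuts R Z I" "P = (\<lambda>z. U z \<and> G z (z v))" by blast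
    define U' where "U' z \<longleftrightarrow> (\<exists>y. G z y \<and> U (z(v := y)))" for z
    have Ud: "dfn U" "supported I U" "\<And>z. U z \<Longrightarrow> Z z" "\<And>z z'. U z' \<Longrightarrow> Z z \<Longrightarrow> R z z' \<Longrightarrow> U z"
      using U(1) unfolding cuts_def by blast+
    have "U' \<in> cuts R' Z' (I - {v})"
      unfolding cuts_def
    proof (intro CollectI conjI allI impI)
      show "dfn U'" unfolding U'_def by (intro dfn_intros dfn_evD[OF G(1)] dfn_subst[OF Ud(1)])
      show "supported (I - {v}) U'" unfolding U'_def by (rule sub_supp[OF Ud(2)])
      show "Z' z" if "U' z" for z using that Ud(3) unfolding U'_def Z'_def by blast
      fix z z' assume "U' z' \<and> Z' z \<and> R' z z'"
      then obtain a b a' b' where *: "G z' b" "U (z'(v := b))" "G z a" "Z (z(v := a))" "G z a'" "G z' b'"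
        "R (z(v := a')) (z'(v := b'))" unfolding U'_def Z'_def R'_def by blast
      have "a' = a" "b' = b" using G(3) * by blast+
      then have "U (z(v := a))" using Ud(4) * by blast
      then show "U' z" using * unfolding U'_def by blast
    qed
    moreover have "P = (\<lambda>z. U' z \<and> G z (z v))"
    proof
      fix z
      have "U' z \<longleftrightarrow> U z" if "G z (z v)"
      proof -
        have "U' z \<longleftrightarrow> U (z(v := z v))" unfolding U'_def using that G(3) by blast
        then show ?thesis by simp
      qed
      then show "P z = (U' z \<and> G z (z v))" using U(2) by blast
    qed
    ultimately show "P \<in> (\<lambda>U z. U z \<and> G z (z v)) ` cuts R' Z' (I - {v})" by blast
  qed
  then show ?thesis using small_image[OF small'] small_subset by blast
qed

lemma gap_index_inj:
  assumes "finite B" "x \<in> B" "y \<in> B" "gap_index B x = gap_index B y" shows "x = y"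
proof -
  have less: "gap_index B u < gap_index B w" if "u \<in> B" "lt u w" for u w
  proof -
    have "{b \<in> B. lt b u} \<subset> {b \<in> B. lt b w}" using that less_trans by blast
    then show ?thesis unfolding gap_index_def using assms(1) by (intro psubset_card_mono) auto
  qed
  show ?thesis using less[of x y] less[of y x] assms less_linear[of x y] by auto
qed

text \<open>
  By uniform finiteness a thin set is a finite union of graphs in direction \<open>v\<close> and of a set which is
  thin already in the coordinates \<open>vs\<close>.
\<close>

lemma small_cuts_on_thin:
  assumes few: "\<And>v. v \<in> I \<Longrightarrow> few_cuts (I - {v})" and od: "order_data R Z I"
  shows "set vs \<subseteq> I \<Longrightarrow> distinct vs \<Longrightarrow> dfn X \<Longrightarrow> supported I X \<Longrightarrow> (\<And>z. \<not> fat vs X z) \<Longrightarrow>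
    small ((\<lambda>U z. U z \<and> X z) ` cuts R Z I)"
proof (induction vs arbitrary: X)
  case Nil
  then have "(\<lambda>U z. U z \<and> X z) ` cuts R Z I \<subseteq> {\<lambda>_. False}" by auto
  then show ?case using small_finite finite_subset by blast
next
  case (Cons v vs)
  have v: "v \<in> I" "v \<notin> set vs" "set vs \<subseteq> I" "distinct vs" using Cons.prems by auto
  note X = Cons.prems(3) and Xs = Cons.prems(4)
  define Q where "Q z x \<longleftrightarrow> fat vs X (z(v := x))" for z x
  have Q: "dfn_ev Q" unfolding Q_def by (intro dfn_evI dfn_fat1[OF X] dfn_intros)
  have finQ: "finite {x. Q z x}" for z using Cons.prems(5)[of z] unfolding Q_def by simp
  have Qs: "supported (I - {v}) Q"
    unfolding supported_def
  proof (intro allI impI ext)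
    fix z z' :: "nat \<Rightarrow> 'a" and x assume "\<forall>i\<in>I - {v}. z i = z' i"
    then show "Q z x = Q z' x" unfolding Q_def by (intro fat_supported[OF Xs]) auto
  qed
  obtain K where K: "\<And>z. card {x. Q z x} \<le> K" using uniform_finiteness[OF Q finQ] by blast
  define G where "G j z x \<longleftrightarrow> Q z x \<and> gap_index {b. Q z b} x = j" for j z x
  have G: "dfn_ev (G j)" for j
  proof -
    have "dfn (\<lambda>e. card {b. Q (\<lambda>i. e (Suc i)) b \<and> lt b (e 0)} = j)"
    proof (rule dfn_card_eq[OF _ _ env_map_id])
      show "dfn_ev (\<lambda>e b. Q (\<lambda>i. e (Suc i)) b \<and> lt b (e 0))"
        by (intro dfn_evI dfn_intros dfn_evD[OF Q])
      show "finite {b. Q (\<lambda>i. s (Suc i)) b \<and> lt b (s 0)}" for s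
        by (rule finite_subset[OF _ finQ[of "\<lambda>i. s (Suc i)"]]) auto
    qed
    then show ?thesis unfolding G_def gap_index_def by simp (intro dfn_evI dfn_intros dfn_evD[OF Q])
  qed
  have Gs: "supported (I - {v}) (G j)" for j
    using Qs unfolding supported_def G_def by metis
  have Gf: "y = y'" if "G j z y" "G j z y'" for j z y y'
    using that gap_index_inj[OF finQ, of y z y'] unfolding G_def by simp
  define X' where "X' z \<longleftrightarrow> X z \<and> \<not> Q z (z v)" for z
  have X': "dfn X'" unfolding X'_def by (intro dfn_intros dfn_subst[OF X] dfn_evD[OF Q])
  have X's: "supported I X'"
    unfolding supported_def
  proof (intro allI impI)
    fix z z' :: "nat \<Rightarrow> 'a" assume a: "\<forall>i\<in>I. z i = z' i"
    then have "Q z = Q z'" by (intro supportedD[OF Qs]) auto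
    moreover have "X z = X z'" using a by (intro supportedD[OF Xs]) auto
    ultimately show "X' z = X' z'" using a v(1) unfolding X'_def by simp
  qed
  have thin': "\<not> fat vs X' z" for z
  proof
    assume f: "fat vs X' z"
    then have "fat vs X z" by (rule fat_mono_on) (simp add: X'_def)
    moreover obtain z0 where z0: "X' z0" "\<forall>i. i \<notin> set vs \<longrightarrow> z0 i = z i" using fat_ex[OF f] by blast
    have "fat vs X z0 = fat vs X z" by (rule fat_cong) (use z0 in auto)
    ultimately show False using z0(1) unfolding X'_def Q_def by simp
  qed
  have IH: "small ((\<lambda>U z. U z \<and> X' z) ` cuts R Z I)" using Cons.IH[OF v(3,4) X' X's thin'] .
  have sG: "small ((\<lambda>U z. U z \<and> G j z (z v)) ` cuts R Z I)" for j
    by (rule small_cuts_on_graph[OF few[OF v(1)] v(1) od G Gs Gf])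
  show ?case
  proof (rule small_determined[of "insert None (Some ` {..K})"
        "\<lambda>k U z. U z \<and> (case k of None \<Rightarrow> X' z | Some j \<Rightarrow> G j z (z v))"])
    fix k assume "k \<in> insert None (Some ` {..K})"
    then show "small ((\<lambda>U z. U z \<and> (case k of None \<Rightarrow> X' z | Some j \<Rightarrow> G j z (z v))) ` cuts R Z I)"
      using IH sG by (cases k) auto
  next
    fix U U' assume eq: "\<And>k. k \<in> insert None (Some ` {..K}) \<Longrightarrow>
       (\<lambda>z. U z \<and> (case k of None \<Rightarrow> X' z | Some j \<Rightarrow> G j z (z v))) =
       (\<lambda>z. U' z \<and> (case k of None \<Rightarrow> X' z | Some j \<Rightarrow> G j z (z v)))"
    show "(\<lambda>z. U z \<and> X z) = (\<lambda>z. U' z \<and> X z)"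
    proof
      fix z
      have 1: "X' z \<Longrightarrow> U z = U' z" using fun_cong[OF eq[of None], of z] by auto
      have "gap_index {b. Q z b} (z v) \<le> K" using gap_index_le[OF finQ] K le_trans by blast
      then have 2: "Q z (z v) \<Longrightarrow> U z = U' z"
        using fun_cong[OF eq[of "Some (gap_index {b. Q z b} (z v))"], of z] by (auto simp: G_def)
      show "(U z \<and> X z) = (U' z \<and> X z)" using 1 2 unfolding X'_def by blast
    qed
  qed simp
qed

text \<open>
  \<open>U\<close> is the downward closure of its part in \<open>X\<close>, or the complement of \<open>U\<close> is the upward
  closure of its part in \<open>X\<close>. In both cases this part of \<open>U\<close> determines \<open>U\<close>.
\<close>

definition decides :: "((nat \<Rightarrow> 'a) \<Rightarrow> (nat \<Rightarrow> 'a) \<Rightarrow> bool) \<Rightarrow> ((nat \<Rightarrow> 'a) \<Rightarrow> bool) \<Rightarrow>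
    ((nat \<Rightarrow> 'a) \<Rightarrow> bool) \<Rightarrow> ((nat \<Rightarrow> 'a) \<Rightarrow> bool) \<Rightarrow> bool" where
  "decides R Z X U \<longleftrightarrow> (\<forall>u. U u \<longrightarrow> (\<exists>x. X x \<and> U x \<and> R u x)) \<or>
    (\<forall>w. Z w \<and> \<not> U w \<longrightarrow> (\<exists>x. X x \<and> Z x \<and> \<not> U x \<and> R x w))"

lemma small_decided_cuts:
  assumes "small \<X>" and tr: "\<And>X. X \<in> \<X> \<Longrightarrow> small ((\<lambda>U z. U z \<and> X z) ` cuts R Z I)"
  shows "small {U \<in> cuts R Z I. \<exists>X\<in>\<X>. decides R Z X U}"
proof -
  define f where "f X T b z \<longleftrightarrow> (if b then Z z \<and> (\<exists>x. T x \<and> R z x)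
     else Z z \<and> \<not> (\<exists>x. X x \<and> Z x \<and> \<not> T x \<and> R x z))" for X T b z
  let ?S = "\<Union>X\<in>\<X>. \<Union>T\<in>(\<lambda>U z. U z \<and> X z) ` cuts R Z I. f X T ` UNIV"
  have "small ?S" using assms by (intro small_UN tr) (auto intro: small_finite)
  moreover have "{U \<in> cuts R Z I. \<exists>X\<in>\<X>. decides R Z X U} \<subseteq> ?S"
  proof
    fix U assume "U \<in> {U \<in> cuts R Z I. \<exists>X\<in>\<X>. decides R Z X U}"
    then obtain X where U: "U \<in> cuts R Z I" and X: "X \<in> \<X>" "decides R Z X U" by blast
    define T where "T = (\<lambda>z. U z \<and> X z)"
    have UZ: "U z \<Longrightarrow> Z z" and down: "U z' \<Longrightarrow> Z z \<Longrightarrow> R z z' \<Longrightarrow> U z" for z z'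
      using U unfolding cuts_def by blast+
    from X(2) have "\<exists>b. U = f X T b"
      unfolding decides_def
    proof
      assume "\<forall>u. U u \<longrightarrow> (\<exists>x. X x \<and> U x \<and> R u x)"
      moreover have "f X T True z \<longleftrightarrow> Z z \<and> (\<exists>x. (U x \<and> X x) \<and> R z x)" for z unfolding f_def T_def by simp
      ultimately have "U z = f X T True z" for z using UZ down by blast
      then show ?thesis by blast
    next
      assume "\<forall>w. Z w \<and> \<not> U w \<longrightarrow> (\<exists>x. X x \<and> Z x \<and> \<not> U x \<and> R x w)"
      moreover have "f X T False z \<longleftrightarrow> Z z \<and> \<not> (\<exists>x. X x \<and> Z x \<and> \<not> (U x \<and> X x) \<and> R x z)" for z
        unfolding f_def T_def by simp
      ultimately have "U z = f X T False z" for z using UZ down by blast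
      then show ?thesis by blast
    qed
    moreover have "T \<in> (\<lambda>U z. U z \<and> X z) ` cuts R Z I" unfolding T_def using U by blast
    ultimately show "U \<in> ?S" using X(1) by blast
  qed
  ultimately show ?thesis by (rule small_subset)
qed

lemma few_cuts_empty: "few_cuts {}"
  unfolding few_cuts_def
proof (intro allI impI)
  fix R Z
  have "cuts R Z {} \<subseteq> {\<lambda>_. True, \<lambda>_. False}"
  proof
    fix U assume "U \<in> cuts R Z {}"
    then have "supported {} U" unfolding cuts_def by blast
    then have "U z = U undefined" for z using supportedD[of "{}" U z undefined] by simp
    then have "U = (\<lambda>_. U undefined)" by (rule ext)
    then show "U \<in> {\<lambda>_. True, \<lambda>_. False}" by (cases "U undefined") auto
  qed
  then show "small (cuts R Z {})" using small_finite finite_subset by blast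
qed

text \<open>
  Cuts decided by a hyperplane or by a thin class are counted by the induction hypothesis. Any other cut
  \<open>U\<close> is recovered from a germ \<open>E\<close> and an index \<open>j\<close>: it consists of the \<open>z\<close> that lie strictly below the
  \<open>j\<close>-th fat class of \<open>S a\<close> for almost all \<open>a\<close> in the sense of \<open>E\<close>, where \<open>S a\<close> is the
  relation of having the same position relative to the hyperplane at \<open>a\<close>.
\<close>

lemma few_cuts_step:
  assumes I: "finite I" "v \<in> I" and few: "\<And>v. v \<in> I \<Longrightarrow> few_cuts (I - {v})"
  shows "few_cuts I"
  unfolding few_cuts_def
proof (intro allI impI)
  fix R Z assume od: "order_data R Z I"
  have R: "dfn_ee R" and Rs: "supported2 I R" and Z: "dfn Z" and Zs: "supported I Z"
    and ZA: "\<And>z i. Z z \<Longrightarrow> i \<in> I \<Longrightarrow> z i \<in> A" and wo: "weak_order_on Z R"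
    using od unfolding order_data_def by blast+
  have tot: "R x y \<or> R y x" if "Z x" "Z y" for x y using wo that unfolding weak_order_on_def by blast
  have tr: "R x z" if "R x y" "R y z" "Z x" "Z y" "Z z" for x y z using wo that unfolding weak_order_on_def by blast
  obtain us where us: "distinct us" "set us = I" using finite_distinct_list[OF I(1)] by blast
  \<comment> \<open>The parameter \<open>a\<close> is coordinate \<open>0\<close> of the environment \<open>p\<close>.\<close>
  define S where "S p z w \<longleftrightarrow> Z z \<and> Z w \<and> (\<forall>h. Z h \<and> h v = p 0 \<longrightarrow> R z h = R w h \<and> R h z = R h w)" for p :: "nat \<Rightarrow> 'a" and z w
  have S: "dfn_eee S" unfolding S_def by (intro dfn_eeeI dfn_intros dfn_eeD[OF R] dfn_subst[OF Z])
  have S_sym: "S p w z" if "S p z w" for p z w using that unfolding S_def by blast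
  have S_trans: "S p x z" if "S p x y" "S p y z" for p x y z using that unfolding S_def by simp
  have S_supp: "supported2 I (S p)" for p
    unfolding supported2_def
  proof (intro allI impI)
    fix x x' y y' :: "nat \<Rightarrow> 'a" assume a: "(\<forall>i\<in>I. x i = x' i) \<and> (\<forall>i\<in>I. y i = y' i)"
    then have "Z x = Z x'" "Z y = Z y'" "\<And>h. R x h = R x' h" "\<And>h. R y h = R y' h"
      "\<And>h. R h x = R h x'" "\<And>h. R h y = R h y'"
      using supportedD[OF Zs] supported2D[OF Rs] by blast+
    then show "S p x y = S p x' y'" unfolding S_def by simp
  qed
  have S_supp1: "supported I (S p w)" for p w
    using S_supp[of p] unfolding supported_def supported2_def by blast
  have S_eq: "S p w = S p w'" if "\<And>i. i \<in> I \<Longrightarrow> w i = w' i" for p w w'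
    by (rule ext, rule supported2D[OF S_supp]) (use that in auto)
  have S_class: "S p w = S p w'" if "S p w w'" for p w w'
    using that S_sym S_trans by (intro ext) blast
  have fat_indep: "fat us (S p w) z = fat us (S p w) z'" for p w z z'
    by (rule fat_supported[OF S_supp1]) (use us in auto)
  define F where "F p w \<longleftrightarrow> Z w \<and> fat us (S p w) w" for p w
  have F: "dfn (\<lambda>e. F (\<sigma> e) (\<rho> e))" if "env_map \<sigma>" "env_map \<rho>" for \<sigma> \<rho>
    unfolding F_def by (intro dfn_intros dfn_subst[OF Z] dfn_fat3[OF S] that)
  obtain N where N: "\<And>p z. finite (S p ` {w. fat us (S p w) z}) \<and> card (S p ` {w. fat us (S p w) z}) \<le> N"
  proof -
    have "\<exists>N. \<forall>p z. finite (S p ` {w. fat us (S p w) z}) \<and> card (S p ` {w. fat us (S p w) z}) \<le> N"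
      by (rule bounded_fat_classes[OF S S_sym S_trans])
    then show ?thesis using that by blast
  qed
  have finF: "finite (S p ` {w. F p w})" and cardF: "card (S p ` {w. F p w}) \<le> N" for p
  proof -
    have sub: "S p ` {w. F p w} \<subseteq> S p ` {w. fat us (S p w) undefined}"
      unfolding F_def using fat_indep by blast
    show "finite (S p ` {w. F p w})" using finite_subset[OF sub] N by blast
    show "card (S p ` {w. F p w}) \<le> N" using card_mono[OF _ sub] N le_trans by blast
  qed
  define lt' where "lt' p w z \<longleftrightarrow> \<not> R z w \<and> \<not> S p w z" for p w z
  have lt'_dfn: "dfn (\<lambda>e. lt' (\<sigma> e) (\<rho> e) (\<omega> e))" if "env_map \<sigma>" "env_map \<rho>" "env_map \<omega>" for \<sigma> \<rho> \<omega>
    unfolding lt'_def by (intro dfn_intros dfn_eeD[OF R] dfn_eeeD[OF S] that)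
  define cb where "cb p j z = count_below (lt' p) (F p) j z" for p j z
  have cb: "env_map \<sigma> \<Longrightarrow> env_map \<rho> \<Longrightarrow> dfn (\<lambda>e. cb (\<sigma> e) j (\<rho> e))" for \<sigma> \<rho> j
    unfolding cb_def
  proof (induction j arbitrary: \<sigma> \<rho>)
    case 0 then show ?case by (simp add: dfn_const)
  next
    case (Suc j)
    show ?case unfolding count_below.simps
      by (intro dfn_intros F lt'_dfn Suc.IH env_map_comp[OF Suc.prems(1)] env_map_comp[OF Suc.prems(2)])
  qed
  have cb_bound: "Z z \<Longrightarrow> cb p j z \<Longrightarrow> \<exists>W. finite W \<and> card (S p ` W) = j \<and> (\<forall>w\<in>W. F p w \<and> lt' p w z)" for p j z
    unfolding cb_def
  proof (induction j arbitrary: z)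
    case 0 then show ?case by (intro exI[of _ "{}"]) simp
  next
    case (Suc j)
    then obtain w where w: "F p w" "lt' p w z" "count_below (lt' p) (F p) j w" by auto
    have Zw: "Z w" using w(1) unfolding F_def by blast
    obtain W where W: "finite W" "card (S p ` W) = j" "\<forall>w'\<in>W. F p w' \<and> lt' p w' w"
      using Suc.IH[OF Zw w(3)] by blast
    have below: "lt' p w' z" if w': "w' \<in> W" for w'
    proof -
      have Zw': "Z w'" and l: "\<not> R w w'" "\<not> S p w' w" using W(3) w' unfolding F_def lt'_def by blast+
      have le1: "R w' w" using tot Zw Zw' l by blast
      have nle: "\<not> R z w" using w(2) unfolding lt'_def by blast
      then have le2: "R w z" using tot Zw Suc.prems(1) by blast
      have "\<not> R z w'" using nle tr[OF _ le1 Suc.prems(1) Zw' Zw] by blast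
      moreover have "\<not> S p w' z"
      proof
        assume s: "S p w' z"
        have "S p w' w" unfolding S_def
        proof (intro conjI allI impI)
          fix h assume h: "Z h \<and> h v = p 0"
          then have hh: "Z h" "R w' h = R z h" "R h w' = R h z" using s unfolding S_def by blast+
          show "R w' h = R w h" using tr[OF le1 _ Zw' Zw hh(1)] tr[OF le2 _ Zw Suc.prems(1) hh(1)] hh(2) by blast
          show "R h w' = R h w" using tr[OF _ le1 hh(1) Zw' Zw] tr[OF _ le2 hh(1) Zw Suc.prems(1)] hh(3) by blast
        qed (fact Zw' Zw)+
        then show False using l(2) by blast
      qed
      ultimately show ?thesis unfolding lt'_def by blast
    qed
    have "S p w \<notin> S p ` W"
    proof
      assume "S p w \<in> S p ` W"
      then obtain w' where w': "w' \<in> W" "S p w = S p w'" by blast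
      have "S p w w" using Zw unfolding S_def by simp
      then show False using w' W(3) unfolding lt'_def by simp
    qed
    then have "card (S p ` insert w W) = Suc j" using W(1,2) by simp
    then show ?case using W below w by (intro exI[of _ "insert w W"]) auto
  qed
  have cb_le: "j \<le> N" if zc: "Z z" "cb p j z" for p j z
  proof -
    obtain W where W: "finite W" "card (S p ` W) = j" "\<forall>w\<in>W. F p w \<and> lt' p w z" using cb_bound[OF zc] by blast
    then have "S p ` W \<subseteq> S p ` {w. F p w}" by blast
    from card_mono[OF finF this] cardF[of p] W(2) show ?thesis by linarith
  qed
  \<comment> \<open>The \<open>j\<close>-th fat class, which need not exist.\<close>
  define K where "K j p z \<longleftrightarrow> F p z \<and> cb p j z \<and> \<not> cb p (Suc j) z" for j p z
  have K: "dfn (\<lambda>e. K j (\<sigma> e) (\<rho> e))" if "env_map \<sigma>" "env_map \<rho>" for j \<sigma> \<rho>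
    unfolding K_def by (intro dfn_intros F cb that)
  have K_ex: "\<exists>j\<le>N. K j p z" if "F p z" for p z
  proof -
    have Zz: "Z z" using that unfolding F_def by blast
    have "cb p 0 z" unfolding cb_def by simp
    moreover have "\<not> cb p (Suc N) z" using cb_le[OF Zz] by (meson not_less_eq_eq Nat.le_refl)
    ultimately obtain j where "j < Suc N" "cb p j z" "\<not> cb p (Suc j) z"
      using ex_least_nat_less[of "\<lambda>j. \<not> cb p j z" "Suc N"] by blast
    then show ?thesis using that unfolding K_def by (auto simp: less_Suc_eq_le)
  qed
  have K_unique: "S p z z'" if z: "K j p z" "K j p z'" for j p z z'
  proof (rule ccontr)
    assume n: "\<not> S p z z'"
    have F2: "F p z" "F p z'" and c: "cb p j z" "cb p j z'" "\<not> cb p (Suc j) z" "\<not> cb p (Suc j) z'"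
      using z unfolding K_def by blast+
    have Zz: "Z z" "Z z'" using F2 unfolding F_def by blast+
    have 1: "R z' z"
    proof (rule ccontr)
      assume "\<not> R z' z"
      then have "lt' p z z'" using n unfolding lt'_def by blast
      then have "cb p (Suc j) z'" using F2(1) c(1) unfolding cb_def by auto
      then show False using c(4) by blast
    qed
    have 2: "R z z'"
    proof (rule ccontr)
      assume "\<not> R z z'"
      then have "lt' p z' z" using n S_sym unfolding lt'_def by blast
      then have "cb p (Suc j) z" using F2(2) c(2) unfolding cb_def by auto
      then show False using c(3) by blast
    qed
    have "S p z z'" unfolding S_def
    proof (intro conjI allI impI)
      fix h assume "Z h \<and> h v = p 0"
      then have "Z h" by blast
      then show "R z h = R z' h" "R h z = R h z'" using tr 1 2 Zz by blast+
    qed (fact Zz)+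
    then show False using n by blast
  qed
  define pa where "pa a = (\<lambda>_::nat. a)" for a :: 'a
  have pa: "env_map (\<lambda>e. pa (e i))" for i unfolding pa_def by (rule env_map_reindex)
  define hyp where "hyp a = (\<lambda>z. Z z \<and> z v = a)" for a
  \<comment> \<open>The hyperplanes, and the thin classes of points with coordinates in \<open>A\<close>.\<close>
  define \<X> where "\<X> = hyp ` A \<union> (\<lambda>(a, z). S (pa a) z) ` {(a, z). a \<in> A \<and> restr I z = z \<and> (\<forall>i\<in>I. z i \<in> A) \<and> \<not> fat us (S (pa a) z) z}"
  have "small \<X>"
  proof -
    have "{(a, z). a \<in> A \<and> restr I z = z \<and> (\<forall>i\<in>I. z i \<in> A) \<and> \<not> fat us (S (pa a) z) z} \<subseteq>
        A \<times> {z. restr I z = z \<and> (\<forall>i\<in>I. z i \<in> A)}" by auto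
    then have "small {(a, z). a \<in> A \<and> restr I z = z \<and> (\<forall>i\<in>I. z i \<in> A) \<and> \<not> fat us (S (pa a) z) z}"
      using small_Times[OF small_A small_envs[OF I(1)]] small_subset by blast
    then show ?thesis unfolding \<X>_def by (rule small_Un[OF small_image[OF small_A] small_image])
  qed
  moreover have "small ((\<lambda>U z. U z \<and> X z) ` cuts R Z I)" if "X \<in> \<X>" for X
    using that unfolding \<X>_def
  proof
    assume "X \<in> hyp ` A"
    then obtain a where X: "X = hyp a" by blast
    have G: "small ((\<lambda>U z. U z \<and> (\<lambda>z y. y = a) z (z v)) ` cuts R Z I)"
      by (rule small_cuts_on_graph[OF few[OF I(2)] I(2) od]) (auto intro!: dfn_evI dfn_intros simp: supported_def)
    have eq: "(U z \<and> X z) = (U z \<and> z v = a)" if "U \<in> cuts R Z I" for U z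
      using that unfolding X hyp_def cuts_def by blast
    have "(\<lambda>U z. U z \<and> X z) ` cuts R Z I = (\<lambda>U z. U z \<and> (\<lambda>z y. y = a) z (z v)) ` cuts R Z I"
      by (rule image_cong[OF refl], rule ext, rule eq)
    then show ?thesis using G by simp
  next
    assume "X \<in> (\<lambda>(a, z). S (pa a) z) ` {(a, z). a \<in> A \<and> restr I z = z \<and> (\<forall>i\<in>I. z i \<in> A) \<and> \<not> fat us (S (pa a) z) z}"
    then obtain a z where X: "X = S (pa a) z" "\<not> fat us (S (pa a) z) z" by auto
    have "dfn X" unfolding X by (intro dfn_eeeD[OF S] dfn_intros)
    moreover have "\<not> fat us X z'" for z' using X fat_indep by blast
    ultimately show ?thesis
      using us X(1) S_supp1 by (intro small_cuts_on_thin[OF few od, of us X]) auto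
  qed
  ultimately have dec: "small {U \<in> cuts R Z I. \<exists>X\<in>\<X>. decides R Z X U}"
    by (rule small_decided_cuts)
  define g where "g E j z \<longleftrightarrow> Z z \<and> E (\<lambda>a. \<forall>k. K j (pa a) k \<longrightarrow> \<not> R k z)" for E j z
  have nondec: "{U \<in> cuts R Z I. \<not> (\<exists>X\<in>\<X>. decides R Z X U)} \<subseteq>
      (\<Union>E\<in>{E \<in> germs. E (\<lambda>a. a \<in> A)}. g E ` {..N})"
  proof
    fix U assume "U \<in> {U \<in> cuts R Z I. \<not> (\<exists>X\<in>\<X>. decides R Z X U)}"
    then have Uc: "U \<in> cuts R Z I" and nd: "\<And>X. X \<in> \<X> \<Longrightarrow> \<not> decides R Z X U" by blast+
    have U: "dfn U" "supported I U" and UZ: "U z \<Longrightarrow> Z z" and down: "U z' \<Longrightarrow> Z z \<Longrightarrow> R z z' \<Longrightarrow> U z" for z z'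
      using Uc unfolding cuts_def by blast+
    have sep: "R z w" if "U z" "Z w" "\<not> U w" for z w
      using that tot[of z w] UZ down by blast
    \<comment> \<open>No point of the hyperplane separates \<open>u\<close> below the cut from \<open>w\<close> above it, and \<open>u\<close> lies above all points of the hyperplane that are below the cut.\<close>
    have gapped: "\<exists>u w. U u \<and> Z w \<and> \<not> U w \<and> (\<forall>h. Z h \<and> h v = a \<and> U h \<longrightarrow> \<not> R u h) \<and> S (pa a) u w" if a: "a \<in> A" for a
    proof -
      have "hyp a \<in> \<X>" unfolding \<X>_def using a by blast
      from nd[OF this] obtain u w where u: "U u" "\<And>x. hyp a x \<Longrightarrow> U x \<Longrightarrow> \<not> R u x"
        and w: "Z w" "\<not> U w" "\<And>x. hyp a x \<Longrightarrow> Z x \<Longrightarrow> \<not> U x \<Longrightarrow> \<not> R x w"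
        unfolding decides_def by blast
      have "S (pa a) u w" unfolding S_def
      proof (intro conjI allI impI)
        fix h assume "Z h \<and> h v = pa a 0"
        then have h: "Z h" "hyp a h" unfolding hyp_def pa_def by blast+
        show "R u h = R w h"
        proof (cases "U h")
          case True
          then have "\<not> R u h" "\<not> R w h" using u(2) h down w(1,2) by blast+
          then show ?thesis by blast
        next
          case False
          then have "R u h" "R w h" using sep u(1) w(3) h tot[OF h(1) w(1)] by blast+
          then show ?thesis by blast
        qed
        show "R h u = R h w"
        proof (cases "U h")
          case True
          then have "R h u" "R h w" using sep[OF True w(1,2)] u(2)[OF h(2)] tot[OF h(1) UZ[OF u(1)]] by blast+
          then show ?thesis by blast
        next
          case False
          then have "\<not> R h u" "\<not> R h w" using down u(1) w(3) h by blast+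
          then show ?thesis by blast
        qed
      qed (fact UZ[OF u(1)] w(1))+
      then show ?thesis using u w(1,2) unfolding hyp_def by blast
    qed
    \<comment> \<open>A thin class that meets both sides of the cut would decide it.\<close>
    have fatK: "F (pa a) u" if a: "a \<in> A" and u: "U u" "Z w" "\<not> U w" "S (pa a) u w" for a u w
    proof -
      have Zu: "Z u" using UZ u(1) .
      have "fat us (S (pa a) u) u"
      proof (rule ccontr)
        assume nf: "\<not> fat us (S (pa a) u) u"
        let ?u = "restr I u"
        have Su: "S (pa a) ?u = S (pa a) u" by (rule S_eq) (simp add: restr_def)
        have "restr I ?u = ?u" unfolding restr_def by auto
        moreover have "\<forall>i\<in>I. ?u i \<in> A" using ZA[OF Zu] by (simp add: restr_def)
        moreover have "\<not> fat us (S (pa a) ?u) ?u" using nf fat_indep unfolding Su by blast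
        ultimately have "S (pa a) ?u \<in> \<X>" using a unfolding \<X>_def
          by (intro UnI2 image_eqI[of _ _ "(a, ?u)"]) auto
        then have "\<not> decides R Z (S (pa a) u) U" using nd Su by simp
        moreover have "\<exists>x. S (pa a) u x \<and> U x \<and> R u' x" if u': "U u'" for u'
        proof (cases "R u' u")
          case True
          have "S (pa a) u u" using Zu unfolding S_def by simp
          then show ?thesis using True u(1) by blast
        next
          case False
          have Zu': "Z u'" using UZ u' .
          have ru: "R u u'" using False tot[OF Zu Zu'] by blast
          have ru': "R u' w" using sep[OF u' u(2,3)] .
          have "S (pa a) u u'" unfolding S_def
          proof (intro conjI allI impI)
            fix h assume h: "Z h \<and> h v = pa a 0"
            then have eq: "R u h = R w h" "R h u = R h w" and Zh: "Z h" using u(4) unfolding S_def by blast+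
            show "R u h = R u' h" using eq(1) tr[OF ru _ Zu Zu' Zh] tr[OF ru' _ Zu' u(2) Zh] by blast
            show "R h u = R h u'" using eq(2) tr[OF _ ru Zh Zu Zu'] tr[OF _ ru' Zh Zu' u(2)] by blast
          qed (fact Zu Zu')+
          moreover have "R u' u'" using tot Zu' by blast
          ultimately show ?thesis using u' by blast
        qed
        ultimately show False unfolding decides_def by blast
      qed
      then show ?thesis using Zu unfolding F_def by blast
    qed
    have A_ne: "\<exists>a. a \<in> A" using infinite_A by (metis finite.emptyI ex_in_conv)
    then obtain u0 where u0: "U u0" using gapped by blast
    \<comment> \<open>The hyperplanes that have a point between \<open>u\<close> and the cut.\<close>
    define C where "C u a \<longleftrightarrow> a \<in> A \<and> (\<exists>h. Z h \<and> U h \<and> h v = a \<and> R u h)" for u a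
    have "\<exists>E\<in>germs. \<forall>u\<in>{u. U u}. E (C u)"
    proof (rule chain_germ)
      show "dfn_v (C u)" for u
        unfolding C_def by (intro dfn_vI dfn_intros dfn_vD[OF dfn_A] dfn_subst[OF Z] dfn_subst[OF U(1)] dfn_eeD[OF R])
      have "dfn_v (\<lambda>t. \<exists>u. U u \<and> (\<forall>x. lt x t \<longrightarrow> \<not> C u x))"
        unfolding C_def by (intro dfn_vI dfn_intros dfn_vD[OF dfn_A] dfn_subst[OF Z] dfn_subst[OF U(1)] dfn_eeD[OF R])
      then show "dfn_v (\<lambda>t. \<exists>u\<in>{u. U u}. \<forall>x. lt x t \<longrightarrow> \<not> C u x)" by (simp add: Bex_def)
    next
      fix u u' assume uu: "u \<in> {u. U u}" "u' \<in> {u. U u}"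
      have mono: "C w x \<Longrightarrow> C u x" if "R u w" "U u" "U w" for u w x
        unfolding C_def using tr[OF that(1)] UZ that by blast
      show "\<exists>w\<in>{u. U u}. (\<forall>x. C w x \<longrightarrow> C u x) \<and> (\<forall>x. C w x \<longrightarrow> C u' x)"
        using tot[of u u'] UZ mono uu by blast
    next
      fix u assume "u \<in> {u. U u}"
      then have "U u" by blast
      then have "C u (u v)" unfolding C_def using UZ ZA I(2) tot by blast
      then show "\<exists>x. C u x" by blast
    next
      fix t
      show "\<exists>u\<in>{u. U u}. \<not> C u t"
      proof (cases "t \<in> A")
        case True
        then show ?thesis using gapped[OF True] UZ unfolding C_def by blast
      next
        case False
        then show ?thesis using u0 unfolding C_def by blast
      qed
    qed
    then obtain E where E: "E \<in> germs" "\<And>u. U u \<Longrightarrow> E (C u)" by blast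
    have gE: "germ E" using germ_germs E(1) .
    have EA: "E (\<lambda>a. a \<in> A)" using E(2)[OF u0] by (rule germ_mono[OF gE]) (simp add: C_def)
    \<comment> \<open>The class through which the cut runs is the \<open>j\<close>-th fat class.\<close>
    define H where "H j a \<longleftrightarrow> (\<exists>u w. U u \<and> Z w \<and> \<not> U w \<and> S (pa a) u w \<and> K j (pa a) u)" for j a
    have "\<exists>j\<le>N. E (H j)"
    proof (rule germ_finite_cases[OF gE EA])
      show "dfn_v (H j)" for j
        unfolding H_def pa_def by (intro dfn_vI dfn_intros dfn_subst[OF Z] dfn_subst[OF U(1)] dfn_eeeD[OF S] K)
      fix a assume a: "a \<in> A"
      then obtain u w where u: "U u" "Z w" "\<not> U w" "S (pa a) u w" using gapped[OF a] by blast
      then show "\<exists>j\<le>N. H j a" using K_ex[OF fatK[OF a u]] unfolding H_def by blast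
    qed
    then obtain j where j: "j \<le> N" "E (H j)" by blast
    have "U z = g E j z" for z
    proof
      assume Uz: "U z"
      have "E (\<lambda>a. \<forall>k. K j (pa a) k \<longrightarrow> \<not> R k z)"
        using germ_conj[OF gE E(2)[OF Uz] j(2)]
      proof (rule germ_mono[OF gE], intro allI impI)
        fix a k assume a: "C z a \<and> H j a" and k: "K j (pa a) k"
        obtain h where h: "Z h" "U h" "h v = a" "R z h" using a unfolding C_def by blast
        obtain u w where u: "U u" "Z w" "\<not> U w" "S (pa a) u w" "K j (pa a) u" using a unfolding H_def by blast
        have Zk: "Z k" using k unfolding K_def F_def by blast
        have "S (pa a) k w" using S_trans[OF K_unique[OF k u(5)] u(4)] .
        then have "R k h = R w h" using h(1,3) unfolding S_def pa_def by blast
        moreover have "\<not> R w h" using down h(2) u(2,3) by blast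
        ultimately have "\<not> R k h" by blast
        then show "\<not> R k z" using tr[OF _ h(4) Zk UZ[OF Uz] h(1)] by blast
      qed
      then show "g E j z" unfolding g_def using UZ Uz by blast
    next
      assume gz: "g E j z"
      then have Zz: "Z z" and "E (\<lambda>a. \<forall>k. K j (pa a) k \<longrightarrow> \<not> R k z)" unfolding g_def by blast+
      from germ_ex[OF gE germ_conj[OF gE this(2) j(2)]] obtain a where
        a: "\<And>k. K j (pa a) k \<Longrightarrow> \<not> R k z" "H j a" by blast
      obtain u where u: "U u" "K j (pa a) u" using a(2) unfolding H_def by blast
      then have "R z u" using a(1) tot[OF Zz UZ[OF u(1)]] by blast
      then show "U z" using down u(1) Zz by blast
    qed
    then have "U = g E j" by blast
    then show "U \<in> (\<Union>E\<in>{E \<in> germs. E (\<lambda>a. a \<in> A)}. g E ` {..N})" using E(1) EA j(1) by blast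
  qed
  have "small (\<Union>E\<in>{E \<in> germs. E (\<lambda>a. a \<in> A)}. g E ` {..N})"
    by (intro small_UN small_germs_in_A small_finite) simp
  then have nd: "small {U \<in> cuts R Z I. \<not> (\<exists>X\<in>\<X>. decides R Z X U)}"
    using nondec by (rule small_subset)
  have "cuts R Z I = {U \<in> cuts R Z I. \<exists>X\<in>\<X>. decides R Z X U} \<union> {U \<in> cuts R Z I. \<not> (\<exists>X\<in>\<X>. decides R Z X U)}" by blast
  then show "small (cuts R Z I)" using small_Un[OF dec nd] by simp
qed

theorem few_cuts: "finite I \<Longrightarrow> few_cuts I"
proof (induction I rule: finite_psubset_induct)
  case (psubset I)
  show ?case
  proof (cases "I = {}")
    case True then show ?thesis using few_cuts_empty by simp
  next
    case False
    then obtain v where "v \<in> I" by blast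
    moreover have "few_cuts (I - {v})" if "v \<in> I" for v using psubset.IH[of "I - {v}"] that by blast
    ultimately show ?thesis using few_cuts_step[OF psubset.hyps] by blast
  qed
qed

end

section \<open>Traces of definable types\<close>

context omin_set begin

definition dfn_eev :: "((nat \<Rightarrow> 'a) \<Rightarrow> (nat \<Rightarrow> 'a) \<Rightarrow> 'a \<Rightarrow> bool) \<Rightarrow> bool" where
  "dfn_eev F \<longleftrightarrow> dfn_eee (\<lambda>s x w. F s x (w 0))"

lemma dfn_eevI:
  "dfn (\<lambda>e. F (\<lambda>i. e (2 * (2 * i))) (\<lambda>i. e (2 * (Suc (2 * i)))) (e 1)) \<Longrightarrow> dfn_eev F"
  unfolding dfn_eev_def by (rule dfn_eeeI) simp

lemma dfn_eevD:
  assumes "dfn_eev F" "env_map \<sigma>" "env_map \<rho>" "coord_map \<tau>" shows "dfn (\<lambda>e. F (\<sigma> e) (\<rho> e) (\<tau> e))"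
proof -
  have "env_map (\<lambda>e i. \<tau> e)" using assms(4) by (simp add: env_map_def)
  from dfn_eeeD[OF assms(1)[unfolded dfn_eev_def] assms(2,3) this] show ?thesis .
qed

text \<open>
  A definable complete type in the variables \<open>V\<close>, as the collection of predicates that it contains. Only
  the values of \<open>q\<close> at definable predicates in these variables matter.
\<close>

definition deftype :: "nat set \<Rightarrow> (((nat \<Rightarrow> 'a) \<Rightarrow> bool) \<Rightarrow> bool) \<Rightarrow> bool" where
  "deftype V q \<longleftrightarrow> (\<forall>P. dfn P \<and> supported V P \<longrightarrow> q (\<lambda>x. \<not> P x) = (\<not> q P)) \<and>
    (\<forall>P Q. dfn P \<and> supported V P \<and> dfn Q \<and> supported V Q \<longrightarrow> q (\<lambda>x. P x \<and> Q x) = (q P \<and> q Q)) \<and>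
    q (\<lambda>_. True) \<and>
    (\<forall>R. dfn_ee R \<and> (\<forall>s. supported V (R s)) \<longrightarrow> dfn (\<lambda>s. q (R s)))"

lemma supported_ops:
  "supported V P \<Longrightarrow> supported V (\<lambda>x. \<not> P x)"
  "supported V P \<Longrightarrow> supported V Q \<Longrightarrow> supported V (\<lambda>x. P x \<and> Q x)"
  "supported V P \<Longrightarrow> V \<subseteq> W \<Longrightarrow> supported W P"
  "supported V (\<lambda>_. c)"
  unfolding supported_def by blast+

lemma deftype_not: "deftype V q \<Longrightarrow> dfn P \<Longrightarrow> supported V P \<Longrightarrow> q (\<lambda>x. \<not> P x) = (\<not> q P)"
  and deftype_conj: "deftype V q \<Longrightarrow> dfn P \<Longrightarrow> supported V P \<Longrightarrow> dfn Q \<Longrightarrow> supported V Q \<Longrightarrow>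
    q (\<lambda>x. P x \<and> Q x) = (q P \<and> q Q)"
  and deftype_True: "deftype V q \<Longrightarrow> q (\<lambda>_. True)"
  and deftype_dfn: "deftype V q \<Longrightarrow> dfn_ee R \<Longrightarrow> (\<And>s. supported V (R s)) \<Longrightarrow> dfn (\<lambda>s. q (R s))"
  unfolding deftype_def by blast+

lemma deftype_False: "deftype V q \<Longrightarrow> \<not> q (\<lambda>_. False)"
  using deftype_not[of V q "\<lambda>_. True"] deftype_True dfn_const supported_ops(4) by fastforce

lemma deftype_mono:
  assumes "deftype V q" "dfn P" "supported V P" "dfn Q" "supported V Q" "q P" "\<And>x. P x \<Longrightarrow> Q x"
  shows "q Q"
proof -
  have "(\<lambda>x. P x \<and> Q x) = P" using assms(7) by blast
  then show ?thesis using deftype_conj[OF assms(1-5)] assms(6) by simp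
qed

lemma deftype_ex:
  assumes "deftype V q" "q P" shows "\<exists>x. P x"
proof (rule ccontr)
  assume "\<not> (\<exists>x. P x)"
  then have "P = (\<lambda>_. False)" by blast
  then show False using deftype_False assms by blast
qed

lemma deftype_cong:
  assumes q: "deftype V q" and P: "dfn P0" "supported V P0" "dfn P" "supported V P" "dfn Q" "supported V Q"
    and "q P0" and eq: "\<And>x. P0 x \<Longrightarrow> P x = Q x"
  shows "q P = q Q"
proof -
  have "(\<lambda>x. P0 x \<and> P x) = (\<lambda>x. P0 x \<and> Q x)" using eq by blast
  then show ?thesis using deftype_conj[OF q P(1,2,3,4)] deftype_conj[OF q P(1,2,5,6)] \<open>q P0\<close> by simp
qed

text \<open>
  If \<open>c\<close> is the truth pattern of \<open>q\<close> on \<open>K\<close>, then the points with this pattern form a set in \<open>q\<close>.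
\<close>

lemma deftype_pattern:
  assumes q: "deftype V q" and K: "finite K" "\<And>P. P \<in> K \<Longrightarrow> dfn P \<and> supported V P"
  shows "dfn (\<lambda>x. \<forall>P\<in>K. P x = c P) \<and> supported V (\<lambda>x. \<forall>P\<in>K. P x = c P) \<and>
    ((\<forall>P\<in>K. c P = q P) \<longrightarrow> q (\<lambda>x. \<forall>P\<in>K. P x = c P))"
  using K
proof (induction K rule: finite_induct)
  case empty
  then show ?case using deftype_True[OF q] by (simp add: dfn_const supported_ops)
next
  case (insert P K)
  let ?\<Phi> = "\<lambda>x. \<forall>P\<in>K. P x = c P"
  have IH: "dfn ?\<Phi>" "supported V ?\<Phi>" "(\<forall>P\<in>K. c P = q P) \<Longrightarrow> q ?\<Phi>" using insert by auto
  have P: "dfn P" "supported V P" using insert.prems by auto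
  have P': "dfn (\<lambda>x. P x = c P)" using P(1) by (intro dfn_intros)
  have Ps: "supported V (\<lambda>x. P x = c P)" using P(2) unfolding supported_def by metis
  have eq: "(\<lambda>x. \<forall>Q\<in>insert P K. Q x = c Q) = (\<lambda>x. P x = c P \<and> ?\<Phi> x)" by auto
  have "q (\<lambda>x. P x = c P)" if "c P = q P"
  proof (cases "c P")
    case True then show ?thesis using that by simp
  next
    case False then show ?thesis using that deftype_not[OF q P] by simp
  qed
  then show ?case unfolding eq
    using deftype_conj[OF q P' Ps IH(1,2)] IH dfn_conj[OF P' IH(1)] supported_ops(2)[OF Ps IH(2)] by auto
qed

text \<open>
  A predicate whose value at a point is a function of finitely many others is decided by \<open>q\<close> in the same
  way as by any type that agrees with \<open>q\<close> on these.
\<close>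

lemma deftype_determined:
  assumes q: "deftype V q" "deftype V q'" and K: "finite K" "\<And>P. P \<in> K \<Longrightarrow> dfn P \<and> supported V P"
    and P0: "dfn P0" "supported V P0" and det: "\<And>x x'. (\<And>P. P \<in> K \<Longrightarrow> P x = P x') \<Longrightarrow> P0 x = P0 x'"
    and eq: "\<And>P. P \<in> K \<Longrightarrow> q P = q' P"
  shows "q P0 = q' P0"
proof -
  have half: "q' P0" if q: "deftype V q" "deftype V q'" and eq: "\<And>P. P \<in> K \<Longrightarrow> q P = q' P" and qP: "q P0" for q q'
  proof (rule ccontr)
    assume n: "\<not> q' P0"
    let ?\<Phi> = "\<lambda>x. \<forall>P\<in>K. P x = q P"
    have \<Phi>: "dfn ?\<Phi>" "supported V ?\<Phi>" "q ?\<Phi>" using deftype_pattern[OF q(1) K, of q] by auto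
    have "q' ?\<Phi>" using deftype_pattern[OF q(2) K, of q] eq by auto
    then have "q' (\<lambda>x. ?\<Phi> x \<and> \<not> P0 x)"
      using n deftype_not[OF q(2) P0] deftype_conj[OF q(2) \<Phi>(1,2) dfn_not[OF P0(1)] supported_ops(1)[OF P0(2)]] by simp
    from deftype_ex[OF q(2) this] obtain x' where x': "\<And>P. P \<in> K \<Longrightarrow> P x' = q P" "\<not> P0 x'" by blast
    have "q (\<lambda>x. ?\<Phi> x \<and> P0 x)" using \<Phi>(3) qP deftype_conj[OF q(1) \<Phi>(1,2) P0] by simp
    from deftype_ex[OF q(1) this] obtain x where x: "\<And>P. P \<in> K \<Longrightarrow> P x = q P" "P0 x" by blast
    show False using det[of x x'] x x' by simp
  qed
  show ?thesis using half[OF q] half[OF q(2,1)] eq by blast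
qed

definition in_A :: "nat set \<Rightarrow> (nat \<Rightarrow> 'a) \<Rightarrow> bool" where
  "in_A I s \<longleftrightarrow> (\<forall>i\<in>I. s i \<in> A)"

lemma dfn_in_A: "finite I \<Longrightarrow> env_map \<sigma> \<Longrightarrow> dfn (\<lambda>e. in_A I (\<sigma> e))"
  unfolding in_A_def
proof (induction I rule: finite_induct)
  case empty then show ?case by (simp add: dfn_const)
next
  case (insert v I)
  then show ?case by simp (intro dfn_conj dfn_vD[OF dfn_A] env_map_coord insert.IH, assumption+)
qed

definition trace :: "nat set \<Rightarrow> ((nat \<Rightarrow> 'a) \<Rightarrow> (nat \<Rightarrow> 'a) \<Rightarrow> bool) \<Rightarrow> (((nat \<Rightarrow> 'a) \<Rightarrow> bool) \<Rightarrow> bool) \<Rightarrow> (nat \<Rightarrow> 'a) \<Rightarrow> bool" where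
  "trace I R q = (\<lambda>s. in_A I s \<and> q (R s))"

text \<open>
  \<open>U\<close> contains the variables that occur in the family, while the types have variables \<open>V\<close>; the induction
  is on \<open>U\<close>.
\<close>

definition few_traces :: "nat set \<Rightarrow> nat set \<Rightarrow> bool" where
  "few_traces V U \<longleftrightarrow> (\<forall>I R. finite I \<and> dfn_ee R \<and> (\<forall>s. supported U (R s)) \<and> supported I R \<longrightarrow>
    small (trace I R ` {q. deftype V q}))"

lemma few_tracesD:
  "few_traces V U \<Longrightarrow> finite I \<Longrightarrow> dfn_ee R \<Longrightarrow> (\<And>s. supported U (R s)) \<Longrightarrow> supported I R \<Longrightarrow>
    small (trace I R ` {q. deftype V q})"
  unfolding few_traces_def by blast

definition pair_trace :: "nat set \<Rightarrow> ((nat \<Rightarrow> 'a) \<Rightarrow> (nat \<Rightarrow> 'a) \<Rightarrow> (nat \<Rightarrow> 'a) \<Rightarrow> bool) \<Rightarrow>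
    (((nat \<Rightarrow> 'a) \<Rightarrow> bool) \<Rightarrow> bool) \<Rightarrow> (nat \<Rightarrow> 'a) \<Rightarrow> (nat \<Rightarrow> 'a) \<Rightarrow> bool" where
  "pair_trace I R q = (\<lambda>s s'. in_A I s \<and> in_A I s' \<and> q (R s s'))"

text \<open>
  The induction hypothesis for families indexed by two tuples, by interleaving them.
\<close>

lemma small_pair_traces:
  assumes few: "few_traces V U" and I: "finite I" and R: "dfn_eee R" "\<And>s s'. supported U (R s s')"
    and Rs: "\<And>s t s' t'. (\<And>i. i \<in> I \<Longrightarrow> s i = t i) \<Longrightarrow> (\<And>i. i \<in> I \<Longrightarrow> s' i = t' i) \<Longrightarrow> R s s' = R t t'"
  shows "small (pair_trace I R ` {q. deftype V q})"
proof -
  let ?J = "(\<lambda>i. 2 * i) ` I \<union> (\<lambda>i. Suc (2 * i)) ` I"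
  let ?R = "\<lambda>p. R (\<lambda>i. p (2 * i)) (\<lambda>i. p (Suc (2 * i)))"
  have "supported ?J ?R" unfolding supported_def by (intro allI impI Rs) auto
  then have "small (trace ?J ?R ` {q. deftype V q})"
    using I R by (intro few_tracesD[OF few]) (auto simp: dfn_eee_def)
  then have "small ((\<lambda>T s s'. T (ilv s s')) ` trace ?J ?R ` {q. deftype V q})" by (rule small_image)
  moreover have "in_A ?J (ilv s s') \<longleftrightarrow> in_A I s \<and> in_A I s'" for s s' :: "nat \<Rightarrow> 'a"
    unfolding in_A_def ball_Un by simp
  then have "pair_trace I R q = (\<lambda>T s s'. T (ilv s s')) (trace ?J ?R q)" for q
    unfolding pair_trace_def trace_def by (intro ext) simp
  ultimately show ?thesis unfolding image_image by simp
qed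

lemma few_traces_empty: "few_traces V {}"
  unfolding few_traces_def
proof (intro allI impI)
  fix I R assume a: "finite I \<and> dfn_ee R \<and> (\<forall>s. supported {} (R s)) \<and> supported I R"
  have "trace I R q = (\<lambda>s. in_A I s \<and> R s undefined)" if q: "deftype V q" for q
  proof
    fix s
    have const: "R s = (\<lambda>_. R s undefined)"
      by (rule ext, rule supportedD[of "{}" "R s"]) (use a in auto)
    have "q (R s) = R s undefined"
      by (subst const, cases "R s undefined") (use deftype_True[OF q] deftype_False[OF q] in auto)
    then show "trace I R q s = (in_A I s \<and> R s undefined)" unfolding trace_def by simp
  qed
  then have "trace I R ` {q. deftype V q} \<subseteq> {\<lambda>s. in_A I s \<and> R s undefined}" by blast
  then show "small (trace I R ` {q. deftype V q})" using small_finite finite_subset by blast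
qed

text \<open>
  \<open>F s x\<close> is a partial function of the variables \<open>U\<close> for each \<open>s\<close>, and its value is compared with the
  new variable \<open>m\<close>.
\<close>

lemma small_function_traces:
  assumes few: "few_traces V U" and U: "U \<subseteq> V" "m \<in> V" and I: "finite I"
    and F: "dfn_eev F" "\<And>s z. supported U (\<lambda>x. F s x z)" "supported I F"
    and fn: "\<And>s x z z'. F s x z \<Longrightarrow> F s x z' \<Longrightarrow> z = z'"
  shows "small (trace I (\<lambda>s x. F s x (x m)) ` {q. deftype V q})"
    and "small (trace I (\<lambda>s x. \<exists>z. F s x z \<and> lt z (x m)) ` {q. deftype V q})"
proof -
  let ?Q = "{q. deftype V q}"
  have FU: "F s x = F s x'" if "\<And>i. i \<in> U \<Longrightarrow> x i = x' i" for s x x'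
  proof (rule ext)
    fix z show "F s x z = F s x' z" using supportedD[OF F(2)[of s z], of x x'] that by blast
  qed
  have FI: "F s = F s'" if "\<And>i. i \<in> I \<Longrightarrow> s i = s' i" for s s' using supportedD[OF F(3) that] .
  have pairU: "supported U (\<lambda>x. G (F s x) (F s' x))" for G :: "_ \<Rightarrow> _ \<Rightarrow> bool" and s s'
    unfolding supported_def using FU by (intro allI impI) metis
  have pairV: "supported V (\<lambda>x. G (F s x) (F s' x))" for G :: "_ \<Rightarrow> _ \<Rightarrow> bool" and s s'
    by (rule supported_ops(3)[OF pairU[of G s s'] U(1)])
  have oneV: "supported V (\<lambda>x. G (F s x))" for G :: "_ \<Rightarrow> bool" and s using pairV[of "\<lambda>f g. G f" s s] .
  have mV: "supported V (\<lambda>x. G (F s x) (x m))" for G :: "_ \<Rightarrow> _ \<Rightarrow> bool" and s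
    unfolding supported_def
  proof (intro allI impI)
    fix x x' :: "nat \<Rightarrow> 'a" assume a: "\<forall>i\<in>V. x i = x' i"
    then have "F s x = F s x'" "x m = x' m" using FU U by blast+
    then show "G (F s x) (x m) = G (F s x') (x' m)" by simp
  qed
  have onV: "supported V (\<lambda>x. F s x (x m))" for s using mV[of "\<lambda>f y. f y" s] .
  have belowV: "supported V (\<lambda>x. \<exists>z. F s x z \<and> lt z (x m))" for s
    using mV[of "\<lambda>f y. \<exists>z. f z \<and> lt z y" s] .
  have on_dfn: "dfn_ee (\<lambda>s x. F s x (x m))" by (intro dfn_eeI dfn_eevD[OF F(1)] dfn_intros)
  have below_dfn: "dfn_ee (\<lambda>s x. \<exists>z. F s x z \<and> lt z (x m))" by (intro dfn_eeI dfn_intros dfn_eevD[OF F(1)])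
  have sec: "dfn (R s)" if "dfn_ee R" for R s using dfn_eeD[OF that env_map_const env_map_id] .
  have pI: "G (F s) (F s') = G (F t) (F t')"
    if "\<And>i. i \<in> I \<Longrightarrow> s i = t i" "\<And>i. i \<in> I \<Longrightarrow> s' i = t' i" for G s t s' t'
    using FI[of s t] FI[of s' t'] that by simp
  \<comment> \<open>The set of all \<open>s\<close> with value below the new variable is a cut for the weak order \<open>L\<close> read in \<open>q\<close>.\<close>
  define L where "L s s' x \<longleftrightarrow> (\<exists>z z'. F s x z \<and> F s' x z' \<and> le z z')" for s s' x
  have L: "dfn_eee L" unfolding L_def by (intro dfn_eeeI dfn_intros dfn_eevD[OF F(1)])
  have LU: "supported U (L s s')" for s s'
    unfolding L_def by (rule pairU[of "\<lambda>f g. \<exists>z z'. f z \<and> g z' \<and> le z z'"])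
  have LV: "supported V (L s s')" for s s' using supported_ops(3)[OF LU U(1)] .
  have LI: "L s s' = L t t'" if "\<And>i. i \<in> I \<Longrightarrow> s i = t i" "\<And>i. i \<in> I \<Longrightarrow> s' i = t' i" for s t s' t'
    unfolding L_def by (intro ext, rule pI[of s t s' t' "\<lambda>f g. \<exists>z z'. f _ z \<and> g _ z' \<and> le z z'"]) (use that in auto)
  have Ls: "dfn (L s s')" for s s' using dfn_eeeD[OF L env_map_const env_map_const env_map_id] .
  let ?P = "pair_trace I L"
  have smallP: "small (?P ` ?Q)" by (rule small_pair_traces[OF few I L LU LI])
  have ord: "order_data (?P q) (\<lambda>s. ?P q s s) I" if q: "deftype V q" for q
    unfolding order_data_def
  proof (intro conjI)
    have "dfn (\<lambda>p. q ((\<lambda>p. L (\<lambda>i. p (2 * i)) (\<lambda>i. p (Suc (2 * i)))) p))"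
      by (rule deftype_dfn[OF q L[unfolded dfn_eee_def] LV])
    then show P: "dfn_ee (?P q)"
      unfolding pair_trace_def by (intro dfn_eeI dfn_conj dfn_in_A[OF I] dfn_intros)
    show "dfn (\<lambda>s. ?P q s s)" by (intro dfn_eeD[OF P] dfn_intros)
    show P2: "supported2 I (?P q)"
      unfolding supported2_def
    proof (intro allI impI)
      fix x x' y y' :: "nat \<Rightarrow> 'a" assume a: "(\<forall>i\<in>I. x i = x' i) \<and> (\<forall>i\<in>I. y i = y' i)"
      then have "L x y = L x' y'" by (intro LI) auto
      then show "?P q x y = ?P q x' y'" using a unfolding pair_trace_def in_A_def by simp
    qed
    show "supported I (\<lambda>s. ?P q s s)" using P2 unfolding supported_def supported2_def by blast
    show "\<forall>z. ?P q z z \<longrightarrow> (\<forall>i\<in>I. z i \<in> A)" unfolding pair_trace_def in_A_def by blast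
    show "weak_order_on (\<lambda>s. ?P q s s) (?P q)"
      unfolding weak_order_on_def
    proof (intro conjI allI impI)
      fix s t assume a: "?P q s s \<and> ?P q t t"
      show "?P q s t \<or> ?P q t s"
      proof (rule ccontr)
        assume "\<not> (?P q s t \<or> ?P q t s)"
        then have n: "\<not> q (L s t)" "\<not> q (L t s)" using a unfolding pair_trace_def by blast+
        then have n': "q (\<lambda>x. \<not> L s t x)" "q (\<lambda>x. \<not> L t s x)" using deftype_not[OF q Ls LV] by blast+
        have y: "q (L s s)" "q (L t t)" using a unfolding pair_trace_def by blast+
        note c = deftype_conj[OF q]
        have "q (\<lambda>x. (\<not> L s t x \<and> \<not> L t s x) \<and> (L s s x \<and> L t t x))"
          using n' y by (simp add: c Ls LV dfn_not dfn_conj supported_ops(1,2))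
        from deftype_ex[OF q this] show False unfolding L_def using linear by blast
      qed
    next
      fix s t u assume a: "?P q s s \<and> ?P q t t \<and> ?P q u u \<and> ?P q s t \<and> ?P q t u"
      have "q (\<lambda>x. L s t x \<and> L t u x)" using a deftype_conj[OF q Ls LV Ls LV, of s t t u] unfolding pair_trace_def by blast
      then have "q (L s u)"
      proof (rule deftype_mono[OF q dfn_conj[OF Ls Ls] supported_ops(2)[OF LV LV] Ls LV])
        fix x assume "L s t x \<and> L t u x"
        then obtain z z' w w' where "F s x z" "F t x z'" "le z z'" "F t x w" "F u x w'" "le w w'"
          unfolding L_def by blast
        then show "L s u x" unfolding L_def using fn[of t x z' w] order.trans by blast
      qed
      then show "?P q s u" using a unfolding pair_trace_def by blast
    qed
  qed
  have "trace I (\<lambda>s x. \<exists>z. F s x z \<and> lt z (x m)) ` ?Q \<subseteq> (\<Union>T\<in>?P ` ?Q. cuts T (\<lambda>s. T s s) I)"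
  proof
    fix W assume "W \<in> trace I (\<lambda>s x. \<exists>z. F s x z \<and> lt z (x m)) ` ?Q"
    then obtain q where q: "deftype V q" and W: "W = trace I (\<lambda>s x. \<exists>z. F s x z \<and> lt z (x m)) q" by blast
    let ?B = "\<lambda>s x. \<exists>z. F s x z \<and> lt z (x m)"
    have "W \<in> cuts (?P q) (\<lambda>s. ?P q s s) I"
      unfolding cuts_def
    proof (intro CollectI conjI allI impI)
      show "dfn W" unfolding W trace_def
        by (intro dfn_conj dfn_in_A[OF I] deftype_dfn[OF q below_dfn belowV] dfn_intros)
      show "supported I W"
        unfolding supported_def
      proof (intro allI impI)
        fix s s' :: "nat \<Rightarrow> 'a" assume a: "\<forall>i\<in>I. s i = s' i"
        then have "F s = F s'" by (intro FI) auto
        then show "W s = W s'" using a unfolding W trace_def in_A_def by simp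
      qed
      fix s
      show "?P q s s" if "W s"
      proof -
        have "q (?B s)" using that unfolding W trace_def by blast
        then have "q (L s s)"
          by (rule deftype_mono[OF q sec[OF below_dfn] belowV Ls LV]) (auto simp: L_def)
        then show ?thesis using that unfolding W trace_def pair_trace_def by blast
      qed
      fix t assume a: "W t \<and> ?P q s s \<and> ?P q s t"
      then have "q (?B t)" "q (L s t)" unfolding W trace_def pair_trace_def by blast+
      then have "q (\<lambda>x. ?B t x \<and> L s t x)" using deftype_conj[OF q sec[OF below_dfn] belowV Ls LV] by blast
      then have "q (?B s)"
      proof (rule deftype_mono[OF q dfn_conj[OF sec[OF below_dfn] Ls] supported_ops(2)[OF belowV LV] sec[OF below_dfn] belowV])
        fix x assume "?B t x \<and> L s t x"
        then obtain z w w' where "F t x z" "lt z (x m)" "F s x w" "F t x w'" "le w w'" unfolding L_def by blast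
        then show "?B s x" using fn[of t x z w'] le_less_trans by blast
      qed
      then show "W s" using a unfolding W trace_def pair_trace_def by blast
    qed
    then show "W \<in> (\<Union>T\<in>?P ` ?Q. cuts T (\<lambda>s. T s s) I)" using q by blast
  qed
  moreover have "small (\<Union>T\<in>?P ` ?Q. cuts T (\<lambda>s. T s s) I)"
  proof (rule small_UN[OF smallP])
    fix T assume "T \<in> ?P ` ?Q"
    then show "small (cuts T (\<lambda>s. T s s) I)" using ord few_cuts[OF I] unfolding few_cuts_def by blast
  qed
  ultimately show "small (trace I (\<lambda>s x. \<exists>z. F s x z \<and> lt z (x m)) ` ?Q)" using small_subset by blast
  \<comment> \<open>If the new variable is the value at some \<open>s\<close>, then it is the value at \<open>s'\<close> just when both values agree.\<close>
  define M where "M s s' x \<longleftrightarrow> (\<exists>z. F s x z \<and> F s' x z)" for s s' x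
  have M: "dfn_eee M" unfolding M_def by (intro dfn_eeeI dfn_intros dfn_eevD[OF F(1)])
  have MU: "supported U (M s s')" for s s'
    unfolding M_def by (rule pairU[of "\<lambda>f g. \<exists>z. f z \<and> g z"])
  have MV: "supported V (M s s')" for s s' using supported_ops(3)[OF MU U(1)] .
  have MI: "M s s' = M t t'" if "\<And>i. i \<in> I \<Longrightarrow> s i = t i" "\<And>i. i \<in> I \<Longrightarrow> s' i = t' i" for s t s' t'
    unfolding M_def by (intro ext, rule pI[of s t s' t' "\<lambda>f g. \<exists>z. f _ z \<and> g _ z"]) (use that in auto)
  have Ms: "dfn (M s s')" for s s' using dfn_eeeD[OF M env_map_const env_map_const env_map_id] .
  have smallM: "small (pair_trace I M ` ?Q)" by (rule small_pair_traces[OF few I M MU MI])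
  let ?E = "{z. restr I z = z \<and> (\<forall>i\<in>I. z i \<in> A)}"
  have "trace I (\<lambda>s x. F s x (x m)) ` ?Q \<subseteq> insert (\<lambda>_. False) ((\<lambda>(s0, T) s. T s0 s) ` (?E \<times> pair_trace I M ` ?Q))"
  proof
    fix W assume "W \<in> trace I (\<lambda>s x. F s x (x m)) ` ?Q"
    then obtain q where q: "deftype V q" and W: "W = trace I (\<lambda>s x. F s x (x m)) q" by blast
    show "W \<in> insert (\<lambda>_. False) ((\<lambda>(s0, T) s. T s0 s) ` (?E \<times> pair_trace I M ` ?Q))"
    proof (cases "\<exists>s. W s")
      case False
      then have "W = (\<lambda>_. False)" by blast
      then show ?thesis by blast
    next
      case True
      then obtain s1 where s1: "in_A I s1" "q (\<lambda>x. F s1 x (x m))" unfolding W trace_def by blast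
      define s0 where "s0 = restr I s1"
      have "F s0 = F s1" by (rule FI) (simp add: s0_def restr_def)
      then have s0: "s0 \<in> ?E" "q (\<lambda>x. F s0 x (x m))" using s1 unfolding s0_def in_A_def restr_def by auto
      have "q (\<lambda>x. F s x (x m)) = q (M s0 s)" for s
      proof (rule deftype_cong[OF q sec[OF on_dfn] onV sec[OF on_dfn] onV Ms MV s0(2)])
        fix x assume "F s0 x (x m)"
        then show "F s x (x m) = M s0 s x" unfolding M_def using fn by blast
      qed
      then have "W = pair_trace I M q s0" using s0(1) unfolding W trace_def pair_trace_def in_A_def by (intro ext) auto
      then show ?thesis using s0(1) q by (intro insertI2 image_eqI[of _ _ "(s0, pair_trace I M q)"]) auto
    qed
  qed
  moreover have "small (insert (\<lambda>_. False) ((\<lambda>(s0, T) s. T s0 s) ` (?E \<times> pair_trace I M ` ?Q)))"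
    using small_Un[OF small_finite[of "{\<lambda>_. False}"] small_image[OF small_Times[OF small_envs[OF I] smallM]]] by simp
  ultimately show "small (trace I (\<lambda>s x. F s x (x m)) ` ?Q)" using small_subset by blast
qed

lemma less_gap_index_iff:
  assumes B: "finite B" shows "i < gap_index B y \<longleftrightarrow> (\<exists>b\<in>B. gap_index B b = i \<and> lt b y)"
proof -
  let ?C = "{b \<in> B. lt b y}"
  have sub: "gap_index B ` ?C \<subseteq> {..<gap_index B y}"
  proof
    fix k assume "k \<in> gap_index B ` ?C"
    then obtain b where b: "b \<in> B" "lt b y" "k = gap_index B b" by blast
    have "{b' \<in> B. lt b' b} \<subset> ?C" using b less_trans by blast
    then have "k < gap_index B y" unfolding b(3) gap_index_def using B by (intro psubset_card_mono) auto
    then show "k \<in> {..<gap_index B y}" by simp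
  qed
  have "inj_on (gap_index B) ?C" using gap_index_inj[OF B] by (intro inj_onI) auto
  then have "card (gap_index B ` ?C) = card {..<gap_index B y}" unfolding card_image[OF \<open>inj_on _ _\<close>] by (simp add: gap_index_def)
  then have "gap_index B ` ?C = {..<gap_index B y}" using sub by (intro card_subset_eq) auto
  then have "i \<in> {..<gap_index B y} \<longleftrightarrow> i \<in> gap_index B ` ?C" by simp
  then show ?thesis by auto
qed

text \<open>
  Whether \<open>R s\<close> holds at \<open>x\<close> is a function of finitely many conditions: whether the new coordinate equals,
  or lies above, the \<open>i\<close>-th boundary point of the corresponding subset of the line, and the truth values
  at the boundary points and between them. The former are treated by \<open>small_function_traces\<close>, the latter
  have one variable less.
\<close>

lemma few_traces_step:
  assumes few: "few_traces V U" and m: "m \<in> V" "m \<notin> U" and U: "U \<subseteq> V"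
  shows "few_traces V (insert m U)"
  unfolding few_traces_def
proof (intro allI impI)
  fix I R assume a: "finite I \<and> dfn_ee R \<and> (\<forall>s. supported (insert m U) (R s)) \<and> supported I R"
  then have I: "finite I" and R: "dfn_ee R" and RU: "\<And>s. supported (insert m U) (R s)" and RI: "supported I R" by blast+
  have RIeq: "R s = R s'" if "\<And>i. i \<in> I \<Longrightarrow> s i = s' i" for s s' using supportedD[OF RI that] .
  define X where "X s x y \<longleftrightarrow> R s (x(m := y))" for s x y
  have X: "dfn (\<lambda>e. X (\<sigma> e) (\<rho> e) (\<tau> e))" if "env_map \<sigma>" "env_map \<rho>" "coord_map \<tau>" for \<sigma> \<rho> \<tau>
    unfolding X_def by (intro dfn_eeD[OF R] env_map_upd that)
  have Xv: "dfn_v (X s x)" for s x by (intro dfn_vI X dfn_intros)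
  have XU: "X s x = X s x'" if "\<And>i. i \<in> U \<Longrightarrow> x i = x' i" for s x x'
    unfolding X_def by (rule ext, rule supportedD[OF RU]) (use that in auto)
  have X_self: "X s x (x m) = R s x" for s x unfolding X_def by simp
  define Bd where "Bd s x = bdry (X s x)" for s x
  have finB: "finite (Bd s x)" for s x unfolding Bd_def by (rule finite_bdry[OF Xv])
  have Bd_iff: "z \<in> Bd s x \<longleftrightarrow> \<not> nbhd z (\<lambda>y. X s x y = X s x z)" for s x z
    unfolding Bd_def using bdry_nbhd by blast
  have Bd: "dfn (\<lambda>e. \<tau> e \<in> Bd (\<sigma> e) (\<rho> e))" if "env_map \<sigma>" "env_map \<rho>" "coord_map \<tau>" for \<sigma> \<rho> \<tau>
    unfolding Bd_iff by (intro dfn_intros X that env_map_comp[OF that(1)] env_map_comp[OF that(2)] coord_map_comp[OF that(3)])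
  have BdU: "Bd s x = Bd s x'" if "\<And>i. i \<in> U \<Longrightarrow> x i = x' i" for s x x'
    using XU[OF that] unfolding Bd_def by simp
  have "dfn_ev (\<lambda>p z. z \<in> Bd (\<lambda>i. p (2 * i)) (\<lambda>i. p (Suc (2 * i))))"
    by (intro dfn_evI Bd dfn_intros)
  from uniform_finiteness[OF this] obtain N where "\<And>p. card {z. z \<in> Bd (\<lambda>i. p (2 * i)) (\<lambda>i. p (Suc (2 * i)))} \<le> N"
    using finB by auto
  from this[of "ilv _ _"] have N: "card (Bd s x) \<le> N" for s x by simp
  define g where "g s x z = gap_index (Bd s x) z" for s x z
  have g_le: "g s x z \<le> N" for s x z unfolding g_def using gap_index_le[OF finB] N le_trans by blast
  have g: "dfn (\<lambda>e. g (\<sigma> e) (\<rho> e) (\<tau> e) = i)" if "env_map \<sigma>" "env_map \<rho>" "coord_map \<tau>" for \<sigma> \<rho> \<tau> i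
  proof -
    let ?E = "\<lambda>p b. b \<in> Bd (\<lambda>i. p (2 * (2 * i))) (\<lambda>i. p (2 * Suc (2 * i))) \<and> lt b (p 1)"
    have "env_map (\<lambda>e. ilv (ilv (\<sigma> e) (\<rho> e)) (\<lambda>_. \<tau> e))"
      by (intro dfn_intros that) (use that(3) in \<open>simp add: env_map_def\<close>)
    then have "dfn (\<lambda>e. card {b. ?E (ilv (ilv (\<sigma> e) (\<rho> e)) (\<lambda>_. \<tau> e)) b} = i)"
      by (intro dfn_card_eq) (auto intro!: dfn_evI dfn_intros Bd intro: finite_subset[OF _ finB])
    moreover have one: "ilv s w 1 = w 0" for s w :: "nat \<Rightarrow> 'a" using ilv_simps(2)[of s w 0] by simp
    ultimately show ?thesis unfolding g_def gap_index_def ilv_simps one by simp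
  qed
  define F where "F i s x z \<longleftrightarrow> z \<in> Bd s x \<and> g s x z = i" for i s x z
  have Fd: "dfn (\<lambda>e. F i (\<sigma> e) (\<rho> e) (\<tau> e))" if "env_map \<sigma>" "env_map \<rho>" "coord_map \<tau>" for \<sigma> \<rho> \<tau> i
    unfolding F_def by (intro dfn_conj Bd g that)
  have F: "dfn_eev (F i)" for i by (intro dfn_eevI Fd dfn_intros)
  have gU: "g s x = g s x'" if "\<And>i. i \<in> U \<Longrightarrow> x i = x' i" for s x x'
    using BdU[OF that] unfolding g_def by (intro ext) simp
  have FU: "F i s x = F i s x'" if "\<And>i. i \<in> U \<Longrightarrow> x i = x' i" for i s x x'
    using BdU[of x x' s] gU[of x x' s] that unfolding F_def by (intro ext) simp
  have Fsupp: "supported U (\<lambda>x. F i s x z)" for i s z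
    unfolding supported_def using FU by metis
  have FI: "supported I (F i)" for i
    unfolding supported_def
  proof (intro allI impI)
    fix s s' :: "nat \<Rightarrow> 'a" assume "\<forall>i\<in>I. s i = s' i"
    then have "R s = R s'" by (intro RIeq) auto
    then show "F i s = F i s'" unfolding F_def g_def Bd_def X_def by simp
  qed
  have Ffn: "z = z'" if "F i s x z" "F i s x z'" for i s x z z'
    using that gap_index_inj[OF finB] unfolding F_def g_def by metis
  define P where "P k i s x \<longleftrightarrow> (if k = 0 then F i s x (x m) else if k = 1 then \<exists>z. F i s x z \<and> lt z (x m)
     else if k = 2 then \<exists>z. F i s x z \<and> X s x z else \<exists>z. z \<notin> Bd s x \<and> g s x z = i \<and> X s x z)" for k :: nat and i s x
  have Pd: "dfn_ee (P k i)" for k i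
  proof -
    consider "k = 0" | "k = 1" | "k = 2" | "k \<noteq> 0 \<and> k \<noteq> 1 \<and> k \<noteq> 2" by blast
    then show ?thesis unfolding P_def by cases (simp_all, (intro dfn_eeI dfn_intros Fd X Bd g)+)
  qed
  have PI: "supported I (P k i)" for k i
    unfolding supported_def
  proof (intro allI impI)
    fix s s' :: "nat \<Rightarrow> 'a" assume "\<forall>i\<in>I. s i = s' i"
    then have "R s = R s'" by (intro RIeq) auto
    then show "P k i s = P k i s'" unfolding P_def F_def g_def Bd_def X_def by simp
  qed
  have PU: "supported U (P k i s)" if "k \<noteq> 0" "k \<noteq> 1" for k i s
    unfolding supported_def
  proof (intro allI impI)
    fix x x' :: "nat \<Rightarrow> 'a" assume "\<forall>i\<in>U. x i = x' i"
    then have "F i s x = F i s x'" "X s x = X s x'" "Bd s x = Bd s x'" "g s x = g s x'"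
      using FU XU BdU gU by blast+
    then show "P k i s x = P k i s x'" using that unfolding P_def by simp
  qed
  have PV: "supported V (P k i s)" for k i s
    unfolding supported_def
  proof (intro allI impI)
    fix x x' :: "nat \<Rightarrow> 'a" assume "\<forall>i\<in>V. x i = x' i"
    then have "F i s x = F i s x'" "X s x = X s x'" "Bd s x = Bd s x'" "g s x = g s x'" "x m = x' m"
      using FU XU BdU gU U m by blast+
    then show "P k i s x = P k i s x'" unfolding P_def by simp
  qed
  have sm: "small (trace I (P k i) ` {q. deftype V q})" for k i
  proof -
    consider "k = 0" | "k = 1" | "k \<noteq> 0" "k \<noteq> 1" by blast
    then show ?thesis
    proof cases
      case 1
      then have "P k i = (\<lambda>s x. F i s x (x m))" unfolding P_def by (intro ext) simp
      then show ?thesis using small_function_traces(1)[OF few U m(1) I F Fsupp FI Ffn, of i] by simp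
    next
      case 2
      then have "P k i = (\<lambda>s x. \<exists>z. F i s x z \<and> lt z (x m))" unfolding P_def by (intro ext) simp
      then show ?thesis using small_function_traces(2)[OF few U m(1) I F Fsupp FI Ffn, of i] by simp
    next
      case 3
      then show ?thesis by (intro few_tracesD[OF few I Pd PU PI])
    qed
  qed
  have det: "R s x = R s x'" if eq: "\<And>k i. k < 4 \<Longrightarrow> i \<le> N \<Longrightarrow> P k i s x = P k i s x'" for s x x'
  proof -
    have on: "R s x = R s x'" if on: "x m \<in> Bd s x" and eq: "\<And>k i. k < 4 \<Longrightarrow> i \<le> N \<Longrightarrow> P k i s x = P k i s x'" for x x'
    proof -
      let ?i = "g s x (x m)"
      have 1: "F ?i s x (x m)" using on unfolding F_def by simp
      then have 2: "F ?i s x' (x' m)" using eq[of 0 ?i] g_le unfolding P_def by simp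
      have P2: "P 2 ?i s y = (\<exists>z. F ?i s y z \<and> X s y z)" for y by (simp add: P_def)
      have "P 2 ?i s x = X s x (x m)" unfolding P2 using 1 Ffn[OF _ 1] by blast
      moreover have "P 2 ?i s x' = X s x' (x' m)" unfolding P2 using 2 Ffn[OF _ 2] by blast
      ultimately show ?thesis using eq[of 2 ?i] g_le X_self by simp
    qed
    show ?thesis
    proof (cases "x m \<in> Bd s x \<or> x' m \<in> Bd s x'")
      case True then show ?thesis using on[of x x'] on[of x' x] eq by metis
    next
      case False
      have P1: "P 1 i s x \<longleftrightarrow> i < g s x (x m)" for i x
        unfolding P_def F_def g_def less_gap_index_iff[OF finB] by auto
      have gg: "g s x (x m) = g s x' (x' m)"
      proof (rule ccontr)
        assume "g s x (x m) \<noteq> g s x' (x' m)"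
        then have "\<exists>i\<le>N. (i < g s x (x m)) \<noteq> (i < g s x' (x' m))"
          using g_le[of s x "x m"] g_le[of s x' "x' m"] by (meson linorder_neqE_nat nat_less_le Nat.le_trans)
        then show False using eq[of 1] P1 by auto
      qed
      have P3: "P 3 (g s x (x m)) s x \<longleftrightarrow> R s x" if x: "x m \<notin> Bd s x" for x
      proof
        assume "R s x"
        then show "P 3 (g s x (x m)) s x" using x X_self unfolding P_def by auto
      next
        assume "P 3 (g s x (x m)) s x"
        then obtain z where z: "z \<notin> Bd s x" "g s x z = g s x (x m)" "X s x z" unfolding P_def by auto
        obtain p q where pq: "lt p z" "lt z q" "lt p (x m)" "lt (x m) q" "\<And>y. lt p y \<Longrightarrow> lt y q \<Longrightarrow> y \<notin> Bd s x"
          by (rule same_gap[OF finB z(1) x z(2)[unfolded g_def]]) (rule that)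
        have "X s x z = X s x (x m)" using const_on_interval[OF Xv pq(5)[unfolded Bd_def] pq(1-4)] .
        then show "R s x" using z(3) X_self by simp
      qed
      show ?thesis using eq[of 3 "g s x (x m)"] g_le P3[of x] P3[of x'] False gg by simp
    qed
  qed
  show "small (trace I R ` {q. deftype V q})"
  proof (rule small_determined[of "{..<4} \<times> {..N}" "\<lambda>(k, i). trace I (P k i)"])
    show "small ((case ki of (k, i) \<Rightarrow> trace I (P k i)) ` {q. deftype V q})" for ki :: "nat \<times> nat"
      using sm by (cases ki) simp
    fix q q' assume q: "q \<in> {q. deftype V q}" "q' \<in> {q. deftype V q}"
      and eq: "\<And>ki. ki \<in> {..<4} \<times> {..N} \<Longrightarrow> (case ki of (k, i) \<Rightarrow> trace I (P k i)) q = (case ki of (k, i) \<Rightarrow> trace I (P k i)) q'"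
    have "q (R s) = q' (R s)" if s: "in_A I s" for s
    proof (rule deftype_determined[of V q q' "(\<lambda>(k, i). P k i s) ` ({..<4} \<times> {..N})"])
      show "deftype V q" "deftype V q'" using q by auto
      show "dfn Q \<and> supported V Q" if "Q \<in> (\<lambda>(k, i). P k i s) ` ({..<4} \<times> {..N})" for Q
        using that PV dfn_eeD[OF Pd env_map_const env_map_id] by auto
      show "dfn (R s)" by (intro dfn_eeD[OF R] dfn_intros)
      show "supported V (R s)" using supported_ops(3)[OF RU] m(1) U by blast
      show "R s x = R s x'" if "\<And>Q. Q \<in> (\<lambda>(k, i). P k i s) ` ({..<4} \<times> {..N}) \<Longrightarrow> Q x = Q x'" for x x'
        by (rule det, rule that) auto
      fix Q assume "Q \<in> (\<lambda>(k, i). P k i s) ` ({..<4} \<times> {..N})"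
      then obtain k i where ki: "(k, i) \<in> {..<4} \<times> {..N}" "Q = P k i s" by blast
      have "trace I (P k i) q s = trace I (P k i) q' s" using eq[OF ki(1)] by simp
      then show "q Q = q' Q" using s ki(2) unfolding trace_def by simp
    qed simp
    then show "trace I R q = trace I R q'" unfolding trace_def by blast
  qed simp
qed

theorem few_traces: "finite V \<Longrightarrow> few_traces V V"
proof -
  assume V: "finite V"
  have "finite U \<Longrightarrow> U \<subseteq> V \<Longrightarrow> few_traces V U" for U
  proof (induction U rule: finite_induct)
    case empty then show ?case using few_traces_empty by blast
  next
    case (insert m U)
    then show ?case by (intro few_traces_step) auto
  qed
  then show ?thesis using V by blast
qed

end

section \<open>Formulas and definable predicates\<close>

lemma trm_val_cong: "(\<And>v. v \<in> trm_vars t \<Longrightarrow> e v = e' v) \<Longrightarrow> trm_val M e t = trm_val M e' t"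
proof (induction t)
  case (Fun f ts)
  have "map (trm_val M e) ts = map (trm_val M e') ts"
    by (rule map_cong[OF refl], rule Fun.IH) (use Fun.prems in auto)
  then show ?case by (metis trm_val.simps(3))
qed auto

lemma sat_cong: "(\<And>v. v \<in> free_vars \<phi> \<Longrightarrow> e v = e' v) \<Longrightarrow> sat M e \<phi> = sat M e' \<phi>"
proof (induction \<phi> arbitrary: e e')
  case (Eq t u)
  have "trm_val M e t = trm_val M e' t" by (rule trm_val_cong) (rule Eq, simp)
  moreover have "trm_val M e u = trm_val M e' u" by (rule trm_val_cong) (rule Eq, simp)
  ultimately show ?case by simp
next
  case (Rel r ts)
  have "map (trm_val M e) ts = map (trm_val M e') ts"
    by (rule map_cong[OF refl], rule trm_val_cong, rule Rel) auto
  then show ?case by (metis sat.simps(2))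
next
  case (Neg \<phi>)
  have "sat M e \<phi> = sat M e' \<phi>" by (rule Neg.IH, rule Neg.prems) simp
  then show ?case by simp
next
  case (Conj \<phi> \<psi>)
  have "sat M e \<phi> = sat M e' \<phi>" by (rule Conj.IH, rule Conj.prems) simp
  moreover have "sat M e \<psi> = sat M e' \<psi>" by (rule Conj.IH, rule Conj.prems) simp
  ultimately show ?case by simp
next
  case (Ex v \<phi>)
  have "sat M (e(v := a)) \<phi> = sat M (e'(v := a)) \<phi>" for a
  proof (rule Ex.IH)
    fix w assume "w \<in> free_vars \<phi>"
    then show "(e(v := a)) w = (e'(v := a)) w" using Ex.prems[of w] by (cases "w = v") simp_all
  qed
  then show ?case by simp
qed

lemma finite_trm_vars: "finite (trm_vars t)"
  by (induction t) auto

lemma finite_free_vars: "finite (free_vars \<phi>)"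
  by (induction \<phi>) (auto simp: finite_trm_vars)

lemma finite_trm_params: "finite (trm_params t)"
  by (induction t) auto

lemma finite_params: "finite (params \<phi>)"
  by (induction \<phi>) (auto simp: finite_trm_params)

text \<open>
  Includes the bound variables, so that a variable outside it may be substituted without capture.
\<close>

primrec all_vars :: "('f, 'r, 'm) fm \<Rightarrow> nat set" where
  "all_vars (Eq t u) = trm_vars t \<union> trm_vars u"
| "all_vars (Rel r ts) = \<Union> (set (map trm_vars ts))"
| "all_vars (Neg \<phi>) = all_vars \<phi>"
| "all_vars (Conj \<phi> \<psi>) = all_vars \<phi> \<union> all_vars \<psi>"
| "all_vars (Ex v \<phi>) = insert v (all_vars \<phi>)"

lemma finite_all_vars: "finite (all_vars \<phi>)"
  by (induction \<phi>) (auto simp: finite_trm_vars)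

primrec subst_trm :: "(nat \<Rightarrow> ('f, 'm) trm) \<Rightarrow> ('m \<Rightarrow> ('f, 'm) trm) \<Rightarrow> ('f, 'm) trm \<Rightarrow> ('f, 'm) trm" where
  "subst_trm g h (Var v) = g v"
| "subst_trm g h (Par a) = h a"
| "subst_trm g h (Fun f ts) = Fun f (map (subst_trm g h) ts)"

lemma trm_val_subst_trm:
  "(\<And>v. v \<in> trm_vars t \<Longrightarrow> trm_val M e (g v) = e' v) \<Longrightarrow> (\<And>a. a \<in> trm_params t \<Longrightarrow> trm_val M e (h a) = a) \<Longrightarrow>
    trm_val M e (subst_trm g h t) = trm_val M e' t"
proof (induction t)
  case (Fun f ts)
  have "map (trm_val M e) (map (subst_trm g h) ts) = map (trm_val M e') ts"
    unfolding map_map comp_def by (rule map_cong[OF refl], rule Fun.IH) (use Fun.prems in auto)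
  then show ?case by (metis subst_trm.simps(3) trm_val.simps(3))
qed auto

lemma wf_subst_trm:
  "wf_trm L t \<Longrightarrow> (\<And>v. wf_trm L (g v)) \<Longrightarrow> (\<And>a. wf_trm L (h a)) \<Longrightarrow> wf_trm L (subst_trm g h t)"
  by (induction t) (auto simp: list_all_iff)

primrec rename_fm :: "(nat \<Rightarrow> nat) \<Rightarrow> ('f, 'r, 'm) fm \<Rightarrow> ('f, 'r, 'm) fm" where
  "rename_fm g (Eq t u) = Eq (subst_trm (\<lambda>v. Var (g v)) Par t) (subst_trm (\<lambda>v. Var (g v)) Par u)"
| "rename_fm g (Rel r ts) = Rel r (map (subst_trm (\<lambda>v. Var (g v)) Par) ts)"
| "rename_fm g (Neg \<phi>) = Neg (rename_fm g \<phi>)"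
| "rename_fm g (Conj \<phi> \<psi>) = Conj (rename_fm g \<phi>) (rename_fm g \<psi>)"
| "rename_fm g (Ex v \<phi>) = Ex (g v) (rename_fm g \<phi>)"

lemma sat_rename_fm: "inj g \<Longrightarrow> sat M e (rename_fm g \<phi>) = sat M (\<lambda>v. e (g v)) \<phi>"
proof (induction \<phi> arbitrary: e)
  case (Eq t u)
  have "trm_val M e (subst_trm (\<lambda>v. Var (g v)) Par t) = trm_val M (\<lambda>v. e (g v)) t" for t :: "('a, 'c) trm"
    by (rule trm_val_subst_trm) auto
  then show ?case by simp
next
  case (Rel r ts)
  have "map (trm_val M e) (map (subst_trm (\<lambda>v. Var (g v)) Par) ts) = map (trm_val M (\<lambda>v. e (g v))) ts"
    unfolding map_map comp_def by (rule map_cong[OF refl], rule trm_val_subst_trm) auto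
  then show ?case by (metis rename_fm.simps(2) sat.simps(2))
next
  case (Ex v \<phi>)
  have "(\<lambda>w. (e(g v := a)) (g w)) = (\<lambda>w. e (g w))(v := a)" for a
    using Ex.prems by (auto simp: inj_def)
  then show ?case using Ex by simp
qed auto

lemma wf_rename_fm: "wf_fm L \<phi> \<Longrightarrow> wf_fm L (rename_fm g \<phi>)"
  by (induction \<phi>) (auto simp: list_all_iff intro!: wf_subst_trm)

text \<open>
  Replaces each parameter \<open>a\<close> by the variable \<open>h a\<close>. With \<open>h\<close> injective into unused variables,
  substituting the parameters again gives back the original formula (\<open>abstraction_inst\<close>).
\<close>

primrec abstract_fm :: "('m \<Rightarrow> nat) \<Rightarrow> ('f, 'r, 'm) fm \<Rightarrow> ('f, 'r, 'm) fm" where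
  "abstract_fm h (Eq t u) = Eq (subst_trm Var (\<lambda>a. Var (h a)) t) (subst_trm Var (\<lambda>a. Var (h a)) u)"
| "abstract_fm h (Rel r ts) = Rel r (map (subst_trm Var (\<lambda>a. Var (h a))) ts)"
| "abstract_fm h (Neg \<phi>) = Neg (abstract_fm h \<phi>)"
| "abstract_fm h (Conj \<phi> \<psi>) = Conj (abstract_fm h \<phi>) (abstract_fm h \<psi>)"
| "abstract_fm h (Ex v \<phi>) = Ex v (abstract_fm h \<phi>)"

lemma wf_abstract_fm: "wf_fm L \<phi> \<Longrightarrow> wf_fm L (abstract_fm h \<phi>)"
  by (induction \<phi>) (auto simp: list_all_iff intro!: wf_subst_trm)

lemma params_abstract_trm: "trm_params (subst_trm Var (\<lambda>a. Var (h a)) t) = {}"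
  by (induction t) auto

lemma params_abstract_fm: "params (abstract_fm h \<phi>) = {}"
  by (induction \<phi>) (auto simp: params_abstract_trm)

lemma trm_vars_abstract: "trm_vars (subst_trm Var (\<lambda>a. Var (h a)) t) = trm_vars t \<union> h ` trm_params t"
  by (induction t) auto

lemma free_vars_abstract_fm: "free_vars (abstract_fm h \<phi>) \<subseteq> free_vars \<phi> \<union> h ` params \<phi>"
  by (induction \<phi>) (auto simp: trm_vars_abstract)

lemma inst_abstract_trm:
  "(\<And>a. a \<in> trm_params t \<Longrightarrow> s (h a) = Some a) \<Longrightarrow> (\<And>v. v \<in> trm_vars t \<Longrightarrow> s v = None) \<Longrightarrow>
    inst_trm s (subst_trm Var (\<lambda>a. Var (h a)) t) = t"
proof (induction t)
  case (Fun f ts)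
  have "inst_trm s (subst_trm Var (\<lambda>a. Var (h a)) t) = t" if "t \<in> set ts" for t
    using that by (rule Fun.IH) (rule Fun.prems, use that in auto)+
  then show ?case by (simp add: map_idI)
qed auto

lemma inst_abstract_fm:
  "(\<And>a. a \<in> params \<phi> \<Longrightarrow> s (h a) = Some a) \<Longrightarrow> (\<And>v. v \<in> all_vars \<phi> \<Longrightarrow> s v = None) \<Longrightarrow>
    (\<And>a. a \<in> params \<phi> \<Longrightarrow> h a \<notin> all_vars \<phi>) \<Longrightarrow> inst_fm s (abstract_fm h \<phi>) = \<phi>"
proof (induction \<phi> arbitrary: s)
  case (Rel r ts)
  have "inst_trm s (subst_trm Var (\<lambda>a. Var (h a)) t) = t" if "t \<in> set ts" for t
    by (rule inst_abstract_trm) (rule Rel.prems(1,2), use that in auto)+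
  then show ?case by (simp add: map_idI)
next
  case (Ex v \<phi>)
  show ?case by simp (rule Ex.IH; use Ex.prems in auto)
qed (auto intro!: inst_abstract_trm)

lemma sat_abstract_fm:
  "(\<And>a. a \<in> params \<phi> \<Longrightarrow> e (h a) = a) \<Longrightarrow> (\<And>a. a \<in> params \<phi> \<Longrightarrow> h a \<notin> all_vars \<phi>) \<Longrightarrow>
    sat M e (abstract_fm h \<phi>) = sat M e \<phi>"
proof (induction \<phi> arbitrary: e)
  case (Eq t u)
  have "trm_val M e (subst_trm Var (\<lambda>a. Var (h a)) t) = trm_val M e t" by (rule trm_val_subst_trm) (simp_all add: Eq)
  moreover have "trm_val M e (subst_trm Var (\<lambda>a. Var (h a)) u) = trm_val M e u" by (rule trm_val_subst_trm) (simp_all add: Eq)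
  ultimately show ?case by simp
next
  case (Rel r ts)
  have "map (trm_val M e) (map (subst_trm Var (\<lambda>a. Var (h a))) ts) = map (trm_val M e) ts"
    unfolding map_map comp_def by (rule map_cong[OF refl], rule trm_val_subst_trm) (use Rel in auto)
  then show ?case by (metis abstract_fm.simps(2) sat.simps(2))
next
  case (Neg \<phi>)
  have "sat M e (abstract_fm h \<phi>) = sat M e \<phi>" by (rule Neg.IH) (use Neg.prems in simp_all)
  then show ?case by simp
next
  case (Conj \<phi> \<psi>)
  have "sat M e (abstract_fm h \<phi>) = sat M e \<phi>" by (rule Conj.IH) (use Conj.prems in simp_all)
  moreover have "sat M e (abstract_fm h \<psi>) = sat M e \<psi>" by (rule Conj.IH) (use Conj.prems in simp_all)
  ultimately show ?case by simp
next
  case (Ex v \<phi>)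
  have "sat M (e(v := b)) (abstract_fm h \<phi>) = sat M (e(v := b)) \<phi>" for b
    by (rule Ex.IH) (use Ex.prems in \<open>auto split: if_splits\<close>)
  then show ?case by simp
qed

text \<open>
  The semantic counterpart of \<open>inst_fm\<close>, see \<open>sat_inst_fm\<close>.
\<close>

definition override :: "(nat \<Rightarrow> 'm) \<Rightarrow> (nat \<rightharpoonup> 'm) \<Rightarrow> nat \<Rightarrow> 'm" where
  "override e s = (\<lambda>v. case s v of None \<Rightarrow> e v | Some a \<Rightarrow> a)"

lemma trm_val_inst: "trm_val M e (inst_trm s t) = trm_val M (override e s) t"
proof (induction t)
  case (Fun f ts)
  have "map (trm_val M e) (map (inst_trm s) ts) = map (trm_val M (override e s)) ts"
    unfolding map_map comp_def by (rule map_cong[OF refl], rule Fun.IH) auto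
  then show ?case by (metis inst_trm.simps(3) trm_val.simps(3))
qed (auto simp: override_def split: option.splits)

lemma sat_inst_fm: "sat M e (inst_fm s \<phi>) = sat M (override e s) \<phi>"
proof (induction \<phi> arbitrary: e s)
  case (Rel r ts)
  have "map (trm_val M e) (map (inst_trm s) ts) = map (trm_val M (override e s)) ts"
    unfolding map_map comp_def by (rule map_cong[OF refl], rule trm_val_inst)
  then show ?case by (metis inst_fm.simps(2) sat.simps(2))
next
  case (Ex v \<phi>)
  have "override (e(v := a)) (s(v := None)) = (override e s)(v := a)" for a
  proof (rule ext)
    fix w show "override (e(v := a)) (s(v := None)) w = ((override e s)(v := a)) w"
      by (cases "w = v") (simp_all add: override_def split: option.split)
  qed
  then show ?case by (simp only: inst_fm.simps sat.simps Ex.IH)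
qed (auto simp: trm_val_inst)

lemma wf_inst_trm: "wf_trm L t \<Longrightarrow> wf_trm L (inst_trm s t)"
  by (induction t) (auto simp: list_all_iff split: option.splits)

lemma wf_inst_fm: "wf_fm L \<phi> \<Longrightarrow> wf_fm L (inst_fm s \<phi>)"
  by (induction \<phi> arbitrary: s) (auto simp: list_all_iff wf_inst_trm)

lemma trm_vars_inst: "trm_vars (inst_trm s t) = trm_vars t - dom s"
  by (induction t) (auto split: option.splits)

lemma free_vars_inst: "free_vars (inst_fm s \<phi>) = free_vars \<phi> - dom s"
  by (induction \<phi> arbitrary: s) (auto simp: trm_vars_inst)

lemma trm_params_inst: "trm_params (inst_trm s t) \<subseteq> trm_params t \<union> ran s"
  by (induction t) (auto split: option.splits simp: ran_def)

lemma ran_upd_None: "ran (s(v := None)) \<subseteq> ran s"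
  by (auto simp: ran_def)

lemma params_inst: "params (inst_fm s \<phi>) \<subseteq> params \<phi> \<union> ran s"
proof (induction \<phi> arbitrary: s)
  case (Ex v \<phi>)
  show ?case using Ex[of "s(v := None)"] ran_upd_None[of s v] unfolding inst_fm.simps fm.set by blast
qed (use trm_params_inst in fastforce)+

lemma map_upds_nth:
  assumes "distinct y" "length b = length y" "i < length y" shows "[y [\<mapsto>] b] (y ! i) = Some (b ! i)"
proof -
  have "map fst (rev (zip y b)) = rev y" using assms(2) by (simp add: rev_map[symmetric])
  then have "distinct (map fst (rev (zip y b)))" using assms(1) by simp
  moreover have "(y ! i, b ! i) \<in> set (rev (zip y b))" using assms(2,3) by (auto simp: set_zip)
  ultimately show ?thesis unfolding map_upds_def by simp
qed

lemma map_upds_None: "v \<notin> set y \<Longrightarrow> [y [\<mapsto>] b] v = None"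
  by (simp add: map_upds_apply_nontin)

definition dfn_in :: "('f, 'r) language \<Rightarrow> ('f, 'r, 'm) struct \<Rightarrow> ((nat \<Rightarrow> 'm) \<Rightarrow> bool) \<Rightarrow> bool" where
  "dfn_in L M P \<longleftrightarrow> (\<exists>\<phi>. wf_fm L \<phi> \<and> (\<forall>e. P e = sat M e \<phi>))"

lemma dfn_in_not: "dfn_in L M P \<Longrightarrow> dfn_in L M (\<lambda>e. \<not> P e)"
proof -
  assume "dfn_in L M P"
  then obtain \<phi> where "wf_fm L \<phi>" "\<And>e. P e = sat M e \<phi>" unfolding dfn_in_def by blast
  then show ?thesis unfolding dfn_in_def by (intro exI[of _ "Neg \<phi>"]) simp
qed

lemma dfn_in_conj: "dfn_in L M P \<Longrightarrow> dfn_in L M Q \<Longrightarrow> dfn_in L M (\<lambda>e. P e \<and> Q e)"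
proof -
  assume "dfn_in L M P" "dfn_in L M Q"
  then obtain \<phi> \<psi> where "wf_fm L \<phi>" "\<And>e. P e = sat M e \<phi>" "wf_fm L \<psi>" "\<And>e. Q e = sat M e \<psi>"
    unfolding dfn_in_def by blast
  then show ?thesis unfolding dfn_in_def by (intro exI[of _ "Conj \<phi> \<psi>"]) simp
qed

lemma finite_nat_bound: "finite S \<Longrightarrow> \<exists>k::nat. \<forall>v\<in>S. v < k"
  by (simp add: finite_nat_set_iff_bounded)

lemma dfn_in_support: "dfn_in L M P \<Longrightarrow> \<exists>k. supported {..<k} P"
proof -
  assume "dfn_in L M P"
  then obtain \<phi> where \<phi>: "\<And>e. P e = sat M e \<phi>" unfolding dfn_in_def by blast
  obtain k where k: "\<forall>v\<in>free_vars \<phi>. v < k" using finite_nat_bound[OF finite_free_vars] by blast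
  have "supported {..<k} P" unfolding supported_def \<phi> by (intro allI impI sat_cong) (use k in auto)
  then show ?thesis by blast
qed

text \<open>
  The variable \<open>0\<close> is renamed to an unused variable \<open>k\<close> and the variables below \<open>k\<close> are shifted back, by an
  injective map, since only such renamings commute with quantifiers.
\<close>

lemma dfn_in_ex:
  assumes "dfn_in L M (\<lambda>e. R (\<lambda>i. e (Suc i)) (e 0))" shows "dfn_in L M (\<lambda>e. \<exists>a. R e a)"
proof -
  obtain \<phi> where \<phi>: "wf_fm L \<phi>" "\<And>e. R (\<lambda>i. e (Suc i)) (e 0) = sat M e \<phi>" using assms unfolding dfn_in_def by blast
  obtain k where k: "\<forall>v\<in>free_vars \<phi>. v < k" using finite_nat_bound[OF finite_free_vars] by blast
  define g where "g v = (if v = 0 then k else if v \<le> k then v - 1 else v)" for v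
  have "inj g" unfolding inj_def g_def by auto
  have "R e a = sat M (e(k := a)) (rename_fm g \<phi>)" for e a
  proof -
    have "R e a = sat M (case_nat a e) \<phi>" using \<phi>(2)[of "case_nat a e"] by simp
    also have "\<dots> = sat M (\<lambda>v. (e(k := a)) (g v)) \<phi>"
    proof (rule sat_cong)
      fix v assume "v \<in> free_vars \<phi>"
      then have "v < k" using k by blast
      then show "case_nat a e v = (e(k := a)) (g v)" by (cases v) (auto simp: g_def)
    qed
    finally show ?thesis by (simp add: sat_rename_fm[OF \<open>inj g\<close>])
  qed
  note R = this
  have "(\<exists>a. R e a) = sat M e (Ex k (rename_fm g \<phi>))" for e by (simp only: sat.simps(5) R)
  then show ?thesis unfolding dfn_in_def
    by (intro exI[of _ "Ex k (rename_fm g \<phi>)"]) (simp only: wf_fm.simps wf_rename_fm[OF \<phi>(1)] simp_thms)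
qed

lemma coord_map_trm: "coord_map \<tau> \<Longrightarrow> \<exists>t. (\<forall>e. trm_val M e t = \<tau> e) \<and> wf_trm L t"
  unfolding coord_map_def
proof (elim disjE exE)
  fix j assume "\<tau> = (\<lambda>e. e j)" then show ?thesis by (intro exI[of _ "Var j"]) simp
next
  fix c assume "\<tau> = (\<lambda>_. c)" then show ?thesis by (intro exI[of _ "Par c"]) simp
qed

lemma subst_trm_env_map:
  fixes L :: "('f, 'r) language" and M :: "('f, 'r, 'm) struct"
  assumes "env_map \<sigma>"
  obtains g where "\<And>v. wf_trm L (g v)" "\<And>e t. trm_val M e (subst_trm g Par t) = trm_val M (\<sigma> e) t"
proof -
  have "\<exists>t. (\<forall>e. trm_val M e t = \<sigma> e v) \<and> wf_trm L t" for v
    by (rule coord_map_trm[OF env_map_coord[OF assms]])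
  then obtain g where g: "\<And>v e. trm_val M e (g v) = \<sigma> e v" "\<And>v. wf_trm L (g v)" by metis
  have "trm_val M e (subst_trm g Par t) = trm_val M (\<sigma> e) t" for e t
    by (rule trm_val_subst_trm) (auto simp: g(1))
  then show ?thesis using that g(2) by blast
qed

text \<open>
  Under a quantifier the substitution is shifted by one and the bound variable becomes coordinate \<open>0\<close>, which
  avoids capture; \<open>dfn_in_ex\<close> turns the result into a formula.
\<close>

lemma dfn_in_subst_sat:
  fixes L :: "('f, 'r) language" and M :: "('f, 'r, 'm) struct"
  shows "wf_fm L \<phi> \<Longrightarrow> env_map \<sigma> \<Longrightarrow> dfn_in L M (\<lambda>e. sat M (\<sigma> e) \<phi>)"
proof (induction \<phi> arbitrary: \<sigma>)
  case (Eq t u)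
  obtain g where g: "\<And>v. wf_trm L (g v)" "\<And>e t. trm_val M e (subst_trm g Par t) = trm_val M (\<sigma> e) t"
    by (rule subst_trm_env_map[OF Eq.prems(2), of L M]) (rule that)
  show ?case unfolding dfn_in_def
    by (rule exI[of _ "Eq (subst_trm g Par t) (subst_trm g Par u)"])
      (use Eq.prems(1) g in \<open>auto intro!: wf_subst_trm\<close>)
next
  case (Rel r ts)
  obtain g where g: "\<And>v. wf_trm L (g v)" "\<And>e t. trm_val M e (subst_trm g Par t) = trm_val M (\<sigma> e) t"
    by (rule subst_trm_env_map[OF Rel.prems(2), of L M]) (rule that)
  show ?case unfolding dfn_in_def
    by (rule exI[of _ "Rel r (map (subst_trm g Par) ts)"])
      (use Rel.prems(1) g in \<open>auto intro!: wf_subst_trm simp: list_all_iff comp_def\<close>)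
next
  case (Neg \<phi>)
  then show ?case by (simp add: dfn_in_not)
next
  case (Conj \<phi> \<psi>)
  then show ?case by (simp add: dfn_in_conj)
next
  case (Ex v \<phi>)
  have "dfn_in L M (\<lambda>e. sat M ((\<sigma> (\<lambda>i. e (Suc i)))(v := e 0)) \<phi>)"
  proof (rule Ex.IH)
    show "env_map (\<lambda>e. (\<sigma> (\<lambda>i. e (Suc i)))(v := e 0))"
      by (rule env_map_upd[OF env_map_comp[OF Ex.prems(2) env_map_reindex] coord_map_var])
  qed (use Ex.prems in simp)
  from dfn_in_ex[OF this] show ?case by (simp only: sat.simps)
qed

lemma dfn_in_subst: "dfn_in L M P \<Longrightarrow> env_map \<sigma> \<Longrightarrow> dfn_in L M (\<lambda>e. P (\<sigma> e))"
proof -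
  assume "dfn_in L M P" "env_map \<sigma>"
  then obtain \<phi> where \<phi>: "wf_fm L \<phi>" "\<And>e. P e = sat M e \<phi>" unfolding dfn_in_def by blast
  show ?thesis unfolding \<phi>(2) using \<phi>(1) \<open>env_map \<sigma>\<close> by (rule dfn_in_subst_sat)
qed

lemma fresh_abstraction:
  fixes \<phi> :: "('f, 'r, 'm) fm"
  obtains h ps where "distinct ps" "set ps = params \<phi>" "inj_on h (set ps)" "\<And>a. a \<in> params \<phi> \<Longrightarrow> B \<le> h a \<and> h a \<notin> all_vars \<phi>"
proof -
  obtain ps where ps: "set ps = params \<phi>" "distinct ps" using finite_distinct_list[OF finite_params[of \<phi>]] by auto
  obtain k where k: "\<forall>v\<in>all_vars \<phi>. v < k" using finite_nat_bound[OF finite_all_vars[of \<phi>]] by auto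
  obtain pos :: "'m \<Rightarrow> nat" where pos: "inj_on pos (set ps)"
    using finite_imp_inj_to_nat_seg[OF finite_set, of ps] by auto
  define h where "h a = B + k + pos a" for a
  have "inj_on h (set ps)" using pos unfolding inj_on_def h_def by simp
  moreover have "B \<le> h a \<and> h a \<notin> all_vars \<phi>" for a
    using bspec[OF k, of "h a"] unfolding h_def by auto
  ultimately show ?thesis using that[OF ps(2,1)] by blast
qed

lemma map_upds_map:
  assumes "inj_on h (set ps)" "distinct ps" "a \<in> set ps" shows "[map h ps [\<mapsto>] ps] (h a) = Some a"
proof -
  obtain i where i: "i < length ps" "a = ps ! i" using assms(3) by (metis in_set_conv_nth)
  have "distinct (map h ps)" using assms by (simp add: distinct_map)
  from map_upds_nth[OF this _, of ps i] i show ?thesis by simp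
qed

lemma abstraction_inst:
  fixes \<phi> :: "('f, 'r, 'm) fm"
  assumes "distinct ps" "set ps = params \<phi>" "inj_on h (set ps)" "\<And>a. a \<in> params \<phi> \<Longrightarrow> h a \<notin> all_vars \<phi>"
  shows "inst (map h ps) ps (abstract_fm h \<phi>) = \<phi>"
  unfolding inst_def
proof (rule inst_abstract_fm)
  show "[map h ps [\<mapsto>] ps] (h a) = Some a" if "a \<in> params \<phi>" for a
    using map_upds_map[OF assms(3,1)] that assms(2) by blast
  show "[map h ps [\<mapsto>] ps] v = None" if "v \<in> all_vars \<phi>" for v
    using assms(2,4) that by (intro map_upds_None) auto
qed (fact assms(4))

lemma sat_inst: "sat M e (inst y b \<phi>) = sat M (override e [y [\<mapsto>] b]) \<phi>"
  unfolding inst_def by (rule sat_inst_fm)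

lemma override_nth:
  assumes "distinct y" "length b = length y" "i < length y" shows "override e [y [\<mapsto>] b] (y ! i) = b ! i"
  using map_upds_nth[OF assms] by (simp add: override_def)

lemma override_notin: "v \<notin> set y \<Longrightarrow> override e [y [\<mapsto>] b] v = e v"
  using map_upds_None[of v y b] by (simp add: override_def)

lemma override_map_upds_cong:
  assumes "distinct y" "length b = length y" "v \<in> set y" shows "override e [y [\<mapsto>] b] v = override e' [y [\<mapsto>] b] v"
proof -
  obtain i where "i < length y" "v = y ! i" using assms(3) by (metis in_set_conv_nth)
  then show ?thesis using override_nth[OF assms(1,2)] by metis
qed

lemma models_inst:
  assumes "distinct y" "length b = length y" "free_vars \<psi> \<subseteq> set y"
  shows "models M (inst y b \<psi>) \<longleftrightarrow> sat M (override e [y [\<mapsto>] b]) \<psi>"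
proof -
  have "sat M (override e' [y [\<mapsto>] b]) \<psi> = sat M (override e [y [\<mapsto>] b]) \<psi>" for e'
    by (rule sat_cong) (use override_map_upds_cong[OF assms(1,2)] assms(3) in blast)
  then show ?thesis unfolding models_def sat_inst by blast
qed

text \<open>
  The parameters of the formula and the values of its other free variables are collected into the tuple \<open>c\<close>.
\<close>

lemma definable_subset_dfn_in:
  assumes "dfn_in L M P" shows "definable_subset L M {t. P (case_nat t s)}"
proof -
  obtain \<phi> where \<phi>: "wf_fm L \<phi>" "\<And>e. P e = sat M e \<phi>" using assms unfolding dfn_in_def by blast
  obtain k where k: "\<forall>v\<in>free_vars \<phi>. v < Suc k" using finite_nat_bound[OF finite_free_vars, of \<phi>] by (meson less_Suc_eq)
  obtain h ps where h: "distinct ps" "set ps = params \<phi>" "inj_on h (set ps)"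
    "\<And>a. a \<in> params \<phi> \<Longrightarrow> Suc k \<le> h a \<and> h a \<notin> all_vars \<phi>"
    by (rule fresh_abstraction[of \<phi> "Suc k"]) (rule that)
  let ?y = "[0::nat]" and ?z = "map Suc [0..<k] @ map h ps" and ?c = "map s [0..<k] @ ps" and ?\<psi> = "abstract_fm h \<phi>"
  have hge: "Suc k \<le> h a" if "a \<in> set ps" for a using h(2,4) that by blast
  have dist: "distinct (?y @ ?z)" using h(1,3) hge by (fastforce simp: distinct_map)
  have fv: "free_vars ?\<psi> \<subseteq> set (?y @ ?z)"
  proof
    fix v assume "v \<in> free_vars ?\<psi>"
    then have "v \<in> free_vars \<phi> \<or> v \<in> h ` set ps" using free_vars_abstract_fm[of h \<phi>] h(2) by blast
    then show "v \<in> set (?y @ ?z)"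
    proof
      assume "v \<in> free_vars \<phi>"
      then have "v < Suc k" using k by blast
      then show ?thesis by (cases v) auto
    qed auto
  qed
  have mem: "models M (inst (?y @ ?z) ([t] @ ?c) ?\<psi>) \<longleftrightarrow> P (case_nat t s)" for t
  proof -
    let ?e = "override (case_nat t s) [?y @ ?z [\<mapsto>] [t] @ ?c]"
    have len: "length ([t] @ ?c) = length (?y @ ?z)" by simp
    have "models M (inst (?y @ ?z) ([t] @ ?c) ?\<psi>) \<longleftrightarrow> sat M ?e ?\<psi>"
      by (rule models_inst[OF dist len fv])
    also have "\<dots> \<longleftrightarrow> sat M ?e \<phi>"
    proof (rule sat_abstract_fm)
      fix a assume "a \<in> params \<phi>"
      then obtain j where j: "j < length ps" "a = ps ! j" using h(2) by (metis in_set_conv_nth)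
      then have "h a = (?y @ ?z) ! (Suc k + j)" by (simp add: nth_append)
      then have "?e (h a) = ([t] @ ?c) ! (Suc k + j)" using override_nth[OF dist len, of "Suc k + j"] j(1) by simp
      then show "?e (h a) = a" using j by (simp add: nth_append)
    qed (use h(4) in blast)
    also have "\<dots> \<longleftrightarrow> sat M (case_nat t s) \<phi>"
    proof (rule sat_cong)
      fix v assume "v \<in> free_vars \<phi>"
      then have v: "v < Suc k" using k by blast
      then have "v = (?y @ ?z) ! v" by (cases v) (simp_all add: nth_append)
      then have "?e v = ([t] @ ?c) ! v" using override_nth[OF dist len, of v] v by simp
      then show "?e v = case_nat t s v" using v by (cases v) (simp_all add: nth_append)
    qed
    finally show ?thesis using \<phi>(2) by simp
  qed
  have "(\<lambda>a. [a]) ` {t. P (case_nat t s)} = solutions M ?\<psi> ?y ?z ?c"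
    unfolding solutions_def using mem by (auto simp: length_Suc_conv)
  moreover have "?\<psi> \<in> formulas L {} (?y @ ?z)"
    unfolding formulas_def mem_Collect_eq by (intro conjI wf_abstract_fm[OF \<phi>(1)] fv) (simp add: params_abstract_fm)
  ultimately show ?thesis unfolding definable_subset_def definable_def using dist
    by (intro exI[of _ ?y] exI[of _ ?z] exI[of _ ?c] bexI[of _ ?\<psi>]) simp_all
qed

lemma interval_cases:
  assumes "F \<in> {{a} | a. True} \<union> open_intervals"
  obtains c where "F = {c}" | c d where "F = {c<..<d}" | c where "F = {c<..}" | d where "F = {..<d}" | "F = UNIV"
proof -
  have "(\<exists>c. F = {c}) \<or> (\<exists>c d. F = {c<..<d}) \<or> (\<exists>c. F = {c<..}) \<or> (\<exists>d. F = {..<d}) \<or> F = UNIV"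
    using assms unfolding open_intervals_def by simp (elim disjE; simp)
  then show ?thesis using that by (elim disjE exE) metis+
qed

lemma interval_union_boundary:
  fixes \<F> :: "'m::unbounded_dense_linorder set set"
  assumes "finite \<F>" "\<F> \<subseteq> {{a} | a. True} \<union> open_intervals"
  shows "\<exists>B. finite B \<and> (\<forall>x. x \<notin> B \<longrightarrow> (\<exists>a b. a < x \<and> x < b \<and> (\<forall>y. a < y \<and> y < b \<longrightarrow> (y \<in> \<Union>\<F>) = (x \<in> \<Union>\<F>))))"
  using assms
proof (induction \<F> rule: finite_induct)
  case empty
  then show ?case using lt_ex gt_ex by (intro exI[of _ "{}"]) auto
next
  case (insert F \<F>)
  from insert.IH[OF subset_trans[OF subset_insertI insert.prems]]
  obtain B where B: "finite B" "\<And>x. x \<notin> B \<Longrightarrow> \<exists>a b. a < x \<and> x < b \<and> (\<forall>y. a < y \<and> y < b \<longrightarrow> (y \<in> \<Union>\<F>) = (x \<in> \<Union>\<F>))" by blast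
  have "\<exists>B'. finite B' \<and> (\<forall>x. x \<notin> B' \<longrightarrow> (\<exists>a b. a < x \<and> x < b \<and> (\<forall>y. a < y \<and> y < b \<longrightarrow> (y \<in> F) = (x \<in> F))))"
  proof -
    have one: "\<exists>a b. a < x \<and> x < b \<and> (\<forall>y. a < y \<and> y < b \<longrightarrow> (y < c) = (x < c) \<and> (c < y) = (c < x) \<and> (y = c) = (x = c))"
      if "x \<noteq> c" for x c :: 'm
    proof (cases "x < c")
      case True
      obtain a where "a < x" using lt_ex by blast
      then show ?thesis using True by (intro exI[of _ a] exI[of _ c]) auto
    next
      case False then have "c < x" using that by simp
      obtain b where "x < b" using gt_ex by blast
      then show ?thesis using \<open>c < x\<close> by (intro exI[of _ c] exI[of _ b]) auto
    qed
    have via: "\<exists>B. finite B \<and> (\<forall>x. x \<notin> B \<longrightarrow> (\<exists>a b. a < x \<and> x < b \<and> (\<forall>y. a < y \<and> y < b \<longrightarrow> (y \<in> F) = (x \<in> F))))"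
      if F: "\<And>x y. (y < c) = (x < c) \<Longrightarrow> (c < y) = (c < x) \<Longrightarrow> (y = c) = (x = c) \<Longrightarrow> (y \<in> F) = (x \<in> F)" for c
    proof (intro exI[of _ "{c}"] conjI allI impI)
      fix x assume "x \<notin> {c}"
      then have "x \<noteq> c" by simp
      obtain a b where ab: "a < x" "x < b" "\<forall>y. a < y \<and> y < b \<longrightarrow> (y < c) = (x < c) \<and> (c < y) = (c < x) \<and> (y = c) = (x = c)"
        using one[OF \<open>x \<noteq> c\<close>] by (elim exE conjE) (rule that)
      have "(y \<in> F) = (x \<in> F)" if "a < y \<and> y < b" for y
        using spec[OF ab(3), THEN mp, OF that] by (elim conjE) (rule F)
      then show "\<exists>a b. a < x \<and> x < b \<and> (\<forall>y. a < y \<and> y < b \<longrightarrow> (y \<in> F) = (x \<in> F))" using ab(1,2) by blast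
    qed simp
    have two: "\<exists>a b. a < x \<and> x < b \<and> (\<forall>y. a < y \<and> y < b \<longrightarrow> P y \<and> Q y)"
      if hPQ: "\<exists>a b. a < x \<and> x < b \<and> (\<forall>y. a < y \<and> y < b \<longrightarrow> P y)" "\<exists>a b. a < x \<and> x < b \<and> (\<forall>y. a < y \<and> y < b \<longrightarrow> Q y)"
      for P Q and x :: 'm
    proof -
      obtain a b a' b' where "a < x" "x < b" "\<forall>y. a < y \<and> y < b \<longrightarrow> P y" "a' < x" "x < b'" "\<forall>y. a' < y \<and> y < b' \<longrightarrow> Q y"
        using hPQ by blast
      then show ?thesis by (intro exI[of _ "max a a'"] exI[of _ "min b b'"]) auto
    qed
    have "F \<in> {{a} | a. True} \<union> open_intervals" using insert.prems by (rule subsetD) simp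
    then show ?thesis
    proof (cases rule: interval_cases)
      case (1 c) then show ?thesis by (intro via[of c]) simp
    next
      case (2 c d)
      have "\<exists>a b. a < x \<and> x < b \<and> (\<forall>y. a < y \<and> y < b \<longrightarrow> (y \<in> F) = (x \<in> F))" if xcd: "x \<noteq> c" "x \<noteq> d" for x
      proof -
        obtain a b where ab: "a < x" "x < b" and
          in_ab: "\<forall>y. a < y \<and> y < b \<longrightarrow> ((y < c) = (x < c) \<and> (c < y) = (c < x) \<and> (y = c) = (x = c)) \<and> ((y < d) = (x < d) \<and> (d < y) = (d < x) \<and> (y = d) = (x = d))"
          using two[OF one[OF xcd(1)] one[OF xcd(2)]] by (elim exE conjE) (rule that)
        have "(y \<in> F) = (x \<in> F)" if "a < y \<and> y < b" for y
          using spec[OF in_ab, THEN mp, OF that] unfolding 2 by simp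
        then show ?thesis using ab by blast
      qed
      then show ?thesis by (intro exI[of _ "{c, d}"]) auto
    next
      case (3 c) then show ?thesis by (intro via[of c]) simp
    next
      case (4 d) then show ?thesis by (intro via[of d]) simp
    next
      case 5 then show ?thesis by (intro via) simp
    qed
  qed
  then obtain B' where B': "finite B'" "\<And>x. x \<notin> B' \<Longrightarrow> \<exists>a b. a < x \<and> x < b \<and> (\<forall>y. a < y \<and> y < b \<longrightarrow> (y \<in> F) = (x \<in> F))" by blast
  have away: "\<exists>a b. a < x \<and> x < b \<and> (\<forall>y. a < y \<and> y < b \<longrightarrow> (y \<in> \<Union>(insert F \<F>)) = (x \<in> \<Union>(insert F \<F>)))" if xB: "x \<notin> B \<union> B'" for x
  proof -
    obtain a b a' b' where ab: "a < x" "x < b" "\<forall>y. a < y \<and> y < b \<longrightarrow> (y \<in> \<Union>\<F>) = (x \<in> \<Union>\<F>)"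
      "a' < x" "x < b'" "\<forall>y. a' < y \<and> y < b' \<longrightarrow> (y \<in> F) = (x \<in> F)" using B(2)[of x] B'(2)[of x] xB by blast
    have "(y \<in> \<Union>(insert F \<F>)) = (x \<in> \<Union>(insert F \<F>))" if "max a a' < y \<and> y < min b b'" for y
    proof -
      have "(y \<in> \<Union>\<F>) = (x \<in> \<Union>\<F>)" using ab(3) that by simp
      moreover have "(y \<in> F) = (x \<in> F)" using ab(6) that by simp
      ultimately show ?thesis by simp
    qed
    note near = this
    have mm: "max a a' < x" "x < min b b'" using ab(1,2,4,5) by simp_all
    show ?thesis
      by (rule exI[of _ "max a a'"], rule exI[of _ "min b b'"], intro conjI mm allI impI, rule near)
  qed
  show ?case
    by (rule exI[of _ "B \<union> B'"], rule conjI[OF finite_UnI[OF B(1) B'(1)]], intro allI impI, rule away)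
qed

text \<open>
  The downward closure of a point or interval is of one of the four forms, and these forms are linearly
  ordered by inclusion.
\<close>

lemma interval_union_sup:
  fixes \<F> :: "'m::unbounded_dense_linorder set set"
  assumes "finite \<F>" "\<F> \<subseteq> {{a} | a. True} \<union> open_intervals"
  shows "{x. \<exists>y\<in>\<Union>\<F>. x \<le> y} = {} \<or> {x. \<exists>y\<in>\<Union>\<F>. x \<le> y} = UNIV \<or>
    (\<exists>a. {x. \<exists>y\<in>\<Union>\<F>. x \<le> y} = {..a}) \<or> (\<exists>a. {x. \<exists>y\<in>\<Union>\<F>. x \<le> y} = {..<a})"
  using assms
proof (induction \<F> rule: finite_induct)
  case empty then show ?case by auto
next
  case (insert F \<F>)
  let ?D = "\<lambda>S. {x. \<exists>y\<in>S. x \<le> y}"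
  have hF: "?D F = {} \<or> ?D F = UNIV \<or> (\<exists>a. ?D F = {..a}) \<or> (\<exists>a. ?D F = {..<a})"
  proof -
    have "F \<in> {{a} | a. True} \<union> open_intervals" using insert.prems by (rule subsetD) simp
    then show ?thesis
    proof (cases rule: interval_cases)
      case (1 c)
      then have "?D F = {..c}" by auto
      then show ?thesis by blast
    next
      case (2 c d)
      show ?thesis
      proof (cases "c < d")
        case True
        have "?D F = {..<d}"
        proof (intro equalityI subsetI)
          fix x assume "x \<in> {..<d}"
          then obtain y where "max c x < y" "y < d" using True dense[of "max c x" d] by auto
          then show "x \<in> ?D F" using 2 by (auto intro!: bexI[of _ y])
        qed (use 2 in auto)
        then show ?thesis by blast
      next
        case False
        then have "?D F = {}" using 2 by auto
        then show ?thesis by blast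
      qed
    next
      case (3 c)
      have "?D F = UNIV"
      proof (intro equalityI subsetI)
        fix x :: 'm
        obtain y where "max c x < y" using gt_ex by blast
        then show "x \<in> ?D F" using 3 by (auto intro!: bexI[of _ y])
      qed auto
      then show ?thesis by blast
    next
      case (4 d)
      then have "?D F = {..<d}" by auto
      then show ?thesis by blast
    next
      case 5
      then have "?D F = UNIV" by auto
      then show ?thesis by blast
    qed
  qed
  have hU: "?D (\<Union>\<F>) = {} \<or> ?D (\<Union>\<F>) = UNIV \<or> (\<exists>a. ?D (\<Union>\<F>) = {..a}) \<or> (\<exists>a. ?D (\<Union>\<F>) = {..<a})"
    by (rule insert.IH) (rule subset_trans[OF subset_insertI insert.prems])
  have U: "X \<union> Y = {} \<or> X \<union> Y = UNIV \<or> (\<exists>a. X \<union> Y = {..a}) \<or> (\<exists>a. X \<union> Y = {..<a})"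
    if X: "X = {} \<or> X = UNIV \<or> (\<exists>a. X = {..a}) \<or> (\<exists>a. X = {..<a})"
      and Y: "Y = {} \<or> Y = UNIV \<or> (\<exists>a. Y = {..a}) \<or> (\<exists>a. Y = {..<a})" for X Y :: "'m set"
  proof -
    have "X \<subseteq> Y \<or> Y \<subseteq> X"
      using X Y by (elim disjE exE) (auto simp: not_le not_less)
    then show ?thesis using X Y by (auto simp: Un_absorb1 Un_absorb2)
  qed
  have "?D F \<union> ?D (\<Union>\<F>) = {} \<or> ?D F \<union> ?D (\<Union>\<F>) = UNIV \<or>
      (\<exists>a. ?D F \<union> ?D (\<Union>\<F>) = {..a}) \<or> (\<exists>a. ?D F \<union> ?D (\<Union>\<F>) = {..<a})" by (rule U[OF hF hU])
  moreover have "?D F \<union> ?D (\<Union>\<F>) = ?D (\<Union>(insert F \<F>))" by auto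
  ultimately show ?case by (simp only:)
qed

lemma omin_dfn_in:
  fixes L :: "('f, 'r) language" and M :: "('f, 'r, 'm::unbounded_dense_linorder) struct"
  assumes om: "o_minimal L M"
  shows "omin (\<le>) (<) (dfn_in L M)"
proof (intro omin.intro omin_axioms.intro)
  show "class.unbounded_dense_linorder (\<le>) ((<) :: 'm \<Rightarrow> _)" by (rule unbounded_dense_linorder_axioms)
next
  fix i j
  obtain l where l: "l \<in> rel_syms L" "rel_ar L l = 2" "\<And>a b. rel_int M l [a, b] \<longleftrightarrow> a < b"
    using om unfolding o_minimal_def by blast
  show "dfn_in L M (\<lambda>e. e i < e j)" unfolding dfn_in_def
    by (intro exI[of _ "Rel l [Var i, Var j]"]) (simp add: l)
next
  fix P and s :: "nat \<Rightarrow> 'm" assume P: "dfn_in L M P"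
  obtain \<F> where \<F>: "finite \<F>" "\<F> \<subseteq> {{a} | a. True} \<union> open_intervals" "{t. P (case_nat t s)} = \<Union>\<F>"
    using om definable_subset_dfn_in[OF P, of s] unfolding o_minimal_def by blast
  have mem: "P (case_nat x s) \<longleftrightarrow> x \<in> \<Union>\<F>" for x using \<F>(3) by blast
  obtain B where B: "finite B" "\<forall>x. x \<notin> B \<longrightarrow> (\<exists>a b. a < x \<and> x < b \<and> (\<forall>y. a < y \<and> y < b \<longrightarrow> (y \<in> \<Union>\<F>) = (x \<in> \<Union>\<F>)))"
    using interval_union_boundary[OF \<F>(1,2)] by blast
  show "finite {x. \<not> (\<exists>a b. a < x \<and> x < b \<and> (\<forall>y. a < y \<and> y < b \<longrightarrow> P (case_nat y s) = P (case_nat x s)))}"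
    by (rule finite_subset[OF _ B(1)]) (use B(2) in \<open>unfold mem, blast\<close>)
  fix u v assume down: "\<And>x y. x < y \<Longrightarrow> P (case_nat y s) \<Longrightarrow> P (case_nat x s)" and uv: "P (case_nat u s)" "\<not> P (case_nat v s)"
  have D: "{x. \<exists>y\<in>\<Union>\<F>. x \<le> y} = {x. P (case_nat x s)}"
  proof (intro equalityI subsetI)
    fix x assume "x \<in> {x. \<exists>y\<in>\<Union>\<F>. x \<le> y}"
    then obtain y where y: "x \<le> y" "P (case_nat y s)" using mem by blast
    have "P (case_nat x s)"
    proof (cases "x = y")
      case False
      then have "x < y" using y(1) by simp
      then show ?thesis using y(2) by (rule down)
    qed (use y in simp)
    then show "x \<in> {x. P (case_nat x s)}" by simp
  qed (use mem in auto)
  have "(\<exists>a. {x. P (case_nat x s)} = {..a}) \<or> (\<exists>a. {x. P (case_nat x s)} = {..<a})"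
  proof -
    have "{x. P (case_nat x s)} \<noteq> {}" "{x. P (case_nat x s)} \<noteq> UNIV" using uv by blast+
    then show ?thesis using interval_union_sup[OF \<F>(1,2)] unfolding D by argo
  qed
  then show "\<exists>a. (\<forall>x. x < a \<longrightarrow> P (case_nat x s)) \<and> (\<forall>x. a < x \<longrightarrow> \<not> P (case_nat x s))"
  proof (elim disjE exE)
    fix a assume "{x. P (case_nat x s)} = {..a}"
    then have X: "P (case_nat x s) \<longleftrightarrow> x \<le> a" for x by (metis atMost_iff mem_Collect_eq)
    show ?thesis unfolding X by (rule exI[of _ a]) (auto simp: not_le)
  next
    fix a assume "{x. P (case_nat x s)} = {..<a}"
    then have X: "P (case_nat x s) \<longleftrightarrow> x < a" for x by (metis lessThan_iff mem_Collect_eq)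
    show ?thesis unfolding X by (rule exI[of _ a]) (auto simp: not_less)
  qed
qed (fact dfn_in_not dfn_in_conj dfn_in_ex dfn_in_subst dfn_in_support)+

section \<open>Types of formulas\<close>

lemma env_map_override:
  assumes y: "distinct y" "length cs = length y" and cs: "\<forall>\<tau>\<in>set cs. coord_map \<tau>" and \<sigma>: "env_map \<sigma>"
  shows "env_map (\<lambda>e. override (\<sigma> e) [y [\<mapsto>] map (\<lambda>\<tau>. \<tau> e) cs])"
  unfolding env_map_def
proof
  fix v
  show "coord_map (\<lambda>e. override (\<sigma> e) [y [\<mapsto>] map (\<lambda>\<tau>. \<tau> e) cs] v)"
  proof (cases "v \<in> set y")
    case True
    then obtain i where i: "i < length y" "v = y ! i" by (metis in_set_conv_nth)
    have "override (\<sigma> e) [y [\<mapsto>] map (\<lambda>\<tau>. \<tau> e) cs] v = (cs ! i) e" for e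
      using override_nth[OF y(1), of "map (\<lambda>\<tau>. \<tau> e) cs" i "\<sigma> e"] y(2) i by simp
    moreover have "coord_map (cs ! i)" using cs i(1) y(2) by simp
    ultimately show ?thesis by simp
  next
    case False
    then show ?thesis using env_map_coord[OF \<sigma>, of v] by (simp add: override_notin)
  qed
qed

text \<open>
  Membership in a definable set of tuples is a definable predicate, also when the tuple consists of
  coordinates and constants.
\<close>

lemma dfn_in_solutions:
  assumes \<psi>: "\<psi> \<in> formulas L {} (y @ z)" "distinct (y @ z)" "length c = length z"
    and cs: "length cs = length y" "\<forall>\<tau>\<in>set cs. coord_map \<tau>"
  shows "dfn_in L M (\<lambda>s. map (\<lambda>\<tau>. \<tau> s) cs \<in> solutions M \<psi> y z c)"
proof -
  let ?cs = "cs @ map (\<lambda>a _. a) c"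
  have map: "map (\<lambda>\<tau>. \<tau> s) cs @ c = map (\<lambda>\<tau>. \<tau> s) ?cs" for s by (simp add: comp_def)
  have len: "length ?cs = length (y @ z)" using cs(1) \<psi>(3) by simp
  have fv: "free_vars \<psi> \<subseteq> set (y @ z)" and wf: "wf_fm L \<psi>" using \<psi>(1) unfolding formulas_def by blast+
  have "map (\<lambda>\<tau>. \<tau> s) cs \<in> solutions M \<psi> y z c \<longleftrightarrow> sat M (override s [y @ z [\<mapsto>] map (\<lambda>\<tau>. \<tau> s) ?cs]) \<psi>" for s
    unfolding solutions_def mem_Collect_eq map
    by (subst models_inst[OF \<psi>(2) _ fv]) (use cs(1) len in simp_all)
  moreover have "dfn_in L M (\<lambda>s. sat M (override s [y @ z [\<mapsto>] map (\<lambda>\<tau>. \<tau> s) ?cs]) \<psi>)"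
    by (rule dfn_in_subst_sat[OF wf env_map_override[OF \<psi>(2) len _ env_map_id]])
      (use cs(2) in \<open>auto simp: coord_map_const\<close>)
  ultimately show ?thesis by simp
qed

lemma omin_set_dfn_in:
  fixes L :: "('f, 'r) language" and M :: "('f, 'r, 'm::unbounded_dense_linorder) struct"
  assumes om: "o_minimal L M" and A: "definable_subset L M A" "infinite A"
  shows "omin_set (\<le>) (<) (dfn_in L M) A"
proof (intro omin_set.intro omin_set_axioms.intro)
  show om': "omin (\<le>) (<) (dfn_in L M)" by (rule omin_dfn_in[OF om])
  obtain y z c \<psi> where \<psi>: "\<psi> \<in> formulas L {} (y @ z)" "distinct (y @ z)" "length c = length z"
    and y: "length y = 1" and eq: "(\<lambda>a. [a]) ` A = solutions M \<psi> y z c"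
    using A(1) unfolding definable_subset_def definable_def by (elim exE bexE conjE) (rule that)
  have "a \<in> A \<longleftrightarrow> [a] \<in> (\<lambda>a. [a]) ` A" for a by auto
  then have mem: "a \<in> A \<longleftrightarrow> [a] \<in> solutions M \<psi> y z c" for a unfolding eq .
  have "dfn_in L M (\<lambda>s. map (\<lambda>\<tau>. \<tau> s) [\<lambda>s. s 0] \<in> solutions M \<psi> y z c)"
    by (rule dfn_in_solutions[OF \<psi>]) (simp_all add: y coord_map_var)
  then show "omin.dfn_v (dfn_in L M) (\<lambda>a. a \<in> A)" unfolding omin.dfn_v_def[OF om'] mem by simp
qed (rule A(2))

lemma types_finite_sat:
  assumes "p \<in> types L M x A" "F \<subseteq> p" "finite F" shows "\<exists>e. \<forall>\<phi>\<in>F. sat M e \<phi>"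
proof -
  have "consistent M p" using assms(1) by (simp add: types_def)
  then show ?thesis using assms(2,3) unfolding consistent_def by simp
qed

lemma types_neg:
  assumes p: "p \<in> types L M x A" and \<phi>: "\<phi> \<in> formulas L A x" shows "Neg \<phi> \<in> p \<longleftrightarrow> \<phi> \<notin> p"
proof -
  have "\<not> (\<phi> \<in> p \<and> Neg \<phi> \<in> p)"
  proof
    assume "\<phi> \<in> p \<and> Neg \<phi> \<in> p"
    then have "\<exists>e. \<forall>\<chi>\<in>{\<phi>, Neg \<phi>}. sat M e \<chi>" by (intro types_finite_sat[OF p]) simp_all
    then show False by auto
  qed
  moreover have "\<phi> \<in> p \<or> Neg \<phi> \<in> p" using p \<phi> by (simp add: types_def)
  ultimately show ?thesis by blast
qed

lemma types_mono:
  assumes p: "p \<in> types L M x A" and \<phi>: "\<phi> \<in> p" and \<chi>: "\<chi> \<in> formulas L A x"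
    and imp: "\<And>e. sat M e \<phi> \<Longrightarrow> sat M e \<chi>" shows "\<chi> \<in> p"
proof (rule ccontr)
  assume "\<chi> \<notin> p"
  then have "Neg \<chi> \<in> p" using types_neg[OF p \<chi>] by blast
  then have "\<exists>e. \<forall>\<theta>\<in>{\<phi>, Neg \<chi>}. sat M e \<theta>" using \<phi> by (intro types_finite_sat[OF p]) simp_all
  then show False using imp by auto
qed

lemma formulas_Neg: "\<phi> \<in> formulas L A x \<Longrightarrow> Neg \<phi> \<in> formulas L A x"
  by (simp add: formulas_def)

lemma formulas_Conj: "\<phi> \<in> formulas L A x \<Longrightarrow> \<psi> \<in> formulas L A x \<Longrightarrow> Conj \<phi> \<psi> \<in> formulas L A x"
  by (simp add: formulas_def)

lemma types_conj:
  assumes p: "p \<in> types L M x A" and \<phi>: "\<phi> \<in> formulas L A x" "\<psi> \<in> formulas L A x"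
  shows "Conj \<phi> \<psi> \<in> p \<longleftrightarrow> \<phi> \<in> p \<and> \<psi> \<in> p"
proof
  assume c: "Conj \<phi> \<psi> \<in> p"
  show "\<phi> \<in> p \<and> \<psi> \<in> p"
    using types_mono[OF p c \<phi>(1)] types_mono[OF p c \<phi>(2)] by simp
next
  assume b: "\<phi> \<in> p \<and> \<psi> \<in> p"
  show "Conj \<phi> \<psi> \<in> p"
  proof (rule ccontr)
    assume "Conj \<phi> \<psi> \<notin> p"
    then have "Neg (Conj \<phi> \<psi>) \<in> p" using types_neg[OF p formulas_Conj[OF \<phi>]] by blast
    then have "\<exists>e. \<forall>\<theta>\<in>{\<phi>, \<psi>, Neg (Conj \<phi> \<psi>)}. sat M e \<theta>" using b by (intro types_finite_sat[OF p]) simp_all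
    then show False by auto
  qed
qed

text \<open>
  The predicates that belong to \<open>p\<close> when a formula is identified with the set it defines.
\<close>

definition holds_in :: "('f, 'r, 'm) struct \<Rightarrow> ('f, 'r, 'm) fm set \<Rightarrow> ((nat \<Rightarrow> 'm) \<Rightarrow> bool) \<Rightarrow> bool" where
  "holds_in M p P \<longleftrightarrow> (\<exists>\<phi>\<in>p. \<forall>e. sat M e \<phi> \<longrightarrow> P e)"

lemma holds_in_sat:
  assumes p: "p \<in> types L M x A" and \<phi>: "\<phi> \<in> formulas L A x"
  shows "holds_in M p (\<lambda>e. sat M e \<phi>) \<longleftrightarrow> \<phi> \<in> p"
proof
  assume "holds_in M p (\<lambda>e. sat M e \<phi>)"
  then obtain \<chi> where "\<chi> \<in> p" "\<forall>e. sat M e \<chi> \<longrightarrow> sat M e \<phi>" unfolding holds_in_def by blast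
  then show "\<phi> \<in> p" using types_mono[OF p _ \<phi>, of \<chi>] by blast
qed (auto simp: holds_in_def)

text \<open>
  Free variables outside \<open>x\<close> have no influence and may be replaced by a constant.
\<close>

lemma formula_of_dfn_in:
  assumes "dfn_in L M P" "supported (set x) P"
  obtains \<chi> where "\<chi> \<in> formulas L UNIV x" "P = (\<lambda>e. sat M e \<chi>)"
proof -
  obtain \<phi> where \<phi>: "wf_fm L \<phi>" "\<And>e. P e = sat M e \<phi>" using assms(1) unfolding dfn_in_def by blast
  let ?s = "\<lambda>v. if v \<in> set x then None else Some undefined"
  have "P e = sat M e (inst_fm ?s \<phi>)" for e
    unfolding sat_inst_fm \<phi>(2)[symmetric] by (rule supportedD[OF assms(2)]) (simp add: override_def)
  moreover have "inst_fm ?s \<phi> \<in> formulas L UNIV x"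
    unfolding formulas_def using wf_inst_fm[OF \<phi>(1)] by (auto simp: free_vars_inst split: if_splits)
  ultimately show ?thesis using that by blast
qed

lemma inst_formulas:
  assumes "\<phi> \<in> formulas L A (x @ y)" "length b = length y" "set b \<subseteq> A" shows "inst y b \<phi> \<in> formulas L A x"
proof -
  have "dom [y [\<mapsto>] b] = set y" using assms(2) by (simp add: dom_map_upds)
  then have "free_vars (inst y b \<phi>) \<subseteq> set x" using assms(1) unfolding inst_def formulas_def free_vars_inst by auto
  moreover have "ran [y [\<mapsto>] b] \<subseteq> set b"
  proof
    fix a assume "a \<in> ran [y [\<mapsto>] b]"
    then obtain v where "[y [\<mapsto>] b] v = Some a" unfolding ran_def by blast
    then show "a \<in> set b" unfolding map_upds_def by (auto dest!: map_of_SomeD simp: map_add_Some_iff set_zip)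
  qed
  then have "params (inst y b \<phi>) \<subseteq> A" using assms(1,3) params_inst[of "[y [\<mapsto>] b]" \<phi>] unfolding inst_def formulas_def by blast
  ultimately show ?thesis using assms(1) wf_inst_fm unfolding formulas_def inst_def by blast
qed

text \<open>
  \<open>R s\<close> is an instance \<open>\<phi>(x;b)\<close> of one formula without parameters, where \<open>b\<close> lists the relevant coordinates
  of \<open>s\<close> followed by the parameters occurring in \<open>R\<close>. The defining scheme of \<open>p\<close> for \<open>\<phi>\<close> then describes the
  set of all \<open>s\<close> with \<open>R s\<close> in \<open>p\<close>.
\<close>

lemma holds_in_definable:
  fixes L :: "('f, 'r) language" and M :: "('f, 'r, 'm::unbounded_dense_linorder) struct"
  assumes om: "omin (\<le>) (<) (dfn_in L M)" and p: "p \<in> types L M x UNIV" "definable_type L M x UNIV p" and x: "distinct x"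
    and R: "omin.dfn_ee (dfn_in L M) R" "\<And>s. supported (set x) (R s)"
  shows "dfn_in L M (\<lambda>s. holds_in M p (R s))"
proof -
  obtain N where N: "\<forall>v\<in>set x. v < N" using finite_nat_bound[OF finite_set, of x] by auto
  define P where "P e = R (\<lambda>i. e (N + i)) e" for e
  have P: "dfn_in L M P" unfolding P_def
    by (rule omin.dfn_eeD[OF om R(1) env_map_reindex env_map_id])
  obtain k where k: "supported {..<k} (\<lambda>e. R (\<lambda>i. e (2 * i)) (\<lambda>i. e (Suc (2 * i))))"
    using dfn_in_support[OF R(1)[unfolded omin.dfn_ee_def[OF om]]] by auto
  have Rk: "R s e = R s' e" if "\<And>i. i < k \<Longrightarrow> s i = s' i" for s s' e
  proof -
    let ?g = "\<lambda>s i. if even i then s (i div 2) else e (i div 2)"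
    have "R (\<lambda>i. ?g s (2 * i)) (\<lambda>i. ?g s (Suc (2 * i))) = R (\<lambda>i. ?g s' (2 * i)) (\<lambda>i. ?g s' (Suc (2 * i)))"
    proof (rule supportedD[OF k])
      fix i assume "i \<in> {..<k}"
      then have "i div 2 < k" by auto
      then show "?g s i = ?g s' i" using that by simp
    qed
    then show ?thesis by simp
  qed
  have "supported (set (x @ [N..<N + k])) P" unfolding supported_def
  proof (intro allI impI)
    fix e e' :: "nat \<Rightarrow> 'm" assume ee: "\<forall>i\<in>set (x @ [N..<N + k]). e i = e' i"
    have "P e = R (\<lambda>i. e (N + i)) e'" unfolding P_def by (rule supportedD[OF R(2)]) (use ee in simp)
    also have "\<dots> = P e'" unfolding P_def by (rule Rk) (use ee in simp)
    finally show "P e = P e'" .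
  qed
  then obtain \<chi> where \<chi>: "\<chi> \<in> formulas L UNIV (x @ [N..<N + k])" "P = (\<lambda>e. sat M e \<chi>)"
    by (rule formula_of_dfn_in[OF P]) (rule that)
  obtain h ps where h: "distinct ps" "set ps = params \<chi>" "inj_on h (set ps)"
    "\<And>a. a \<in> params \<chi> \<Longrightarrow> N + k \<le> h a \<and> h a \<notin> all_vars \<chi>"
    by (rule fresh_abstraction[of \<chi> "N + k"]) (rule that)
  let ?y = "[N..<N + k] @ map h ps" and ?\<phi> = "abstract_fm h \<chi>"
  let ?b = "\<lambda>s. map s [0..<k] @ ps"
  have hge: "N + k \<le> h a" if "a \<in> set ps" for a using h(2,4) that by blast
  have y: "distinct ?y" using h(1,3) hge by (fastforce simp: distinct_map)
  have xy: "distinct (x @ ?y)" using x y N hge by fastforce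
  have \<phi>: "?\<phi> \<in> formulas L {} (x @ ?y)"
    using \<chi>(1) free_vars_abstract_fm[of h \<chi>] h(2) unfolding formulas_def
    by (auto simp: wf_abstract_fm params_abstract_fm)
  have len: "length (?b s) = length ?y" for s by simp
  obtain z c \<psi> where \<psi>: "\<psi> \<in> formulas L {} (?y @ z)" "distinct (?y @ z)" "length c = length z"
    and sol: "{b. length b = length ?y \<and> set b \<subseteq> UNIV \<and> inst ?y b ?\<phi> \<in> p} = solutions M \<psi> ?y z c"
    using p(2)[unfolded definable_type_def, rule_format, OF \<phi> xy] by blast
  have "holds_in M p (R s) \<longleftrightarrow> ?b s \<in> solutions M \<psi> ?y z c" for s
  proof -
    have R_sat: "R s = (\<lambda>e. sat M e (inst ?y (?b s) ?\<phi>))"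
    proof
      fix e
      let ?e = "override e [?y [\<mapsto>] ?b s]"
      have "sat M e (inst ?y (?b s) ?\<phi>) \<longleftrightarrow> sat M ?e ?\<phi>" by (rule sat_inst)
      also have "\<dots> \<longleftrightarrow> sat M ?e \<chi>"
      proof (rule sat_abstract_fm)
        fix a assume "a \<in> params \<chi>"
        then obtain j where j: "j < length ps" "a = ps ! j" using h(2) by (metis in_set_conv_nth)
        then have "h a = ?y ! (k + j)" by (simp add: nth_append)
        then have "?e (h a) = ?b s ! (k + j)" using override_nth[OF y len, of "k + j"] j(1) by simp
        then show "?e (h a) = a" using j by (simp add: nth_append)
      qed (use h(4) in blast)
      also have "\<dots> \<longleftrightarrow> R (\<lambda>i. ?e (N + i)) ?e" using fun_cong[OF \<chi>(2), of ?e] unfolding P_def by (rule sym)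
      also have "\<dots> \<longleftrightarrow> R s ?e"
      proof (rule Rk)
        fix i assume i: "i < k"
        then have "?e (?y ! i) = ?b s ! i" by (intro override_nth[OF y len]) simp
        then show "?e (N + i) = s i" using i by (simp add: nth_append)
      qed
      also have "\<dots> \<longleftrightarrow> R s e"
        by (rule supportedD[OF R(2)], rule override_notin) (use xy in auto)
      finally show "R s e = sat M e (inst ?y (?b s) ?\<phi>)" by simp
    qed
    have "inst ?y (?b s) ?\<phi> \<in> formulas L UNIV x"
      by (rule inst_formulas) (use \<phi> in \<open>auto simp: formulas_def\<close>)
    from holds_in_sat[OF p(1) this] show ?thesis unfolding R_sat sol[symmetric] by simp
  qed
  moreover have "?b s = map (\<lambda>\<tau>. \<tau> s) (map (\<lambda>i s. s i) [0..<k] @ map (\<lambda>a _. a) ps)" for s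
    by (simp add: comp_def)
  moreover have "dfn_in L M (\<lambda>s. map (\<lambda>\<tau>. \<tau> s) (map (\<lambda>i s. s i) [0..<k] @ map (\<lambda>a _. a) ps) \<in> solutions M \<psi> ?y z c)"
    by (rule dfn_in_solutions[OF \<psi>]) (auto simp: coord_map_var coord_map_const)
  ultimately show ?thesis by simp
qed

lemma deftype_holds_in:
  fixes L :: "('f, 'r) language" and M :: "('f, 'r, 'm::unbounded_dense_linorder) struct"
  assumes om: "omin_set (\<le>) (<) (dfn_in L M) A" and p: "p \<in> def_types_in L M x UNIV" and x: "distinct x"
  shows "omin_set.deftype (dfn_in L M) (set x) (holds_in M p)"
  unfolding omin_set.deftype_def[OF om]
proof (intro conjI allI impI; (elim conjE)?)
  have p': "p \<in> types L M x UNIV" "definable_type L M x UNIV p" using p unfolding def_types_in_def by blast+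
  show "holds_in M p (\<lambda>x. \<not> P x) = (\<not> holds_in M p P)" if P: "dfn_in L M P" "supported (set x) P" for P
  proof -
    obtain \<chi> where \<chi>: "\<chi> \<in> formulas L UNIV x" "P = (\<lambda>e. sat M e \<chi>)" by (rule formula_of_dfn_in[OF P]) (rule that)
    show ?thesis using holds_in_sat[OF p'(1) \<chi>(1)] holds_in_sat[OF p'(1) formulas_Neg[OF \<chi>(1)]]
      types_neg[OF p'(1) \<chi>(1)] unfolding \<chi>(2) by simp
  qed
  show "holds_in M p (\<lambda>x. P x \<and> Q x) = (holds_in M p P \<and> holds_in M p Q)"
    if P: "dfn_in L M P" "supported (set x) P" and Q: "dfn_in L M Q" "supported (set x) Q" for P Q
  proof -
    obtain \<chi> where \<chi>: "\<chi> \<in> formulas L UNIV x" "P = (\<lambda>e. sat M e \<chi>)" by (rule formula_of_dfn_in[OF P]) (rule that)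
    obtain \<theta> where \<theta>: "\<theta> \<in> formulas L UNIV x" "Q = (\<lambda>e. sat M e \<theta>)" by (rule formula_of_dfn_in[OF Q]) (rule that)
    show ?thesis using holds_in_sat[OF p'(1) \<chi>(1)] holds_in_sat[OF p'(1) \<theta>(1)]
      holds_in_sat[OF p'(1) formulas_Conj[OF \<chi>(1) \<theta>(1)]] types_conj[OF p'(1) \<chi>(1) \<theta>(1)]
      unfolding \<chi>(2) \<theta>(2) by simp
  qed
  let ?\<tau> = "Eq (Par undefined) (Par undefined) :: ('f, 'r, 'm) fm"
  have \<tau>: "?\<tau> \<in> formulas L UNIV x" by (simp add: formulas_def)
  have "Neg ?\<tau> \<notin> p"
  proof
    assume "Neg ?\<tau> \<in> p"
    then have "\<exists>e. \<forall>\<phi>\<in>{Neg ?\<tau>}. sat M e \<phi>" by (intro types_finite_sat[OF p'(1)]) simp_all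
    then show False by simp
  qed
  then have "?\<tau> \<in> p" using types_neg[OF p'(1) \<tau>] by blast
  then show "holds_in M p (\<lambda>_. True)" unfolding holds_in_def by blast
  show "dfn_in L M (\<lambda>s. holds_in M p (R s))"
    if "omin.dfn_ee (dfn_in L M) R" "\<forall>s. supported (set x) (R s)" for R
    using holds_in_definable[OF omin_set.axioms(1)[OF om] p' x that(1)] that(2) by blast
qed

text \<open>
  The predicates \<open>\<phi>(x;b)\<close>, where \<open>b\<close> is given by the first coordinates of an environment \<open>s\<close>.
\<close>

definition family :: "('f, 'r, 'm) struct \<Rightarrow> nat list \<Rightarrow> ('f, 'r, 'm) fm \<Rightarrow> (nat \<Rightarrow> 'm) \<Rightarrow> (nat \<Rightarrow> 'm) \<Rightarrow> bool" where
  "family M y \<phi> s e \<longleftrightarrow> sat M (override e [y [\<mapsto>] map s [0..<length y]]) \<phi>"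

context
  fixes L :: "('f, 'r) language" and M :: "('f, 'r, 'm::unbounded_dense_linorder) struct" and A :: "'m set"
    and x y :: "nat list" and \<phi> :: "('f, 'r, 'm) fm"
  assumes om: "omin_set (\<le>) (<) (dfn_in L M) A" and \<phi>: "\<phi> \<in> formulas L {} (x @ y)" and xy: "distinct (x @ y)"
begin

lemma omin_structure: "omin (\<le>) (<) (dfn_in L M)"
  using om unfolding omin_set_def by blast

lemma small_family_traces:
  "omin_set.small A (omin_set.trace A {..<length y} (family M y \<phi>) ` {q. omin_set.deftype (dfn_in L M) (set x) q})"
proof (rule omin_set.few_tracesD[OF om omin_set.few_traces[OF om]])
  let ?cs = "map (\<lambda>i e. e (2 * i)) [0..<length y]"
  have "dfn_in L M (\<lambda>e. sat M (override (\<lambda>i. e (Suc (2 * i))) [y [\<mapsto>] map (\<lambda>\<tau>. \<tau> e) ?cs]) \<phi>)"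
    by (rule dfn_in_subst_sat[OF _ env_map_override[OF _ _ _ env_map_reindex]])
      (use \<phi> xy in \<open>auto simp: formulas_def coord_map_var\<close>)
  then show "omin.dfn_ee (dfn_in L M) (family M y \<phi>)"
    unfolding omin.dfn_ee_def[OF omin_structure] family_def by (simp add: comp_def)
  show "supported (set x) ((family M y \<phi>) s)" for s
    unfolding supported_def family_def
  proof (intro allI impI sat_cong)
    fix e e' :: "nat \<Rightarrow> 'm" and v assume ee: "\<forall>i\<in>set x. e i = e' i" and "v \<in> free_vars \<phi>"
    then have "v \<in> set x \<union> set y" using \<phi> unfolding formulas_def by auto
    then show "override e [y [\<mapsto>] map s [0..<length y]] v = override e' [y [\<mapsto>] map s [0..<length y]] v"
    proof (cases "v \<in> set y")
      case True
      show ?thesis by (rule override_map_upds_cong[OF _ _ True]) (use xy in simp_all)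
    qed (use ee in \<open>auto simp: override_notin\<close>)
  qed
  show "supported {..<length y} (family M y \<phi>)"
    unfolding supported_def family_def
    by (intro allI impI ext arg_cong[where f = "\<lambda>b. sat M (override _ [y [\<mapsto>] b]) \<phi>"] map_cong) auto
qed simp_all

lemma family_nth: "length a = length y \<Longrightarrow> (family M y \<phi>) ((!) a) = (\<lambda>e. sat M e (inst y a \<phi>))"
  unfolding family_def sat_inst using map_nth[of a] by simp

text \<open>
  The restriction of \<open>p\<close> is a function of the trace of \<open>p\<close> on the family \<open>\<phi>(x;b)\<close>.
\<close>

lemma few_restrictions: "|restrict_type y \<phi> A ` def_types_in L M x UNIV| \<le>o |A|"
proof -
  define g where "g T = {inst y a \<phi> | a. length a = length y \<and> set a \<subseteq> A \<and> T ((!) a)}" for T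
  have in_A: "omin_set.in_A A {..<length y} ((!) a) \<longleftrightarrow> set a \<subseteq> A" if "length a = length y" for a
    unfolding omin_set.in_A_def[OF om] using that by (auto simp: set_conv_nth)
  have "restrict_type y \<phi> A p = g (omin_set.trace A {..<length y} (family M y \<phi>) (holds_in M p))" if p: "p \<in> def_types_in L M x UNIV" for p
  proof -
    have t: "p \<in> types L M x UNIV" using p unfolding def_types_in_def by blast
    have "inst y a \<phi> \<in> p \<longleftrightarrow> holds_in M p ((family M y \<phi>) ((!) a))" if a: "length a = length y" for a
      unfolding family_nth[OF a]
      by (rule holds_in_sat[OF t, symmetric], rule inst_formulas) (use \<phi> a in \<open>auto simp: formulas_def\<close>)
    then show ?thesis unfolding restrict_type_def g_def omin_set.trace_def[OF om] using in_A by blast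
  qed
  then have "restrict_type y \<phi> A ` def_types_in L M x UNIV \<subseteq>
      g ` omin_set.trace A {..<length y} (family M y \<phi>) ` {q. omin_set.deftype (dfn_in L M) (set x) q}"
    using deftype_holds_in[OF om] xy by fastforce
  moreover have "omin_set.small A (g ` omin_set.trace A {..<length y} (family M y \<phi>) ` {q. omin_set.deftype (dfn_in L M) (set x) q})"
    by (rule omin_set.small_image[OF om small_family_traces])
  ultimately have "omin_set.small A (restrict_type y \<phi> A ` def_types_in L M x UNIV)"
    using omin_set.small_subset[OF om] by blast
  then show ?thesis unfolding omin_set.small_def[OF om] .
qed

end

section \<open>Counting types\<close>

lemma image_ordLeq: "|S| \<le>o r \<Longrightarrow> |f ` S| \<le>o r"
  using card_of_image ordLeq_transitive by blast

lemma subset_ordLeq: "S \<subseteq> T \<Longrightarrow> |T| \<le>o r \<Longrightarrow> |S| \<le>o r"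
  using card_of_mono1 ordLeq_transitive by blast

lemma Times_ordLeq: "Cinfinite r \<Longrightarrow> |S| \<le>o r \<Longrightarrow> |T| \<le>o r \<Longrightarrow> |S \<times> T| \<le>o r"
  unfolding cinfinite_def by (intro card_of_Times_ordLeq_infinite_Field) simp_all

lemma nat_ordLeq: "Cinfinite r \<Longrightarrow> |S :: nat set| \<le>o r"
  by (rule subset_ordLeq[OF subset_UNIV ordIso_ordLeq_trans[OF card_of_nat natLeq_ordLeq_cinfinite]])

lemma lists_ordLeq:
  assumes r: "Cinfinite r" and S: "|S| \<le>o r" shows "|lists S| \<le>o r"
proof -
  have "|{xs \<in> lists S. length xs = n}| \<le>o r" for n
  proof (induction n)
    case 0
    have "{xs \<in> lists S. length xs = 0} \<subseteq> (\<lambda>_. []) ` {0::nat}" by auto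
    then show ?case by (rule subset_ordLeq) (intro image_ordLeq nat_ordLeq r)
  next
    case (Suc n)
    have "{xs \<in> lists S. length xs = Suc n} \<subseteq> (\<lambda>(a, xs). a # xs) ` (S \<times> {xs \<in> lists S. length xs = n})"
    proof
      fix xs assume "xs \<in> {xs \<in> lists S. length xs = Suc n}"
      then obtain a ys where "xs = a # ys" "a \<in> S" "ys \<in> lists S" "length ys = n" by (cases xs) auto
      then show "xs \<in> (\<lambda>(a, xs). a # xs) ` (S \<times> {xs \<in> lists S. length xs = n})" by (intro image_eqI[of _ _ "(a, ys)"]) auto
    qed
    then show ?case by (rule subset_ordLeq) (intro image_ordLeq Times_ordLeq r S Suc)
  qed
  then have "|\<Union>n. {xs \<in> lists S. length xs = n}| \<le>o r"
    by (intro UNION_Cinfinite_bound[OF nat_ordLeq[OF r] _ r]) blast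
  then show ?thesis by (rule subset_ordLeq[rotated]) blast
qed

text \<open>
  Terms are counted by size, since a term of size at most \<open>n\<close> is built from a symbol and a list of terms
  of smaller size.
\<close>

lemma terms_ordLeq:
  fixes L :: "('f, 'r) language" and A :: "'m set"
  assumes r: "Cinfinite r" and f: "|fun_syms L| \<le>o r" and A: "|A| \<le>o r"
  shows "|{t :: ('f, 'm) trm. wf_trm L t \<and> trm_params t \<subseteq> A}| \<le>o r"
proof -
  let ?T = "\<lambda>n. {t :: ('f, 'm) trm. wf_trm L t \<and> trm_params t \<subseteq> A \<and> size t < n}"
  have "|?T n| \<le>o r" for n
  proof (induction n)
    case 0
    have "?T 0 \<subseteq> Var ` {}" by simp
    then show ?case by (rule subset_ordLeq) (intro image_ordLeq nat_ordLeq r)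
  next
    case (Suc n)
    have "?T (Suc n) \<subseteq> (Var ` UNIV \<union> Par ` A) \<union> (\<lambda>(g, ts). Fun g ts) ` (fun_syms L \<times> lists (?T n))"
    proof
      fix t assume t: "t \<in> ?T (Suc n)"
      show "t \<in> (Var ` UNIV \<union> Par ` A) \<union> (\<lambda>(g, ts). Fun g ts) ` (fun_syms L \<times> lists (?T n))"
      proof (cases t)
        case (Fun g ts)
        have "size u < n" if "u \<in> set ts" for u
          using t Fun size_list_estimation'[OF that, of "size u" size] by simp
        then have "ts \<in> lists (?T n)" "g \<in> fun_syms L" using t Fun by (auto simp: list_all_iff)
        then show ?thesis unfolding Fun by (intro UnI2 image_eqI[of _ _ "(g, ts)"]) simp_all
      qed (use t in auto)
    qed
    then show ?case
      by (rule subset_ordLeq) (intro Un_Cinfinite_bound image_ordLeq Times_ordLeq lists_ordLeq nat_ordLeq r f A Suc)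
  qed
  then have "|\<Union>n. ?T n| \<le>o r" by (intro UNION_Cinfinite_bound[OF nat_ordLeq[OF r] _ r]) blast
  then show ?thesis by (rule subset_ordLeq[rotated]) blast
qed

lemma formulas_ordLeq:
  fixes L :: "('f, 'r) language" and A :: "'m set"
  assumes r: "Cinfinite r" and f: "|fun_syms L| \<le>o r" and R: "|rel_syms L| \<le>o r" and A: "|A| \<le>o r"
  shows "|{\<phi> :: ('f, 'r, 'm) fm. wf_fm L \<phi> \<and> params \<phi> \<subseteq> A}| \<le>o r"
proof -
  let ?T = "{t :: ('f, 'm) trm. wf_trm L t \<and> trm_params t \<subseteq> A}"
  let ?F = "\<lambda>n. {\<phi> :: ('f, 'r, 'm) fm. wf_fm L \<phi> \<and> params \<phi> \<subseteq> A \<and> size \<phi> < n}"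
  note T = terms_ordLeq[OF r f A]
  have "|?F n| \<le>o r" for n
  proof (induction n)
    case 0
    have "?F 0 \<subseteq> (\<lambda>_. Eq (Var 0) (Var 0)) ` ({} :: nat set)" by simp
    then show ?case by (rule subset_ordLeq) (intro image_ordLeq nat_ordLeq r)
  next
    case (Suc n)
    let ?U = "(\<lambda>(t, u). Eq t u) ` (?T \<times> ?T) \<union> (\<lambda>(q, ts). Rel q ts) ` (rel_syms L \<times> lists ?T) \<union> Neg ` ?F n \<union>
      (\<lambda>(\<phi>, \<psi>). Conj \<phi> \<psi>) ` (?F n \<times> ?F n) \<union> (\<lambda>(v, \<phi>). Ex v \<phi>) ` (UNIV \<times> ?F n)"
    have "?F (Suc n) \<subseteq> ?U"
    proof
      fix \<phi> assume \<phi>: "\<phi> \<in> ?F (Suc n)"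
      show "\<phi> \<in> ?U"
      proof (cases \<phi>)
        case (Eq t u)
        then have "(t, u) \<in> ?T \<times> ?T" using \<phi> by simp
        then show ?thesis unfolding Eq by fast
      next
        case (Rel q ts)
        then have "(q, ts) \<in> rel_syms L \<times> lists ?T" using \<phi> by (auto simp: list_all_iff)
        then show ?thesis unfolding Rel by fast
      next
        case (Neg \<psi>)
        then have "\<psi> \<in> ?F n" using \<phi> by simp
        then show ?thesis unfolding Neg by fast
      next
        case (Conj \<psi> \<chi>)
        then have "(\<psi>, \<chi>) \<in> ?F n \<times> ?F n" using \<phi> by simp
        then show ?thesis unfolding Conj by fast
      next
        case (Ex v \<psi>)
        then have "(v, \<psi>) \<in> UNIV \<times> ?F n" using \<phi> by simp
        then show ?thesis unfolding Ex by fast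
      qed
    qed
    then show ?case
      by (rule subset_ordLeq) (intro Un_Cinfinite_bound image_ordLeq Times_ordLeq lists_ordLeq nat_ordLeq r R T Suc)
  qed
  then have "|\<Union>n. ?F n| \<le>o r" by (intro UNION_Cinfinite_bound[OF nat_ordLeq[OF r] _ r]) blast
  then show ?thesis by (rule subset_ordLeq[rotated]) blast
qed

lemma Cinfinite_number_of_formulas: "Cinfinite (lang_card L +c natLeq)"
  by (rule Cinfinite_csum) (simp add: natLeq_Cinfinite)

lemma formulas_ordLeq_lang_card:
  fixes L :: "('f, 'r) language" and A :: "'m set"
  assumes "|A| \<le>o lang_card L +c natLeq"
  shows "|{\<phi> :: ('f, 'r, 'm) fm. wf_fm L \<phi> \<and> params \<phi> \<subseteq> A}| \<le>o lang_card L +c natLeq"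
proof (rule formulas_ordLeq[OF Cinfinite_number_of_formulas _ _ assms])
  have "lang_card L \<le>o lang_card L +c natLeq"
    unfolding lang_card_def by (rule ordLeq_csum1[OF card_of_Card_order])
  then show "|fun_syms L| \<le>o lang_card L +c natLeq" "|rel_syms L| \<le>o lang_card L +c natLeq"
    using card_of_Plus1[of "fun_syms L" "rel_syms L"] card_of_Plus2[of "rel_syms L" "fun_syms L"]
    unfolding lang_card_def by (blast intro: ordLeq_transitive)+
qed

text \<open>
  The type of a tuple from the structure itself is definable.
\<close>

lemma deftype_point:
  assumes om: "omin_set (\<le>) (<) (dfn_in L M) (A :: 'm::unbounded_dense_linorder set)"
  shows "omin_set.deftype (dfn_in L M) V (\<lambda>P. P e)"
  unfolding omin_set.deftype_def[OF om]
proof (intro conjI allI impI)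
  fix R :: "(nat \<Rightarrow> 'm) \<Rightarrow> (nat \<Rightarrow> 'm) \<Rightarrow> bool"
  assume "omin.dfn_ee (dfn_in L M) R \<and> (\<forall>s. supported V (R s))"
  then show "dfn_in L M (\<lambda>s. R s e)"
    using omin.dfn_eeD[OF omin_set.axioms(1)[OF om] _ env_map_id env_map_const, of R e] by simp
qed simp_all

text \<open>
  The roles of variables and parameters are exchanged: \<open>\<psi>(b;c)\<close> is an instance of \<open>\<psi>\<close> at the
  parameters \<open>b\<close> from \<open>A\<close>, and the set of all such \<open>b\<close> is the trace of the type of \<open>c\<close>.
\<close>

lemma few_definable_families:
  fixes L :: "('f, 'r) language" and M :: "('f, 'r, 'm::unbounded_dense_linorder) struct" and A :: "'m set"
  assumes om: "omin_set (\<le>) (<) (dfn_in L M) A" and \<psi>: "\<psi> \<in> formulas L {} (y @ z)" and yz: "distinct (y @ z)"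
  shows "|(\<lambda>c. solutions M \<psi> y z c \<inter> {b. set b \<subseteq> A}) ` {c. length c = length z}| \<le>o |A|"
proof -
  have \<psi>': "\<psi> \<in> formulas L {} (z @ y)" using \<psi> unfolding formulas_def by auto
  have zy: "distinct (z @ y)" using yz by auto
  let ?tr = "omin_set.trace A {..<length y} (family M y \<psi>)"
  let ?q = "\<lambda>c P. P (override undefined [z [\<mapsto>] c])"
  define g where "g T = {b. length b = length y \<and> set b \<subseteq> A \<and> T ((!) b)}" for T
  have "solutions M \<psi> y z c \<inter> {b. set b \<subseteq> A} = g (?tr (?q c))" if c: "length c = length z" for c
  proof -
    let ?e = "override undefined [z [\<mapsto>] c]"
    have in_A: "omin_set.in_A A {..<length y} ((!) b) \<longleftrightarrow> set b \<subseteq> A" if "length b = length y" for b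
      unfolding omin_set.in_A_def[OF om] using that by (auto simp: set_conv_nth)
    have "models M (inst (y @ z) (b @ c) \<psi>) \<longleftrightarrow> family M y \<psi> ((!) b) ?e" if b: "length b = length y" for b
    proof -
      have len: "length (b @ c) = length (y @ z)" using b c by simp
      have "models M (inst (y @ z) (b @ c) \<psi>) \<longleftrightarrow> sat M (override undefined [y @ z [\<mapsto>] b @ c]) \<psi>"
        by (rule models_inst[OF yz len]) (use \<psi> in \<open>simp add: formulas_def\<close>)
      also have "\<dots> \<longleftrightarrow> sat M (override ?e [y [\<mapsto>] b]) \<psi>"
      proof (rule sat_cong)
        fix v assume "v \<in> free_vars \<psi>"
        then have "v \<in> set y \<or> v \<in> set z" using \<psi> unfolding formulas_def by auto
        then show "override undefined [y @ z [\<mapsto>] b @ c] v = override ?e [y [\<mapsto>] b] v"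
        proof
          assume "v \<in> set y"
          then obtain i where i: "i < length y" "v = y ! i" by (metis in_set_conv_nth)
          then show ?thesis
            using override_nth[OF yz len, of i undefined] override_nth[of y b i ?e] b yz by (simp add: nth_append)
        next
          assume v: "v \<in> set z"
          then obtain i where i: "i < length z" "v = z ! i" by (metis in_set_conv_nth)
          have "v \<notin> set y" using v yz by auto
          then show ?thesis
            using override_nth[OF yz len, of "length y + i" undefined] override_nth[of z c i undefined] b c yz i
            by (simp add: nth_append override_notin)
        qed
      qed
      also have "\<dots> \<longleftrightarrow> family M y \<psi> ((!) b) ?e" unfolding family_def using map_nth[of b] b by simp
      finally show ?thesis .
    qed
    then show ?thesis unfolding solutions_def g_def omin_set.trace_def[OF om] using in_A by auto
  qed
  then have "(\<lambda>c. solutions M \<psi> y z c \<inter> {b. set b \<subseteq> A}) ` {c. length c = length z} \<subseteq>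
      g ` ?tr ` {q. omin_set.deftype (dfn_in L M) (set z) q}"
    using deftype_point[OF om] by fastforce
  moreover have "omin_set.small A (g ` ?tr ` {q. omin_set.deftype (dfn_in L M) (set z) q})"
    by (rule omin_set.small_image[OF om small_family_traces[OF om \<psi>' zy]])
  ultimately show ?thesis unfolding omin_set.small_def[OF om] by (rule subset_ordLeq)
qed

text \<open>
  Every formula over \<open>A\<close> is an instance of a formula without parameters at a tuple from \<open>A\<close>.
\<close>

lemma def_types_in_determined:
  assumes p: "p \<in> types L M x A" and p': "p' \<in> types L M x A" and x: "distinct x"
    and eq: "\<And>\<phi> y b. \<phi> \<in> formulas L {} (x @ y) \<Longrightarrow> distinct (x @ y) \<Longrightarrow> length b = length y \<Longrightarrow> set b \<subseteq> A \<Longrightarrow>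
      inst y b \<phi> \<in> p \<Longrightarrow> inst y b \<phi> \<in> p'"
  shows "p \<subseteq> p'"
proof
  fix \<theta> assume \<theta>: "\<theta> \<in> p"
  have \<theta>A: "\<theta> \<in> formulas L A x" using p \<theta> unfolding types_def by auto
  obtain N where N: "\<forall>v\<in>set x. v < N" using finite_nat_bound[OF finite_set, of x] by auto
  obtain h ps where h: "distinct ps" "set ps = params \<theta>" "inj_on h (set ps)"
    "\<And>a. a \<in> params \<theta> \<Longrightarrow> N \<le> h a \<and> h a \<notin> all_vars \<theta>"
    by (rule fresh_abstraction[of \<theta> N]) (rule that)
  have inst: "inst (map h ps) ps (abstract_fm h \<theta>) = \<theta>"
    by (rule abstraction_inst[OF h(1,2,3)]) (use h(4) in blast)
  have "inst (map h ps) ps (abstract_fm h \<theta>) \<in> p'"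
  proof (rule eq)
    show "abstract_fm h \<theta> \<in> formulas L {} (x @ map h ps)"
      using \<theta>A free_vars_abstract_fm[of h \<theta>] h(2) unfolding formulas_def
      by (auto simp: wf_abstract_fm params_abstract_fm)
    have "N \<le> h a" if "a \<in> set ps" for a using h(2,4) that by blast
    then show "distinct (x @ map h ps)" using x N h(1,3) by (fastforce simp: distinct_map)
    show "set ps \<subseteq> A" using \<theta>A h(2) unfolding formulas_def by simp
  qed (simp_all add: inst \<theta>)
  then show "\<theta> \<in> p'" unfolding inst .
qed

lemma ctwo_ordLeq: "cone <o |A| \<Longrightarrow> ctwo \<le>o |A|"
proof -
  assume A: "cone <o |A|"
  have "\<exists>a\<in>A. \<exists>b\<in>A. a \<noteq> b"
  proof (rule ccontr)
    assume "\<not> ?thesis"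
    then have "|A| \<le>o cone" unfolding cone_def by (intro card_of_ordLeqI[of "\<lambda>_. ()"]) (auto simp: inj_on_def)
    then show False using A not_ordLess_ordLeq by blast
  qed
  then obtain a b where ab: "a \<in> A" "b \<in> A" "a \<noteq> b" by blast
  show ?thesis unfolding ctwo_def
    by (rule card_of_ordLeqI[of "\<lambda>c. if c then a else b"]) (use ab in \<open>auto simp: inj_on_def split: if_splits\<close>)
qed

lemma card_def_types_in:
  fixes L :: "('f, 'r) language" and M :: "('f, 'r, 'm::unbounded_dense_linorder) struct" and A :: "'m set"
  assumes om: "omin_set (\<le>) (<) (dfn_in L M) A" and A: "ctwo \<le>o |A|" and x: "distinct x"
  shows "|def_types_in L M x A| \<le>o |A| ^c (lang_card L +c natLeq)"
proof -
  define \<kappa> where "\<kappa> = lang_card L +c natLeq"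
  define D where "D = {(\<phi> :: ('f, 'r, 'm) fm, y). \<phi> \<in> formulas L {} (x @ y) \<and> distinct (x @ y)}"
  define J where "J = {(\<psi> :: ('f, 'r, 'm) fm, y, z). \<psi> \<in> formulas L {} (y @ z) \<and> distinct (y @ z)}"
  define V where "V = (\<Union>(\<psi>, y, z)\<in>J. (\<lambda>c. solutions M \<psi> y z c \<inter> {b. set b \<subseteq> A}) ` {c. length c = length z})"
  define S where "S p = (\<lambda>(\<phi>, y). {b. length b = length y \<and> set b \<subseteq> A \<and> inst y b \<phi> \<in> p})" for p :: "('f, 'r, 'm) fm set"
  define f where "f p = (\<lambda>i. if i \<in> D then S p i else undefined)" for p
  have \<kappa>: "Cinfinite \<kappa>" unfolding \<kappa>_def by (rule Cinfinite_number_of_formulas)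
  let ?F = "{\<phi> :: ('f, 'r, 'm) fm. wf_fm L \<phi> \<and> params \<phi> \<subseteq> {}}"
  have F: "|?F| \<le>o \<kappa>" unfolding \<kappa>_def
    by (rule formulas_ordLeq_lang_card, rule card_of_empty1, rule disjI2, rule Card_order_csum)
  have lists: "|UNIV :: nat list set| \<le>o \<kappa>"
    using lists_ordLeq[OF \<kappa> nat_ordLeq[OF \<kappa>, of UNIV]] by (simp add: lists_UNIV)
  have D: "|D| \<le>o \<kappa>"
    by (rule subset_ordLeq[OF _ Times_ordLeq[OF \<kappa> F lists]]) (auto simp: D_def formulas_def)
  have J: "|J| \<le>o \<kappa>"
    by (rule subset_ordLeq[OF _ Times_ordLeq[OF \<kappa> F Times_ordLeq[OF \<kappa> lists lists]]]) (auto simp: J_def formulas_def)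
  let ?E = "|A| ^c \<kappa>"
  have E: "Cinfinite ?E" by (rule Cinfinite_cexp[OF A \<kappa>])
  have \<kappa>E: "\<kappa> \<le>o ?E" by (rule ordLeq_cexp2[OF A]) (use \<kappa> in simp)
  have AE: "|A| \<le>o ?E" by (rule ordLeq_cexp1[OF Cinfinite_Cnotzero[OF \<kappa>] card_of_Card_order])
  have V: "|V| \<le>o ?E" unfolding V_def
  proof (rule UNION_Cinfinite_bound[OF ordLeq_transitive[OF J \<kappa>E] _ E], rule ballI)
    fix i assume i: "i \<in> J"
    obtain \<psi> y z where [simp]: "i = (\<psi>, y, z)" by (cases i)
    have "|(\<lambda>c. solutions M \<psi> y z c \<inter> {b. set b \<subseteq> A}) ` {c. length c = length z}| \<le>o |A|"
      by (rule few_definable_families[OF om]) (use i in \<open>simp_all add: J_def\<close>)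
    then show "|case i of (\<psi>, y, z) \<Rightarrow> (\<lambda>c. solutions M \<psi> y z c \<inter> {b. set b \<subseteq> A}) ` {c. length c = length z}| \<le>o ?E"
      using AE by (simp add: ordLeq_transitive)
  qed
  have SV: "S p i \<in> V" if p: "p \<in> def_types_in L M x A" and i: "i \<in> D" for p i
  proof -
    obtain \<phi> y where i': "i = (\<phi>, y)" by (cases i)
    have \<phi>: "\<phi> \<in> formulas L {} (x @ y)" "distinct (x @ y)" using i unfolding i' D_def by simp_all
    have "definable_type L M x A p" using p unfolding def_types_in_def by simp
    from this[unfolded definable_type_def, rule_format, OF \<phi>]
    obtain z c \<psi> where \<psi>: "\<psi> \<in> formulas L {} (y @ z)" "distinct (y @ z)" "length c = length z"
      and eq: "{b. length b = length y \<and> set b \<subseteq> A \<and> inst y b \<phi> \<in> p} = solutions M \<psi> y z c"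
      by (elim exE bexE conjE) (rule that)
    have "(\<psi>, y, z) \<in> J" using \<psi> unfolding J_def by simp
    moreover have "S p i = solutions M \<psi> y z c \<inter> {b. set b \<subseteq> A}"
      unfolding i' S_def prod.case eq[symmetric] by blast
    ultimately show ?thesis unfolding V_def using \<psi>(3) by (intro UN_I[of "(\<psi>, y, z)"]) auto
  qed
  have inj: "inj_on f (def_types_in L M x A)"
  proof (rule inj_onI)
    fix p p' assume p: "p \<in> def_types_in L M x A" "p' \<in> def_types_in L M x A" and ff: "f p = f p'"
    have t: "p \<in> types L M x A" "p' \<in> types L M x A" using p unfolding def_types_in_def by simp_all
    have S: "S p i = S p' i" if "i \<in> D" for i using fun_cong[OF ff, of i] that unfolding f_def by simp
    have "inst y b \<phi> \<in> p \<longleftrightarrow> inst y b \<phi> \<in> p'"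
      if "\<phi> \<in> formulas L {} (x @ y)" "distinct (x @ y)" "length b = length y" "set b \<subseteq> A" for \<phi> y b
    proof -
      have "S p (\<phi>, y) = S p' (\<phi>, y)" by (rule S) (use that in \<open>simp add: D_def\<close>)
      then have "b \<in> S p (\<phi>, y) \<longleftrightarrow> b \<in> S p' (\<phi>, y)" by simp
      then show ?thesis unfolding S_def using that(3,4) by simp
    qed
    note iff = this
    show "p = p'"
      by (rule subset_antisym; rule def_types_in_determined[OF _ _ x]) (fact t | simp only: iff)+
  qed
  have "|def_types_in L M x A| \<le>o |Func D V|"
    by (rule card_of_ordLeqI[OF inj]) (simp add: Func_def f_def SV)
  also have "|Func D V| = |V| ^c |D|" unfolding cexp_def Field_card_of ..
  also have "|V| ^c |D| \<le>o ?E ^c \<kappa>"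
  proof (rule cexp_mono'[OF V D])
    have "(Ex 0 (Eq (Var 0) (Var 0)), []) \<in> D" using x unfolding D_def formulas_def by simp
    then show "Field |D| = {} \<Longrightarrow> Field \<kappa> = {}" by (simp add: Field_card_of)
  qed
  also have "?E ^c \<kappa> =o ?E"
    by (rule cexp_cprod_ordLeq[OF card_of_Card_order \<kappa> Cinfinite_Cnotzero[OF \<kappa>]]) (use \<kappa> in \<open>simp add: ordLeq_refl\<close>)
  finally show ?thesis unfolding \<kappa>_def .
qed

lemma card_def_types_infinite:
  fixes L :: "('f, 'r) language" and M :: "('f, 'r, 'm::unbounded_dense_linorder) struct" and A :: "'m set"
  assumes om: "omin_set (\<le>) (<) (dfn_in L M) A" and A: "ctwo \<le>o |A|"
  shows "|def_types L M A| \<le>o |A| ^c (lang_card L +c natLeq)"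
  unfolding def_types_def
proof (rule UNION_Cinfinite_bound)
  let ?\<kappa> = "lang_card L +c natLeq"
  show E: "Cinfinite ( |A| ^c ?\<kappa>)" by (rule Cinfinite_cexp[OF A Cinfinite_number_of_formulas])
  show "|{x :: nat list. distinct x}| \<le>o |A| ^c ?\<kappa>"
    using lists_ordLeq[OF E nat_ordLeq[OF E, of UNIV]] by (rule subset_ordLeq[rotated]) (simp add: lists_UNIV)
  show "\<forall>x\<in>{x. distinct x}. |def_types_in L M x A| \<le>o |A| ^c ?\<kappa>" using card_def_types_in[OF om A] by blast
qed

lemma card_def_types_finite:
  fixes L :: "('f, 'r) language" and M :: "('f, 'r, 'm) struct" and A :: "'m set"
  assumes fin: "finite A" and A: "ctwo \<le>o |A|"
  shows "|def_types L M A| \<le>o |A| ^c (lang_card L +c natLeq)"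
proof -
  let ?\<kappa> = "lang_card L +c natLeq"
  let ?F = "{\<phi> :: ('f, 'r, 'm) fm. wf_fm L \<phi> \<and> params \<phi> \<subseteq> A}"
  have \<kappa>: "Cinfinite ?\<kappa>" by (rule Cinfinite_number_of_formulas)
  have "|A| \<le>o ?\<kappa>"
    by (rule ordLess_imp_ordLeq, rule Cfinite_ordLess_Cinfinite[OF _ \<kappa>]) (simp add: cfinite_def fin Field_card_of card_of_card_order_on)
  then have F: "|?F| \<le>o ?\<kappa>" by (rule formulas_ordLeq_lang_card)
  have K: "?\<kappa> = |Field (lang_card L) <+> Field natLeq|" by (simp add: csum_def)
  have "def_types L M A \<subseteq> Pow ?F"
    unfolding def_types_def def_types_in_def types_def formulas_def by blast
  then have "|def_types L M A| \<le>o |Pow ?F|" by (rule card_of_mono1)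
  also have "|Pow ?F| \<le>o |Pow (Field (lang_card L) <+> Field natLeq)|"
  proof -
    obtain f where f: "inj_on f ?F" "f ` ?F \<subseteq> Field (lang_card L) <+> Field natLeq"
      using F unfolding K card_of_ordLeq[symmetric] by (elim exE conjE) (rule that)
    show ?thesis by (rule card_of_ordLeqI[OF inj_on_image_Pow[OF f(1)]]) (use f(2) in blast)
  qed
  also have "|Pow (Field (lang_card L) <+> Field natLeq)| =o ctwo ^c ?\<kappa>"
    unfolding ctwo_def cexp_def csum_def Field_card_of by (rule card_of_Pow_Func)
  also have "ctwo ^c ?\<kappa> \<le>o |A| ^c ?\<kappa>" by (rule cexp_mono1[OF A Card_order_csum])
  finally show ?thesis .
qed

theorem corollary1:
  fixes L :: "('f, 'r) language"
    and M :: "('f, 'r, 'm::unbounded_dense_linorder) struct"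
    and A :: "'m set"
  assumes "o_minimal L M"
    and "definable_subset L M A"
    and "cone <o |A|"
  shows "|def_types L M A| \<le>o |A| ^c (lang_card L +c natLeq) \<and>
    (infinite A \<longrightarrow>
      (\<forall>x y. \<forall>\<phi>\<in>formulas L {} (x @ y). distinct (x @ y) \<longrightarrow>
        |restrict_type y \<phi> A ` def_types_in L M x UNIV| \<le>o |A| ))"
proof (cases "finite A")
  case True
  then show ?thesis using card_def_types_finite[OF True ctwo_ordLeq[OF assms(3)]] by simp
next
  case False
  note om = omin_set_dfn_in[OF assms(1,2) False]
  show ?thesis using card_def_types_infinite[OF om ctwo_ordLeq[OF assms(3)]] few_restrictions[OF om] by simp
qed

end
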